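(* Let $d=(d(1),d(2),\ldots)$ be a sequence in $\{2,3,\ldots\}$, and let $I=(I_1,I_2,\ldots)$, $s=(s_1,s_2,\ldots)$, $f=(f_1,f_2,\ldots)$ be sequences such that $S_n=(I_n,s_n,f_n)$ is a system of $d(n)$-similarities for every $n\ge1$. Let $A=D_{2,d,I,s,f}\subset L(L^2(X_{I,s,f},\mu_{I,s,f}))$. If $A$ is amenable, then there exists an invertible element $v\in L(L^2(X_{I,s,f},\mu_{I,s,f}))$ such that $vAv^{-1}$ is a C*-algebra (that is, a closed selfadjoint subalgebra of $L(L^2(X_{I,s,f},\mu_{I,s,f}))$).
   Context: $L(E)$ is the algebra of bounded operators on a Banach space $E$; $\mathrm{inv}(M_d)$ is the group of invertible $d\times d$ complex matrices. $M_d^2=L(l_d^2)$, where $l_d^2=L^2(\{1,\ldots,d\})$ with normalized counting measure. A system of $d$-similarities is a triple $S=(I,s,f)$ with $I$ a countable (possibly finite) set, $s\colon I\to\mathrm{inv}(M_d)$, $f\colon I\to[0,1]$, such that the identity matrix $1\in\mathrm{ran}(s)$, $\overline{\mathrm{ran}(s)}$ is compact and contained in $\mathrm{inv}(M_d)$, $f(i)>0$ for all $i\in I$, and $\sum_{i\in I}f(i)=1$. Put $X_S=\{1,\ldots,d\}\times I$ with the atomic probability measure $\mu_S(\{(j,i)\})=d^{-1}f(i)$, and identify $L(L^2(\{1,\ldots,d\}\times\{i\},\mu_S))=M_d^2$. The representation $\psi^{2,S}\colon M_d\to L(L^2(X_S,\mu_S))$ is the (Hilbert space) direct sum over $i\in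 I$ of the representations $a\mapsto s(i)as(i)^{-1}$ on $L^2(\{1,\ldots,d\}\times\{i\},\mu_S)$. Let $(X_{I,s,f},\mu_{I,s,f})=\prod_{n=1}^\infty(X_{S_n},\mu_{S_n})$. Then $D_{2,d,I,s,f}$ is the closed subalgebra of $L(L^2(X_{I,s,f},\mu_{I,s,f}))$ generated by all operators $\psi^{2,S_1}(a_1)\otimes\cdots\otimes\psi^{2,S_n}(a_n)\otimes1$ with $n\ge0$, $a_k\in M_{d(k)}$, where $1$ is the identity on $L^2(\prod_{k>n}X_{S_k})$. Amenability is amenability as a Banach algebra: a unital Banach algebra $A$ is amenable iff there is a bounded net $(m_\lambda)$ in the projective tensor product $A\widehat\otimes A$ with $(a\otimes1)m_\lambda-m_\lambda(1\otimes a)\to0$ for all $a\in A$ and $\Delta_A(m_\lambda)\to1$, where $\Delta_A(a\otimes b)=ab$ and $A\widehat\otimes A$ has the multiplication $(a\otimes b)(c\otimes e)=ac\otimes be$. *)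

theory Defs
  imports
    "HOL-Probability.Probability"
    "HOL-Algebra.Module"
    "Jordan_Normal_Form.Gauss_Jordan_Elimination"
begin

section \<open>The Hilbert space of square integrable functions\<close>

text \<open>
  Vectors of \<open>L\<^sup>2\<close> are equivalence classes of complex functions modulo equality almost everywhere.
  The operations are computed on arbitrary representatives.
\<close>

type_synonym 'w l2 = "('w \<Rightarrow> complex) set"

definition square_integrable :: "'w measure \<Rightarrow> ('w \<Rightarrow> complex) set" where
  "square_integrable M =
     {x \<in> borel_measurable M. integrable M (\<lambda>\<omega>. (cmod (x \<omega>))\<^sup>2)}"

definition l2_class :: "'w measure \<Rightarrow> ('w \<Rightarrow> complex) \<Rightarrow> 'w l2" where
  "l2_class M x = {y \<in> square_integrable M. AE \<omega> in M. y \<omega> = x \<omega>}"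

definition L2 :: "'w measure \<Rightarrow> 'w l2 set" where
  "L2 M = l2_class M ` square_integrable M"

definition l2_rep :: "'w l2 \<Rightarrow> 'w \<Rightarrow> complex" where
  "l2_rep u = (SOME x. x \<in> u)"

definition l2_add :: "'w measure \<Rightarrow> 'w l2 \<Rightarrow> 'w l2 \<Rightarrow> 'w l2" where
  "l2_add M u v = l2_class M (\<lambda>\<omega>. l2_rep u \<omega> + l2_rep v \<omega>)"

definition l2_scale :: "'w measure \<Rightarrow> complex \<Rightarrow> 'w l2 \<Rightarrow> 'w l2" where
  "l2_scale M c u = l2_class M (\<lambda>\<omega>. c * l2_rep u \<omega>)"

definition l2_inner :: "'w measure \<Rightarrow> 'w l2 \<Rightarrow> 'w l2 \<Rightarrow> complex" where
  "l2_inner M u v = (LINT \<omega>|M. l2_rep u \<omega> * cnj (l2_rep v \<omega>))"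

definition l2_norm :: "'w measure \<Rightarrow> 'w l2 \<Rightarrow> real" where
  "l2_norm M u = sqrt (LINT \<omega>|M. (cmod (l2_rep u \<omega>))\<^sup>2)"


section \<open>Normed algebras and bounded operators\<close>

text \<open>
  The record \<^typ>\<open>(complex, 'a) module\<close> has all the operations of a complex algebra.
\<close>

record 'a normed_algebra = "(complex, 'a) module" +
  nrm :: "'a \<Rightarrow> real"

definition bounded_ops :: "'w measure \<Rightarrow> ('w l2 \<Rightarrow> 'w l2) set" where
  "bounded_ops M = {T \<in> L2 M \<rightarrow>\<^sub>E L2 M.
     (\<forall>u\<in>L2 M. \<forall>v\<in>L2 M. T (l2_add M u v) = l2_add M (T u) (T v)) \<and>
     (\<forall>c. \<forall>u\<in>L2 M. T (l2_scale M c u) = l2_scale M c (T u)) \<and>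
     (\<exists>K. \<forall>u\<in>L2 M. l2_norm M (T u) \<le> K * l2_norm M u)}"

definition op_norm :: "'w measure \<Rightarrow> ('w l2 \<Rightarrow> 'w l2) \<Rightarrow> real" where
  "op_norm M T = (SUP u\<in>{u \<in> L2 M. l2_norm M u \<le> 1}. l2_norm M (T u))"

definition op_algebra :: "'w measure \<Rightarrow> ('w l2 \<Rightarrow> 'w l2) normed_algebra" where
  "op_algebra M =
     \<lparr> carrier = bounded_ops M,
       mult = compose (L2 M),
       one = (\<lambda>u\<in>L2 M. u),
       zero = (\<lambda>u\<in>L2 M. l2_class M (\<lambda>_. 0)),
       add = (\<lambda>S T. \<lambda>u\<in>L2 M. l2_add M (S u) (T u)),
       smult = (\<lambda>c T. \<lambda>u\<in>L2 M. l2_scale M c (T u)),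
       nrm = op_norm M \<rparr>"

definition closed_subalgebra :: "('a, 'm) normed_algebra_scheme \<Rightarrow> 'a set \<Rightarrow> bool" where
  "closed_subalgebra L B \<longleftrightarrow>
     B \<subseteq> carrier L \<and> \<zero>\<^bsub>L\<^esub> \<in> B \<and>
     (\<forall>a\<in>B. \<forall>b\<in>B. a \<oplus>\<^bsub>L\<^esub> b \<in> B \<and> a \<otimes>\<^bsub>L\<^esub> b \<in> B) \<and>
     (\<forall>c. \<forall>a\<in>B. c \<odot>\<^bsub>L\<^esub> a \<in> B) \<and>
     (\<forall>t a. (\<forall>n. t n \<in> B) \<and> a \<in> carrier L \<and> (\<lambda>n. nrm L (t n \<ominus>\<^bsub>L\<^esub> a)) \<longlonglongrightarrow> 0
        \<longrightarrow> a \<in> B)"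

definition closed_subalgebra_generated ::
  "('a, 'm) normed_algebra_scheme \<Rightarrow> 'a set \<Rightarrow> 'a set" where
  "closed_subalgebra_generated L G = \<Inter>{B. closed_subalgebra L B \<and> G \<subseteq> B}"

definition adjoint_pair ::
  "'w measure \<Rightarrow> ('w l2 \<Rightarrow> 'w l2) \<Rightarrow> ('w l2 \<Rightarrow> 'w l2) \<Rightarrow> bool" where
  "adjoint_pair M T S \<longleftrightarrow>
     (\<forall>u\<in>L2 M. \<forall>v\<in>L2 M. l2_inner M (T u) v = l2_inner M u (S v))"

definition cstar_subalgebra :: "'w measure \<Rightarrow> ('w l2 \<Rightarrow> 'w l2) set \<Rightarrow> bool" where
  "cstar_subalgebra M B \<longleftrightarrow>
     closed_subalgebra (op_algebra M) B \<and> (\<forall>T\<in>B. \<exists>S\<in>B. adjoint_pair M T S)"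


section \<open>Projective tensor products and amenability\<close>

text \<open>
  The completed projective tensor product of \<open>A\<close> with itself consists of the sums
  \<open>\<Sum>n. a n \<otimes> b n\<close> of series with \<open>\<Sum>n. \<parallel>a n\<parallel> * \<parallel>b n\<parallel> < \<infinity>\<close>, and the norm is the infimum of
  \<open>\<Sum>n. \<parallel>a n\<parallel> * \<parallel>b n\<parallel>\<close> over all such representations. Since its dual is the space of
  bounded bilinear forms on \<open>A\<close>, an element is determined by its pairing with these forms.
  Accordingly a tensor is represented by the functional \<open>\<phi> \<mapsto> \<Sum>n. \<phi> (a n) (b n)\<close>, extended
  by \<open>0\<close> to those \<open>\<phi>\<close> that are not bounded bilinear forms.
\<close>

type_synonym 'a tensor = "('a \<Rightarrow> 'a \<Rightarrow> complex) \<Rightarrow> complex"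

definition bilinear_forms :: "('a, 'm) normed_algebra_scheme \<Rightarrow> ('a \<Rightarrow> 'a \<Rightarrow> complex) set" where
  "bilinear_forms A = {\<phi>.
     (\<forall>a\<in>carrier A. \<forall>b\<in>carrier A. \<forall>c\<in>carrier A.
        \<phi> (a \<oplus>\<^bsub>A\<^esub> b) c = \<phi> a c + \<phi> b c \<and> \<phi> a (b \<oplus>\<^bsub>A\<^esub> c) = \<phi> a b + \<phi> a c) \<and>
     (\<forall>z. \<forall>a\<in>carrier A. \<forall>b\<in>carrier A.
        \<phi> (z \<odot>\<^bsub>A\<^esub> a) b = z * \<phi> a b \<and> \<phi> a (z \<odot>\<^bsub>A\<^esub> b) = z * \<phi> a b) \<and>
     (\<exists>K. \<forall>a\<in>carrier A. \<forall>b\<in>carrier A. cmod (\<phi> a b) \<le> K * nrm A a * nrm A b)}"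

definition tensor_series ::
  "('a, 'm) normed_algebra_scheme \<Rightarrow> (nat \<Rightarrow> 'a) \<Rightarrow> (nat \<Rightarrow> 'a) \<Rightarrow> bool" where
  "tensor_series A a b \<longleftrightarrow>
     (\<forall>n. a n \<in> carrier A \<and> b n \<in> carrier A) \<and> summable (\<lambda>n. nrm A (a n) * nrm A (b n))"

definition tensor_sum ::
  "('a, 'm) normed_algebra_scheme \<Rightarrow> (nat \<Rightarrow> 'a) \<Rightarrow> (nat \<Rightarrow> 'a) \<Rightarrow> 'a tensor" where
  "tensor_sum A a b = (\<lambda>\<phi>. if \<phi> \<in> bilinear_forms A then (\<Sum>n. \<phi> (a n) (b n)) else 0)"

definition proj_tensor :: "('a, 'm) normed_algebra_scheme \<Rightarrow> 'a tensor set" where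
  "proj_tensor A = {tensor_sum A a b | a b. tensor_series A a b}"

definition proj_norm :: "('a, 'm) normed_algebra_scheme \<Rightarrow> 'a tensor \<Rightarrow> real" where
  "proj_norm A m =
     Inf {(\<Sum>n. nrm A (a n) * nrm A (b n)) | a b. tensor_series A a b \<and> m = tensor_sum A a b}"

definition pure_tensor :: "('a, 'm) normed_algebra_scheme \<Rightarrow> 'a \<Rightarrow> 'a \<Rightarrow> 'a tensor" where
  "pure_tensor A a b = (\<lambda>\<phi>. if \<phi> \<in> bilinear_forms A then \<phi> a b else 0)"

text \<open>
  The bounded bilinear extension of \<open>(a \<otimes> b)(c \<otimes> e) = ac \<otimes> be\<close>.
\<close>

definition tensor_mult ::
  "('a, 'm) normed_algebra_scheme \<Rightarrow> 'a tensor \<Rightarrow> 'a tensor \<Rightarrow> 'a tensor" where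
  "tensor_mult A m k =
     (\<lambda>\<phi>. if \<phi> \<in> bilinear_forms A
           then m (\<lambda>a b. k (\<lambda>c e. \<phi> (a \<otimes>\<^bsub>A\<^esub> c) (b \<otimes>\<^bsub>A\<^esub> e))) else 0)"

text \<open>
  The bounded linear extension of \<open>a \<otimes> b \<mapsto> ab\<close>; the limit does not depend on the series
  representing the tensor.
\<close>

definition product_map :: "('a, 'm) normed_algebra_scheme \<Rightarrow> 'a tensor \<Rightarrow> 'a" where
  "product_map A m = (THE c. c \<in> carrier A \<and>
     (\<exists>a b. tensor_series A a b \<and> m = tensor_sum A a b \<and>
        (\<lambda>N. nrm A (finsum A (\<lambda>n. a n \<otimes>\<^bsub>A\<^esub> b n) {..<N} \<ominus>\<^bsub>A\<^esub> c)) \<longlonglongrightarrow> 0))"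

text \<open>
  Amenability of a unital Banach algebra. A bounded net is given by its filter of tails: a proper
  filter containing a bounded set of tensors.
\<close>

definition amenable :: "('a, 'm) normed_algebra_scheme \<Rightarrow> bool" where
  "amenable A \<longleftrightarrow> (\<exists>F C. F \<noteq> bot \<and>
     F \<le> principal {m \<in> proj_tensor A. proj_norm A m \<le> C} \<and>
     (\<forall>a\<in>carrier A.
        ((\<lambda>m. proj_norm A (\<lambda>\<phi>. tensor_mult A (pure_tensor A a \<one>\<^bsub>A\<^esub>) m \<phi>
                             - tensor_mult A m (pure_tensor A \<one>\<^bsub>A\<^esub> a) \<phi>)) \<longlongrightarrow> 0) F) \<and>
     ((\<lambda>m. nrm A (product_map A m \<ominus>\<^bsub>A\<^esub> \<one>\<^bsub>A\<^esub>)) \<longlongrightarrow> 0) F)"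


section \<open>Systems of similarities and the associated algebras\<close>

definition inv_matrices :: "nat \<Rightarrow> complex mat set" where
  "inv_matrices d = {A \<in> carrier_mat d d. invertible_mat A}"

text \<open>
  Matrices carry no topology in the library; \<open>M\<^sub>d\<close> is topologised by its entries, extended by
  zero. This identifies \<open>M\<^sub>d\<close> with a closed finite-dimensional subspace of the function space.
\<close>

definition mat_entries :: "nat \<Rightarrow> complex mat \<Rightarrow> nat \<times> nat \<Rightarrow> complex" where
  "mat_entries d A = (\<lambda>(j, k). if j < d \<and> k < d then A $$ (j, k) else 0)"

definition similarity_system ::
  "nat \<Rightarrow> 'i set \<Rightarrow> ('i \<Rightarrow> complex mat) \<Rightarrow> ('i \<Rightarrow> real) \<Rightarrow> bool" where
  "similarity_system d I s f \<longleftrightarrow>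
     countable I \<and> s ` I \<subseteq> inv_matrices d \<and> f ` I \<subseteq> {0..1} \<and>
     1\<^sub>m d \<in> s ` I \<and>
     compact (closure (mat_entries d ` s ` I)) \<and>
     closure (mat_entries d ` s ` I) \<subseteq> mat_entries d ` inv_matrices d \<and>
     (\<forall>i\<in>I. f i > 0) \<and> (f has_sum 1) I"

text \<open>
  Rows and columns are indexed by \<open>{..<d}\<close>.
\<close>

definition system_measure :: "nat \<Rightarrow> 'i set \<Rightarrow> ('i \<Rightarrow> real) \<Rightarrow> (nat \<times> 'i) measure" where
  "system_measure d I f = point_measure ({..<d} \<times> I) (\<lambda>(j, i). ennreal (f i / real d))"

text \<open>
  The direct sum over \<open>i \<in> I\<close> of the representations \<open>a \<mapsto> s(i) a s(i)\<inverse>\<close>: the matrix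
  \<open>s(i) a s(i)\<inverse>\<close> acts on the restriction of the function to \<open>{..<d} \<times> {i}\<close>.
\<close>

definition psi :: "nat \<Rightarrow> 'i set \<Rightarrow> ('i \<Rightarrow> complex mat) \<Rightarrow> ('i \<Rightarrow> real) \<Rightarrow>
    complex mat \<Rightarrow> (nat \<times> 'i) l2 \<Rightarrow> (nat \<times> 'i) l2" where
  "psi d I s f a = (\<lambda>u\<in>L2 (system_measure d I f).
     l2_class (system_measure d I f) (\<lambda>(j, i).
       ((s i * a * the (mat_inverse (s i))) *\<^sub>v vec d (\<lambda>k. l2_rep u (k, i))) $ j))"

text \<open>
  \<open>\<xi>\<^sub>0 \<otimes> \<dots> \<otimes> \<xi>\<^sub>n\<^sub>-\<^sub>1 \<otimes> \<eta>\<close>, where \<open>\<eta>\<close> is a function of the coordinates with index at least \<open>n\<close>.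
\<close>

definition tensor_vector ::
  "(nat \<Rightarrow> 'x measure) \<Rightarrow> nat \<Rightarrow> (nat \<Rightarrow> 'x l2) \<Rightarrow> (nat \<Rightarrow> 'x) l2 \<Rightarrow> (nat \<Rightarrow> 'x) l2" where
  "tensor_vector M n \<xi> \<eta> = l2_class (PiM UNIV M)
     (\<lambda>\<omega>. (\<Prod>k<n. l2_rep (\<xi> k) (\<omega> k)) * l2_rep \<eta> (restrict \<omega> {n..}))"

text \<open>
  \<open>T = R\<^sub>0 \<otimes> \<dots> \<otimes> R\<^sub>n\<^sub>-\<^sub>1 \<otimes> 1\<close>, i.e. the bounded operator that acts as expected on elementary
  tensors.
\<close>

definition is_tensor_op ::
  "(nat \<Rightarrow> 'x measure) \<Rightarrow> nat \<Rightarrow> (nat \<Rightarrow> 'x l2 \<Rightarrow> 'x l2) \<Rightarrow>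
    ((nat \<Rightarrow> 'x) l2 \<Rightarrow> (nat \<Rightarrow> 'x) l2) \<Rightarrow> bool" where
  "is_tensor_op M n R T \<longleftrightarrow> T \<in> bounded_ops (PiM UNIV M) \<and>
     (\<forall>\<xi> \<eta>. (\<forall>k<n. \<xi> k \<in> L2 (M k)) \<and> \<eta> \<in> L2 (PiM {n..} M) \<longrightarrow>
        T (tensor_vector M n \<xi> \<eta>) = tensor_vector M n (\<lambda>k. R k (\<xi> k)) \<eta>)"

text \<open>The sequence index starts at \<open>0\<close>.\<close>

definition product_measure ::
  "(nat \<Rightarrow> nat) \<Rightarrow> (nat \<Rightarrow> 'i set) \<Rightarrow> (nat \<Rightarrow> 'i \<Rightarrow> real) \<Rightarrow> (nat \<Rightarrow> nat \<times> 'i) measure" where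
  "product_measure d I f = PiM UNIV (\<lambda>n. system_measure (d n) (I n) (f n))"

definition D2 :: "(nat \<Rightarrow> nat) \<Rightarrow> (nat \<Rightarrow> 'i set) \<Rightarrow> (nat \<Rightarrow> 'i \<Rightarrow> complex mat) \<Rightarrow>
    (nat \<Rightarrow> 'i \<Rightarrow> real) \<Rightarrow> ((nat \<Rightarrow> nat \<times> 'i) l2 \<Rightarrow> (nat \<Rightarrow> nat \<times> 'i) l2) set" where
  "D2 d I s f = closed_subalgebra_generated (op_algebra (product_measure d I f))
     {T. \<exists>n a. (\<forall>k<n. a k \<in> carrier_mat (d k) (d k)) \<and>
        is_tensor_op (\<lambda>k. system_measure (d k) (I k) (f k)) n
          (\<lambda>k. psi (d k) (I k) (s k) (f k) (a k)) T}"

end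

theory Submission
  imports Defs "Jordan_Normal_Form.Determinant"
begin

text \<open>
  Amenability provides approximate diagonals \<open>m\<close>. Averaging a bounded bilinear form \<open>\<Phi>\<close> over matrix
  units in one coordinate, \<open>\<Phi>(x, y) \<mapsto> \<Sum>j. \<Phi>(e j 0 x, y e 0 j)\<close>, does not change the limit of
  \<open>m \<Phi>\<close>. Fix \<open>i k \<in> I k\<close> and unit vectors \<open>v k, w k\<close> for \<open>k < N\<close>. For a suitable \<open>\<Phi>\<close> of norm at most
  \<open>1\<close>, of the form \<open>\<langle>x T y \<xi>, \<eta>\<rangle>\<close> with \<open>T\<close> a tensor product of contractions that interchange the fibre
  over \<open>i k\<close> with one on which \<open>s = 1\<close>, averaging in the first \<open>N\<close> coordinates produces
  \<open>\<lambda> \<langle>x y \<zeta>, \<zeta>\<rangle>\<close>, where \<open>\<lambda>\<close> is the product of the numbers \<open>(\<parallel>s(i k)\<inverse> v k\<parallel> \<parallel>s(i k) w k\<parallel>)\<^sup>1\<^sup>/\<^sup>2\<close>. Hence these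
  products are bounded by the bound of the net.

  Consequently, if the \<open>s(i)\<inverse>\<close> are normalised to contractions \<open>v(i)\<close>, the operators \<open>V N\<close> that apply
  them in the first \<open>N\<close> coordinates are bounded below uniformly in \<open>N\<close>. The decreasing sequence
  \<open>V N\<^sup>* V N\<close> converges strongly to a positive invertible \<open>P\<close>, and \<open>\<psi>(a)\<close> and \<open>\<psi>(a\<^sup>*)\<close> are adjoint with
  respect to \<open>\<langle>P u, w\<rangle>\<close>. Conjugation with the square root of \<open>P\<close> makes the algebra selfadjoint.
\<close>

section \<open>Square integrable functions\<close>

text \<open>The outcome of the first half is a statement about condition numbers: the products over
  k of the supremum over i of the norm of s(i) times the norm of its inverse stay bounded. The
  obstacle is uniformity in N. The net has one bound for all forms of norm at most 1, so each
  coordinate may contribute only a contraction and unit vectors, and the gain must come from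
  averaging alone. Inside a single fibre nothing can be gained, because the matrix units meet s(i)
  on one side and its inverse on the other and the two cancel. The contraction therefore has to pass
  between fibres, and the assumption that the identity is among the s(i) supplies the partner
  against which s(i) is measured. The limit of the averaged form is known because the product of the
  net tends to 1.

  In the second half the operators V N need not converge, since unitary parts of the s(i) survive in
  them. Their absolute values suffice to determine adjoints, and the squares of these are monotone
  in N. A square root of the limit thus replaces an infinite tensor product of similarities, which
  may not exist.\<close>

lemma square_integrableD:
  assumes "x \<in> square_integrable M"
  shows "x \<in> borel_measurable M" "integrable M (\<lambda>\<omega>. (cmod (x \<omega>))\<^sup>2)"
  using assms by (auto simp: square_integrable_def)

text \<open>Lets membership come out of estimates between nonnegative integrals, where Fubini and
  Fatou apply without integrability in advance.\<close>

lemma square_integrable_iff_nn_integral: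
  "x \<in> square_integrable M \<longleftrightarrow>
    x \<in> borel_measurable M \<and> (\<integral>\<^sup>+\<omega>. ennreal ((cmod (x \<omega>))\<^sup>2) \<partial>M) < \<infinity>"
  by (auto simp: square_integrable_def integrable_iff_bounded)

lemma square_integrable_zero [simp]: "(\<lambda>_. 0) \<in> square_integrable M"
  by (simp add: square_integrable_def)

lemma square_integrable_scale:
  assumes "x \<in> square_integrable M"
  shows "(\<lambda>\<omega>. c * x \<omega>) \<in> square_integrable M"
  using assms by (auto simp: square_integrable_def norm_mult power_mult_distrib)

lemma borel_measurable_cnj [measurable]: "cnj \<in> borel_measurable borel"
  by (intro borel_measurable_continuous_onI continuous_intros)

lemma integrable_product:
  assumes x: "x \<in> square_integrable M" and y: "y \<in> square_integrable M"
  shows "integrable M (\<lambda>\<omega>. x \<omega> * cnj (y \<omega>))"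
proof (rule Bochner_Integration.integrable_bound)
  show "integrable M (\<lambda>\<omega>. (cmod (x \<omega>))\<^sup>2 + (cmod (y \<omega>))\<^sup>2)"
    using square_integrableD[OF x] square_integrableD[OF y] by simp
  show "(\<lambda>\<omega>. x \<omega> * cnj (y \<omega>)) \<in> borel_measurable M"
    using square_integrableD(1)[OF x] square_integrableD(1)[OF y] by measurable
  show "AE \<omega> in M. norm (x \<omega> * cnj (y \<omega>)) \<le> norm ((cmod (x \<omega>))\<^sup>2 + (cmod (y \<omega>))\<^sup>2)"
  proof (rule AE_I2)
    fix \<omega>
    have "2 * (cmod (x \<omega>) * cmod (y \<omega>)) \<le> (cmod (x \<omega>))\<^sup>2 + (cmod (y \<omega>))\<^sup>2"
      using sum_squares_bound[of "cmod (x \<omega>)" "cmod (y \<omega>)"] by (simp add: mult.assoc)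
    moreover have "0 \<le> cmod (x \<omega>) * cmod (y \<omega>)" by simp
    ultimately show "norm (x \<omega> * cnj (y \<omega>)) \<le> norm ((cmod (x \<omega>))\<^sup>2 + (cmod (y \<omega>))\<^sup>2)"
      unfolding norm_mult complex_mod_cnj real_norm_def by linarith
  qed
qed

lemma square_integrable_add:
  assumes x: "x \<in> square_integrable M" and y: "y \<in> square_integrable M"
  shows "(\<lambda>\<omega>. x \<omega> + y \<omega>) \<in> square_integrable M"
proof -
  have "integrable M (\<lambda>\<omega>. (cmod (x \<omega> + y \<omega>))\<^sup>2)"
  proof (rule Bochner_Integration.integrable_bound)
    show "integrable M (\<lambda>\<omega>. 2 * (cmod (x \<omega>))\<^sup>2 + 2 * (cmod (y \<omega>))\<^sup>2)"
      using square_integrableD[OF x] square_integrableD[OF y] by simp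
    show "(\<lambda>\<omega>. (cmod (x \<omega> + y \<omega>))\<^sup>2) \<in> borel_measurable M"
      using square_integrableD(1)[OF x] square_integrableD(1)[OF y] by measurable
    show "AE \<omega> in M. norm ((cmod (x \<omega> + y \<omega>))\<^sup>2) \<le> norm (2 * (cmod (x \<omega>))\<^sup>2 + 2 * (cmod (y \<omega>))\<^sup>2)"
    proof (rule AE_I2)
      fix \<omega>
      have "(cmod (x \<omega> + y \<omega>))\<^sup>2 \<le> (cmod (x \<omega>) + cmod (y \<omega>))\<^sup>2"
        by (intro power_mono norm_triangle_ineq) simp
      also have "\<dots> \<le> 2 * (cmod (x \<omega>))\<^sup>2 + 2 * (cmod (y \<omega>))\<^sup>2"
        using sum_squares_bound[of "cmod (x \<omega>)" "cmod (y \<omega>)"] by (simp add: power2_sum)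
      finally show "norm ((cmod (x \<omega> + y \<omega>))\<^sup>2) \<le> norm (2 * (cmod (x \<omega>))\<^sup>2 + 2 * (cmod (y \<omega>))\<^sup>2)"
        by simp
    qed
  qed
  moreover have "(\<lambda>\<omega>. x \<omega> + y \<omega>) \<in> borel_measurable M"
    using square_integrableD(1)[OF x] square_integrableD(1)[OF y] by measurable
  ultimately show ?thesis by (simp add: square_integrable_def)
qed

lemma square_integrable_diff:
  assumes x: "x \<in> square_integrable M" and y: "y \<in> square_integrable M"
  shows "(\<lambda>\<omega>. x \<omega> - y \<omega>) \<in> square_integrable M"
  using square_integrable_add[OF x square_integrable_scale[OF y, of "-1"]] by simp

section \<open>Classes modulo null sets\<close>

lemma l2_class_eqI:
  assumes "AE \<omega> in M. x \<omega> = y \<omega>"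
  shows "l2_class M x = l2_class M y"
  using assms unfolding l2_class_def by auto

lemma l2_class_cong_space:
  assumes "\<And>\<omega>. \<omega> \<in> space M \<Longrightarrow> x \<omega> = y \<omega>"
  shows "l2_class M x = l2_class M y"
  by (rule l2_class_eqI) (use assms in auto)

lemma l2_class_in_L2 [intro]: "x \<in> square_integrable M \<Longrightarrow> l2_class M x \<in> L2 M"
  by (simp add: L2_def)

lemma L2_cases [elim?]:
  assumes "u \<in> L2 M"
  obtains x where "x \<in> square_integrable M" "u = l2_class M x"
  using assms by (auto simp: L2_def)

lemma l2_rep_class:
  assumes "x \<in> square_integrable M"
  shows "l2_rep (l2_class M x) \<in> square_integrable M" "AE \<omega> in M. l2_rep (l2_class M x) \<omega> = x \<omega>"
proof -
  have "x \<in> l2_class M x" using assms by (simp add: l2_class_def)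
  then have "l2_rep (l2_class M x) \<in> l2_class M x"
    unfolding l2_rep_def by (rule someI[where P = "\<lambda>z. z \<in> _"])
  then show "l2_rep (l2_class M x) \<in> square_integrable M" "AE \<omega> in M. l2_rep (l2_class M x) \<omega> = x \<omega>"
    by (auto simp: l2_class_def)
qed

lemma l2_rep_L2:
  assumes "u \<in> L2 M"
  shows "l2_rep u \<in> square_integrable M" "l2_class M (l2_rep u) = u"
proof -
  obtain x where x: "x \<in> square_integrable M" "u = l2_class M x" using assms by (rule L2_cases)
  show "l2_rep u \<in> square_integrable M" using l2_rep_class x by simp
  show "l2_class M (l2_rep u) = u" unfolding x(2) by (rule l2_class_eqI[OF l2_rep_class(2)[OF x(1)]])
qed

lemma l2_add_class:
  assumes "x \<in> square_integrable M" "y \<in> square_integrable M"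
  shows "l2_add M (l2_class M x) (l2_class M y) = l2_class M (\<lambda>\<omega>. x \<omega> + y \<omega>)"
  unfolding l2_add_def using l2_rep_class(2)[OF assms(1)] l2_rep_class(2)[OF assms(2)]
  by (intro l2_class_eqI) auto

lemma l2_scale_class:
  assumes "x \<in> square_integrable M"
  shows "l2_scale M c (l2_class M x) = l2_class M (\<lambda>\<omega>. c * x \<omega>)"
  unfolding l2_scale_def using l2_rep_class(2)[OF assms(1)]
  by (intro l2_class_eqI) auto

lemma l2_inner_class:
  assumes x: "x \<in> square_integrable M" and y: "y \<in> square_integrable M"
  shows "l2_inner M (l2_class M x) (l2_class M y) = (LINT \<omega>|M. x \<omega> * cnj (y \<omega>))"
  unfolding l2_inner_def
proof (rule integral_cong_AE)
  note m = square_integrableD(1)[OF x] square_integrableD(1)[OF y]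
    square_integrableD(1)[OF l2_rep_class(1)[OF x]] square_integrableD(1)[OF l2_rep_class(1)[OF y]]
  show "(\<lambda>\<omega>. l2_rep (l2_class M x) \<omega> * cnj (l2_rep (l2_class M y) \<omega>)) \<in> borel_measurable M"
    using m by measurable
  show "(\<lambda>\<omega>. x \<omega> * cnj (y \<omega>)) \<in> borel_measurable M" using m by measurable
  show "AE \<omega> in M. l2_rep (l2_class M x) \<omega> * cnj (l2_rep (l2_class M y) \<omega>) = x \<omega> * cnj (y \<omega>)"
    using l2_rep_class(2)[OF x] l2_rep_class(2)[OF y] by auto
qed

lemma l2_norm_power2: "(l2_norm M u)\<^sup>2 = (LINT \<omega>|M. (cmod (l2_rep u \<omega>))\<^sup>2)"
  unfolding l2_norm_def by (subst real_sqrt_pow2) (auto intro: integral_nonneg_AE)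

lemma l2_norm_inner: "complex_of_real ((l2_norm M u)\<^sup>2) = l2_inner M u u"
  unfolding l2_norm_power2 l2_inner_def integral_complex_of_real[symmetric]
  by (simp only: complex_norm_square)

lemma l2_norm_class_power2:
  assumes x: "x \<in> square_integrable M"
  shows "(l2_norm M (l2_class M x))\<^sup>2 = (LINT \<omega>|M. (cmod (x \<omega>))\<^sup>2)"
proof -
  \<comment> \<open>Independence of the representative is inherited from the inner product, of which
    the squared norm is the diagonal value.\<close>
  have "complex_of_real ((l2_norm M (l2_class M x))\<^sup>2) = complex_of_real (LINT \<omega>|M. (cmod (x \<omega>))\<^sup>2)"
    unfolding l2_norm_inner l2_inner_class[OF x x] integral_complex_of_real[symmetric]
    by (simp only: complex_norm_square)
  then show ?thesis using of_real_eq_iff by blast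
qed

lemma l2_norm_nonneg [simp]: "l2_norm M u \<ge> 0"
  unfolding l2_norm_def by (auto intro: integral_nonneg_AE)

lemma l2_norm_class_nn_integral:
  assumes x: "x \<in> square_integrable M"
  shows "ennreal ((l2_norm M (l2_class M x))\<^sup>2) = (\<integral>\<^sup>+\<omega>. ennreal ((cmod (x \<omega>))\<^sup>2) \<partial>M)"
  unfolding l2_norm_class_power2[OF x]
  by (rule nn_integral_eq_integral[symmetric]) (use square_integrableD[OF x] in auto)

definition l2_zero :: "'w measure \<Rightarrow> 'w l2" where
  "l2_zero M = l2_class M (\<lambda>_. 0)"

text \<open>Built from addition and scaling, the two operations in the definition of a bounded
  operator, so that operators respect differences by unfolding.\<close>

definition l2_minus :: "'w measure \<Rightarrow> 'w l2 \<Rightarrow> 'w l2 \<Rightarrow> 'w l2" where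
  "l2_minus M u v = l2_add M u (l2_scale M (- 1) v)"

lemma l2_minus_class:
  assumes "x \<in> square_integrable M" "y \<in> square_integrable M"
  shows "l2_minus M (l2_class M x) (l2_class M y) = l2_class M (\<lambda>\<omega>. x \<omega> - y \<omega>)"
  unfolding l2_minus_def
  using assms l2_add_class[OF assms(1) square_integrable_scale[OF assms(2), of "- 1"]]
  by (simp add: l2_scale_class)

lemma L2_closed [intro, simp]:
  "l2_zero M \<in> L2 M"
  "u \<in> L2 M \<Longrightarrow> v \<in> L2 M \<Longrightarrow> l2_add M u v \<in> L2 M"
  "u \<in> L2 M \<Longrightarrow> l2_scale M c u \<in> L2 M"
  "u \<in> L2 M \<Longrightarrow> v \<in> L2 M \<Longrightarrow> l2_minus M u v \<in> L2 M"
  unfolding l2_zero_def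
  by (auto elim!: L2_cases intro!: l2_class_in_L2
      simp: l2_add_class l2_scale_class l2_minus_class square_integrable_add
        square_integrable_scale square_integrable_diff)

lemmas l2_class_simps = l2_add_class l2_scale_class l2_minus_class square_integrable_add
  square_integrable_scale square_integrable_diff

lemma l2_vector_space:
  assumes "u \<in> L2 M" "v \<in> L2 M" "w \<in> L2 M"
  shows "l2_add M (l2_add M u v) w = l2_add M u (l2_add M v w)"
    "l2_add M u v = l2_add M v u"
    "l2_add M (l2_zero M) u = u"
    "l2_add M u (l2_zero M) = u"
    "l2_scale M c (l2_add M u v) = l2_add M (l2_scale M c u) (l2_scale M c v)"
    "l2_scale M (c + e) u = l2_add M (l2_scale M c u) (l2_scale M e u)"
    "l2_scale M c (l2_scale M e u) = l2_scale M (c * e) u"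
    "l2_scale M 1 u = u"
    "l2_scale M 0 u = l2_zero M"
    "l2_scale M c (l2_zero M) = l2_zero M"
    "l2_minus M u u = l2_zero M"
    "l2_minus M u (l2_zero M) = u"
    "l2_add M (l2_minus M u v) v = u"
  using assms
  by (auto elim!: L2_cases simp: l2_class_simps l2_zero_def algebra_simps)

lemma l2_inner_linear:
  assumes "u \<in> L2 M" "v \<in> L2 M" "w \<in> L2 M"
  shows "l2_inner M (l2_add M u v) w = l2_inner M u w + l2_inner M v w"
    "l2_inner M w (l2_add M u v) = l2_inner M w u + l2_inner M w v"
    "l2_inner M (l2_minus M u v) w = l2_inner M u w - l2_inner M v w"
    "l2_inner M w (l2_minus M u v) = l2_inner M w u - l2_inner M w v"
    "l2_inner M (l2_scale M c u) w = c * l2_inner M u w"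
    "l2_inner M w (l2_scale M c u) = cnj c * l2_inner M w u"
    "l2_inner M (l2_zero M) w = 0"
    "l2_inner M w (l2_zero M) = 0"
proof -
  obtain x y z where [simp]: "u = l2_class M x" "v = l2_class M y" "w = l2_class M z"
    and [simp]: "x \<in> square_integrable M" "y \<in> square_integrable M" "z \<in> square_integrable M"
    using assms by (metis L2_cases)
  note [simp] = l2_class_simps l2_inner_class integrable_product
  show "l2_inner M (l2_add M u v) w = l2_inner M u w + l2_inner M v w"
    by (simp add: distrib_right)
  show "l2_inner M w (l2_add M u v) = l2_inner M w u + l2_inner M w v"
    by (simp add: distrib_left)
  show "l2_inner M (l2_minus M u v) w = l2_inner M u w - l2_inner M v w"
    by (simp add: left_diff_distrib)
  show "l2_inner M w (l2_minus M u v) = l2_inner M w u - l2_inner M w v"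
    by (simp add: right_diff_distrib)
  show "l2_inner M (l2_scale M c u) w = c * l2_inner M u w"
    by (simp add: mult.assoc)
  show "l2_inner M w (l2_scale M c u) = cnj c * l2_inner M w u"
    by (simp add: mult.left_commute)
  show "l2_inner M (l2_zero M) w = 0" "l2_inner M w (l2_zero M) = 0"
    by (simp_all add: l2_zero_def)
qed

lemma l2_inner_cnj: "cnj (l2_inner M u v) = l2_inner M v u"
  unfolding l2_inner_def Bochner_Integration.integral_cnj[symmetric] by (simp add: mult.commute)

text \<open>Stated for semidefinite forms, so that it also applies to \<open>\<langle>T u, v\<rangle>\<close> with \<open>T \<ge> 0\<close>.\<close>

lemma semidefinite_Cauchy_Schwarz:
  fixes a b z :: real
  assumes "a \<ge> 0" "b \<ge> 0"
    and *: "\<And>t. 0 \<le> a - 2 * t * z\<^sup>2 + t\<^sup>2 * z\<^sup>2 * b"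
  shows "z\<^sup>2 \<le> a * b"
proof (cases "b = 0")
  case True
  show ?thesis
  proof (cases "z = 0")
    case False
    \<comment> \<open>For \<open>b = 0\<close> the quadratic is linear in \<open>t\<close>; this
      \<open>t\<close> makes it negative, so \<open>z\<close> must vanish.\<close>
    then have "0 \<le> a - 2 * (a + 1)"
      using *[of "(a + 1) / z\<^sup>2"] True by simp
    then show ?thesis using assms by simp
  qed (use True in auto)
next
  case False
  with assms have b: "b > 0" by simp
  \<comment> \<open>\<open>t = 1 / b\<close> minimises the quadratic.\<close>
  have "0 \<le> a - z\<^sup>2 / b"
    using *[of "1 / b"] b by (simp add: power2_eq_square)
  then show ?thesis using b by (simp add: field_simps)
qed

lemma l2_norm_add_scale_power2:
  assumes "u \<in> L2 M" "v \<in> L2 M"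
  shows "(l2_norm M (l2_add M u (l2_scale M c v)))\<^sup>2 =
    (l2_norm M u)\<^sup>2 + 2 * Re (c * l2_inner M v u) + (cmod c)\<^sup>2 * (l2_norm M v)\<^sup>2"
proof -
  let ?z = "l2_inner M v u"
  have "complex_of_real ((l2_norm M (l2_add M u (l2_scale M c v)))\<^sup>2) =
      l2_inner M u u + (c * ?z + cnj (c * ?z)) + c * cnj c * l2_inner M v v"
    unfolding l2_norm_inner complex_cnj_mult l2_inner_cnj using assms
    by (simp add: l2_inner_linear algebra_simps)
  also have "\<dots> = complex_of_real ((l2_norm M u)\<^sup>2 + 2 * Re (c * ?z) + (cmod c)\<^sup>2 * (l2_norm M v)\<^sup>2)"
    unfolding complex_add_cnj l2_norm_inner[symmetric] complex_norm_square[symmetric] by simp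
  finally show ?thesis using of_real_eq_iff by blast
qed

lemma l2_Cauchy_Schwarz:
  assumes "u \<in> L2 M" "v \<in> L2 M"
  shows "cmod (l2_inner M u v) \<le> l2_norm M u * l2_norm M v"
proof -
  let ?z = "l2_inner M v u"
  have "(cmod ?z)\<^sup>2 \<le> (l2_norm M u)\<^sup>2 * (l2_norm M v)\<^sup>2"
  proof (rule semidefinite_Cauchy_Schwarz)
    fix t :: real
    \<comment> \<open>The phase of \<open>cnj ?z\<close> makes the cross term real, and its modulus
      puts the factor |z|^2 into both terms, as the semidefinite inequality expects.\<close>
    let ?c = "complex_of_real (- t) * cnj ?z"
    have "?c * ?z = complex_of_real (- t * (cmod ?z)\<^sup>2)"
      unfolding of_real_mult complex_norm_square by simp
    then have "Re (?c * ?z) = - t * (cmod ?z)\<^sup>2" by (metis Re_complex_of_real)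
    moreover have "(cmod ?c)\<^sup>2 = t\<^sup>2 * (cmod ?z)\<^sup>2"
      by (simp add: norm_mult power_mult_distrib)
    ultimately have "(l2_norm M (l2_add M u (l2_scale M ?c v)))\<^sup>2 =
        (l2_norm M u)\<^sup>2 + 2 * (- t * (cmod ?z)\<^sup>2) + t\<^sup>2 * (cmod ?z)\<^sup>2 * (l2_norm M v)\<^sup>2"
      by (simp only: l2_norm_add_scale_power2[OF assms, of ?c])
    then show "0 \<le> (l2_norm M u)\<^sup>2 - 2 * t * (cmod ?z)\<^sup>2 + t\<^sup>2 * (cmod ?z)\<^sup>2 * (l2_norm M v)\<^sup>2"
      using zero_le_power2[of "l2_norm M (l2_add M u (l2_scale M ?c v))"] by simp
  qed simp_all
  then have "cmod ?z \<le> l2_norm M u * l2_norm M v"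
    unfolding power_mult_distrib[symmetric] by (rule power2_le_imp_le) simp
  moreover have "cmod (l2_inner M u v) = cmod ?z"
    by (metis l2_inner_cnj complex_mod_cnj)
  ultimately show ?thesis by simp
qed

lemma l2_norm_scale:
  assumes "u \<in> L2 M"
  shows "l2_norm M (l2_scale M c u) = cmod c * l2_norm M u"
proof -
  obtain x where [simp]: "u = l2_class M x" "x \<in> square_integrable M" using assms by (rule L2_cases)
  have "(l2_norm M (l2_scale M c u))\<^sup>2 = (cmod c * l2_norm M u)\<^sup>2"
    by (simp add: l2_class_simps l2_norm_class_power2 power_mult_distrib norm_mult)
  then show ?thesis by simp
qed

lemma l2_norm_triangle:
  assumes "u \<in> L2 M" "v \<in> L2 M"
  shows "l2_norm M (l2_add M u v) \<le> l2_norm M u + l2_norm M v"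
proof (rule power2_le_imp_le)
  have "(l2_norm M (l2_add M u v))\<^sup>2 = (l2_norm M u)\<^sup>2 + 2 * Re (l2_inner M v u) + (l2_norm M v)\<^sup>2"
    using l2_norm_add_scale_power2[OF assms, of 1] l2_vector_space(8)[OF assms(2,2,2)] by simp
  also have "\<dots> \<le> (l2_norm M u)\<^sup>2 + 2 * (l2_norm M v * l2_norm M u) + (l2_norm M v)\<^sup>2"
    using complex_Re_le_cmod[of "l2_inner M v u"] l2_Cauchy_Schwarz[OF assms(2,1)] by simp
  also have "\<dots> = (l2_norm M u + l2_norm M v)\<^sup>2" by (simp add: power2_sum)
  finally show "(l2_norm M (l2_add M u v))\<^sup>2 \<le> (l2_norm M u + l2_norm M v)\<^sup>2" .
qed simp

lemma l2_norm_minus_commute: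
  assumes "u \<in> L2 M" "v \<in> L2 M"
  shows "l2_norm M (l2_minus M u v) = l2_norm M (l2_minus M v u)"
proof -
  have "l2_minus M u v = l2_scale M (- 1) (l2_minus M v u)"
    using assms by (auto elim!: L2_cases simp: l2_class_simps)
  then show ?thesis using assms by (simp add: l2_norm_scale)
qed

lemma l2_norm_triangle_minus:
  assumes "u \<in> L2 M" "v \<in> L2 M" "w \<in> L2 M"
  shows "l2_norm M (l2_minus M u w) \<le> l2_norm M (l2_minus M u v) + l2_norm M (l2_minus M v w)"
proof -
  have "l2_minus M u w = l2_add M (l2_minus M u v) (l2_minus M v w)"
    using assms by (auto elim!: L2_cases simp: l2_class_simps)
  then show ?thesis using assms by (simp add: l2_norm_triangle)
qed

lemma l2_norm_le_add_minus:
  assumes "u \<in> L2 M" "v \<in> L2 M"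
  shows "l2_norm M u \<le> l2_norm M v + l2_norm M (l2_minus M u v)"
proof -
  have "u = l2_add M v (l2_minus M u v)"
    using assms by (auto elim!: L2_cases simp: l2_class_simps)
  then show ?thesis using assms l2_norm_triangle[of v M "l2_minus M u v"] by simp
qed

lemma l2_norm_zero [simp]: "l2_norm M (l2_zero M) = 0"
  using l2_norm_scale[of "l2_zero M" M 0] l2_vector_space(9)[of "l2_zero M" M "l2_zero M" "l2_zero M"] by simp

lemma l2_norm_eq_zero_iff:
  assumes "u \<in> L2 M"
  shows "l2_norm M u = 0 \<longleftrightarrow> u = l2_zero M"
proof
  obtain x where x: "u = l2_class M x" "x \<in> square_integrable M" using assms by (metis L2_cases)
  assume "l2_norm M u = 0"
  then have "(LINT \<omega>|M. (cmod (x \<omega>))\<^sup>2) = 0" using x l2_norm_class_power2[of x M] by simp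
  then have "AE \<omega> in M. (cmod (x \<omega>))\<^sup>2 = 0"
    using integral_nonneg_eq_0_iff_AE[of M "\<lambda>\<omega>. (cmod (x \<omega>))\<^sup>2"] square_integrableD[OF x(2)] by simp
  then show "u = l2_zero M" unfolding x l2_zero_def by (intro l2_class_eqI) auto
qed auto

lemma l2_minus_eq_zero_iff:
  assumes "u \<in> L2 M" "v \<in> L2 M"
  shows "l2_minus M u v = l2_zero M \<longleftrightarrow> u = v"
  by (metis assms L2_closed(1) l2_vector_space(3,11,13))

lemma l2_eqI_inner:
  assumes "u \<in> L2 M" "v \<in> L2 M" "\<And>w. w \<in> L2 M \<Longrightarrow> l2_inner M u w = l2_inner M v w"
  shows "u = v"
proof -
  let ?w = "l2_minus M u v"
  have "l2_inner M ?w ?w = 0"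
    using assms by (simp add: l2_inner_linear(3))
  then have "l2_norm M ?w = 0" using l2_norm_inner[of M ?w] by (metis of_real_eq_0_iff zero_eq_power2)
  then show ?thesis using assms l2_norm_eq_zero_iff l2_minus_eq_zero_iff L2_closed(4) by metis
qed

section \<open>Completeness\<close>

text \<open>Riesz-Fischer: on a finite measure space L2 norms control L1 norms, so summable
  increments have an integrable sum of absolute values and the representatives converge almost
  everywhere. Fatou's lemma then turns pointwise convergence into norm convergence.\<close>

lemma l2_complete_summable:
  assumes "finite_measure M"
    and u: "\<And>n. u n \<in> L2 M"
    and r: "\<And>n. l2_norm M (l2_minus M (u (Suc n)) (u n)) \<le> r n" "summable r"
  shows "\<exists>v\<in>L2 M. (\<lambda>n. l2_norm M (l2_minus M (u n) v)) \<longlonglongrightarrow> 0"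
proof -
  interpret finite_measure M by fact
  obtain x where x: "\<And>n. x n \<in> square_integrable M" "\<And>n. u n = l2_class M (x n)"
    using that[of "\<lambda>n. l2_rep (u n)"] l2_rep_L2[OF u] by simp
  have xm [measurable]: "x n \<in> borel_measurable M" for n using square_integrableD(1)[OF x(1)] .
  define D where "D n \<omega> = x (Suc n) \<omega> - x n \<omega>" for n \<omega>
  have D: "D n \<in> square_integrable M" for n unfolding D_def by (intro square_integrable_diff x)
  have Dm [measurable]: "D n \<in> borel_measurable M" for n using square_integrableD(1)[OF D] .
  have r0: "r n \<ge> 0" for n using r(1)[of n] l2_norm_nonneg[of M] by (meson order.trans)
  have normD: "l2_norm M (l2_class M (D n)) \<le> r n" for n
    using r(1)[of n] x by (simp add: l2_minus_class D_def[abs_def])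
  \<comment> \<open>Norm of the constant 1, finite because the measure is: the constant in the
    passage from L2 to L1.\<close>
  define Cm where "Cm = l2_norm M (l2_class M (\<lambda>_. 1))"
  have one: "(\<lambda>_. 1) \<in> square_integrable M" by (simp add: square_integrable_def)
  have abs1: "(\<integral>\<^sup>+\<omega>. ennreal (cmod (D n \<omega>)) \<partial>M) \<le> ennreal (Cm * r n)" for n
  proof -
    have absD: "(\<lambda>\<omega>. complex_of_real (cmod (D n \<omega>))) \<in> square_integrable M"
      using D[of n] by (auto simp: square_integrable_def)
    have "l2_norm M (l2_class M (\<lambda>\<omega>. complex_of_real (cmod (D n \<omega>)))) = l2_norm M (l2_class M (D n))"
    proof (rule power2_eq_imp_eq)
      show "(l2_norm M (l2_class M (\<lambda>\<omega>. complex_of_real (cmod (D n \<omega>)))))\<^sup>2 = (l2_norm M (l2_class M (D n)))\<^sup>2"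
        unfolding l2_norm_class_power2[OF absD] l2_norm_class_power2[OF D] by simp
    qed simp_all
    then have "cmod (LINT \<omega>|M. complex_of_real (cmod (D n \<omega>)) * cnj 1) \<le> r n * Cm"
      using l2_Cauchy_Schwarz[OF l2_class_in_L2[OF absD] l2_class_in_L2[OF one]] normD[of n]
        mult_right_mono[OF normD[of n], of Cm]
      unfolding l2_inner_class[OF absD one] by (simp add: Cm_def)
    then have *: "(LINT \<omega>|M. cmod (D n \<omega>)) \<le> Cm * r n"
      by (simp add: mult.commute abs_le_iff)
    have "integrable M (\<lambda>\<omega>. cmod (D n \<omega>))"
      using integrable_norm[OF integrable_product[OF D one, of n]] by (simp add: norm_mult)
    then show ?thesis
      using * by (subst nn_integral_eq_integral) (auto intro!: ennreal_leI)
  qed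
  have "(\<integral>\<^sup>+\<omega>. (\<Sum>n. ennreal (cmod (D n \<omega>))) \<partial>M) = (\<Sum>n. \<integral>\<^sup>+\<omega>. ennreal (cmod (D n \<omega>)) \<partial>M)"
    by (rule nn_integral_suminf) simp
  also have "\<dots> \<le> (\<Sum>n. ennreal (Cm * r n))"
    by (intro suminf_le abs1) auto
  also have "\<dots> < \<infinity>"
    using r(2) r0 by (subst suminf_ennreal2) (auto simp: Cm_def intro!: summable_mult)
  finally have "AE \<omega> in M. (\<Sum>n. ennreal (cmod (D n \<omega>))) \<noteq> \<infinity>"
    by (intro nn_integral_noteq_infinite) auto
  then have conv: "AE \<omega> in M. convergent (\<lambda>n. x n \<omega>)"
  proof eventually_elim
    case (elim \<omega>)
    then have "summable (\<lambda>n. cmod (D n \<omega>))"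
      by (intro summable_suminf_not_top) auto
    then have "summable (\<lambda>n. D n \<omega>)" by (rule summable_norm_cancel)
    then have "convergent (\<lambda>n. \<Sum>k<n. D k \<omega>)" by (simp add: summable_iff_convergent)
    then have "convergent (\<lambda>n. x 0 \<omega> + (\<Sum>k<n. D k \<omega>))"
      by (intro convergent_add convergent_const)
    moreover have "x 0 \<omega> + (\<Sum>k<n. D k \<omega>) = x n \<omega>" for n
      using sum_lessThan_telescope[of "\<lambda>k. x k \<omega>" n] unfolding D_def by simp
    ultimately show ?case by simp
  qed
  define y where "y \<omega> = lim (\<lambda>n. x n \<omega>)" for \<omega>
  have ym [measurable]: "y \<in> borel_measurable M"
    unfolding y_def[abs_def] by (rule borel_measurable_lim_metric) simp
  have ylim: "AE \<omega> in M. (\<lambda>n. x n \<omega>) \<longlonglongrightarrow> y \<omega>"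
    using conv unfolding y_def by (auto simp: convergent_LIMSEQ_iff)
  have tele: "l2_norm M (l2_minus M (u (n + k)) (u n)) \<le> (\<Sum>j. r (j + n))" for n k
  proof -
    have "l2_norm M (l2_minus M (u (n + k)) (u n)) \<le> (\<Sum>j<k. r (j + n))"
    proof (induction k)
      case 0 then show ?case using u by (simp add: l2_vector_space(11)[OF u u u])
    next
      case (Suc k)
      have "l2_norm M (l2_minus M (u (n + Suc k)) (u n)) \<le>
        l2_norm M (l2_minus M (u (Suc (n + k))) (u (n + k))) + l2_norm M (l2_minus M (u (n + k)) (u n))"
        using l2_norm_triangle_minus[OF u u u] by simp
      also have "\<dots> \<le> r (n + k) + (\<Sum>j<k. r (j + n))" using r(1) Suc by (intro add_mono)
      finally show ?case by (simp add: add.commute)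
    qed
    also have "\<dots> \<le> (\<Sum>j. r (j + n))"
      using r(2) r0 by (intro sum_le_suminf) (auto simp: summable_iff_shift)
    finally show ?thesis .
  qed
  \<comment> \<open>The pointwise limit is compared with \<open>x n\<close> before it is known to be
    square integrable; this estimate yields both that and the rate of convergence.\<close>
  have fatou: "(\<integral>\<^sup>+\<omega>. ennreal ((cmod (x n \<omega> - y \<omega>))\<^sup>2) \<partial>M) \<le> ennreal ((\<Sum>j. r (j + n))\<^sup>2)" for n
  proof -
    have "(\<integral>\<^sup>+\<omega>. ennreal ((cmod (x n \<omega> - y \<omega>))\<^sup>2) \<partial>M) =
        (\<integral>\<^sup>+\<omega>. liminf (\<lambda>k. ennreal ((cmod (x n \<omega> - x k \<omega>))\<^sup>2)) \<partial>M)"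
      using ylim
      by (intro nn_integral_cong_AE, eventually_elim)
        (intro lim_imp_Liminf[symmetric] tendsto_ennrealI tendsto_intros, auto)
    also have "\<dots> \<le> liminf (\<lambda>k. \<integral>\<^sup>+\<omega>. ennreal ((cmod (x n \<omega> - x k \<omega>))\<^sup>2) \<partial>M)"
      by (intro nn_integral_liminf) simp
    also have "\<dots> \<le> ennreal ((\<Sum>j. r (j + n))\<^sup>2)"
    proof (rule Liminf_le, simp)
      have "(\<integral>\<^sup>+\<omega>. ennreal ((cmod (x n \<omega> - x k \<omega>))\<^sup>2) \<partial>M) \<le> ennreal ((\<Sum>j. r (j + n))\<^sup>2)" if "k \<ge> n" for k
      proof -
        have "(\<integral>\<^sup>+\<omega>. ennreal ((cmod (x n \<omega> - x k \<omega>))\<^sup>2) \<partial>M) = ennreal ((l2_norm M (l2_minus M (u n) (u k)))\<^sup>2)"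
          using x by (simp add: l2_minus_class l2_norm_class_nn_integral square_integrable_diff)
        also have "l2_norm M (l2_minus M (u n) (u k)) = l2_norm M (l2_minus M (u k) (u n))"
          by (rule l2_norm_minus_commute[OF u u])
        finally show ?thesis using tele[of n "k - n"] that by (auto intro!: ennreal_leI power_mono)
      qed
      then show "\<forall>\<^sub>F k in sequentially. (\<integral>\<^sup>+\<omega>. ennreal ((cmod (x n \<omega> - x k \<omega>))\<^sup>2) \<partial>M) \<le> ennreal ((\<Sum>j. r (j + n))\<^sup>2)"
        by (auto simp: eventually_sequentially)
    qed
    finally show ?thesis .
  qed
  have diff: "(\<lambda>\<omega>. x n \<omega> - y \<omega>) \<in> square_integrable M" for n
    using fatou[of n] unfolding square_integrable_iff_nn_integral by (auto intro: le_less_trans)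
  have y: "y \<in> square_integrable M"
    using square_integrable_diff[OF x(1)[of 0] diff[of 0]] by simp
  have bd: "l2_norm M (l2_minus M (u n) (l2_class M y)) \<le> (\<Sum>j. r (j + n))" for n
  proof (rule power2_le_imp_le)
    have "ennreal ((l2_norm M (l2_minus M (u n) (l2_class M y)))\<^sup>2) \<le> ennreal ((\<Sum>j. r (j + n))\<^sup>2)"
      using fatou[of n] x y diff by (simp add: l2_minus_class l2_norm_class_nn_integral)
    then show "(l2_norm M (l2_minus M (u n) (l2_class M y)))\<^sup>2 \<le> (\<Sum>j. r (j + n))\<^sup>2"
      by (simp add: ennreal_le_iff)
    show "0 \<le> (\<Sum>j. r (j + n))" using r r0 by (intro suminf_nonneg) (auto simp: summable_iff_shift)
  qed
  have "(\<lambda>n. \<Sum>j. r (j + n)) \<longlonglongrightarrow> 0" using suminf_exist_split2[OF r(2)] .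
  then have "(\<lambda>n. l2_norm M (l2_minus M (u n) (l2_class M y))) \<longlonglongrightarrow> 0"
    by (rule tendsto_sandwich[OF _ _ tendsto_const, rotated 2]) (use bd in auto)
  then show ?thesis using y by blast
qed

lemma l2_complete:
  assumes "finite_measure M"
    and u: "\<And>n. u n \<in> L2 M"
    and cauchy: "\<And>e. e > 0 \<Longrightarrow> \<exists>N. \<forall>m\<ge>N. \<forall>n\<ge>m. l2_norm M (l2_minus M (u n) (u m)) < e"
  shows "\<exists>v\<in>L2 M. (\<lambda>n. l2_norm M (l2_minus M (u n) v)) \<longlonglongrightarrow> 0"
proof -
  have "\<exists>N. \<forall>k. \<forall>m\<ge>N k. \<forall>n\<ge>m. l2_norm M (l2_minus M (u n) (u m)) < (1 / 2) ^ k"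
    using cauchy by (intro choice allI) simp
  then obtain N where N: "\<And>k m n. m \<ge> N k \<Longrightarrow> n \<ge> m \<Longrightarrow> l2_norm M (l2_minus M (u n) (u m)) < (1 / 2) ^ k"
    by blast
  \<comment> \<open>Summing the thresholds gives a monotone sequence with
    \<open>h k \<ge> N k\<close>, so consecutive members of the subsequence differ by less than
    \<open>(1 / 2) ^ k\<close>.\<close>
  define h where "h k = (\<Sum>j\<le>k. N j)" for k
  have h1: "h k \<ge> N k" for k unfolding h_def by (rule member_le_sum) auto
  have h2: "h (Suc k) \<ge> h k" for k by (simp add: h_def)
  obtain v where v: "v \<in> L2 M" and lim: "(\<lambda>k. l2_norm M (l2_minus M (u (h k)) v)) \<longlonglongrightarrow> 0"
    using l2_complete_summable[OF assms(1), of "\<lambda>k. u (h k)" "\<lambda>k. (1 / 2) ^ k"] u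
      N[OF h1 h2] by (fastforce intro: less_imp_le)
  have "(\<lambda>n. l2_norm M (l2_minus M (u n) v)) \<longlonglongrightarrow> 0"
  proof (rule LIMSEQ_I)
    fix e :: real assume "e > 0"
    obtain k0 where k0: "\<And>k. k \<ge> k0 \<Longrightarrow> l2_norm M (l2_minus M (u (h k)) v) < e / 2"
      using LIMSEQ_D[OF lim, of "e / 2"] \<open>e > 0\<close> by auto
    obtain k1 where k1: "(1 / 2 :: real) ^ k1 < e / 2"
      using real_arch_pow_inv[of "e / 2" "1 / 2"] \<open>e > 0\<close> by auto
    let ?k = "max k0 k1"
    have "norm (l2_norm M (l2_minus M (u n) v) - 0) < e" if "n \<ge> h ?k" for n
    proof -
      have "l2_norm M (l2_minus M (u n) (u (h ?k))) < (1 / 2) ^ ?k"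
        using N[OF h1 that] .
      also have "\<dots> \<le> (1 / 2) ^ k1" by (intro power_decreasing) auto
      finally have "l2_norm M (l2_minus M (u n) (u (h ?k))) < e / 2" using k1 by simp
      moreover have "l2_norm M (l2_minus M (u (h ?k)) v) < e / 2" by (rule k0) simp
      ultimately show ?thesis
        using l2_norm_triangle_minus[OF u[of n] u[of "h ?k"] v] by simp
    qed
    then show "\<exists>n0. \<forall>n\<ge>n0. norm (l2_norm M (l2_minus M (u n) v) - 0) < e" by blast
  qed
  with v show ?thesis by blast
qed

section \<open>Bounded operators\<close>

definition l2_lim :: "'w measure \<Rightarrow> (nat \<Rightarrow> 'w l2) \<Rightarrow> 'w l2 \<Rightarrow> bool" where
  "l2_lim M f u \<longleftrightarrow> (\<lambda>n. l2_norm M (l2_minus M (f n) u)) \<longlonglongrightarrow> 0"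

lemma l2_lim_bound:
  assumes "\<And>n. l2_norm M (l2_minus M (f n) u) \<le> g n" "g \<longlonglongrightarrow> 0"
  shows "l2_lim M f u"
  unfolding l2_lim_def
  by (rule tendsto_sandwich[OF _ _ tendsto_const assms(2)]) (use assms(1) in auto)

lemma l2_lim_inner:
  assumes "l2_lim M f u" "\<And>n. f n \<in> L2 M" "u \<in> L2 M" "w \<in> L2 M"
  shows "(\<lambda>n. l2_inner M (f n) w) \<longlonglongrightarrow> l2_inner M u w"
    "(\<lambda>n. l2_inner M w (f n)) \<longlonglongrightarrow> l2_inner M w u"
proof -
  have lim: "(\<lambda>n. l2_norm M (l2_minus M (f n) u) * l2_norm M w) \<longlonglongrightarrow> 0"
    using tendsto_mult_left_zero[OF assms(1)[unfolded l2_lim_def]] .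
  have "(\<lambda>n. l2_inner M (f n) w - l2_inner M u w) \<longlonglongrightarrow> 0"
  proof (rule Lim_null_comparison[OF _ lim])
    have "cmod (l2_inner M (f n) w - l2_inner M u w) \<le> l2_norm M (l2_minus M (f n) u) * l2_norm M w" for n
      using l2_Cauchy_Schwarz[of "l2_minus M (f n) u" M w] assms
      by (simp add: l2_inner_linear(3))
    then show "\<forall>\<^sub>F n in sequentially. cmod (l2_inner M (f n) w - l2_inner M u w)
        \<le> l2_norm M (l2_minus M (f n) u) * l2_norm M w" by simp
  qed
  then show *: "(\<lambda>n. l2_inner M (f n) w) \<longlonglongrightarrow> l2_inner M u w" by (simp add: LIM_zero_iff)
  show "(\<lambda>n. l2_inner M w (f n)) \<longlonglongrightarrow> l2_inner M w u"
    using tendsto_cnj[OF *] by (simp add: l2_inner_cnj)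
qed

lemma l2_lim_unique:
  assumes "l2_lim M f u" "l2_lim M f v" "\<And>n. f n \<in> L2 M" "u \<in> L2 M" "v \<in> L2 M"
  shows "u = v"
  using assms by (intro l2_eqI_inner[of u M v]) (auto intro: LIMSEQ_unique l2_lim_inner)

lemma l2_lim_const: "u \<in> L2 M \<Longrightarrow> l2_lim M (\<lambda>_. u) u"
  unfolding l2_lim_def using l2_vector_space(11)[of u M u u] by simp

lemma l2_lim_add:
  assumes "l2_lim M f u" "l2_lim M g v" "\<And>n. f n \<in> L2 M" "\<And>n. g n \<in> L2 M" "u \<in> L2 M" "v \<in> L2 M"
  shows "l2_lim M (\<lambda>n. l2_add M (f n) (g n)) (l2_add M u v)"
proof (rule l2_lim_bound)
  have id: "l2_minus M (l2_add M a b) (l2_add M u v) = l2_add M (l2_minus M a u) (l2_minus M b v)"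
    if "a \<in> L2 M" "b \<in> L2 M" for a b
    using that assms(5,6) by (auto elim!: L2_cases simp: l2_class_simps algebra_simps)
  show "l2_norm M (l2_minus M (l2_add M (f n) (g n)) (l2_add M u v)) \<le>
    l2_norm M (l2_minus M (f n) u) + l2_norm M (l2_minus M (g n) v)" for n
    using assms by (simp add: id l2_norm_triangle)
  show "(\<lambda>n. l2_norm M (l2_minus M (f n) u) + l2_norm M (l2_minus M (g n) v)) \<longlonglongrightarrow> 0"
    using tendsto_add[OF assms(1,2)[unfolded l2_lim_def]] by simp
qed

lemma l2_lim_scale:
  assumes "l2_lim M f u" "\<And>n. f n \<in> L2 M" "u \<in> L2 M"
  shows "l2_lim M (\<lambda>n. l2_scale M c (f n)) (l2_scale M c u)"
proof (rule l2_lim_bound)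
  have id: "l2_minus M (l2_scale M c a) (l2_scale M c u) = l2_scale M c (l2_minus M a u)"
    if "a \<in> L2 M" for a
    using that assms(3) by (auto elim!: L2_cases simp: l2_class_simps algebra_simps)
  show "l2_norm M (l2_minus M (l2_scale M c (f n)) (l2_scale M c u)) \<le>
    cmod c * l2_norm M (l2_minus M (f n) u)" for n
    using assms by (simp add: id l2_norm_scale)
  show "(\<lambda>n. cmod c * l2_norm M (l2_minus M (f n) u)) \<longlonglongrightarrow> 0"
    using tendsto_mult_right_zero[OF assms(1)[unfolded l2_lim_def]] by simp
qed

lemma l2_lim_norm_le:
  assumes "l2_lim M f u" "\<And>n. f n \<in> L2 M" "u \<in> L2 M" "\<And>n. l2_norm M (f n) \<le> K"
  shows "l2_norm M u \<le> K"
proof -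
  have "l2_norm M u \<le> K + l2_norm M (l2_minus M (f n) u)" for n
    using l2_norm_le_add_minus[OF assms(3) assms(2)[of n]] assms(4)[of n]
      l2_norm_minus_commute[OF assms(2)[of n] assms(3)] by simp
  then show ?thesis
    using LIMSEQ_le_const[OF tendsto_add[OF tendsto_const[of K] assms(1)[unfolded l2_lim_def]]] by auto
qed

lemma l2_lim_Suc: "l2_lim M f u \<Longrightarrow> l2_lim M (\<lambda>n. f (Suc n)) u"
  unfolding l2_lim_def using LIMSEQ_Suc by blast

section \<open>Bounded operators and the operator norm\<close>

lemma bounded_opsD:
  assumes "T \<in> bounded_ops M"
  shows "u \<in> L2 M \<Longrightarrow> T u \<in> L2 M"
    "u \<in> L2 M \<Longrightarrow> v \<in> L2 M \<Longrightarrow> T (l2_add M u v) = l2_add M (T u) (T v)"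
    "u \<in> L2 M \<Longrightarrow> T (l2_scale M c u) = l2_scale M c (T u)"
    "u \<in> L2 M \<Longrightarrow> v \<in> L2 M \<Longrightarrow> T (l2_minus M u v) = l2_minus M (T u) (T v)"
    "u \<notin> L2 M \<Longrightarrow> T u = undefined"
  using assms by (auto simp: bounded_ops_def l2_minus_def)

lemma bounded_ops_bound:
  assumes "T \<in> bounded_ops M"
  obtains K where "K \<ge> 0" "\<And>u. u \<in> L2 M \<Longrightarrow> l2_norm M (T u) \<le> K * l2_norm M u"
proof -
  obtain K where K: "\<And>u. u \<in> L2 M \<Longrightarrow> l2_norm M (T u) \<le> K * l2_norm M u"
    using assms unfolding bounded_ops_def by blast
  have "l2_norm M (T u) \<le> \<bar>K\<bar> * l2_norm M u" if "u \<in> L2 M" for u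
    using K[OF that] mult_right_mono[OF abs_ge_self[of K] l2_norm_nonneg[of M u]] by simp
  then show ?thesis using that[of "\<bar>K\<bar>"] by simp
qed

lemma bounded_ops_zero: "T \<in> bounded_ops M \<Longrightarrow> T (l2_zero M) = l2_zero M"
  by (metis L2_closed(1) bounded_opsD(1,3) l2_vector_space(9))

lemma bounded_opsI:
  assumes "\<And>u. u \<in> L2 M \<Longrightarrow> F u \<in> L2 M"
    "\<And>u v. u \<in> L2 M \<Longrightarrow> v \<in> L2 M \<Longrightarrow> F (l2_add M u v) = l2_add M (F u) (F v)"
    "\<And>c u. u \<in> L2 M \<Longrightarrow> F (l2_scale M c u) = l2_scale M c (F u)"
    "\<And>u. u \<in> L2 M \<Longrightarrow> l2_norm M (F u) \<le> K * l2_norm M u"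
  shows "(\<lambda>u\<in>L2 M. F u) \<in> bounded_ops M"
  using assms unfolding bounded_ops_def by (auto intro!: exI[of _ K])

text \<open>Operators are extensional, with value \<open>undefined\<close> off \<open>L2 M\<close>,
  so agreement on \<open>L2 M\<close> is equality.\<close>

lemma bounded_ops_ext:
  assumes "S \<in> bounded_ops M" "T \<in> bounded_ops M" "\<And>u. u \<in> L2 M \<Longrightarrow> S u = T u"
  shows "S = T"
proof
  fix u show "S u = T u"
    using assms bounded_opsD(5)[OF assms(1)] bounded_opsD(5)[OF assms(2)] by (cases "u \<in> L2 M") auto
qed

lemma op_norm_bdd:
  assumes "T \<in> bounded_ops M"
  shows "bdd_above ((\<lambda>u. l2_norm M (T u)) ` {u \<in> L2 M. l2_norm M u \<le> 1})"
proof -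
  obtain K where K: "K \<ge> 0" "\<And>u. u \<in> L2 M \<Longrightarrow> l2_norm M (T u) \<le> K * l2_norm M u"
    using bounded_ops_bound[OF assms] by blast
  have "l2_norm M (T u) \<le> K" if "u \<in> L2 M" "l2_norm M u \<le> 1" for u
    using K(2)[OF that(1)] mult_left_mono[OF that(2) K(1)] by simp
  then show ?thesis by (auto intro!: bdd_aboveI[of _ K])
qed

lemma op_norm_nonneg:
  assumes "T \<in> bounded_ops M"
  shows "0 \<le> op_norm M T"
proof -
  have "l2_norm M (T (l2_zero M)) \<le> op_norm M T"
    unfolding op_norm_def by (rule cSUP_upper[OF _ op_norm_bdd[OF assms]]) simp
  then show ?thesis using l2_norm_nonneg order.trans by blast
qed

lemma op_norm_bound:
  assumes T: "T \<in> bounded_ops M" and u: "u \<in> L2 M"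
  shows "l2_norm M (T u) \<le> op_norm M T * l2_norm M u"
proof (cases "l2_norm M u = 0")
  case True
  then have "T u = l2_zero M" using l2_norm_eq_zero_iff[OF u] bounded_ops_zero[OF T] by simp
  then show ?thesis using op_norm_nonneg[OF T] True by simp
next
  case False
  define n where "n = l2_norm M u"
  have n: "n > 0" using False unfolding n_def by (simp add: order.strict_iff_order)
  let ?v = "l2_scale M (complex_of_real (1 / n)) u"
  have "l2_norm M ?v = 1" using n u by (simp add: l2_norm_scale n_def norm_divide)
  then have "l2_norm M (T ?v) \<le> op_norm M T"
    unfolding op_norm_def using u by (intro cSUP_upper op_norm_bdd[OF T]) auto
  then have "1 / n * l2_norm M (T u) \<le> op_norm M T"
    using n u bounded_opsD(1)[OF T u] by (simp add: bounded_opsD(3)[OF T] l2_norm_scale norm_divide)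
  then show ?thesis using n by (simp add: n_def field_simps)
qed

lemma op_norm_le:
  assumes "K \<ge> 0" "\<And>u. u \<in> L2 M \<Longrightarrow> l2_norm M (T u) \<le> K * l2_norm M u"
  shows "op_norm M T \<le> K"
  unfolding op_norm_def
proof (rule cSUP_least)
  show "{u \<in> L2 M. l2_norm M u \<le> 1} \<noteq> {}" using L2_closed(1)[of M] l2_norm_zero[of M] by fastforce
  show "l2_norm M (T u) \<le> K" if "u \<in> {u \<in> L2 M. l2_norm M u \<le> 1}" for u
    using assms(2)[of u] mult_left_mono[of "l2_norm M u" 1 K] assms(1) that by auto
qed

text \<open>A plain pointwise difference for estimates. That it agrees with the subtraction of the
  algebra record is a separate fact about additive inverses.\<close>

definition op_minus :: "'w measure \<Rightarrow> ('w l2 \<Rightarrow> 'w l2) \<Rightarrow> ('w l2 \<Rightarrow> 'w l2) \<Rightarrow> 'w l2 \<Rightarrow> 'w l2" where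
  "op_minus M S T = (\<lambda>u\<in>L2 M. l2_minus M (S u) (T u))"

lemma bounded_ops_add:
  assumes S: "S \<in> bounded_ops M" and T: "T \<in> bounded_ops M"
  shows "(\<lambda>u\<in>L2 M. l2_add M (S u) (T u)) \<in> bounded_ops M"
proof (rule bounded_opsI)
  fix u v c assume uv: "u \<in> L2 M" "v \<in> L2 M"
  note [simp] = bounded_opsD(1-3)[OF S] bounded_opsD(1-3)[OF T]
  have 1: "l2_add M (l2_add M a b) (l2_add M a' b') = l2_add M (l2_add M a a') (l2_add M b b')"
    if "a \<in> L2 M" "b \<in> L2 M" "a' \<in> L2 M" "b' \<in> L2 M" for a b a' b'
    using that by (auto elim!: L2_cases simp: l2_class_simps algebra_simps)
  show "l2_add M (S (l2_add M u v)) (T (l2_add M u v)) = l2_add M (l2_add M (S u) (T u)) (l2_add M (S v) (T v))"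
    using uv by (simp add: 1)
  show "l2_add M (S (l2_scale M c u)) (T (l2_scale M c u)) = l2_scale M c (l2_add M (S u) (T u))"
    using uv by (simp add: l2_vector_space(5)[of "S u" M "T u" "T u"])
  show "l2_norm M (l2_add M (S u) (T u)) \<le> (op_norm M S + op_norm M T) * l2_norm M u"
    using l2_norm_triangle[of "S u" M "T u"] op_norm_bound[OF S uv(1)] op_norm_bound[OF T uv(1)] uv
    by (simp add: distrib_right)
qed (auto simp: bounded_opsD[OF S] bounded_opsD[OF T])

lemma bounded_ops_scale:
  assumes T: "T \<in> bounded_ops M"
  shows "(\<lambda>u\<in>L2 M. l2_scale M c (T u)) \<in> bounded_ops M"
proof (rule bounded_opsI)
  fix u v e assume uv: "u \<in> L2 M" "v \<in> L2 M"
  note [simp] = bounded_opsD(1-3)[OF T]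
  show "l2_scale M c (T (l2_add M u v)) = l2_add M (l2_scale M c (T u)) (l2_scale M c (T v))"
    using uv by (simp add: l2_vector_space(5)[of "T u" M "T v" "T v"])
  show "l2_scale M c (T (l2_scale M e u)) = l2_scale M e (l2_scale M c (T u))"
    using uv by (simp add: l2_vector_space(7)[of "T u" M "T u" "T u"] mult.commute)
  show "l2_norm M (l2_scale M c (T u)) \<le> (cmod c * op_norm M T) * l2_norm M u"
    using op_norm_bound[OF T uv(1)] uv by (simp add: l2_norm_scale mult_left_mono mult.assoc)
qed (auto simp: bounded_opsD[OF T])

lemma bounded_ops_compose:
  assumes S: "S \<in> bounded_ops M" and T: "T \<in> bounded_ops M"
  shows "compose (L2 M) S T \<in> bounded_ops M"
  unfolding compose_def
proof (rule bounded_opsI)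
  fix u assume u: "u \<in> L2 M"
  have "l2_norm M (S (T u)) \<le> op_norm M S * l2_norm M (T u)"
    using op_norm_bound[OF S bounded_opsD(1)[OF T u]] .
  also have "\<dots> \<le> op_norm M S * (op_norm M T * l2_norm M u)"
    using op_norm_bound[OF T u] op_norm_nonneg[OF S] by (rule mult_left_mono)
  finally show "l2_norm M (S (T u)) \<le> (op_norm M S * op_norm M T) * l2_norm M u"
    by (simp add: mult.assoc)
qed (auto simp: bounded_opsD[OF S] bounded_opsD[OF T])

lemma bounded_ops_one: "(\<lambda>u\<in>L2 M. u) \<in> bounded_ops M"
  by (rule bounded_opsI[where K = 1]) auto

lemma bounded_ops_zero_op: "(\<lambda>u\<in>L2 M. l2_zero M) \<in> bounded_ops M"
  by (rule bounded_opsI[where K = 1])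
    (auto simp: l2_vector_space(3)[of "l2_zero M" M "l2_zero M"] l2_vector_space(10)[of "l2_zero M" M "l2_zero M"])

lemma bounded_ops_minus:
  assumes S: "S \<in> bounded_ops M" and T: "T \<in> bounded_ops M"
  shows "op_minus M S T \<in> bounded_ops M"
proof -
  have "op_minus M S T = (\<lambda>u\<in>L2 M. l2_add M (S u) ((\<lambda>u\<in>L2 M. l2_scale M (- 1) (T u)) u))"
    by (auto simp: op_minus_def l2_minus_def fun_eq_iff)
  then show ?thesis by (simp only: bounded_ops_add[OF S bounded_ops_scale[OF T]])
qed

lemma op_minus_apply [simp]: "u \<in> L2 M \<Longrightarrow> op_minus M S T u = l2_minus M (S u) (T u)"
  by (simp add: op_minus_def)

lemma op_norm_compose:
  assumes S: "S \<in> bounded_ops M" and T: "T \<in> bounded_ops M"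
  shows "op_norm M (compose (L2 M) S T) \<le> op_norm M S * op_norm M T"
proof (rule op_norm_le)
  show "0 \<le> op_norm M S * op_norm M T" using op_norm_nonneg[OF S] op_norm_nonneg[OF T] by simp
  fix u assume u: "u \<in> L2 M"
  have "l2_norm M (S (T u)) \<le> op_norm M S * l2_norm M (T u)"
    using op_norm_bound[OF S bounded_opsD(1)[OF T u]] .
  also have "\<dots> \<le> op_norm M S * (op_norm M T * l2_norm M u)"
    using op_norm_bound[OF T u] op_norm_nonneg[OF S] by (rule mult_left_mono)
  finally show "l2_norm M (compose (L2 M) S T u) \<le> (op_norm M S * op_norm M T) * l2_norm M u"
    using u by (simp add: mult.assoc compose_def)
qed

text \<open>Linearity of the limit is uniqueness of limits; the bound \<open>K\<close>, uniform in
  \<open>n\<close>, survives because norm inequalities pass to limits.\<close>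

lemma strong_limit:
  assumes T: "\<And>n. T n \<in> bounded_ops M"
    and bd: "\<And>n u. u \<in> L2 M \<Longrightarrow> l2_norm M (T n u) \<le> K * l2_norm M u"
    and ex: "\<And>u. u \<in> L2 M \<Longrightarrow> \<exists>w\<in>L2 M. l2_lim M (\<lambda>n. T n u) w"
  obtains S where "S \<in> bounded_ops M" "\<And>u. u \<in> L2 M \<Longrightarrow> l2_lim M (\<lambda>n. T n u) (S u)"
    "\<And>u. u \<in> L2 M \<Longrightarrow> l2_norm M (S u) \<le> K * l2_norm M u"
proof -
  obtain F where F: "\<And>u. u \<in> L2 M \<Longrightarrow> F u \<in> L2 M" "\<And>u. u \<in> L2 M \<Longrightarrow> l2_lim M (\<lambda>n. T n u) (F u)"
    using ex by metis
  note TD = bounded_opsD[OF T]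
  have bdF: "l2_norm M (F u) \<le> K * l2_norm M u" if "u \<in> L2 M" for u
    using F bd that by (auto intro!: l2_lim_norm_le[OF F(2)] TD)
  have "(\<lambda>u\<in>L2 M. F u) \<in> bounded_ops M"
  proof (rule bounded_opsI[OF F(1) _ _ bdF])
    fix u v c assume uv: "u \<in> L2 M" "v \<in> L2 M"
    have "l2_lim M (\<lambda>n. T n (l2_add M u v)) (l2_add M (F u) (F v))"
      unfolding TD(2)[OF uv] using uv by (intro l2_lim_add F TD)
    then show "F (l2_add M u v) = l2_add M (F u) (F v)"
      using uv by (intro l2_lim_unique[OF F(2)]) (auto intro: F TD)
    have "l2_lim M (\<lambda>n. T n (l2_scale M c u)) (l2_scale M c (F u))"
      unfolding TD(3)[OF uv(1)] using uv by (intro l2_lim_scale F TD)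
    then show "F (l2_scale M c u) = l2_scale M c (F u)"
      using uv by (intro l2_lim_unique[OF F(2)]) (auto intro: F TD)
  qed
  then show ?thesis using that[of "\<lambda>u\<in>L2 M. F u"] F bdF by simp
qed

lemma op_norm_complete:
  assumes fin: "finite_measure M" and T: "\<And>n. T n \<in> bounded_ops M"
    and cauchy: "\<And>e. e > 0 \<Longrightarrow> \<exists>N. \<forall>m\<ge>N. \<forall>n\<ge>m. op_norm M (op_minus M (T n) (T m)) \<le> e"
  obtains S where "S \<in> bounded_ops M" "(\<lambda>n. op_norm M (op_minus M (T n) S)) \<longlonglongrightarrow> 0"
proof -
  note TD = bounded_opsD[OF T]
  have diff: "l2_norm M (l2_minus M (T n u) (T m u)) \<le> op_norm M (op_minus M (T n) (T m)) * l2_norm M u"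
    if "u \<in> L2 M" for n m u
    using op_norm_bound[OF bounded_ops_minus[OF T T] that] that by simp
  \<comment> \<open>Beyond \<open>N1\<close> all operators lie within 1 of \<open>T N1\<close>. This
    gives the uniform bound \<open>K\<close>, and the sequence is shifted by \<open>N1\<close> so
    that the bound holds for all its members.\<close>
  have "\<exists>N. \<forall>m\<ge>N. \<forall>n\<ge>m. op_norm M (op_minus M (T n) (T m)) \<le> 1" using cauchy[of 1] by simp
  then obtain N1 where N1: "\<And>n. n \<ge> N1 \<Longrightarrow> op_norm M (op_minus M (T n) (T N1)) \<le> 1" by blast
  define K where "K = op_norm M (T N1) + 1"
  have bd: "l2_norm M (T (n + N1) u) \<le> K * l2_norm M u" if u: "u \<in> L2 M" for n u
  proof -
    have "l2_norm M (T (n + N1) u) \<le> l2_norm M (T N1 u) + l2_norm M (l2_minus M (T (n + N1) u) (T N1 u))"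
      using TD(1)[OF u] by (intro l2_norm_le_add_minus)
    also have "\<dots> \<le> op_norm M (T N1) * l2_norm M u + op_norm M (op_minus M (T (n + N1)) (T N1)) * l2_norm M u"
      using diff[OF u] op_norm_bound[OF T u] by (intro add_mono)
    also have "\<dots> \<le> op_norm M (T N1) * l2_norm M u + 1 * l2_norm M u"
      using N1 by (intro add_mono mult_right_mono) auto
    finally show ?thesis by (simp add: K_def distrib_right)
  qed
  have ex: "\<exists>w\<in>L2 M. l2_lim M (\<lambda>n. T (n + N1) u) w" if u: "u \<in> L2 M" for u
    unfolding l2_lim_def
  proof (rule l2_complete[OF fin TD(1)[OF u]])
    fix e :: real assume e: "e > 0"
    define n where "n = l2_norm M u + 1"
    have n: "n > 0" "l2_norm M u < n" unfolding n_def using l2_norm_nonneg[of M u] by linarith+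
    obtain N where N: "\<And>m k. m \<ge> N \<Longrightarrow> k \<ge> m \<Longrightarrow> op_norm M (op_minus M (T k) (T m)) \<le> e / n"
      using cauchy[of "e / n"] e n by auto
    have "l2_norm M (l2_minus M (T (k + N1) u) (T (m + N1) u)) < e" if "m \<ge> N" "k \<ge> m" for m k
    proof -
      have "l2_norm M (l2_minus M (T (k + N1) u) (T (m + N1) u)) \<le> e / n * l2_norm M u"
        using diff[OF u, of "k + N1" "m + N1"] mult_right_mono[OF N[of "m + N1" "k + N1"], of "l2_norm M u"] that
        by simp
      also have "\<dots> < e" using e n by (simp add: field_simps)
      finally show ?thesis .
    qed
    then show "\<exists>N. \<forall>m\<ge>N. \<forall>k\<ge>m. l2_norm M (l2_minus M (T (k + N1) u) (T (m + N1) u)) < e" by blast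
  qed
  obtain S where S: "S \<in> bounded_ops M" "\<And>u. u \<in> L2 M \<Longrightarrow> l2_lim M (\<lambda>n. T (n + N1) u) (S u)"
    by (rule strong_limit[where T = "\<lambda>n. T (n + N1)", OF T bd ex]) simp_all
  have "(\<lambda>n. op_norm M (op_minus M (T n) S)) \<longlonglongrightarrow> 0"
  proof (rule LIMSEQ_I)
    fix e :: real assume e: "e > 0"
    obtain N where N: "\<And>m k. m \<ge> N \<Longrightarrow> k \<ge> m \<Longrightarrow> op_norm M (op_minus M (T k) (T m)) \<le> e / 2"
      using cauchy[of "e / 2"] e by auto
    \<comment> \<open>For fixed \<open>m\<close> the strong limit in the other index keeps the
      estimate \<open>e / 2\<close>, which upgrades strong convergence to norm convergence.\<close>
    have half: "op_norm M (op_minus M (T m) S) \<le> e / 2" if m: "m \<ge> N" for m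
    proof (rule op_norm_le)
      fix u assume u: "u \<in> L2 M"
      have "l2_norm M (l2_minus M (S u) (T m u)) \<le> e / 2 * l2_norm M u"
      proof (rule l2_lim_norm_le)
        show "l2_lim M (\<lambda>k. l2_minus M (T (k + m + N1) u) (T m u)) (l2_minus M (S u) (T m u))"
        proof -
          have "l2_lim M (\<lambda>k. T (k + m + N1) u) (S u)"
            using LIMSEQ_ignore_initial_segment[OF S(2)[OF u, unfolded l2_lim_def], of m] by (simp add: l2_lim_def)
          then show ?thesis
            unfolding l2_minus_def using u S
            by (intro l2_lim_add l2_lim_const L2_closed TD) (auto simp: bounded_opsD)
        qed
        show "l2_norm M (l2_minus M (T (k + m + N1) u) (T m u)) \<le> e / 2 * l2_norm M u" for k
          using diff[OF u, of "k + m + N1" m] mult_right_mono[OF N[OF m, of "k + m + N1"], of "l2_norm M u"] by simp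
      qed (use u S TD bounded_opsD(1)[OF S(1)] in auto)
      then show "l2_norm M (op_minus M (T m) S u) \<le> e / 2 * l2_norm M u"
        using u S TD(1)[OF u, of m] bounded_opsD(1)[OF S(1) u] by (simp add: l2_norm_minus_commute)
    qed (use e in auto)
    have "norm (op_norm M (op_minus M (T m) S) - 0) < e" if m: "m \<ge> N" for m
    proof -
      have "\<bar>op_norm M (op_minus M (T m) S)\<bar> = op_norm M (op_minus M (T m) S)"
        by (rule abs_of_nonneg[OF op_norm_nonneg[OF bounded_ops_minus[OF T S(1)]]])
      also have "\<dots> \<le> e / 2" by (rule half[OF m])
      also have "\<dots> < e" using e by simp
      finally show ?thesis by (simp only: real_norm_def diff_0_right)
    qed
    then show "\<exists>N. \<forall>m\<ge>N. norm (op_norm M (op_minus M (T m) S) - 0) < e" by blast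
  qed
  then show ?thesis using that S by blast
qed

lemma op_norm_lim_strong:
  assumes "\<And>n. T n \<in> bounded_ops M" "S \<in> bounded_ops M" "(\<lambda>n. op_norm M (op_minus M (T n) S)) \<longlonglongrightarrow> 0"
    and u: "u \<in> L2 M"
  shows "l2_lim M (\<lambda>n. T n u) (S u)"
proof (rule l2_lim_bound)
  show "l2_norm M (l2_minus M (T n u) (S u)) \<le> op_norm M (op_minus M (T n) S) * l2_norm M u" for n
    using op_norm_bound[OF bounded_ops_minus[OF assms(1) assms(2)] u] u by simp
  show "(\<lambda>n. op_norm M (op_minus M (T n) S) * l2_norm M u) \<longlonglongrightarrow> 0"
    using tendsto_mult_left_zero[OF assms(3)] .
qed

section \<open>The operator algebra\<close>

lemma op_algebra_simps [simp]:
  "carrier (op_algebra M) = bounded_ops M"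
  "mult (op_algebra M) = compose (L2 M)"
  "one (op_algebra M) = (\<lambda>u\<in>L2 M. u)"
  "zero (op_algebra M) = (\<lambda>u\<in>L2 M. l2_zero M)"
  "add (op_algebra M) = (\<lambda>S T. \<lambda>u\<in>L2 M. l2_add M (S u) (T u))"
  "smult (op_algebra M) = (\<lambda>c T. \<lambda>u\<in>L2 M. l2_scale M c (T u))"
  "nrm (op_algebra M) = op_norm M"
  by (simp_all add: op_algebra_def l2_zero_def)

text \<open>Subtraction in the record is addition of the group inverse, and that inverse is a
  definite description; the group laws are what identifies it with scaling by -1. They also make
  \<open>finsum\<close> usable for partial sums of tensor series.\<close>

lemma abelian_group_op_subalgebra:
  assumes B: "B \<subseteq> bounded_ops M" "(\<lambda>u\<in>L2 M. l2_zero M) \<in> B"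
    "\<And>S T. S \<in> B \<Longrightarrow> T \<in> B \<Longrightarrow> (\<lambda>u\<in>L2 M. l2_add M (S u) (T u)) \<in> B"
    "\<And>c T. T \<in> B \<Longrightarrow> (\<lambda>u\<in>L2 M. l2_scale M c (T u)) \<in> B"
  shows "abelian_group (op_algebra M\<lparr>carrier := B\<rparr>)"
    and "S \<in> B \<Longrightarrow> T \<in> B \<Longrightarrow> S \<ominus>\<^bsub>op_algebra M\<lparr>carrier := B\<rparr>\<^esub> T = op_minus M S T"
proof -
  have L2: "T \<in> B \<Longrightarrow> u \<in> L2 M \<Longrightarrow> T u \<in> L2 M" for T u using B(1) bounded_opsD(1) by blast
  have neg: "l2_add M (l2_scale M (- 1) x) x = l2_zero M" if "x \<in> L2 M" for x
    using that l2_vector_space(2)[of "l2_scale M (- 1) x" M x x] l2_vector_space(11)[of x M x x]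
    by (simp add: l2_minus_def)
  show ag: "abelian_group (op_algebra M\<lparr>carrier := B\<rparr>)"
  proof (rule abelian_groupI, goal_cases)
    case (3 x y z)
    then show ?case using L2 l2_vector_space(1)[of _ M] by (simp add: fun_eq_iff)
  next
    case (4 x y)
    then show ?case using L2 l2_vector_space(2)[of _ M] by (simp add: fun_eq_iff)
  next
    case (5 x)
    have "x \<in> bounded_ops M" using 5 B by auto
    then show ?case
      using L2[of x] l2_vector_space(3)[of _ M] bounded_opsD(5)[of x M] 5 by (simp add: fun_eq_iff restrict_def)
  next
    case (6 x)
    then show ?case using L2[of x] neg B(4)[of x "- 1"]
      by (intro bexI[of _ "\<lambda>u\<in>L2 M. l2_scale M (- 1) (x u)"]) (simp_all add: fun_eq_iff)
  qed (use B in simp_all)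
  assume S: "S \<in> B" and T: "T \<in> B"
  interpret abelian_group "op_algebra M\<lparr>carrier := B\<rparr>" by (rule ag)
  have "\<ominus>\<^bsub>op_algebra M\<lparr>carrier := B\<rparr>\<^esub> T = (\<lambda>u\<in>L2 M. l2_scale M (- 1) (T u))"
    using T B(4)[of T "- 1"] L2[of T] neg by (intro minus_equality) (simp_all add: fun_eq_iff)
  then show "S \<ominus>\<^bsub>op_algebra M\<lparr>carrier := B\<rparr>\<^esub> T = op_minus M S T"
    using S T by (simp add: a_minus_def op_minus_def l2_minus_def fun_eq_iff)
qed

lemma op_algebra_minus [simp]:
  assumes "S \<in> bounded_ops M" "T \<in> bounded_ops M"
  shows "S \<ominus>\<^bsub>op_algebra M\<^esub> T = op_minus M S T"
proof -
  have *: "op_algebra M\<lparr>carrier := bounded_ops M\<rparr> = op_algebra M"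
    by (simp add: op_algebra_def)
  show ?thesis
    using abelian_group_op_subalgebra(2)[of "bounded_ops M" M S T] assms
    by (auto simp: * bounded_ops_zero_op bounded_ops_add bounded_ops_scale)
qed

lemma closed_subalgebra_op_iff:
  "closed_subalgebra (op_algebra M) B \<longleftrightarrow>
    B \<subseteq> bounded_ops M \<and> (\<lambda>u\<in>L2 M. l2_zero M) \<in> B \<and>
    (\<forall>S\<in>B. \<forall>T\<in>B. (\<lambda>u\<in>L2 M. l2_add M (S u) (T u)) \<in> B \<and> compose (L2 M) S T \<in> B) \<and>
    (\<forall>c. \<forall>T\<in>B. (\<lambda>u\<in>L2 M. l2_scale M c (T u)) \<in> B) \<and>
    (\<forall>t T. (\<forall>n. t n \<in> B) \<and> T \<in> bounded_ops M \<and> (\<lambda>n. op_norm M (op_minus M (t n) T)) \<longlonglongrightarrow> 0 \<longrightarrow> T \<in> B)"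
proof (cases "B \<subseteq> bounded_ops M")
  case True
  have *: "((\<forall>n. t n \<in> B) \<and> T \<in> bounded_ops M \<and> (\<lambda>n. op_norm M (t n \<ominus>\<^bsub>op_algebra M\<^esub> T)) \<longlonglongrightarrow> 0) \<longleftrightarrow>
    ((\<forall>n. t n \<in> B) \<and> T \<in> bounded_ops M \<and> (\<lambda>n. op_norm M (op_minus M (t n) T)) \<longlonglongrightarrow> 0)" for t T
  proof (cases "(\<forall>n. t n \<in> B) \<and> T \<in> bounded_ops M")
    case *: True
    then have "(\<lambda>n. op_norm M (t n \<ominus>\<^bsub>op_algebra M\<^esub> T)) = (\<lambda>n. op_norm M (op_minus M (t n) T))"
      using True by (intro ext arg_cong[of _ _ "op_norm M"] op_algebra_minus) auto
    then show ?thesis by simp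
  qed auto
  show ?thesis using True unfolding closed_subalgebra_def by (simp add: *)
qed (simp add: closed_subalgebra_def)

lemma closed_subalgebraD:
  assumes "closed_subalgebra (op_algebra M) B"
  shows "T \<in> B \<Longrightarrow> T \<in> bounded_ops M" "(\<lambda>u\<in>L2 M. l2_zero M) \<in> B"
    "S \<in> B \<Longrightarrow> T \<in> B \<Longrightarrow> (\<lambda>u\<in>L2 M. l2_add M (S u) (T u)) \<in> B"
    "S \<in> B \<Longrightarrow> T \<in> B \<Longrightarrow> compose (L2 M) S T \<in> B"
    "T \<in> B \<Longrightarrow> (\<lambda>u\<in>L2 M. l2_scale M c (T u)) \<in> B"
    "S \<in> B \<Longrightarrow> T \<in> B \<Longrightarrow> op_minus M S T \<in> B"
    "(\<And>n. t n \<in> B) \<Longrightarrow> T \<in> bounded_ops M \<Longrightarrow> (\<lambda>n. op_norm M (op_minus M (t n) T)) \<longlonglongrightarrow> 0 \<Longrightarrow> T \<in> B"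
proof -
  note * = assms[unfolded closed_subalgebra_op_iff]
  show add: "S \<in> B \<Longrightarrow> T \<in> B \<Longrightarrow> (\<lambda>u\<in>L2 M. l2_add M (S u) (T u)) \<in> B" for S T using * by blast
  show scale: "T \<in> B \<Longrightarrow> (\<lambda>u\<in>L2 M. l2_scale M c (T u)) \<in> B" for T c using * by blast
  have "op_minus M S T = (\<lambda>u\<in>L2 M. l2_add M (S u) ((\<lambda>u\<in>L2 M. l2_scale M (- 1) (T u)) u))"
    by (simp add: op_minus_def l2_minus_def fun_eq_iff)
  then show "S \<in> B \<Longrightarrow> T \<in> B \<Longrightarrow> op_minus M S T \<in> B" by (simp only: add scale)
qed (use assms[unfolded closed_subalgebra_op_iff] in blast)+

text \<open>Ensures that the intersection defining a generated subalgebra is over a nonempty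
  family.\<close>

lemma closed_subalgebra_bounded_ops: "closed_subalgebra (op_algebra M) (bounded_ops M)"
  unfolding closed_subalgebra_op_iff
  by (auto simp: bounded_ops_zero_op bounded_ops_add bounded_ops_scale bounded_ops_compose)

lemma closed_subalgebra_generated:
  assumes "G \<subseteq> bounded_ops M"
  shows "closed_subalgebra (op_algebra M) (closed_subalgebra_generated (op_algebra M) G)"
    and "G \<subseteq> closed_subalgebra_generated (op_algebra M) G"
proof -
  let ?\<B> = "{B. closed_subalgebra (op_algebra M) B \<and> G \<subseteq> B}"
  have ne: "bounded_ops M \<in> ?\<B>" using assms closed_subalgebra_bounded_ops by blast
  show "closed_subalgebra (op_algebra M) (closed_subalgebra_generated (op_algebra M) G)"
    unfolding closed_subalgebra_generated_def closed_subalgebra_op_iff[of M "\<Inter>?\<B>"]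
  proof (intro conjI allI ballI impI)
    show "\<Inter>?\<B> \<subseteq> bounded_ops M" using ne by blast
    show "(\<lambda>u\<in>L2 M. l2_zero M) \<in> \<Inter>?\<B>" using closed_subalgebraD(2) by blast
    show "(\<lambda>u\<in>L2 M. l2_add M (S u) (T u)) \<in> \<Inter>?\<B>" "compose (L2 M) S T \<in> \<Inter>?\<B>"
      if "S \<in> \<Inter>?\<B>" "T \<in> \<Inter>?\<B>" for S T
      using that closed_subalgebraD(3)[of M _ S T] closed_subalgebraD(4)[of M _ S T] by blast+
    show "(\<lambda>u\<in>L2 M. l2_scale M c (T u)) \<in> \<Inter>?\<B>" if "T \<in> \<Inter>?\<B>" for c T
      using that closed_subalgebraD(5)[of M _ T c] by blast
    fix t T assume "(\<forall>n. t n \<in> \<Inter>?\<B>) \<and> T \<in> bounded_ops M \<and> (\<lambda>n. op_norm M (op_minus M (t n) T)) \<longlonglongrightarrow> 0"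
    then show "T \<in> \<Inter>?\<B>" using closed_subalgebraD(7)[of M _ t T] by blast
  qed
  show "G \<subseteq> closed_subalgebra_generated (op_algebra M) G"
    unfolding closed_subalgebra_generated_def by blast
qed

lemma closed_subalgebra_generated_least:
  assumes "closed_subalgebra (op_algebra M) B" "G \<subseteq> B"
  shows "closed_subalgebra_generated (op_algebra M) G \<subseteq> B"
  using assms unfolding closed_subalgebra_generated_def by blast

text \<open>The inverse relations are checked on vectors; the monoid laws are what makes
  \<open>inv\<close> equal to the given \<open>W\<close>.\<close>

lemma op_algebra_unitI:
  assumes "V \<in> bounded_ops M" "W \<in> bounded_ops M"
    "\<And>u. u \<in> L2 M \<Longrightarrow> V (W u) = u" "\<And>u. u \<in> L2 M \<Longrightarrow> W (V u) = u"
  shows "V \<in> Units (op_algebra M)" "inv\<^bsub>op_algebra M\<^esub> V = W"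
proof -
  interpret monoid "op_algebra M"
  proof
    fix x y z assume "x \<in> carrier (op_algebra M)" "y \<in> carrier (op_algebra M)" "z \<in> carrier (op_algebra M)"
    then show "x \<otimes>\<^bsub>op_algebra M\<^esub> y \<otimes>\<^bsub>op_algebra M\<^esub> z = x \<otimes>\<^bsub>op_algebra M\<^esub> (y \<otimes>\<^bsub>op_algebra M\<^esub> z)"
      by (auto simp: compose_def fun_eq_iff bounded_opsD(1))
  next
    fix x assume x: "x \<in> carrier (op_algebra M)"
    then show "\<one>\<^bsub>op_algebra M\<^esub> \<otimes>\<^bsub>op_algebra M\<^esub> x = x" "x \<otimes>\<^bsub>op_algebra M\<^esub> \<one>\<^bsub>op_algebra M\<^esub> = x"
      using bounded_ops_compose[OF bounded_ops_one, of x] bounded_ops_compose[OF _ bounded_ops_one, of x]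
      by (auto intro!: bounded_ops_ext simp: compose_def bounded_opsD(1))
  qed (auto simp: bounded_ops_compose bounded_ops_one)
  have *: "V \<otimes>\<^bsub>op_algebra M\<^esub> W = \<one>\<^bsub>op_algebra M\<^esub>" "W \<otimes>\<^bsub>op_algebra M\<^esub> V = \<one>\<^bsub>op_algebra M\<^esub>"
    using assms by (auto simp: compose_def fun_eq_iff)
  then show "V \<in> Units (op_algebra M)" "inv\<^bsub>op_algebra M\<^esub> V = W"
    using assms(1,2) unfolding Units_def by (auto intro!: inv_char)
qed

section \<open>Positive operators and similarity to C*-algebras\<close>

lemma adjoint_pairD:
  "adjoint_pair M T S \<Longrightarrow> u \<in> L2 M \<Longrightarrow> v \<in> L2 M \<Longrightarrow> l2_inner M (T u) v = l2_inner M u (S v)"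
  by (simp add: adjoint_pair_def)

text \<open>Cauchy-Schwarz for the semidefinite form of \<open>T\<close>, applied to
  \<open>u\<close> and \<open>T u\<close>, bounds the fourth power of the norm of \<open>T u\<close>
  by the form at \<open>u\<close> times the form at \<open>T u\<close>. The latter is at most
  \<open>k\<close> times the squared norm of \<open>T u\<close>, which cancels.\<close>

lemma positive_operator_bound:
  assumes T: "T \<in> bounded_ops M" and adj: "adjoint_pair M T T" and k: "k \<ge> 0"
    and pos: "\<And>u. u \<in> L2 M \<Longrightarrow> 0 \<le> Re (l2_inner M (T u) u)"
    and le: "\<And>u. u \<in> L2 M \<Longrightarrow> Re (l2_inner M (T u) u) \<le> k * (l2_norm M u)\<^sup>2"
    and u: "u \<in> L2 M"
  shows "(l2_norm M (T u))\<^sup>2 \<le> k * Re (l2_inner M (T u) u)"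
proof (cases "l2_norm M (T u) = 0")
  case True
  then show ?thesis using k pos[OF u] by simp
next
  case False
  note [simp] = bounded_opsD(1)[OF T]
  let ?w = "T u"
  let ?N = "(l2_norm M ?w)\<^sup>2"
  have w: "?w \<in> L2 M" using u by simp
  have ww: "l2_inner M ?w ?w = complex_of_real ?N" by (simp only: l2_norm_inner)
  have "?N\<^sup>2 \<le> Re (l2_inner M (T u) u) * Re (l2_inner M (T ?w) ?w)"
  proof (rule semidefinite_Cauchy_Schwarz)
    fix t :: real
    \<comment> \<open>The form at this vector is quadratic in \<open>t\<close>; both mixed terms
      equal \<open>t\<close> times the fourth power of the norm of \<open>T u\<close>, one of them
      by self-adjointness.\<close>
    let ?v = "l2_minus M u (l2_scale M (complex_of_real (t * ?N)) ?w)"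
    have "0 \<le> Re (l2_inner M (T ?v) ?v)" by (rule pos) (use u in simp)
    moreover have "l2_inner M (T ?v) ?v = l2_inner M (T u) u - complex_of_real (2 * t * ?N\<^sup>2)
        + complex_of_real (t\<^sup>2 * ?N\<^sup>2) * l2_inner M (T ?w) ?w"
      using u adjoint_pairD[OF adj w u]
      by (simp add: bounded_opsD(3,4)[OF T] l2_inner_linear ww algebra_simps power2_eq_square
          del: of_real_power)
    ultimately show "0 \<le> Re (l2_inner M (T u) u) - 2 * t * ?N\<^sup>2 + t\<^sup>2 * ?N\<^sup>2 * Re (l2_inner M (T ?w) ?w)"
      by simp
  qed (use pos u in auto)
  also have "\<dots> \<le> Re (l2_inner M (T u) u) * (k * ?N)"
    using le[OF w] pos[OF u] by (rule mult_left_mono)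
  finally have "?N * ?N \<le> (k * Re (l2_inner M (T u) u)) * ?N" by (simp add: power2_eq_square mult_ac)
  moreover have "?N > 0" using False by simp
  ultimately show ?thesis by (rule mult_right_le_imp_le)
qed

lemma positive_contraction_bound:
  assumes T: "T \<in> bounded_ops M" and adj: "adjoint_pair M T T" and k: "k \<ge> 0"
    and pos: "\<And>u. u \<in> L2 M \<Longrightarrow> 0 \<le> Re (l2_inner M (T u) u)"
    and le: "\<And>u. u \<in> L2 M \<Longrightarrow> Re (l2_inner M (T u) u) \<le> k * (l2_norm M u)\<^sup>2"
    and u: "u \<in> L2 M"
  shows "l2_norm M (T u) \<le> k * l2_norm M u"
proof (rule power2_le_imp_le)
  have "(l2_norm M (T u))\<^sup>2 \<le> k * Re (l2_inner M (T u) u)"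
    by (rule positive_operator_bound[OF T adj k pos le u])
  also have "\<dots> \<le> k * (k * (l2_norm M u)\<^sup>2)" using le[OF u] k by (rule mult_left_mono)
  finally show "(l2_norm M (T u))\<^sup>2 \<le> (k * l2_norm M u)\<^sup>2" by (simp add: power2_eq_square mult_ac)
qed (use k in simp)

text \<open>The iteration \<open>Y \<mapsto> (K + Y\<^sup>2) / 2\<close> converges to \<open>1 - (1 - K)\<^bsup>1/2\<^esup>\<close>.\<close>

lemma sqrt_iteration:
  assumes fin: "finite_measure M" and K: "K \<in> bounded_ops M" and adj: "adjoint_pair M K K"
    and k: "0 \<le> k" "k < 1" and bd: "\<And>u. u \<in> L2 M \<Longrightarrow> l2_norm M (K u) \<le> k * l2_norm M u"
  obtains Y where "Y \<in> bounded_ops M" "adjoint_pair M Y Y"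
    "\<And>u. u \<in> L2 M \<Longrightarrow> l2_norm M (Y u) \<le> k * l2_norm M u"
    "\<And>u. u \<in> L2 M \<Longrightarrow> l2_scale M 2 (Y u) = l2_add M (K u) (Y (Y u))"
proof -
  \<comment> \<open>A fixed point satisfies 2 Y = K + Y^2, that is (1 - Y)^2 = 1 - K. Starting at 0
    keeps all iterates self-adjoint and bounded by \<open>k\<close>.\<close>
  define F where "F T = (\<lambda>u\<in>L2 M. l2_scale M (1 / 2) (l2_add M (K u) (T (T u))))" for T
  define Y where "Y = rec_nat (\<lambda>u\<in>L2 M. l2_zero M) (\<lambda>_. F)"
  have Y_0: "Y 0 = (\<lambda>u\<in>L2 M. l2_zero M)" and Y_Suc: "Y (Suc n) = F (Y n)" for n
    by (simp_all add: Y_def)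
  have Y_ops: "Y n \<in> bounded_ops M" for n
  proof (induction n)
    case (Suc n)
    have "F (Y n) = (\<lambda>u\<in>L2 M. l2_scale M (1 / 2) ((\<lambda>u\<in>L2 M. l2_add M (K u) (compose (L2 M) (Y n) (Y n) u)) u))"
      by (simp add: F_def compose_def fun_eq_iff)
    then show ?case
      unfolding Y_Suc by (simp only: bounded_ops_scale bounded_ops_add bounded_ops_compose K Suc)
  qed (simp only: Y_0 bounded_ops_zero_op)
  note YD = bounded_opsD[OF Y_ops] and KD = bounded_opsD[OF K]
  note [simp] = YD(1) KD(1)
  have Y_adj: "adjoint_pair M (Y n) (Y n)" for n
  proof (induction n)
    case 0
    show ?case unfolding Y_0 adjoint_pair_def by (simp add: l2_inner_linear(7,8)[of "l2_zero M" M "l2_zero M"])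
  next
    case (Suc n)
    show ?case unfolding adjoint_pair_def
    proof (intro ballI)
      fix u v assume uv: "u \<in> L2 M" "v \<in> L2 M"
      have "l2_inner M (Y n (Y n u)) v = l2_inner M u (Y n (Y n v))"
        using uv by (simp add: adjoint_pairD[OF Suc])
      then show "l2_inner M (Y (Suc n) u) v = l2_inner M u (Y (Suc n) v)"
        using uv adjoint_pairD[OF adj uv] by (simp add: Y_Suc F_def l2_inner_linear)
    qed
  qed
  have Y_bd: "l2_norm M (Y n u) \<le> k * l2_norm M u" if "u \<in> L2 M" for n u
    using that
  proof (induction n arbitrary: u)
    case (Suc n)
    have "l2_norm M (Y n (Y n u)) \<le> k * (k * l2_norm M u)"
      using Suc.IH[of "Y n u"] Suc.IH[of u] Suc.prems k(1) by (meson YD(1) mult_left_mono order.trans)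
    also have "\<dots> \<le> 1 * (k * l2_norm M u)" using k by (intro mult_right_mono) auto
    finally have "l2_norm M (l2_add M (K u) (Y n (Y n u))) \<le> k * l2_norm M u + k * l2_norm M u"
      using l2_norm_triangle[of "K u" M "Y n (Y n u)"] bd[OF Suc.prems] Suc.prems by simp
    then show ?case using Suc.prems by (simp add: Y_Suc F_def l2_norm_scale)
  qed (use k in \<open>simp add: Y_0\<close>)
  have Y_diff: "l2_norm M (l2_minus M (Y (Suc n) u) (Y n u)) \<le> k ^ n * l2_norm M u" if "u \<in> L2 M" for n u
    using that
  proof (induction n arbitrary: u)
    case 0
    then show ?case
      using Y_bd[of u 1] k by (simp add: Y_0 l2_vector_space(12)[of _ M "l2_zero M" "l2_zero M"])
        (meson l2_norm_nonneg less_imp_le mult_left_le_one_le order.trans)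
  next
    case (Suc n)
    note u = Suc.prems
    let ?a = "Y (Suc n)" and ?b = "Y n"
    \<comment> \<open>This carries the splitting a^2 - b^2 = a (a - b) + (a - b) b. Each half is at
      most \<open>k\<close> times the previous difference, and the factor 1/2 compensates for having
      two of them, so the differences decay with ratio \<open>k\<close>.\<close>
    have id: "l2_minus M (l2_scale M (1/2) (l2_add M x y)) (l2_scale M (1/2) (l2_add M x z)) =
        l2_scale M (1/2) (l2_add M (l2_minus M y y') (l2_minus M y' z))"
      if "x \<in> L2 M" "y \<in> L2 M" "z \<in> L2 M" "y' \<in> L2 M" for x y z y'
      using that by (elim L2_cases, simp only: l2_class_simps) (rule l2_class_cong_space, simp add: field_simps)
    have 1: "l2_norm M (l2_minus M (?a (?a u)) (?a (?b u))) \<le> k * (k ^ n * l2_norm M u)"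
    proof -
      have "l2_norm M (?a (l2_minus M (?a u) (?b u))) \<le> k * l2_norm M (l2_minus M (?a u) (?b u))"
        using u by (intro Y_bd) simp
      also have "\<dots> \<le> k * (k ^ n * l2_norm M u)" using Suc.IH[OF u] k by (intro mult_left_mono)
      finally show ?thesis using u by (simp add: YD(4))
    qed
    have 2: "l2_norm M (l2_minus M (?a (?b u)) (?b (?b u))) \<le> k * (k ^ n * l2_norm M u)"
    proof -
      have "l2_norm M (l2_minus M (?a (?b u)) (?b (?b u))) \<le> k ^ n * l2_norm M (?b u)"
        using u by (intro Suc.IH) simp
      also have "\<dots> \<le> k ^ n * (k * l2_norm M u)" using Y_bd[OF u] k by (intro mult_left_mono) auto
      finally show ?thesis by (simp add: mult_ac)
    qed
    have "l2_minus M (Y (Suc (Suc n)) u) (Y (Suc n) u) =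
        l2_scale M (1/2) (l2_add M (l2_minus M (?a (?a u)) (?a (?b u))) (l2_minus M (?a (?b u)) (?b (?b u))))"
      using id[of "K u" "?a (?a u)" "?b (?b u)" "?a (?b u)"] u
      by (simp only: Y_Suc[of "Suc n"] Y_Suc[of n, symmetric] F_def restrict_apply' YD(1) KD(1))
        (simp add: Y_Suc[of n] F_def)
    then have "l2_norm M (l2_minus M (Y (Suc (Suc n)) u) (Y (Suc n) u)) \<le>
        1/2 * (l2_norm M (l2_minus M (?a (?a u)) (?a (?b u))) + l2_norm M (l2_minus M (?a (?b u)) (?b (?b u))))"
      using l2_norm_triangle[of "l2_minus M (?a (?a u)) (?a (?b u))" M "l2_minus M (?a (?b u)) (?b (?b u))"] u
      by (simp add: l2_norm_scale)
    also have "\<dots> \<le> 1/2 * (k * (k ^ n * l2_norm M u) + k * (k ^ n * l2_norm M u))"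
      using 1 2 by (intro mult_left_mono add_mono) auto
    finally show ?case by (simp add: mult_ac)
  qed
  have ex: "\<exists>w\<in>L2 M. l2_lim M (\<lambda>n. Y n u) w" if "u \<in> L2 M" for u
    unfolding l2_lim_def
    using k that
    by (intro l2_complete_summable[where u = "\<lambda>n. Y n u" and r = "\<lambda>n. k ^ n * l2_norm M u", OF fin _ Y_diff])
      (auto intro!: summable_mult2 summable_geometric)
  obtain Z where Z: "Z \<in> bounded_ops M" "\<And>u. u \<in> L2 M \<Longrightarrow> l2_lim M (\<lambda>n. Y n u) (Z u)"
    "\<And>u. u \<in> L2 M \<Longrightarrow> l2_norm M (Z u) \<le> k * l2_norm M u"
    by (rule strong_limit[where T = Y, OF Y_ops Y_bd ex], assumption, assumption) (rule that)
  note ZD = bounded_opsD[OF Z(1)]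
  note [simp] = ZD(1)
  have "adjoint_pair M Z Z" unfolding adjoint_pair_def
  proof (intro ballI)
    fix u v assume uv: "u \<in> L2 M" "v \<in> L2 M"
    have "(\<lambda>n. l2_inner M (Y n u) v) \<longlonglongrightarrow> l2_inner M (Z u) v"
      using uv by (intro l2_lim_inner(1)[OF Z(2)]) auto
    moreover have "(\<lambda>n. l2_inner M u (Y n v)) \<longlonglongrightarrow> l2_inner M u (Z v)"
      using uv by (intro l2_lim_inner(2)[OF Z(2)]) auto
    ultimately show "l2_inner M (Z u) v = l2_inner M u (Z v)"
      using adjoint_pairD[OF Y_adj uv] by (auto intro: LIMSEQ_unique)
  qed
  moreover have "l2_scale M 2 (Z u) = l2_add M (K u) (Z (Z u))" if u: "u \<in> L2 M" for u
  proof -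
    \<comment> \<open>Squares converge strongly because the factors are bounded uniformly by
      \<open>k\<close>.\<close>
    have "l2_lim M (\<lambda>n. Y n (Y n u)) (Z (Z u))"
    proof (rule l2_lim_bound)
      fix n
      have "l2_norm M (l2_minus M (Y n (Y n u)) (Z (Z u))) \<le>
          l2_norm M (l2_minus M (Y n (Y n u)) (Y n (Z u))) + l2_norm M (l2_minus M (Y n (Z u)) (Z (Z u)))"
        using u by (intro l2_norm_triangle_minus) auto
      also have "l2_norm M (l2_minus M (Y n (Y n u)) (Y n (Z u))) \<le> k * l2_norm M (l2_minus M (Y n u) (Z u))"
        using Y_bd[of "l2_minus M (Y n u) (Z u)" n] u by (simp add: YD(4))
      finally show "l2_norm M (l2_minus M (Y n (Y n u)) (Z (Z u))) \<le>
          k * l2_norm M (l2_minus M (Y n u) (Z u)) + l2_norm M (l2_minus M (Y n (Z u)) (Z (Z u)))" by simp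
    next
      show "(\<lambda>n. k * l2_norm M (l2_minus M (Y n u) (Z u)) + l2_norm M (l2_minus M (Y n (Z u)) (Z (Z u)))) \<longlonglongrightarrow> 0"
        using Z(2)[OF u] Z(2)[OF ZD(1)[OF u]] unfolding l2_lim_def
        by (intro tendsto_add_zero tendsto_mult_right_zero)
    qed
    then have "l2_lim M (\<lambda>n. l2_add M (K u) (Y n (Y n u))) (l2_add M (K u) (Z (Z u)))"
      using u by (intro l2_lim_add l2_lim_const) auto
    moreover have "l2_lim M (\<lambda>n. l2_scale M 2 (Y (Suc n) u)) (l2_scale M 2 (Z u))"
      using u by (intro l2_lim_scale l2_lim_Suc Z) auto
    moreover have "l2_scale M 2 (Y (Suc n) u) = l2_add M (K u) (Y n (Y n u))" for n
      unfolding Y_Suc F_def using u l2_vector_space(7)[of "l2_add M (K u) (Y n (Y n u))" M "K u" "K u"]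
        l2_vector_space(8)[of "l2_add M (K u) (Y n (Y n u))" M "K u" "K u"] by simp
    ultimately show ?thesis
      using u by (intro l2_lim_unique[of M "\<lambda>n. l2_scale M 2 (Y (Suc n) u)"]) auto
  qed
  ultimately show ?thesis using that Z by blast
qed

text \<open>The iteration Z \<mapsto> 1 + Y Z produces the partial sums of the Neumann series, whose
  increments decay like \<open>k ^ n\<close>.\<close>

lemma neumann_inverse:
  assumes fin: "finite_measure M" and Y: "Y \<in> bounded_ops M"
    and k: "0 \<le> k" "k < 1" and bd: "\<And>u. u \<in> L2 M \<Longrightarrow> l2_norm M (Y u) \<le> k * l2_norm M u"
  obtains Z where "Z \<in> bounded_ops M"
    "\<And>u. u \<in> L2 M \<Longrightarrow> l2_minus M (Z u) (Y (Z u)) = u"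
    "\<And>u. u \<in> L2 M \<Longrightarrow> Z (l2_minus M u (Y u)) = u"
proof -
  define F where "F T = (\<lambda>u\<in>L2 M. l2_add M u (Y (T u)))" for T
  define Z where "Z = rec_nat (\<lambda>u\<in>L2 M. l2_zero M) (\<lambda>_. F)"
  have Z_0: "Z 0 = (\<lambda>u\<in>L2 M. l2_zero M)" and Z_Suc: "Z (Suc n) = F (Z n)" for n
    by (simp_all add: Z_def)
  have Z_ops: "Z n \<in> bounded_ops M" for n
  proof (induction n)
    case (Suc n)
    have "F (Z n) = (\<lambda>u\<in>L2 M. l2_add M ((\<lambda>u\<in>L2 M. u) u) (compose (L2 M) Y (Z n) u))"
      by (simp add: F_def compose_def fun_eq_iff)
    then show ?case
      unfolding Z_Suc by (simp only: bounded_ops_add bounded_ops_compose bounded_ops_one Y Suc)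
  qed (simp only: Z_0 bounded_ops_zero_op)
  note ZD = bounded_opsD[OF Z_ops] and YD = bounded_opsD[OF Y]
  note [simp] = ZD(1) YD(1)
  have Z_bd: "l2_norm M (Z n u) \<le> 1 / (1 - k) * l2_norm M u" if "u \<in> L2 M" for n u
  proof (induction n)
    case (Suc n)
    have "l2_norm M (Y (Z n u)) \<le> k * (1 / (1 - k) * l2_norm M u)"
      using bd[of "Z n u"] mult_left_mono[OF Suc k(1)] that by simp
    then have "l2_norm M (l2_add M u (Y (Z n u))) \<le> l2_norm M u + k * (1 / (1 - k) * l2_norm M u)"
      using l2_norm_triangle[of u M "Y (Z n u)"] that by simp
    also have "\<dots> = 1 / (1 - k) * l2_norm M u" using k by (simp add: field_simps)
    finally show ?case using that by (simp add: Z_Suc F_def)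
  qed (use that k in \<open>simp add: Z_0\<close>)
  have Z_diff: "l2_norm M (l2_minus M (Z (Suc n) u) (Z n u)) \<le> k ^ n * l2_norm M u" if u: "u \<in> L2 M" for n u
  proof (induction n)
    case 0
    show ?case using u by (simp add: Z_0 Z_Suc F_def bounded_ops_zero[OF Y]
        l2_vector_space(4)[of _ M "l2_zero M" "l2_zero M"] l2_vector_space(12)[of _ M "l2_zero M" "l2_zero M"])
  next
    case (Suc n)
    have id: "l2_minus M (l2_add M x y) (l2_add M x z) = l2_minus M y z"
      if "x \<in> L2 M" "y \<in> L2 M" "z \<in> L2 M" for x y z
      using that by (auto elim!: L2_cases simp: l2_class_simps algebra_simps)
    have "l2_minus M (Z (Suc (Suc n)) u) (Z (Suc n) u) = Y (l2_minus M (Z (Suc n) u) (Z n u))"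
      unfolding Z_Suc[of "Suc n"] using id[of u "Y (Z (Suc n) u)" "Y (Z n u)"] u
      by (simp only: F_def restrict_apply' Z_Suc[of n] YD(4) ZD(1)) (simp add: YD(4))
    then have "l2_norm M (l2_minus M (Z (Suc (Suc n)) u) (Z (Suc n) u)) \<le> k * l2_norm M (l2_minus M (Z (Suc n) u) (Z n u))"
      using bd[of "l2_minus M (Z (Suc n) u) (Z n u)"] u by simp
    also have "\<dots> \<le> k * (k ^ n * l2_norm M u)" using Suc k(1) by (rule mult_left_mono)
    finally show ?case by simp
  qed
  have ex: "\<exists>w\<in>L2 M. l2_lim M (\<lambda>n. Z n u) w" if "u \<in> L2 M" for u
    unfolding l2_lim_def
    using k that
    by (intro l2_complete_summable[where u = "\<lambda>n. Z n u" and r = "\<lambda>n. k ^ n * l2_norm M u", OF fin _ Z_diff])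
      (auto intro!: summable_mult2 summable_geometric)
  obtain S where S: "S \<in> bounded_ops M" "\<And>u. u \<in> L2 M \<Longrightarrow> l2_lim M (\<lambda>n. Z n u) (S u)"
    by (rule strong_limit[where T = Z, OF Z_ops Z_bd ex]) simp_all
  note SD = bounded_opsD[OF S(1)]
  note [simp] = SD(1)
  have lim: "l2_lim M (\<lambda>n. Y (Z n u)) (Y (S u))" if u: "u \<in> L2 M" for u
  proof (rule l2_lim_bound)
    show "l2_norm M (l2_minus M (Y (Z n u)) (Y (S u))) \<le> k * l2_norm M (l2_minus M (Z n u) (S u))" for n
      using bd[of "l2_minus M (Z n u) (S u)"] u by (simp add: YD(4))
    show "(\<lambda>n. k * l2_norm M (l2_minus M (Z n u) (S u))) \<longlonglongrightarrow> 0"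
      using S(2)[OF u] unfolding l2_lim_def by (intro tendsto_mult_right_zero)
  qed
  have 1: "S u = l2_add M u (Y (S u))" if u: "u \<in> L2 M" for u
  proof -
    have "l2_lim M (\<lambda>n. l2_add M u (Y (Z n u))) (l2_add M u (Y (S u)))"
      using u lim by (intro l2_lim_add l2_lim_const) auto
    then have "l2_lim M (\<lambda>n. Z (Suc n) u) (l2_add M u (Y (S u)))"
      using u by (simp add: Z_Suc F_def)
    then show ?thesis
      using u by (intro l2_lim_unique[OF l2_lim_Suc[OF S(2)]]) auto
  qed
  \<comment> \<open>The limit solves S = 1 + Y S, which makes it a right inverse of 1 - Y; since the
    iterates commute with \<open>Y\<close>, it is a left inverse as well.\<close>
  have comm: "Z n (Y u) = Y (Z n u)" if u: "u \<in> L2 M" for n u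
    using u by (induction n) (simp_all add: Z_0 Z_Suc F_def bounded_ops_zero[OF Y] YD(2))
  have 2: "S (Y u) = Y (S u)" if u: "u \<in> L2 M" for u
  proof (rule l2_lim_unique[OF S(2)])
    show "l2_lim M (\<lambda>n. Z n (Y u)) (Y (S u))" using lim[OF u] comm[OF u] by simp
  qed (use u in auto)
  have id: "l2_minus M (l2_add M x y) y = x" if "x \<in> L2 M" "y \<in> L2 M" for x y
    using that by (auto elim!: L2_cases simp: l2_class_simps algebra_simps)
  have 3: "l2_minus M (S u) (Y (S u)) = u" if u: "u \<in> L2 M" for u
    using 1[OF u] id[of u "Y (S u)"] u by simp
  moreover have "S (l2_minus M u (Y u)) = u" if u: "u \<in> L2 M" for u
    using 2 3 u by (simp add: SD(4))
  ultimately show ?thesis using that S(1) by blast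
qed

text \<open>With P = 1 - K the bounds say 0 \<le> K \<le> 1 - c, so K has norm below 1. The
  iteration gives Y with 2 Y = K + Y^2, hence V = 1 - Y has square 1 - K = P, and the Neumann series
  inverts V.\<close>

lemma positive_square_root:
  assumes fin: "finite_measure M" and P: "P \<in> bounded_ops M" and adj: "adjoint_pair M P P"
    and c: "0 < c" "c \<le> 1"
    and lower: "\<And>u. u \<in> L2 M \<Longrightarrow> c * (l2_norm M u)\<^sup>2 \<le> Re (l2_inner M (P u) u)"
    and upper: "\<And>u. u \<in> L2 M \<Longrightarrow> Re (l2_inner M (P u) u) \<le> (l2_norm M u)\<^sup>2"
  obtains V W where "V \<in> bounded_ops M" "W \<in> bounded_ops M" "adjoint_pair M V V"
    "\<And>u. u \<in> L2 M \<Longrightarrow> V (V u) = P u"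
    "\<And>u. u \<in> L2 M \<Longrightarrow> V (W u) = u" "\<And>u. u \<in> L2 M \<Longrightarrow> W (V u) = u"
proof -
  define K where "K = op_minus M (\<lambda>u\<in>L2 M. u) P"
  have K: "K \<in> bounded_ops M" unfolding K_def by (intro bounded_ops_minus bounded_ops_one P)
  note [simp] = bounded_opsD(1)[OF P] bounded_opsD(1)[OF K]
  have K_u: "K u = l2_minus M u (P u)" if "u \<in> L2 M" for u using that by (simp add: K_def)
  have K_adj: "adjoint_pair M K K"
    using adjoint_pairD[OF adj] by (simp add: adjoint_pair_def K_u l2_inner_linear)
  have K_in: "Re (l2_inner M (K u) u) = (l2_norm M u)\<^sup>2 - Re (l2_inner M (P u) u)" if "u \<in> L2 M" for u
    using that l2_norm_inner[of M u, symmetric] by (simp add: K_u l2_inner_linear del: of_real_power)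
  have K_bd: "l2_norm M (K u) \<le> (1 - c) * l2_norm M u" if "u \<in> L2 M" for u
  proof (rule positive_contraction_bound[OF K K_adj _ _ _ that])
    show "0 \<le> Re (l2_inner M (K w) w)" if "w \<in> L2 M" for w
      unfolding K_in[OF that] using upper[OF that] by simp
    show "Re (l2_inner M (K w) w) \<le> (1 - c) * (l2_norm M w)\<^sup>2" if "w \<in> L2 M" for w
      unfolding K_in[OF that] using lower[OF that] by (simp add: left_diff_distrib)
  qed (use c in simp)
  obtain Y where Y: "Y \<in> bounded_ops M" "adjoint_pair M Y Y"
    "\<And>u. u \<in> L2 M \<Longrightarrow> l2_norm M (Y u) \<le> (1 - c) * l2_norm M u"
    "\<And>u. u \<in> L2 M \<Longrightarrow> l2_scale M 2 (Y u) = l2_add M (K u) (Y (Y u))"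
    by (rule sqrt_iteration[OF fin K K_adj _ _ K_bd]) (use c in auto)
  note YD = bounded_opsD[OF Y(1)]
  note [simp] = YD(1)
  obtain W where W: "W \<in> bounded_ops M"
    "\<And>u. u \<in> L2 M \<Longrightarrow> l2_minus M (W u) (Y (W u)) = u"
    "\<And>u. u \<in> L2 M \<Longrightarrow> W (l2_minus M u (Y u)) = u"
    by (rule neumann_inverse[OF fin Y(1) _ _ Y(3)]) (use c in auto)
  define V where "V = op_minus M (\<lambda>u\<in>L2 M. u) Y"
  have V: "V \<in> bounded_ops M" unfolding V_def by (intro bounded_ops_minus bounded_ops_one Y)
  have V_u: "V u = l2_minus M u (Y u)" if "u \<in> L2 M" for u using that by (simp add: V_def)
  have V_adj: "adjoint_pair M V V"
    using adjoint_pairD[OF Y(2)] by (simp add: adjoint_pair_def V_u l2_inner_linear)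
  have VV: "V (V u) = P u" if u: "u \<in> L2 M" for u
  proof -
    have id: "l2_minus M (l2_minus M x y) (l2_minus M y z) = l2_minus M (l2_add M x z) (l2_scale M 2 y)"
      if "x \<in> L2 M" "y \<in> L2 M" "z \<in> L2 M" for x y z
      using that by (elim L2_cases, simp only: l2_class_simps) (simp add: algebra_simps)
    have id2: "l2_minus M (l2_add M x z) (l2_add M (l2_minus M x p) z) = p"
      if "x \<in> L2 M" "p \<in> L2 M" "z \<in> L2 M" for x p z
      using that by (auto elim!: L2_cases simp: l2_class_simps algebra_simps)
    show ?thesis
      using u id[of u "Y u" "Y (Y u)"] id2[of u "P u" "Y (Y u)"] Y(4)[OF u]
      by (simp add: V_u YD(4) K_u)
  qed
  show ?thesis
    by (rule that[OF V W(1) V_adj VV]) (use W bounded_opsD(1)[OF W(1)] in \<open>auto simp: V_u\<close>)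
qed

text \<open>Conjugation with \<open>P\<^bsup>1/2\<^esup>\<close> makes \<open>B\<close> selfadjoint.\<close>

lemma similar_to_cstar_subalgebra:
  assumes fin: "finite_measure M" and P: "P \<in> bounded_ops M" and adj: "adjoint_pair M P P"
    and c: "0 < c" "c \<le> 1"
    and lower: "\<And>u. u \<in> L2 M \<Longrightarrow> c * (l2_norm M u)\<^sup>2 \<le> Re (l2_inner M (P u) u)"
    and upper: "\<And>u. u \<in> L2 M \<Longrightarrow> Re (l2_inner M (P u) u) \<le> (l2_norm M u)\<^sup>2"
    and B: "closed_subalgebra (op_algebra M) B"
    and B_adj: "\<And>T. T \<in> B \<Longrightarrow> \<exists>S\<in>B. \<forall>u\<in>L2 M. \<forall>w\<in>L2 M. l2_inner M (P (T u)) w = l2_inner M (P u) (S w)"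
  shows "\<exists>v \<in> Units (op_algebra M). cstar_subalgebra M
    ((\<lambda>a. v \<otimes>\<^bsub>op_algebra M\<^esub> a \<otimes>\<^bsub>op_algebra M\<^esub> inv\<^bsub>op_algebra M\<^esub> v) ` B)"
proof -
  obtain V W where V: "V \<in> bounded_ops M" and W: "W \<in> bounded_ops M" and V_adj: "adjoint_pair M V V"
    and VV: "\<And>u. u \<in> L2 M \<Longrightarrow> V (V u) = P u"
    and VW: "\<And>u. u \<in> L2 M \<Longrightarrow> V (W u) = u" and WV: "\<And>u. u \<in> L2 M \<Longrightarrow> W (V u) = u"
    by (rule positive_square_root[OF fin P adj c lower upper], assumption, assumption) (rule that)
  note VD = bounded_opsD[OF V] and WD = bounded_opsD[OF W]
  note BD = closed_subalgebraD[OF B]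
  note [simp] = VD(1) WD(1) VW WV
  have [simp]: "T u \<in> L2 M" if "T \<in> B" "u \<in> L2 M" for T u using that BD(1) bounded_opsD(1) by blast
  define C where "C T = (\<lambda>u\<in>L2 M. V (T (W u)))" for T
  \<comment> \<open>The inverse conjugation. A norm convergent sequence of conjugates is pulled back
    by it to \<open>B\<close>, where closedness is known.\<close>
  define C' where "C' T = (\<lambda>u\<in>L2 M. W (T (V u)))" for T
  have C_comp: "C T = compose (L2 M) (compose (L2 M) V T) W" for T
    by (simp add: C_def compose_def fun_eq_iff)
  have C'_comp: "C' T = compose (L2 M) (compose (L2 M) W T) V" for T
    by (simp add: C'_def compose_def fun_eq_iff)
  have C_ops: "C T \<in> bounded_ops M" if "T \<in> bounded_ops M" for T
    unfolding C_comp by (intro bounded_ops_compose V W that)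
  have C'_ops: "C' T \<in> bounded_ops M" if "T \<in> bounded_ops M" for T
    unfolding C'_comp by (intro bounded_ops_compose V W that)
  have CC': "C (C' T) = T" if "T \<in> bounded_ops M" for T
    using that by (intro bounded_ops_ext[OF C_ops[OF C'_ops]]) (auto simp: C_def C'_def bounded_opsD(1))
  have C'C: "C' (C T) = T" if "T \<in> bounded_ops M" for T
    using that by (intro bounded_ops_ext[OF C'_ops[OF C_ops]]) (auto simp: C_def C'_def bounded_opsD(1))
  have eq: "V \<otimes>\<^bsub>op_algebra M\<^esub> T \<otimes>\<^bsub>op_algebra M\<^esub> inv\<^bsub>op_algebra M\<^esub> V = C T" for T
    using op_algebra_unitI(2)[OF V W VW WV] by (simp add: C_comp)
  have closed: "closed_subalgebra (op_algebra M) (C ` B)"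
    unfolding closed_subalgebra_op_iff
  proof (intro conjI ballI allI impI)
    show "C ` B \<subseteq> bounded_ops M" using C_ops BD(1) by auto
    have "C (\<lambda>u\<in>L2 M. l2_zero M) = (\<lambda>u\<in>L2 M. l2_zero M)"
      using bounded_ops_zero[OF V] by (simp add: C_def fun_eq_iff)
    then show "(\<lambda>u\<in>L2 M. l2_zero M) \<in> C ` B" using BD(2) by (rule image_eqI[OF sym])
    fix S T assume "S \<in> C ` B" "T \<in> C ` B"
    then obtain S' T' where ST: "S = C S'" "T = C T'" "S' \<in> B" "T' \<in> B" by blast
    have "(\<lambda>u\<in>L2 M. l2_add M (S u) (T u)) = C (\<lambda>u\<in>L2 M. l2_add M (S' u) (T' u))"
      using ST by (simp add: C_def fun_eq_iff VD(2))
    then show "(\<lambda>u\<in>L2 M. l2_add M (S u) (T u)) \<in> C ` B" by (rule image_eqI[OF _ BD(3)[OF ST(3,4)]])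
    have "compose (L2 M) S T = C (compose (L2 M) S' T')"
      using ST by (simp add: C_def fun_eq_iff compose_def)
    then show "compose (L2 M) S T \<in> C ` B" by (rule image_eqI[OF _ BD(4)[OF ST(3,4)]])
  next
    fix c T assume "T \<in> C ` B"
    then obtain T' where T: "T = C T'" "T' \<in> B" by blast
    have "(\<lambda>u\<in>L2 M. l2_scale M c (T u)) = C (\<lambda>u\<in>L2 M. l2_scale M c (T' u))"
      using T by (simp add: C_def fun_eq_iff VD(3))
    then show "(\<lambda>u\<in>L2 M. l2_scale M c (T u)) \<in> C ` B" by (rule image_eqI[OF _ BD(5)[OF T(2)]])
  next
    fix t T
    assume *: "(\<forall>n. t n \<in> C ` B) \<and> T \<in> bounded_ops M \<and> (\<lambda>n. op_norm M (op_minus M (t n) T)) \<longlonglongrightarrow> 0"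
    note tC = conjunct1[OF *] and T = conjunct1[OF conjunct2[OF *]] and lim = conjunct2[OF conjunct2[OF *]]
    have t: "t n \<in> bounded_ops M" for n using spec[OF tC, of n] C_ops BD(1) by auto
    have tB: "C' (t n) \<in> B" for n using spec[OF tC, of n] C'C BD(1) by auto
    have le: "op_norm M (op_minus M (C' (t n)) (C' T)) \<le> op_norm M W * op_norm M (op_minus M (t n) T) * op_norm M V" for n
    proof -
      note tT = bounded_ops_minus[OF t[of n] T]
      have "op_minus M (C' (t n)) (C' T) = compose (L2 M) (compose (L2 M) W (op_minus M (t n) T)) V"
        using bounded_opsD(1)[OF t] bounded_opsD(1)[OF T]
        by (simp add: op_minus_def C'_def compose_def fun_eq_iff WD(4))
      then have "op_norm M (op_minus M (C' (t n)) (C' T)) \<le> op_norm M (compose (L2 M) W (op_minus M (t n) T)) * op_norm M V"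
        by (simp only: op_norm_compose bounded_ops_compose W V tT)
      also have "\<dots> \<le> op_norm M W * op_norm M (op_minus M (t n) T) * op_norm M V"
        by (intro mult_right_mono op_norm_compose W tT op_norm_nonneg V)
      finally show ?thesis .
    qed
    have "(\<lambda>n. op_norm M W * op_norm M (op_minus M (t n) T) * op_norm M V) \<longlonglongrightarrow> 0"
      by (intro tendsto_mult_left_zero tendsto_mult_right_zero lim)
    moreover have "\<bar>op_norm M (op_minus M (C' (t n)) (C' T))\<bar> = op_norm M (op_minus M (C' (t n)) (C' T))" for n
      by (rule abs_of_nonneg[OF op_norm_nonneg[OF bounded_ops_minus[OF C'_ops[OF t] C'_ops[OF T]]]])
    ultimately have "(\<lambda>n. op_norm M (op_minus M (C' (t n)) (C' T))) \<longlonglongrightarrow> 0"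
      by (elim Lim_null_comparison[rotated]) (simp only: real_norm_def le eventually_True)
    then have "C' T \<in> B" by (rule BD(7)[OF tB C'_ops[OF T]])
    then show "T \<in> C ` B" by (rule image_eqI[where f = C and x = "C' T", OF CC'[OF T, symmetric]])
  qed
  have "\<exists>S\<in>C ` B. adjoint_pair M (C T) S" if T: "T \<in> B" for T
  proof -
    obtain S where S: "S \<in> B" "\<And>u w. u \<in> L2 M \<Longrightarrow> w \<in> L2 M \<Longrightarrow> l2_inner M (P (T u)) w = l2_inner M (P u) (S w)"
      using B_adj[OF T] by blast
    have "adjoint_pair M (C T) (C S)" unfolding adjoint_pair_def
    proof (intro ballI)
      fix u w assume uw: "u \<in> L2 M" "w \<in> L2 M"
      \<comment> \<open>Replacing \<open>w\<close> by \<open>V (W w)\<close> makes \<open>V\<close>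
        occur on both sides; the two copies combine to \<open>P\<close>, relative to which
        \<open>T\<close> and \<open>S\<close> are adjoint.\<close>
      have "l2_inner M (C T u) w = l2_inner M (V (T (W u))) (V (W w))"
        using uw by (simp add: C_def)
      also have "\<dots> = l2_inner M (P (T (W u))) (W w)"
        using uw T by (subst adjoint_pairD[OF V_adj, symmetric]) (simp_all add: VV)
      also have "\<dots> = l2_inner M (P (W u)) (S (W w))" using uw by (intro S) auto
      also have "\<dots> = l2_inner M (V (W u)) (V (S (W w)))"
        using uw S(1) by (subst VV[symmetric]) (simp_all add: adjoint_pairD[OF V_adj])
      also have "\<dots> = l2_inner M u (C S w)" using uw by (simp add: C_def)
      finally show "l2_inner M (C T u) w = l2_inner M u (C S w)" .
    qed
    then show ?thesis using S(1) by blast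
  qed
  then have "cstar_subalgebra M (C ` B)" using closed unfolding cstar_subalgebra_def by blast
  then show ?thesis using op_algebra_unitI(1)[OF V W VW WV] by (intro bexI[of _ V]) (simp_all only: eq)
qed

text \<open>Reduces the relative adjoint condition to generators. The point is closure under norm
  limits: \<open>lower\<close> makes the relative adjoint depend boundedly on the operator, so the
  adjoints of a Cauchy sequence are again Cauchy.\<close>

lemma relative_adjoint_closed:
  assumes fin: "finite_measure M" and P: "P \<in> bounded_ops M" and adj: "adjoint_pair M P P"
    and P_le: "\<And>u. u \<in> L2 M \<Longrightarrow> l2_norm M (P u) \<le> l2_norm M u"
    and c: "0 < c"
    and lower: "\<And>u. u \<in> L2 M \<Longrightarrow> c * (l2_norm M u)\<^sup>2 \<le> Re (l2_inner M (P u) u)"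
    and B: "closed_subalgebra (op_algebra M) B"
  shows "closed_subalgebra (op_algebra M)
    {T \<in> B. \<exists>S\<in>B. \<forall>u\<in>L2 M. \<forall>w\<in>L2 M. l2_inner M (P (T u)) w = l2_inner M (P u) (S w)}"
    (is "closed_subalgebra _ {T \<in> B. \<exists>S\<in>B. ?R T S}")
proof -
  note BD = closed_subalgebraD[OF B] and PD = bounded_opsD[OF P]
  have [simp]: "T u \<in> L2 M" if "T \<in> B" "u \<in> L2 M" for T u using that BD(1) bounded_opsD(1) by blast
  note [simp] = PD(1)
  show ?thesis unfolding closed_subalgebra_op_iff
  proof (intro conjI ballI allI impI)
    show "{T \<in> B. \<exists>S\<in>B. ?R T S} \<subseteq> bounded_ops M" using BD(1) by blast
    have "?R (\<lambda>u\<in>L2 M. l2_zero M) (\<lambda>u\<in>L2 M. l2_zero M)"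
      using l2_inner_linear(7,8)[of _ M "l2_zero M"] by (simp add: bounded_ops_zero[OF P])
    then show "(\<lambda>u\<in>L2 M. l2_zero M) \<in> {T \<in> B. \<exists>S\<in>B. ?R T S}" using BD(2) by blast
    fix S T assume "S \<in> {T \<in> B. \<exists>S\<in>B. ?R T S}" "T \<in> {T \<in> B. \<exists>S\<in>B. ?R T S}"
    then obtain S' T' where ST: "S \<in> B" "T \<in> B" "S' \<in> B" "T' \<in> B" "?R S S'" "?R T T'" by blast
    have "?R (\<lambda>u\<in>L2 M. l2_add M (S u) (T u)) (\<lambda>u\<in>L2 M. l2_add M (S' u) (T' u))"
      using ST by (simp add: PD(2) l2_inner_linear)
    then show "(\<lambda>u\<in>L2 M. l2_add M (S u) (T u)) \<in> {T \<in> B. \<exists>S\<in>B. ?R T S}"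
      using BD(3)[OF ST(1,2)] BD(3)[OF ST(3,4)] by blast
    have "?R (compose (L2 M) S T) (compose (L2 M) T' S')"
      using ST by (simp add: compose_def)
    then show "compose (L2 M) S T \<in> {T \<in> B. \<exists>S\<in>B. ?R T S}"
      using BD(4)[OF ST(1,2)] BD(4)[OF ST(4,3)] by blast
  next
    fix e T assume "T \<in> {T \<in> B. \<exists>S\<in>B. ?R T S}"
    then obtain S where ST: "S \<in> B" "T \<in> B" "?R T S" by blast
    have "?R (\<lambda>u\<in>L2 M. l2_scale M e (T u)) (\<lambda>u\<in>L2 M. l2_scale M (cnj e) (S u))"
      using ST by (simp add: PD(3) l2_inner_linear)
    then show "(\<lambda>u\<in>L2 M. l2_scale M e (T u)) \<in> {T \<in> B. \<exists>S\<in>B. ?R T S}"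
      using BD(5)[OF ST(1)] BD(5)[OF ST(2)] by blast
  next
    fix t T
    assume *: "(\<forall>n. t n \<in> {T \<in> B. \<exists>S\<in>B. ?R T S}) \<and> T \<in> bounded_ops M \<and> (\<lambda>n. op_norm M (op_minus M (t n) T)) \<longlonglongrightarrow> 0"
    note tE = conjunct1[OF *] and T = conjunct1[OF conjunct2[OF *]] and lim = conjunct2[OF conjunct2[OF *]]
    have tB: "t n \<in> B" for n using tE by blast
    have TB: "T \<in> B" by (rule BD(7)[OF tB T lim])
    have t: "t n \<in> bounded_ops M" for n using tB BD(1) by blast
    have "\<forall>n. \<exists>S. S \<in> B \<and> ?R (t n) S" using tE by blast
    then obtain s where sB: "\<And>n. s n \<in> B" and R: "\<And>n. ?R (t n) (s n)" by metis
    have s: "s n \<in> bounded_ops M" for n using sB BD(1) by blast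
    have diff: "op_norm M (op_minus M (s n) (s m)) \<le> op_norm M (op_minus M (t n) (t m)) / c" for n m
    proof (rule op_norm_le)
      let ?d = "op_norm M (op_minus M (t n) (t m))"
      have d0: "?d \<ge> 0" by (intro op_norm_nonneg bounded_ops_minus t)
      then show "0 \<le> ?d / c" using c by simp
      fix w assume w: "w \<in> L2 M"
      \<comment> \<open>Testing the form of \<open>P\<close> on the difference of the adjoints at
        \<open>w\<close> itself moves the difference over to the operators \<open>t n\<close>; one
        factor of the norm of \<open>?x\<close> then cancels.\<close>
      let ?x = "op_minus M (s n) (s m) w"
      have x: "?x \<in> L2 M" "?x = l2_minus M (s n w) (s m w)" using w sB by simp_all
      have "l2_inner M (P ?x) ?x = l2_inner M (P (op_minus M (t n) (t m) ?x)) w"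
      proof -
        have "l2_inner M (P ?x) ?x = l2_inner M (P ?x) (s n w) - l2_inner M (P ?x) (s m w)"
          by (subst x(2), subst l2_inner_linear(4)) (use w sB x in auto)
        also have "\<dots> = l2_inner M (P (t n ?x)) w - l2_inner M (P (t m ?x)) w"
          using R w x(1) by simp
        also have "\<dots> = l2_inner M (P (op_minus M (t n) (t m) ?x)) w"
          using w x(1) tB by (simp add: PD(4) l2_inner_linear(3))
        finally show ?thesis .
      qed
      then have "c * (l2_norm M ?x)\<^sup>2 \<le> cmod (l2_inner M (P (op_minus M (t n) (t m) ?x)) w)"
        using lower[OF x(1)] complex_Re_le_cmod by (metis order.trans)
      also have "\<dots> \<le> l2_norm M (P (op_minus M (t n) (t m) ?x)) * l2_norm M w"
        using x(1) w tB by (intro l2_Cauchy_Schwarz) simp_all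
      also have "\<dots> \<le> ?d * l2_norm M ?x * l2_norm M w"
        using P_le[of "op_minus M (t n) (t m) ?x"] op_norm_bound[OF bounded_ops_minus[OF t t] x(1), of n m] x(1) tB
        by (intro mult_right_mono) (simp_all del: op_minus_apply add: bounded_opsD(1)[OF bounded_ops_minus[OF t t]])
      finally have *: "l2_norm M ?x * (c * l2_norm M ?x) \<le> l2_norm M ?x * (?d * l2_norm M w)"
        by (simp add: power2_eq_square mult_ac)
      show "l2_norm M ?x \<le> ?d / c * l2_norm M w"
      proof (cases "l2_norm M ?x = 0")
        case True
        then show ?thesis using d0 c by simp
      next
        case False
        then have "0 < l2_norm M ?x" using l2_norm_nonneg[of M ?x] by linarith
        then have "c * l2_norm M ?x \<le> ?d * l2_norm M w" using * by (simp only: mult_le_cancel_left_pos)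
        then show ?thesis using c by (simp add: field_simps)
      qed
    qed
    have tdiff: "op_norm M (op_minus M (t n) (t m)) \<le> op_norm M (op_minus M (t n) T) + op_norm M (op_minus M (t m) T)" for n m
    proof (rule op_norm_le)
      fix u assume u: "u \<in> L2 M"
      have "l2_norm M (l2_minus M (t n u) (t m u)) \<le> l2_norm M (l2_minus M (t n u) (T u)) + l2_norm M (l2_minus M (T u) (t m u))"
        using u tB TB by (intro l2_norm_triangle_minus) auto
      also have "l2_norm M (l2_minus M (T u) (t m u)) = l2_norm M (l2_minus M (t m u) (T u))"
        using u tB TB by (intro l2_norm_minus_commute) auto
      finally show "l2_norm M (op_minus M (t n) (t m) u) \<le> (op_norm M (op_minus M (t n) T) + op_norm M (op_minus M (t m) T)) * l2_norm M u"
        using op_norm_bound[OF bounded_ops_minus[OF t T] u, of n] op_norm_bound[OF bounded_ops_minus[OF t T] u, of m] u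
        by (simp add: distrib_right)
    qed (intro add_nonneg_nonneg op_norm_nonneg bounded_ops_minus t T)
    obtain S where S: "S \<in> bounded_ops M" "(\<lambda>n. op_norm M (op_minus M (s n) S)) \<longlonglongrightarrow> 0"
    proof (rule op_norm_complete[OF fin s])
      fix e :: real assume e: "e > 0"
      obtain N where "\<And>n. n \<ge> N \<Longrightarrow> norm (op_norm M (op_minus M (t n) T) - 0) < e * c / 2"
        using LIMSEQ_D[OF lim, of "e * c / 2"] e c by auto
      then have N: "op_norm M (op_minus M (t n) T) \<le> e * c / 2" if "n \<ge> N" for n
        using that by (fastforce simp: abs_less_iff)
      have "op_norm M (op_minus M (s n) (s m)) \<le> e" if "m \<ge> N" "n \<ge> m" for m n
      proof -
        have "op_norm M (op_minus M (s n) (s m)) \<le> (e * c / 2 + e * c / 2) / c"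
        proof -
          have "op_norm M (op_minus M (t n) (t m)) \<le> e * c / 2 + e * c / 2"
            using tdiff[of n m] N[of n] N[of m] that by linarith
          then show ?thesis using diff[of n m] c by (meson divide_right_mono less_imp_le order.trans)
        qed
        also have "\<dots> = e" using c by simp
        finally show ?thesis .
      qed
      then show "\<exists>N. \<forall>m\<ge>N. \<forall>n\<ge>m. op_norm M (op_minus M (s n) (s m)) \<le> e" by blast
    qed
    have SB: "S \<in> B" by (rule BD(7)[OF sB S])
    have "?R T S"
    proof (intro ballI)
      fix u w assume uw: "u \<in> L2 M" "w \<in> L2 M"
      have tl: "l2_lim M (\<lambda>n. t n u) (T u)" by (rule op_norm_lim_strong[OF t T lim uw(1)])
      have sl: "l2_lim M (\<lambda>n. s n w) (S w)" by (rule op_norm_lim_strong[OF s S uw(2)])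
      have "(\<lambda>n. l2_inner M (t n u) (P w)) \<longlonglongrightarrow> l2_inner M (T u) (P w)"
        using uw tB TB by (intro l2_lim_inner(1)[OF tl]) auto
      moreover have "(\<lambda>n. l2_inner M (P u) (s n w)) \<longlonglongrightarrow> l2_inner M (P u) (S w)"
        using uw sB SB by (intro l2_lim_inner(2)[OF sl]) auto
      moreover have "l2_inner M (t n u) (P w) = l2_inner M (P u) (s n w)" for n
        using R uw tB adjoint_pairD[OF adj, of "t n u" w] by simp
      ultimately have "l2_inner M (T u) (P w) = l2_inner M (P u) (S w)"
        by (auto intro: LIMSEQ_unique)
      then show "l2_inner M (P (T u)) w = l2_inner M (P u) (S w)"
        using adjoint_pairD[OF adj, of "T u" w] uw TB by simp
    qed
    then show "T \<in> {T \<in> B. \<exists>S\<in>B. ?R T S}" using TB SB by blast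
  qed
qed

section \<open>Operators acting on one coordinate\<close>

text \<open>Separates the finite row index from the countable fibre index, so that estimates can be
  made one fibre at a time.\<close>

lemma nn_integral_count_space_Times_finite:
  fixes h :: "'a \<times> 'b \<Rightarrow> ennreal"
  assumes "finite A"
  shows "(\<integral>\<^sup>+q. h q \<partial>count_space (A \<times> B)) = (\<integral>\<^sup>+i. (\<Sum>l\<in>A. h (l, i)) \<partial>count_space B)"
proof -
  have "(\<integral>\<^sup>+q. h q \<partial>count_space (A \<times> B)) = (\<integral>\<^sup>+q. h q * indicator (A \<times> B) q \<partial>count_space UNIV)"
    unfolding nn_integral_count_space_eq[of "A \<times> B" UNIV "\<lambda>q. h q * indicator (A \<times> B) q", simplified, symmetric]
    by (rule nn_integral_cong) (auto simp: indicator_def)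
  also have "\<dots> = (\<integral>\<^sup>+i. \<integral>\<^sup>+l. h (l, i) * indicator (A \<times> B) (l, i) \<partial>count_space UNIV \<partial>count_space UNIV)"
    by (rule nn_integral_snd_count_space[symmetric])
  also have "\<dots> = (\<integral>\<^sup>+i. (\<Sum>l\<in>A. h (l, i) * indicator (A \<times> B) (l, i)) \<partial>count_space UNIV)"
    using assms by (intro nn_integral_cong nn_integral_count_space') auto
  also have "\<dots> = (\<integral>\<^sup>+i. (\<Sum>l\<in>A. h (l, i) * indicator (A \<times> B) (l, i)) \<partial>count_space B)"
    by (rule nn_integral_count_space_eq) auto
  also have "\<dots> = (\<integral>\<^sup>+i. (\<Sum>l\<in>A. h (l, i)) \<partial>count_space B)"
    by (intro nn_integral_cong sum.cong) (auto simp: indicator_def)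
  finally show ?thesis .
qed

text \<open>Acts on functions of which only the values below \<open>d\<close> count, so that a fibre
  of a function on the measure space can be inserted as it is.\<close>

definition mat_app :: "nat \<Rightarrow> complex mat \<Rightarrow> (nat \<Rightarrow> complex) \<Rightarrow> nat \<Rightarrow> complex" where
  "mat_app d B g j = (\<Sum>l<d. B $$ (j, l) * g l)"

definition sq_norm :: "nat \<Rightarrow> (nat \<Rightarrow> complex) \<Rightarrow> real" where
  "sq_norm d g = (\<Sum>l<d. (cmod (g l))\<^sup>2)"

lemma sq_norm_nonneg [simp]: "0 \<le> sq_norm d g"
  unfolding sq_norm_def by (intro sum_nonneg) simp

lemma mat_app_cong: "(\<And>l. l < d \<Longrightarrow> g l = h l) \<Longrightarrow> mat_app d B g j = mat_app d B h j"
  unfolding mat_app_def by (intro sum.cong) auto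

lemma mat_app_mult:
  assumes "A \<in> carrier_mat d d" "B \<in> carrier_mat d d" "j < d"
  shows "mat_app d (A * B) g j = mat_app d A (mat_app d B g) j"
proof -
  have "mat_app d (A * B) g j = (\<Sum>l<d. (\<Sum>m<d. A $$ (j, m) * B $$ (m, l)) * g l)"
    unfolding mat_app_def using assms
    by (intro sum.cong) (auto simp: scalar_prod_def lessThan_atLeast0)
  also have "\<dots> = (\<Sum>m<d. \<Sum>l<d. A $$ (j, m) * (B $$ (m, l) * g l))"
    unfolding sum_distrib_right by (subst sum.swap) (simp add: mult.assoc)
  finally show ?thesis unfolding mat_app_def by (simp add: sum_distrib_left)
qed

lemma mat_app_one: "j < d \<Longrightarrow> mat_app d (1\<^sub>m d) g j = g j"
proof -
  assume "j < d"
  then have "mat_app d (1\<^sub>m d) g j = (\<Sum>l<d. if l = j then g l else 0)"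
    unfolding mat_app_def by (intro sum.cong) auto
  then show ?thesis using \<open>j < d\<close> by simp
qed

text \<open>The fibre of the result over \<open>i\<close> is \<open>B i\<close> applied to the fibre
  over \<open>\<tau> i\<close>: the identity permutation gives the direct sums that occur in the
  algebra, a transposition the exchange of two fibres.\<close>

definition loc_op :: "nat \<Rightarrow> ('i \<Rightarrow> complex mat) \<Rightarrow> ('i \<Rightarrow> 'i) \<Rightarrow> (nat \<times> 'i \<Rightarrow> complex) \<Rightarrow> nat \<times> 'i \<Rightarrow> complex" where
  "loc_op d B \<tau> y q = mat_app d (B (snd q)) (\<lambda>l. y (l, \<tau> (snd q))) (fst q)"

text \<open>Describes an operator on representatives: linear as a map of functions, and not merely
  almost everywhere. \<open>K\<close> bounds the square of the operator norm.\<close>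

definition finitely_bounded :: "'w measure \<Rightarrow> real \<Rightarrow> (('w \<Rightarrow> complex) \<Rightarrow> 'w \<Rightarrow> complex) \<Rightarrow> bool" where
  "finitely_bounded M K C \<longleftrightarrow> K \<ge> 0 \<and>
    (\<forall>x y. C (\<lambda>\<omega>. x \<omega> + y \<omega>) = (\<lambda>\<omega>. C x \<omega> + C y \<omega>)) \<and>
    (\<forall>c x. C (\<lambda>\<omega>. c * x \<omega>) = (\<lambda>\<omega>. c * C x \<omega>)) \<and>
    (\<forall>x\<in>square_integrable M. C x \<in> square_integrable M \<and>
       (\<integral>\<^sup>+\<omega>. ennreal ((cmod (C x \<omega>))\<^sup>2) \<partial>M) \<le> ennreal K * (\<integral>\<^sup>+\<omega>. ennreal ((cmod (x \<omega>))\<^sup>2) \<partial>M))"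

definition class_op :: "'w measure \<Rightarrow> (('w \<Rightarrow> complex) \<Rightarrow> 'w \<Rightarrow> complex) \<Rightarrow> 'w l2 \<Rightarrow> 'w l2" where
  "class_op M C = (\<lambda>u\<in>L2 M. l2_class M (C (l2_rep u)))"

lemma finitely_bounded_id: "finitely_bounded M 1 (\<lambda>x. x)"
  by (simp add: finitely_bounded_def)

lemma finitely_bounded_comp:
  assumes C: "finitely_bounded M K C" and D: "finitely_bounded M L D"
  shows "finitely_bounded M (K * L) (\<lambda>x. C (D x))"
  unfolding finitely_bounded_def
proof (intro conjI ballI)
  fix x assume x: "x \<in> square_integrable M"
  then have Dx: "D x \<in> square_integrable M" using D by (simp add: finitely_bounded_def)
  show "C (D x) \<in> square_integrable M" using C Dx by (simp add: finitely_bounded_def)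
  have "(\<integral>\<^sup>+\<omega>. ennreal ((cmod (C (D x) \<omega>))\<^sup>2) \<partial>M) \<le> ennreal K * (\<integral>\<^sup>+\<omega>. ennreal ((cmod (D x \<omega>))\<^sup>2) \<partial>M)"
    using C Dx by (simp add: finitely_bounded_def)
  also have "\<dots> \<le> ennreal K * (ennreal L * (\<integral>\<^sup>+\<omega>. ennreal ((cmod (x \<omega>))\<^sup>2) \<partial>M))"
    using D x by (intro mult_left_mono) (simp_all add: finitely_bounded_def)
  also have "\<dots> = ennreal (K * L) * (\<integral>\<^sup>+\<omega>. ennreal ((cmod (x \<omega>))\<^sup>2) \<partial>M)"
    using C D by (simp add: ennreal_mult mult.assoc finitely_bounded_def)
  finally show "(\<integral>\<^sup>+\<omega>. ennreal ((cmod (C (D x) \<omega>))\<^sup>2) \<partial>M) \<le> ennreal (K * L) * (\<integral>\<^sup>+\<omega>. ennreal ((cmod (x \<omega>))\<^sup>2) \<partial>M)" .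
qed (use C D in \<open>simp_all add: finitely_bounded_def\<close>)

text \<open>Two representatives differ by a null function, which a bounded linear map sends to a
  null function.\<close>

lemma class_op_class:
  assumes C: "finitely_bounded M K C" and x: "x \<in> square_integrable M"
  shows "class_op M C (l2_class M x) = l2_class M (C x)"
proof -
  note r = l2_rep_class[OF x]
  define z where "z = (\<lambda>\<omega>. l2_rep (l2_class M x) \<omega> + (- 1) * x \<omega>)"
  have z: "z \<in> square_integrable M"
    unfolding z_def by (intro square_integrable_add square_integrable_scale r x)
  have Cz: "C z = (\<lambda>\<omega>. C (l2_rep (l2_class M x)) \<omega> + (- 1) * C x \<omega>)"
    using C unfolding finitely_bounded_def z_def by metis
  have "(\<integral>\<^sup>+\<omega>. ennreal ((cmod (z \<omega>))\<^sup>2) \<partial>M) = (\<integral>\<^sup>+\<omega>. 0 \<partial>M)"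
    using r(2) by (intro nn_integral_cong_AE) (auto simp: z_def)
  moreover have "(\<integral>\<^sup>+\<omega>. ennreal ((cmod (C z \<omega>))\<^sup>2) \<partial>M) \<le> ennreal K * (\<integral>\<^sup>+\<omega>. ennreal ((cmod (z \<omega>))\<^sup>2) \<partial>M)"
    using C z by (simp add: finitely_bounded_def)
  ultimately have "(\<integral>\<^sup>+\<omega>. ennreal ((cmod (C z \<omega>))\<^sup>2) \<partial>M) = 0" by simp
  moreover have "C z \<in> borel_measurable M"
    using C z by (intro square_integrableD(1)) (simp add: finitely_bounded_def)
  ultimately have "AE \<omega> in M. ennreal ((cmod (C z \<omega>))\<^sup>2) = 0"
    by (subst nn_integral_0_iff_AE[symmetric]) simp_all
  then have "AE \<omega> in M. C (l2_rep (l2_class M x)) \<omega> = C x \<omega>"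
    unfolding Cz by eventually_elim simp
  then show ?thesis
    using x by (auto simp: class_op_def intro!: l2_class_eqI)
qed

lemma class_op_bounded_ops:
  assumes C: "finitely_bounded M K C"
  shows "class_op M C \<in> bounded_ops M"
    and "u \<in> L2 M \<Longrightarrow> l2_norm M (class_op M C u) \<le> sqrt K * l2_norm M u"
proof -
  note CD = C[unfolded finitely_bounded_def]
  have bd: "l2_norm M (class_op M C u) \<le> sqrt K * l2_norm M u" if "u \<in> L2 M" for u
  proof -
    obtain x where x: "x \<in> square_integrable M" "u = l2_class M x" using \<open>u \<in> L2 M\<close> by (rule L2_cases)
    then have Cx: "C x \<in> square_integrable M" using CD by blast
    have "ennreal ((l2_norm M (class_op M C u))\<^sup>2) \<le> ennreal K * ennreal ((l2_norm M u)\<^sup>2)"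
      unfolding x(2) class_op_class[OF C x(1)] l2_norm_class_nn_integral[OF Cx] l2_norm_class_nn_integral[OF x(1)]
      using CD x(1) by blast
    also have "\<dots> = ennreal (K * (l2_norm M u)\<^sup>2)" using CD by (simp add: ennreal_mult)
    finally have "(l2_norm M (class_op M C u))\<^sup>2 \<le> K * (l2_norm M u)\<^sup>2"
      using CD by (simp add: ennreal_le_iff)
    then have "(l2_norm M (class_op M C u))\<^sup>2 \<le> (sqrt K * l2_norm M u)\<^sup>2"
      using CD by (simp add: power_mult_distrib)
    then show ?thesis by (rule power2_le_imp_le) (use CD in simp)
  qed
  then show "u \<in> L2 M \<Longrightarrow> l2_norm M (class_op M C u) \<le> sqrt K * l2_norm M u" .
  have "(\<lambda>u\<in>L2 M. class_op M C u) \<in> bounded_ops M"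
  proof (rule bounded_opsI[OF _ _ _ bd])
    fix u v c assume "u \<in> L2 M" "v \<in> L2 M"
    then obtain x y where [simp]: "u = l2_class M x" "v = l2_class M y"
      and xy: "x \<in> square_integrable M" "y \<in> square_integrable M" by (metis L2_cases)
    have [simp]: "C x \<in> square_integrable M" "C y \<in> square_integrable M" using CD xy by blast+
    show "class_op M C u \<in> L2 M" using xy by (simp add: class_op_class[OF C] l2_class_in_L2)
    show "class_op M C (l2_add M u v) = l2_add M (class_op M C u) (class_op M C v)"
      using xy CD by (simp add: l2_class_simps class_op_class[OF C])
    show "class_op M C (l2_scale M c u) = l2_scale M c (class_op M C u)"
      using xy CD by (simp add: l2_class_simps class_op_class[OF C])
  qed
  then show "class_op M C \<in> bounded_ops M" by (simp add: class_op_def restrict_def cong: if_cong)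
qed

lemma class_op_comp:
  assumes C: "finitely_bounded M K C" and D: "finitely_bounded M L D" and u: "u \<in> L2 M"
  shows "class_op M C (class_op M D u) = class_op M (\<lambda>x. C (D x)) u"
proof -
  obtain x where x: "x \<in> square_integrable M" "u = l2_class M x" using u by (rule L2_cases)
  then have "D x \<in> square_integrable M" using D by (simp add: finitely_bounded_def)
  then show ?thesis
    using x by (simp add: class_op_class[OF C] class_op_class[OF D] class_op_class[OF finitely_bounded_comp[OF C D]])
qed

section \<open>The infinite product of atomic probability spaces\<close>

locale product_system =
  fixes d :: "nat \<Rightarrow> nat" and I :: "nat \<Rightarrow> 'i set" and f :: "nat \<Rightarrow> 'i \<Rightarrow> real"
  assumes d_pos: "\<And>n. d n > 0" and countable_I: "\<And>n. countable (I n)"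
    and f_pos: "\<And>n i. i \<in> I n \<Longrightarrow> f n i > 0" and f_sum: "\<And>n. (f n has_sum 1) (I n)"
begin

abbreviation X :: "nat \<Rightarrow> (nat \<times> 'i) measure" where "X k \<equiv> system_measure (d k) (I k) (f k)"

abbreviation \<mu> :: "(nat \<Rightarrow> nat \<times> 'i) measure" where "\<mu> \<equiv> product_measure d I f"

lemma \<mu>_eq: "\<mu> = PiM UNIV X"
  by (simp add: product_measure_def)

lemma space_X [simp]: "space (X k) = {..<d k} \<times> I k"
  by (simp add: system_measure_def space_point_measure)

lemma sets_X [simp]: "sets (X k) = Pow ({..<d k} \<times> I k)"
  by (simp add: system_measure_def sets_point_measure)

lemma space_\<mu>: "\<omega> \<in> space \<mu> \<longleftrightarrow> (\<forall>k. fst (\<omega> k) < d k \<and> snd (\<omega> k) \<in> I k)"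
  by (auto simp: \<mu>_eq space_PiM PiE_iff mem_Times_iff)

lemma measurable_X [simp]: "g \<in> measurable (X k) M \<longleftrightarrow> g \<in> {..<d k} \<times> I k \<rightarrow> space M"
  by (simp add: system_measure_def)

lemma nn_integral_X:
  "(\<integral>\<^sup>+q. h q \<partial>X k) = (\<integral>\<^sup>+i. ennreal (f k i / d k) * (\<Sum>l<d k. h (l, i)) \<partial>count_space (I k))"
proof -
  have "(\<integral>\<^sup>+q. h q \<partial>X k) = (\<integral>\<^sup>+q. ennreal (f k (snd q) / d k) * h q \<partial>count_space ({..<d k} \<times> I k))"
    unfolding system_measure_def point_measure_def
    by (subst nn_integral_density) (auto simp: case_prod_unfold)
  then show ?thesis
    by (simp add: nn_integral_count_space_Times_finite sum_distrib_left)
qed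

lemma prob_space_X: "prob_space (X k)"
proof
  \<comment> \<open>Prepares the conversion of the \<open>has_sum\<close> hypothesis into an
    integral with respect to counting measure.\<close>
  have "Infinite_Set_Sum.abs_summable_on (f k) (I k)"
    using has_sum_imp_summable[OF f_sum[of k]]
    by (simp only: abs_summable_equivalent[symmetric] summable_on_iff_abs_summable_on_real[symmetric])
  moreover have "infsetsum (f k) (I k) = 1"
    unfolding infsetsum_infsum[OF calculation] by (rule infsumI[OF f_sum])
  ultimately have 1: "(\<integral>\<^sup>+i. ennreal (f k i) \<partial>count_space (I k)) = 1"
    using f_pos[of _ k] by (subst nn_integral_conv_infsetsum) (auto simp: less_imp_le)
  have "emeasure (X k) (space (X k)) = (\<integral>\<^sup>+q. 1 \<partial>X k)" by simp
  also have "\<dots> = (\<integral>\<^sup>+i. ennreal (f k i / d k) * of_nat (d k) \<partial>count_space (I k))"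
    unfolding nn_integral_X by simp
  also have "\<dots> = (\<integral>\<^sup>+i. ennreal (f k i) \<partial>count_space (I k))"
    using f_pos[of _ k] d_pos[of k]
    by (intro nn_integral_cong) (simp add: ennreal_of_nat_eq_real_of_nat ennreal_mult''[symmetric])
  finally show "emeasure (X k) (space (X k)) = 1" using 1 by simp
qed

lemma prob_space_\<mu>: "prob_space \<mu>"
  unfolding \<mu>_eq by (intro prob_space_PiM prob_space_X)

lemma finite_measure_\<mu>: "finite_measure \<mu>"
  using prob_space_\<mu> by (simp add: prob_space_def)

lemma measurable_upd:
  assumes "g \<in> {..<d k} \<times> I k \<rightarrow> {..<d k} \<times> I k"
  shows "(\<lambda>\<omega>. \<omega> (k := g (\<omega> k))) \<in> measurable \<mu> \<mu>"
  unfolding \<mu>_eq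
proof (rule measurable_fun_upd[where J = "UNIV"])
  show "(\<lambda>\<omega>. g (\<omega> k)) \<in> measurable (PiM UNIV X) (X k)"
    by (rule measurable_compose[OF measurable_component_singleton]) (use assms in auto)
qed auto

lemma measurable_upd_pair:
  "(\<lambda>p. (snd p)(k := fst p)) \<in> measurable (X k \<Otimes>\<^sub>M \<mu>) \<mu>"
  "(\<lambda>p. (fst p)(k := snd p)) \<in> measurable (\<mu> \<Otimes>\<^sub>M X k) \<mu>"
  unfolding \<mu>_eq
  by (rule measurable_fun_upd[where J = UNIV], (rule measurable_snd measurable_fst | simp only: Un_UNIV_left)+)+

text \<open>Fubini in one coordinate: overwriting coordinate \<open>k\<close> by an independent
  sample leaves the product measure unchanged. This reduces statements about one coordinate to the
  atomic space \<open>X k\<close>.\<close>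

lemma resample:
  assumes h: "h \<in> borel_measurable \<mu>"
  shows "(\<integral>\<^sup>+\<omega>. h \<omega> \<partial>\<mu>) = (\<integral>\<^sup>+\<omega>. (\<integral>\<^sup>+q. h (\<omega> (k := q)) \<partial>X k) \<partial>\<mu>)"
proof -
  interpret Xk: prob_space "X k" by (rule prob_space_X)
  interpret m: prob_space \<mu> by (rule prob_space_\<mu>)
  interpret pair_sigma_finite "X k" \<mu> ..
  have eq: "distr (X k \<Otimes>\<^sub>M \<mu>) \<mu> (\<lambda>(q, \<omega>). \<omega> (k := q)) = \<mu>"
    using distr_pair_PiM_eq_PiM[of UNIV X k] prob_space_X by (simp add: \<mu>_eq)
  have meas: "(\<lambda>(q, \<omega>). \<omega> (k := q)) \<in> measurable (X k \<Otimes>\<^sub>M \<mu>) \<mu>"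
    unfolding case_prod_unfold by (rule measurable_upd_pair)
  have "(\<integral>\<^sup>+\<omega>. h \<omega> \<partial>\<mu>) = (\<integral>\<^sup>+p. h ((\<lambda>(q, \<omega>). \<omega> (k := q)) p) \<partial>(X k \<Otimes>\<^sub>M \<mu>))"
    by (subst eq[symmetric]) (rule nn_integral_distr[OF meas], simp add: h)
  also have "\<dots> = (\<integral>\<^sup>+\<omega>. (\<integral>\<^sup>+q. h ((\<lambda>(q, \<omega>). \<omega> (k := q)) (q, \<omega>)) \<partial>X k) \<partial>\<mu>)"
    by (rule nn_integral_snd[symmetric]) (use measurable_compose[OF meas h] in simp)
  finally show ?thesis by simp
qed

text \<open>By resampling, the old value of coordinate \<open>k\<close> may be taken independent of
  the other coordinates; with these fixed, the hypothesis on \<open>X k\<close> applies.\<close>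

lemma preserving_upd:
  assumes g: "g \<in> {..<d k} \<times> I k \<rightarrow> {..<d k} \<times> I k"
    and pres: "\<And>h :: nat \<times> 'i \<Rightarrow> ennreal. (\<integral>\<^sup>+q. h (g q) \<partial>X k) = (\<integral>\<^sup>+q. h q \<partial>X k)"
  shows "distr \<mu> \<mu> (\<lambda>\<omega>. \<omega> (k := g (\<omega> k))) = \<mu>"
proof (rule measure_eqI)
  note m = measurable_upd[OF g]
  fix A assume "A \<in> sets (distr \<mu> \<mu> (\<lambda>\<omega>. \<omega> (k := g (\<omega> k))))"
  then have A [measurable]: "A \<in> sets \<mu>" by simp
  have "emeasure (distr \<mu> \<mu> (\<lambda>\<omega>. \<omega> (k := g (\<omega> k)))) A = (\<integral>\<^sup>+\<omega>. indicator A \<omega> \<partial>distr \<mu> \<mu> (\<lambda>\<omega>. \<omega> (k := g (\<omega> k))))"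
    using A by simp
  also have "\<dots> = (\<integral>\<^sup>+\<omega>. indicator A (\<omega> (k := g (\<omega> k))) \<partial>\<mu>)"
    by (rule nn_integral_distr[OF m]) simp
  also have "\<dots> = (\<integral>\<^sup>+\<omega>. (\<integral>\<^sup>+q. indicator A (\<omega> (k := g q)) \<partial>X k) \<partial>\<mu>)"
    using measurable_compose[OF m, of "indicator A :: _ \<Rightarrow> ennreal" borel] by (subst resample[of _ k]) simp_all
  also have "\<dots> = (\<integral>\<^sup>+\<omega>. (\<integral>\<^sup>+q. indicator A (\<omega> (k := q)) \<partial>X k) \<partial>\<mu>)"
    by (intro nn_integral_cong pres)
  also have "\<dots> = emeasure \<mu> A" by (subst resample[symmetric]) simp_all
  finally show "emeasure (distr \<mu> \<mu> (\<lambda>\<omega>. \<omega> (k := g (\<omega> k)))) A = emeasure \<mu> A" .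
qed simp

text \<open>Averaging over the rotations of \<open>{..<d k}\<close> replaces an integral by a mean over the
  \<open>k\<close>-th fibre.\<close>

lemma fibre_average:
  fixes h :: "(nat \<Rightarrow> nat \<times> 'i) \<Rightarrow> complex"
  assumes h: "integrable \<mu> h"
  shows "(LINT \<omega>|\<mu>. h \<omega>) = (LINT \<omega>|\<mu>. (\<Sum>l<d k. h (\<omega> (k := (l, snd (\<omega> k))))) / d k)"
proof -
  \<comment> \<open>Rotation by \<open>c\<close> of the row index alone; it preserves
    \<open>X k\<close> because the mass of a point depends only on its fibre.\<close>
  define g where "g c q = ((fst q + c) mod d k, snd q)" for c :: nat and q :: "nat \<times> 'i"
  have rot: "bij_betw (\<lambda>l. (l + c) mod d k) {..<d k} {..<d k}" for c
  proof -
    have "\<exists>x\<in>{..<d k}. y = (x + c) mod d k" if y: "y \<in> {..<d k}" for y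
    proof -
      let ?x = "(y + (d k - c mod d k)) mod d k"
      have "(?x + c) mod d k = (y + (d k - c mod d k) + c mod d k) mod d k"
        by (simp add: mod_add_left_eq mod_add_right_eq)
      also have "y + (d k - c mod d k) + c mod d k = y + d k"
        using mod_less_divisor[OF d_pos[of k], of c] by linarith
      also have "(y + d k) mod d k = y" using y by simp
      finally show ?thesis using d_pos[of k] by (intro bexI[of _ ?x]) auto
    qed
    then have img: "(\<lambda>l. (l + c) mod d k) ` {..<d k} = {..<d k}" using d_pos[of k] by auto
    then show ?thesis unfolding bij_betw_def by (auto intro: eq_card_imp_inj_on)
  qed
  have g: "g c \<in> {..<d k} \<times> I k \<rightarrow> {..<d k} \<times> I k" for c
    using d_pos by (auto simp: g_def)
  have "(\<Sum>l<d k. h' (g c (l, i))) = (\<Sum>l<d k. h' (l, i))" for c i and h' :: "nat \<times> 'i \<Rightarrow> ennreal"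
    using sum.reindex_bij_betw[OF rot[of c], of "\<lambda>l. h' (l, i)"] by (simp add: g_def)
  then have "distr \<mu> \<mu> (\<lambda>\<omega>. \<omega> (k := g c (\<omega> k))) = \<mu>" for c
    by (intro preserving_upd[OF g]) (simp add: nn_integral_X)
  then have inv: "(LINT \<omega>|\<mu>. h (\<omega> (k := g c (\<omega> k)))) = (LINT \<omega>|\<mu>. h \<omega>)"
    and int: "integrable \<mu> (\<lambda>\<omega>. h (\<omega> (k := g c (\<omega> k))))" for c
    using integral_distr[OF measurable_upd[OF g, of c], of h] integrable_distr[OF measurable_upd[OF g, of c], of h] h
    by simp_all
  \<comment> \<open>As \<open>c\<close> runs through \<open>{..<d k}\<close>, the index
    \<open>fst (\<omega> k) + c\<close> modulo \<open>d k\<close> meets every row once, so the sum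
    over rotations is the sum over the fibre through \<open>\<omega>\<close>.\<close>
  have sum_eq: "(\<Sum>c<d k. h (\<omega> (k := g c (\<omega> k)))) = (\<Sum>l<d k. h (\<omega> (k := (l, snd (\<omega> k)))))" for \<omega>
    using sum.reindex_bij_betw[OF rot[of "fst (\<omega> k)"], of "\<lambda>l. h (\<omega> (k := (l, snd (\<omega> k))))"]
    by (simp add: g_def add.commute)
  have "(LINT \<omega>|\<mu>. (\<Sum>l<d k. h (\<omega> (k := (l, snd (\<omega> k))))) / d k) =
      (\<Sum>c<d k. LINT \<omega>|\<mu>. h (\<omega> (k := g c (\<omega> k)))) / d k"
    unfolding sum_eq[symmetric] using int by simp
  also have "\<dots> = (LINT \<omega>|\<mu>. h \<omega>)" using d_pos[of k] by (simp add: inv)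
  finally show ?thesis by simp
qed

section \<open>Operators in one coordinate\<close>

definition coord_op :: "nat \<Rightarrow> ('i \<Rightarrow> complex mat) \<Rightarrow> ('i \<Rightarrow> 'i) \<Rightarrow>
    ((nat \<Rightarrow> nat \<times> 'i) \<Rightarrow> complex) \<Rightarrow> (nat \<Rightarrow> nat \<times> 'i) \<Rightarrow> complex" where
  "coord_op k B \<tau> x \<omega> = loc_op (d k) B \<tau> (\<lambda>q. x (\<omega> (k := q))) (\<omega> k)"

text \<open>Fibrewise form of a bound \<open>K\<close> for the squared norm. The weights enter
  because the fibres over \<open>i\<close> and \<open>\<tau> i\<close> may have different masses;
  bijectivity of \<open>\<tau>\<close> lets the estimates add up over all fibres.\<close>

definition fibre_bounded :: "nat \<Rightarrow> ('i \<Rightarrow> complex mat) \<Rightarrow> ('i \<Rightarrow> 'i) \<Rightarrow> real \<Rightarrow> bool" where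
  "fibre_bounded k B \<tau> K \<longleftrightarrow> K \<ge> 0 \<and> bij_betw \<tau> (I k) (I k) \<and>
    (\<forall>i\<in>I k. \<forall>g. f k i * sq_norm (d k) (mat_app (d k) (B i) g) \<le> K * (f k (\<tau> i) * sq_norm (d k) g))"

lemma nn_integral_sq_X:
  "(\<integral>\<^sup>+q. ennreal ((cmod (y q))\<^sup>2) \<partial>X k) =
    (\<integral>\<^sup>+i. ennreal (f k i / d k * sq_norm (d k) (\<lambda>l. y (l, i))) \<partial>count_space (I k))"
  unfolding nn_integral_X
proof (rule nn_integral_cong)
  fix i assume "i \<in> space (count_space (I k))"
  then show "ennreal (f k i / d k) * (\<Sum>l<d k. ennreal ((cmod (y (l, i)))\<^sup>2)) =
      ennreal (f k i / d k * sq_norm (d k) (\<lambda>l. y (l, i)))"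
    using f_pos[of i k] by (subst ennreal_mult) (simp_all add: sq_norm_def less_imp_le sum_nonneg)
qed

lemma loc_op_bound:
  assumes "fibre_bounded k B \<tau> K"
  shows "(\<integral>\<^sup>+q. ennreal ((cmod (loc_op (d k) B \<tau> y q))\<^sup>2) \<partial>X k) \<le> ennreal K * (\<integral>\<^sup>+q. ennreal ((cmod (y q))\<^sup>2) \<partial>X k)"
proof -
  have bij: "bij_betw \<tau> (I k) (I k)" and K: "K \<ge> 0" using assms by (auto simp: fibre_bounded_def)
  have "(\<integral>\<^sup>+q. ennreal ((cmod (loc_op (d k) B \<tau> y q))\<^sup>2) \<partial>X k) =
      (\<integral>\<^sup>+i. ennreal (f k i / d k * sq_norm (d k) (mat_app (d k) (B i) (\<lambda>l. y (l, \<tau> i)))) \<partial>count_space (I k))"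
    unfolding nn_integral_sq_X by (simp add: loc_op_def)
  also have "\<dots> \<le> (\<integral>\<^sup>+i. ennreal (K * (f k (\<tau> i) / d k * sq_norm (d k) (\<lambda>l. y (l, \<tau> i)))) \<partial>count_space (I k))"
  proof (intro nn_integral_mono ennreal_leI)
    fix i assume "i \<in> space (count_space (I k))"
    then have "f k i * sq_norm (d k) (mat_app (d k) (B i) (\<lambda>l. y (l, \<tau> i))) \<le>
        K * (f k (\<tau> i) * sq_norm (d k) (\<lambda>l. y (l, \<tau> i)))"
      using assms by (simp add: fibre_bounded_def)
    then show "f k i / d k * sq_norm (d k) (mat_app (d k) (B i) (\<lambda>l. y (l, \<tau> i))) \<le>
        K * (f k (\<tau> i) / d k * sq_norm (d k) (\<lambda>l. y (l, \<tau> i)))"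
      using d_pos[of k] by (simp add: field_simps)
  qed
  also have "\<dots> = (\<integral>\<^sup>+i. ennreal (K * (f k i / d k * sq_norm (d k) (\<lambda>l. y (l, i)))) \<partial>count_space (I k))"
    using nn_integral_bij_count_space[OF bij, of "\<lambda>i. ennreal (K * (f k i / d k * sq_norm (d k) (\<lambda>l. y (l, i))))"] .
  also have "\<dots> = ennreal K * (\<integral>\<^sup>+i. ennreal (f k i / d k * sq_norm (d k) (\<lambda>l. y (l, i))) \<partial>count_space (I k))"
    using K f_pos[of _ k]
    by (subst nn_integral_cmult[symmetric], simp, intro nn_integral_cong, subst ennreal_mult)
      (simp_all add: less_imp_le)
  finally show ?thesis unfolding nn_integral_sq_X .
qed

lemma coord_op_measurable:
  assumes x: "x \<in> borel_measurable \<mu>" and \<tau>: "\<tau> \<in> I k \<rightarrow> I k"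
  shows "coord_op k B \<tau> x \<in> borel_measurable \<mu>"
proof -
  have "(\<lambda>\<omega>. \<Sum>l<d k. B (snd (\<omega> k)) $$ (fst (\<omega> k), l) * x (\<omega> (k := (l, \<tau> (snd (\<omega> k)))))) \<in> borel_measurable \<mu>"
  proof (intro borel_measurable_sum borel_measurable_times)
    fix l assume l: "l \<in> {..<d k}"
    show "(\<lambda>\<omega>. B (snd (\<omega> k)) $$ (fst (\<omega> k), l)) \<in> borel_measurable \<mu>"
      unfolding \<mu>_eq
      using measurable_compose[OF measurable_component_singleton[of k UNIV X], of "\<lambda>q. B (snd q) $$ (fst q, l)" borel]
      by simp
    have "(\<lambda>q. (l, \<tau> (snd q))) \<in> {..<d k} \<times> I k \<rightarrow> {..<d k} \<times> I k" using l \<tau> by auto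
    from measurable_compose[OF measurable_upd[OF this] x]
    show "(\<lambda>\<omega>. x (\<omega> (k := (l, \<tau> (snd (\<omega> k)))))) \<in> borel_measurable \<mu>" .
  qed
  then show ?thesis by (simp add: coord_op_def[abs_def] loc_op_def mat_app_def)
qed

lemma coord_op_upd: "coord_op k B \<tau> x (\<omega> (k := q)) = loc_op (d k) B \<tau> (\<lambda>q. x (\<omega> (k := q))) q"
  by (simp add: coord_op_def)

text \<open>Resampling coordinate \<open>k\<close> leaves an inner integral over \<open>X k\<close>,
  where the bound for \<open>loc_op\<close> applies with all other coordinates fixed.\<close>

lemma coord_op_nn_integral:
  assumes B: "fibre_bounded k B \<tau> K" and x: "x \<in> borel_measurable \<mu>"
  shows "(\<integral>\<^sup>+\<omega>. ennreal ((cmod (coord_op k B \<tau> x \<omega>))\<^sup>2) \<partial>\<mu>) \<le> ennreal K * (\<integral>\<^sup>+\<omega>. ennreal ((cmod (x \<omega>))\<^sup>2) \<partial>\<mu>)"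
proof -
  have \<tau>: "\<tau> \<in> I k \<rightarrow> I k" using B by (auto simp: fibre_bounded_def dest: bij_betw_imp_funcset)
  note [measurable] = x coord_op_measurable[OF x \<tau>, of B]
  have *: "(\<lambda>\<omega>. \<integral>\<^sup>+q. ennreal ((cmod (x (\<omega> (k := q))))\<^sup>2) \<partial>X k) \<in> borel_measurable \<mu>"
  proof -
    interpret Xk: prob_space "X k" by (rule prob_space_X)
    from measurable_compose[OF measurable_upd_pair(2)[of k], of "\<lambda>\<omega>. ennreal ((cmod (x \<omega>))\<^sup>2)" borel]
    have "(\<lambda>(\<omega>, q). ennreal ((cmod (x (\<omega> (k := q))))\<^sup>2)) \<in> borel_measurable (\<mu> \<Otimes>\<^sub>M X k)"
      by (simp add: case_prod_unfold)
    then show ?thesis by (rule Xk.borel_measurable_nn_integral)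
  qed
  have "(\<integral>\<^sup>+\<omega>. ennreal ((cmod (coord_op k B \<tau> x \<omega>))\<^sup>2) \<partial>\<mu>) =
      (\<integral>\<^sup>+\<omega>. (\<integral>\<^sup>+q. ennreal ((cmod (loc_op (d k) B \<tau> (\<lambda>q. x (\<omega> (k := q))) q))\<^sup>2) \<partial>X k) \<partial>\<mu>)"
    by (subst resample[of _ k]) (simp_all add: coord_op_upd)
  also have "\<dots> \<le> (\<integral>\<^sup>+\<omega>. ennreal K * (\<integral>\<^sup>+q. ennreal ((cmod (x (\<omega> (k := q))))\<^sup>2) \<partial>X k) \<partial>\<mu>)"
    by (intro nn_integral_mono loc_op_bound B)
  also have "\<dots> = ennreal K * (\<integral>\<^sup>+\<omega>. (\<integral>\<^sup>+q. ennreal ((cmod (x (\<omega> (k := q))))\<^sup>2) \<partial>X k) \<partial>\<mu>)"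
    by (rule nn_integral_cmult[OF *])
  also have "\<dots> = ennreal K * (\<integral>\<^sup>+\<omega>. ennreal ((cmod (x \<omega>))\<^sup>2) \<partial>\<mu>)"
    by (subst resample[of _ k, symmetric]) simp_all
  finally show ?thesis .
qed

lemma coord_op_bounded:
  assumes B: "fibre_bounded k B \<tau> K"
  shows "finitely_bounded \<mu> K (coord_op k B \<tau>)"
  unfolding finitely_bounded_def
proof (intro conjI allI ballI)
  show "K \<ge> 0" using B by (simp add: fibre_bounded_def)
  show "coord_op k B \<tau> (\<lambda>\<omega>. x \<omega> + y \<omega>) = (\<lambda>\<omega>. coord_op k B \<tau> x \<omega> + coord_op k B \<tau> y \<omega>)" for x y
    by (simp add: fun_eq_iff coord_op_def loc_op_def mat_app_def distrib_left sum.distrib)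
  show "coord_op k B \<tau> (\<lambda>\<omega>. c * x \<omega>) = (\<lambda>\<omega>. c * coord_op k B \<tau> x \<omega>)" for c x
    by (simp add: fun_eq_iff coord_op_def loc_op_def mat_app_def sum_distrib_left mult.left_commute)
  fix x assume x: "x \<in> square_integrable \<mu>"
  have \<tau>: "\<tau> \<in> I k \<rightarrow> I k" using B by (auto simp: fibre_bounded_def dest: bij_betw_imp_funcset)
  show *: "(\<integral>\<^sup>+\<omega>. ennreal ((cmod (coord_op k B \<tau> x \<omega>))\<^sup>2) \<partial>\<mu>) \<le> ennreal K * (\<integral>\<^sup>+\<omega>. ennreal ((cmod (x \<omega>))\<^sup>2) \<partial>\<mu>)"
    using square_integrableD(1)[OF x] by (rule coord_op_nn_integral[OF B])
  have "ennreal K * (\<integral>\<^sup>+\<omega>. ennreal ((cmod (x \<omega>))\<^sup>2) \<partial>\<mu>) < \<infinity>"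
    using x unfolding square_integrable_iff_nn_integral by (simp add: ennreal_mult_less_top)
  then show "coord_op k B \<tau> x \<in> square_integrable \<mu>"
    using coord_op_measurable[OF square_integrableD(1)[OF x] \<tau>] *
    unfolding square_integrable_iff_nn_integral by (auto intro: le_less_trans)
qed

lemma coord_op_commute:
  assumes "k \<noteq> k'"
  shows "coord_op k B \<tau> (coord_op k' B' \<tau>' x) = coord_op k' B' \<tau>' (coord_op k B \<tau> x)"
proof
  fix \<omega>
  have "coord_op k B \<tau> (coord_op k' B' \<tau>' x) \<omega> = (\<Sum>l<d k. \<Sum>m<d k'. B (snd (\<omega> k)) $$ (fst (\<omega> k), l) *
      (B' (snd (\<omega> k')) $$ (fst (\<omega> k'), m) * x (\<omega> (k := (l, \<tau> (snd (\<omega> k))), k' := (m, \<tau>' (snd (\<omega> k')))))))"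
    using assms by (simp add: coord_op_def loc_op_def mat_app_def sum_distrib_left)
  also have "\<dots> = (\<Sum>m<d k'. \<Sum>l<d k. B' (snd (\<omega> k')) $$ (fst (\<omega> k'), m) * (B (snd (\<omega> k)) $$ (fst (\<omega> k), l) *
      x (\<omega> (k' := (m, \<tau>' (snd (\<omega> k'))), k := (l, \<tau> (snd (\<omega> k)))))))"
    unfolding fun_upd_twist[OF assms] by (subst sum.swap) (simp add: mult.left_commute)
  also have "\<dots> = coord_op k' B' \<tau>' (coord_op k B \<tau> x) \<omega>"
    using assms by (simp add: coord_op_def loc_op_def mat_app_def sum_distrib_left)
  finally show "coord_op k B \<tau> (coord_op k' B' \<tau>' x) \<omega> = coord_op k' B' \<tau>' (coord_op k B \<tau> x) \<omega>" .
qed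

text \<open>Functions and matrices are compared only where the space and the index ranges see them;
  \<open>\<tau>\<close> has to stay in \<open>I k\<close> so that updated points remain in the
  space.\<close>

lemma coord_op_cong:
  assumes "\<And>\<omega>. \<omega> \<in> space \<mu> \<Longrightarrow> x \<omega> = y \<omega>" and "\<tau> \<in> I k \<rightarrow> I k" "\<omega> \<in> space \<mu>"
    "\<And>i j l. i \<in> I k \<Longrightarrow> j < d k \<Longrightarrow> l < d k \<Longrightarrow> B i $$ (j, l) = B' i $$ (j, l)"
  shows "coord_op k B \<tau> x \<omega> = coord_op k B' \<tau> y \<omega>"
proof -
  have "\<omega> (k := (l, \<tau> (snd (\<omega> k)))) \<in> space \<mu>" if "l < d k" for l
    using assms(2,3) that by (auto simp: space_\<mu>)
  moreover have "fst (\<omega> k) < d k" "snd (\<omega> k) \<in> I k" using assms(3) by (auto simp: space_\<mu>)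
  ultimately show ?thesis unfolding coord_op_def loc_op_def mat_app_def
    using assms(1,4) by (intro sum.cong) auto
qed

lemma coord_op_mult:
  assumes "\<And>i. i \<in> I k \<Longrightarrow> A i \<in> carrier_mat (d k) (d k)" "\<And>i. i \<in> I k \<Longrightarrow> B i \<in> carrier_mat (d k) (d k)"
    and "\<omega> \<in> space \<mu>"
  shows "coord_op k A (\<lambda>i. i) (coord_op k B (\<lambda>i. i) x) \<omega> = coord_op k (\<lambda>i. A i * B i) (\<lambda>i. i) x \<omega>"
proof -
  have "fst (\<omega> k) < d k" "snd (\<omega> k) \<in> I k" using assms(3) by (auto simp: space_\<mu>)
  then show ?thesis using assms
    by (simp add: coord_op_def loc_op_def mat_app_mult)
qed

lemma coord_op_one:
  assumes "\<omega> \<in> space \<mu>"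
  shows "coord_op k (\<lambda>_. 1\<^sub>m (d k)) (\<lambda>i. i) x \<omega> = x \<omega>"
proof -
  have "fst (\<omega> k) < d k" using assms by (auto simp: space_\<mu>)
  then show ?thesis by (simp add: coord_op_def loc_op_def mat_app_one)
qed

definition adj :: "nat \<Rightarrow> complex mat \<Rightarrow> complex mat" where
  "adj n A = mat n n (\<lambda>(i, j). cnj (A $$ (j, i)))"

text \<open>Averaging both integrals over the fibre of coordinate \<open>k\<close> leaves finite
  sums over rows, where the claim is the adjoint relation of matrices.\<close>

lemma coord_op_adjoint:
  assumes B: "fibre_bounded k B (\<lambda>i. i) K" and B': "fibre_bounded k (\<lambda>i. adj (d k) (B i)) (\<lambda>i. i) K'"
    and x: "x \<in> square_integrable \<mu>" and y: "y \<in> square_integrable \<mu>"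
  shows "(LINT \<omega>|\<mu>. coord_op k B (\<lambda>i. i) x \<omega> * cnj (y \<omega>)) =
    (LINT \<omega>|\<mu>. x \<omega> * cnj (coord_op k (\<lambda>i. adj (d k) (B i)) (\<lambda>i. i) y \<omega>))"
proof -
  note c = coord_op_bounded[OF B] coord_op_bounded[OF B']
  have 1: "integrable \<mu> (\<lambda>\<omega>. coord_op k B (\<lambda>i. i) x \<omega> * cnj (y \<omega>))"
    using c x y by (intro integrable_product) (auto simp: finitely_bounded_def)
  have 2: "integrable \<mu> (\<lambda>\<omega>. x \<omega> * cnj (coord_op k (\<lambda>i. adj (d k) (B i)) (\<lambda>i. i) y \<omega>))"
    using c x y by (intro integrable_product) (auto simp: finitely_bounded_def)
  have "(\<Sum>j<d k. mat_app (d k) b g j * cnj (h j)) = (\<Sum>l<d k. g l * cnj (mat_app (d k) (adj (d k) b) h l))" for b g h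
  proof -
    have "(\<Sum>j<d k. mat_app (d k) b g j * cnj (h j)) = (\<Sum>l<d k. \<Sum>j<d k. b $$ (j, l) * g l * cnj (h j))"
      unfolding mat_app_def sum_distrib_right by (rule sum.swap)
    also have "\<dots> = (\<Sum>l<d k. g l * cnj (mat_app (d k) (adj (d k) b) h l))"
      unfolding mat_app_def sum_distrib_left cnj_sum
      by (intro sum.cong refl) (simp_all add: adj_def mult_ac)
    finally show ?thesis .
  qed
  then show ?thesis
    unfolding fibre_average[OF 1, of k] fibre_average[OF 2, of k] by (simp add: coord_op_upd loc_op_def)
qed

section \<open>Products over finitely many coordinates\<close>

fun tensor_op :: "nat \<Rightarrow> (nat \<Rightarrow> 'i \<Rightarrow> complex mat) \<Rightarrow> (nat \<Rightarrow> 'i \<Rightarrow> 'i) \<Rightarrow>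
    ((nat \<Rightarrow> nat \<times> 'i) \<Rightarrow> complex) \<Rightarrow> (nat \<Rightarrow> nat \<times> 'i) \<Rightarrow> complex" where
  "tensor_op 0 B \<tau> x = x"
| "tensor_op (Suc n) B \<tau> x = coord_op n (B n) (\<tau> n) (tensor_op n B \<tau> x)"

lemma tensor_op_bounded:
  assumes "\<And>k. k < n \<Longrightarrow> fibre_bounded k (B k) (\<tau> k) (K k)"
  shows "finitely_bounded \<mu> (\<Prod>k<n. K k) (tensor_op n B \<tau>)"
  using assms
proof (induction n)
  case 0
  have "tensor_op 0 B \<tau> = (\<lambda>x. x)" by auto
  then show ?case using finitely_bounded_id by simp
next
  case (Suc n)
  have "tensor_op (Suc n) B \<tau> = (\<lambda>x. coord_op n (B n) (\<tau> n) (tensor_op n B \<tau> x))" by auto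
  then show ?case
    using finitely_bounded_comp[OF coord_op_bounded[OF Suc.prems[of n]] Suc.IH] Suc.prems
    by (simp add: mult.commute)
qed

lemma tensor_op_commute:
  "k \<ge> n \<Longrightarrow> coord_op k A \<sigma> (tensor_op n B \<tau> x) = tensor_op n B \<tau> (coord_op k A \<sigma> x)"
  by (induction n) (simp_all add: coord_op_commute)

lemma tensor_op_cong:
  assumes "\<And>k. k < n \<Longrightarrow> \<tau> k \<in> I k \<rightarrow> I k" "\<And>\<omega>. \<omega> \<in> space \<mu> \<Longrightarrow> x \<omega> = y \<omega>"
    "\<And>k i j l. k < n \<Longrightarrow> i \<in> I k \<Longrightarrow> j < d k \<Longrightarrow> l < d k \<Longrightarrow> B k i $$ (j, l) = B' k i $$ (j, l)" "\<omega> \<in> space \<mu>"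
  shows "tensor_op n B \<tau> x \<omega> = tensor_op n B' \<tau> y \<omega>"
  using assms
proof (induction n arbitrary: \<omega>)
  case (Suc n)
  show ?case unfolding tensor_op.simps
    by (rule coord_op_cong) (use Suc in auto)
qed simp

lemma tensor_op_mult:
  assumes "\<And>k i. k < n \<Longrightarrow> i \<in> I k \<Longrightarrow> A k i \<in> carrier_mat (d k) (d k)"
    "\<And>k i. k < n \<Longrightarrow> i \<in> I k \<Longrightarrow> B k i \<in> carrier_mat (d k) (d k)" "\<omega> \<in> space \<mu>"
  shows "tensor_op n A (\<lambda>_ i. i) (tensor_op n B (\<lambda>_ i. i) x) \<omega> = tensor_op n (\<lambda>k i. A k i * B k i) (\<lambda>_ i. i) x \<omega>"
  using assms
proof (induction n arbitrary: \<omega>)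
  case (Suc n)
  \<comment> \<open>The operator in coordinate \<open>n\<close> commutes with the tensor over the
    earlier ones, so the two operators in coordinate \<open>n\<close> become adjacent.\<close>
  have "tensor_op (Suc n) A (\<lambda>_ i. i) (tensor_op (Suc n) B (\<lambda>_ i. i) x) =
      coord_op n (A n) (\<lambda>i. i) (coord_op n (B n) (\<lambda>i. i) (tensor_op n A (\<lambda>_ i. i) (tensor_op n B (\<lambda>_ i. i) x)))"
    by (simp add: tensor_op_commute)
  then have "tensor_op (Suc n) A (\<lambda>_ i. i) (tensor_op (Suc n) B (\<lambda>_ i. i) x) \<omega> =
      coord_op n (\<lambda>i. A n i * B n i) (\<lambda>i. i) (tensor_op n A (\<lambda>_ i. i) (tensor_op n B (\<lambda>_ i. i) x)) \<omega>"
    using Suc.prems by (simp add: coord_op_mult)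
  also have "\<dots> = coord_op n (\<lambda>i. A n i * B n i) (\<lambda>i. i) (tensor_op n (\<lambda>k i. A k i * B k i) (\<lambda>_ i. i) x) \<omega>"
    by (rule coord_op_cong) (use Suc in auto)
  finally show ?case by simp
qed simp

lemma tensor_op_pad:
  assumes "n \<le> m" "\<And>k i. n \<le> k \<Longrightarrow> k < m \<Longrightarrow> i \<in> I k \<Longrightarrow> B k i = 1\<^sub>m (d k)" "\<omega> \<in> space \<mu>"
  shows "tensor_op m B (\<lambda>_ i. i) x \<omega> = tensor_op n B (\<lambda>_ i. i) x \<omega>"
  using assms
proof (induction m arbitrary: \<omega> rule: dec_induct)
  case (step m)
  have "coord_op m (B m) (\<lambda>i. i) (tensor_op m B (\<lambda>_ i. i) x) \<omega> =
      coord_op m (\<lambda>_. 1\<^sub>m (d m)) (\<lambda>i. i) (tensor_op n B (\<lambda>_ i. i) x) \<omega>"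
    by (rule coord_op_cong) (use step in auto)
  then show ?case using step.prems by (simp add: coord_op_one)
qed simp

lemma tensor_op_adjoint:
  assumes "\<And>k. k < n \<Longrightarrow> fibre_bounded k (B k) (\<lambda>i. i) (K k)"
    "\<And>k. k < n \<Longrightarrow> fibre_bounded k (\<lambda>i. adj (d k) (B k i)) (\<lambda>i. i) (K' k)"
    and x: "x \<in> square_integrable \<mu>" and y: "y \<in> square_integrable \<mu>"
  shows "(LINT \<omega>|\<mu>. tensor_op n B (\<lambda>_ i. i) x \<omega> * cnj (y \<omega>)) =
    (LINT \<omega>|\<mu>. x \<omega> * cnj (tensor_op n (\<lambda>k i. adj (d k) (B k i)) (\<lambda>_ i. i) y \<omega>))"
  using assms(1,2) y
proof (induction n arbitrary: y)
  case (Suc n)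
  let ?B' = "\<lambda>k i. adj (d k) (B k i)"
  have c: "tensor_op n B (\<lambda>_ i. i) x \<in> square_integrable \<mu>"
    using tensor_op_bounded[of n B "\<lambda>_ i. i" K] Suc.prems(1) x by (simp add: finitely_bounded_def)
  have c': "coord_op n (?B' n) (\<lambda>i. i) y \<in> square_integrable \<mu>"
    using coord_op_bounded[OF Suc.prems(2)[of n]] Suc.prems(3) by (simp add: finitely_bounded_def)
  have "(LINT \<omega>|\<mu>. tensor_op (Suc n) B (\<lambda>_ i. i) x \<omega> * cnj (y \<omega>)) =
      (LINT \<omega>|\<mu>. tensor_op n B (\<lambda>_ i. i) x \<omega> * cnj (coord_op n (?B' n) (\<lambda>i. i) y \<omega>))"
    using coord_op_adjoint[OF Suc.prems(1)[of n] Suc.prems(2)[of n] c Suc.prems(3)] by simp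
  also have "\<dots> = (LINT \<omega>|\<mu>. x \<omega> * cnj (tensor_op n ?B' (\<lambda>_ i. i) (coord_op n (?B' n) (\<lambda>i. i) y) \<omega>))"
    using Suc.prems(1,2) by (intro Suc.IH c') auto
  \<comment> \<open>The adjoint comes out with its factors in reversed order; commutation restores
    it.\<close>
  finally show ?case by (simp add: tensor_op_commute)
qed simp

section \<open>Elementary tensors\<close>

text \<open>Says that \<open>h\<close> is a function of the coordinates from \<open>n\<close> on,
  phrased by updates because those are what resampling and coordinate operators perform.\<close>

definition indep :: "nat \<Rightarrow> ((nat \<Rightarrow> nat \<times> 'i) \<Rightarrow> 'b) \<Rightarrow> bool" where
  "indep n h \<longleftrightarrow> (\<forall>k<n. \<forall>\<omega> q. h (\<omega> (k := q)) = h \<omega>)"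

lemma indepD: "indep n h \<Longrightarrow> k < n \<Longrightarrow> h (\<omega> (k := q)) = h \<omega>"
  unfolding indep_def by blast

definition elem :: "nat \<Rightarrow> (nat \<Rightarrow> nat \<times> 'i \<Rightarrow> complex) \<Rightarrow> ((nat \<Rightarrow> nat \<times> 'i) \<Rightarrow> complex) \<Rightarrow>
    (nat \<Rightarrow> nat \<times> 'i) \<Rightarrow> complex" where
  "elem n g h \<omega> = (\<Prod>k<n. g k (\<omega> k)) * h \<omega>"

lemma coord_op_elem:
  assumes "k < n" "indep n h"
  shows "coord_op k B \<tau> (elem n g h) = elem n (g(k := loc_op (d k) B \<tau> (g k))) h"
proof
  fix \<omega>
  have split: "(\<Prod>m<n. g' m (\<omega>' m)) = g' k (\<omega>' k) * (\<Prod>m\<in>{..<n} - {k}. g' m (\<omega>' m))"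
    for g' :: "nat \<Rightarrow> nat \<times> 'i \<Rightarrow> complex" and \<omega>'
    using assms(1) by (intro prod.remove) auto
  let ?r = "(\<Prod>m\<in>{..<n} - {k}. g m (\<omega> m)) * h \<omega>"
  have 1: "elem n g h (\<omega> (k := q)) = g k q * ?r" for q
    using assms unfolding elem_def split by (simp add: indepD)
  have 2: "elem n (g(k := g')) h \<omega> = g' (\<omega> k) * ?r" for g'
    unfolding elem_def split[of "g(k := g')"] by simp
  show "coord_op k B \<tau> (elem n g h) \<omega> = elem n (g(k := loc_op (d k) B \<tau> (g k))) h \<omega>"
    unfolding 2 coord_op_def 1 by (simp add: loc_op_def mat_app_def sum_distrib_right mult.assoc)
qed

lemma tensor_op_elem:
  assumes "m \<le> n" "indep n h"
  shows "tensor_op m B \<tau> (elem n g h) = elem n (\<lambda>k. if k < m then loc_op (d k) (B k) (\<tau> k) (g k) else g k) h"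
  using assms(1)
proof (induction m)
  case (Suc m)
  have "(\<lambda>k. if k < m then loc_op (d k) (B k) (\<tau> k) (g k) else g k)(m := loc_op (d m) (B m) (\<tau> m) (g m)) =
      (\<lambda>k. if k < Suc m then loc_op (d k) (B k) (\<tau> k) (g k) else g k)" by (auto simp: fun_eq_iff less_Suc_eq)
  then show ?case using Suc assms(2) by (simp add: coord_op_elem)
qed simp

text \<open>Independence: resampling coordinate \<open>m\<close> touches only the factor
  \<open>\<phi> m\<close>, whose integral comes out as a constant.\<close>

lemma nn_integral_elem:
  fixes \<phi> :: "nat \<Rightarrow> nat \<times> 'i \<Rightarrow> ennreal"
  assumes h: "h \<in> borel_measurable \<mu>" "indep n h"
  shows "(\<integral>\<^sup>+\<omega>. (\<Prod>k<n. \<phi> k (\<omega> k)) * h \<omega> \<partial>\<mu>) = (\<Prod>k<n. \<integral>\<^sup>+q. \<phi> k q \<partial>X k) * (\<integral>\<^sup>+\<omega>. h \<omega> \<partial>\<mu>)"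
proof -
  have comp [measurable]: "(\<lambda>\<omega>. \<phi> k (\<omega> k)) \<in> borel_measurable \<mu>" for k
    unfolding \<mu>_eq using measurable_compose[OF measurable_component_singleton[of k UNIV X], of "\<phi> k" borel] by simp
  note [measurable] = h(1)
  have "m \<le> n \<Longrightarrow> (\<integral>\<^sup>+\<omega>. (\<Prod>k<m. \<phi> k (\<omega> k)) * h \<omega> \<partial>\<mu>) = (\<Prod>k<m. \<integral>\<^sup>+q. \<phi> k q \<partial>X k) * (\<integral>\<^sup>+\<omega>. h \<omega> \<partial>\<mu>)" for m
  proof (induction m)
    case (Suc m)
    have "(\<integral>\<^sup>+\<omega>. (\<Prod>k<Suc m. \<phi> k (\<omega> k)) * h \<omega> \<partial>\<mu>) =
        (\<integral>\<^sup>+\<omega>. (\<integral>\<^sup>+q. \<phi> m q * ((\<Prod>k<m. \<phi> k (\<omega> k)) * h \<omega>) \<partial>X m) \<partial>\<mu>)"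
      using Suc.prems by (subst resample[of _ m]) (simp_all add: indepD[OF h(2)] mult_ac)
    also have "\<dots> = (\<integral>\<^sup>+\<omega>. (\<integral>\<^sup>+q. \<phi> m q \<partial>X m) * ((\<Prod>k<m. \<phi> k (\<omega> k)) * h \<omega>) \<partial>\<mu>)"
      by (subst nn_integral_multc) simp_all
    also have "\<dots> = (\<integral>\<^sup>+q. \<phi> m q \<partial>X m) * (\<integral>\<^sup>+\<omega>. (\<Prod>k<m. \<phi> k (\<omega> k)) * h \<omega> \<partial>\<mu>)"
      by (rule nn_integral_cmult) simp
    finally show ?case using Suc by (simp add: mult_ac)
  qed simp
  then show ?thesis by simp
qed

lemma elem_square_integrable:
  assumes h: "h \<in> square_integrable \<mu>" "indep n h" and g: "\<And>k. k < n \<Longrightarrow> g k \<in> square_integrable (X k)"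
  shows "elem n g h \<in> square_integrable \<mu>"
    and "(l2_norm \<mu> (l2_class \<mu> (elem n g h)))\<^sup>2 =
      (\<Prod>k<n. (l2_norm (X k) (l2_class (X k) (g k)))\<^sup>2) * (l2_norm \<mu> (l2_class \<mu> h))\<^sup>2"
proof -
  have comp [measurable]: "(\<lambda>\<omega>. g k (\<omega> k)) \<in> borel_measurable \<mu>" for k
    unfolding \<mu>_eq using measurable_compose[OF measurable_component_singleton[of k UNIV X], of "g k" borel] by simp
  note [measurable] = square_integrableD(1)[OF h(1)]
  have "(\<integral>\<^sup>+\<omega>. ennreal ((cmod (elem n g h \<omega>))\<^sup>2) \<partial>\<mu>) =
      (\<integral>\<^sup>+\<omega>. (\<Prod>k<n. ennreal ((cmod (g k (\<omega> k)))\<^sup>2)) * ennreal ((cmod (h \<omega>))\<^sup>2) \<partial>\<mu>)"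
    unfolding elem_def norm_mult power_mult_distrib prod_norm[symmetric] prod_power_distrib
    by (intro nn_integral_cong) (simp add: ennreal_mult prod_nonneg prod_ennreal)
  also have "\<dots> = (\<Prod>k<n. \<integral>\<^sup>+q. ennreal ((cmod (g k q))\<^sup>2) \<partial>X k) * (\<integral>\<^sup>+\<omega>. ennreal ((cmod (h \<omega>))\<^sup>2) \<partial>\<mu>)"
    using h(2) by (intro nn_integral_elem[where \<phi> = "\<lambda>k q. ennreal ((cmod (g k q))\<^sup>2)"]) (simp_all add: indep_def)
  also have "\<dots> = (\<Prod>k<n. ennreal ((l2_norm (X k) (l2_class (X k) (g k)))\<^sup>2)) * ennreal ((l2_norm \<mu> (l2_class \<mu> h))\<^sup>2)"
    using g h by (simp add: l2_norm_class_nn_integral)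
  also have "\<dots> = ennreal ((\<Prod>k<n. (l2_norm (X k) (l2_class (X k) (g k)))\<^sup>2) * (l2_norm \<mu> (l2_class \<mu> h))\<^sup>2)"
    by (simp add: prod_ennreal ennreal_mult prod_nonneg)
  finally have *: "(\<integral>\<^sup>+\<omega>. ennreal ((cmod (elem n g h \<omega>))\<^sup>2) \<partial>\<mu>) =
    ennreal ((\<Prod>k<n. (l2_norm (X k) (l2_class (X k) (g k)))\<^sup>2) * (l2_norm \<mu> (l2_class \<mu> h))\<^sup>2)" .
  have "elem n g h \<in> borel_measurable \<mu>" unfolding elem_def[abs_def] by measurable
  then show S: "elem n g h \<in> square_integrable \<mu>"
    using * unfolding square_integrable_iff_nn_integral by simp
  show "(l2_norm \<mu> (l2_class \<mu> (elem n g h)))\<^sup>2 =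
      (\<Prod>k<n. (l2_norm (X k) (l2_class (X k) (g k)))\<^sup>2) * (l2_norm \<mu> (l2_class \<mu> h))\<^sup>2"
    using *[folded l2_norm_class_nn_integral[OF S]] by (simp add: prod_nonneg)
qed

lemma integral_elem:
  assumes "\<And>k. k < n \<Longrightarrow> integrable (X k) (g k)"
  shows "(LINT \<omega>|\<mu>. (\<Prod>k<n. g k (\<omega> k))) = (\<Prod>k<n. LINT q|X k. (g k q :: complex))"
proof -
  interpret X: prob_space "X k" for k by (rule prob_space_X)
  interpret product_prob_space X UNIV by unfold_locales
  interpret product_sigma_finite X by unfold_locales
  \<comment> \<open>Only \<open>n\<close> coordinates occur, so the integral descends to a finite
    product, where Fubini is available for integrable complex factors.\<close>
  have "(LINT \<omega>|\<mu>. (\<Prod>k<n. g k (\<omega> k))) = (LINT \<omega>|distr (PiM UNIV X) (PiM {..<n} X) (\<lambda>\<omega>. restrict \<omega> {..<n}). (\<Prod>k<n. g k (\<omega> k)))"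
    unfolding \<mu>_eq
  proof (subst integral_distr)
    show "(\<lambda>\<omega>. \<Prod>k<n. g k (\<omega> k)) \<in> borel_measurable (PiM {..<n} X)"
    proof (rule borel_measurable_prod)
      fix k assume "k \<in> {..<n}"
      then show "(\<lambda>\<omega>. g k (\<omega> k)) \<in> borel_measurable (PiM {..<n} X)"
        by (intro measurable_compose[OF measurable_component_singleton]) auto
    qed
  qed (auto intro: measurable_restrict_subset)
  also have "\<dots> = (LINT \<omega>|PiM {..<n} X. (\<Prod>k<n. g k (\<omega> k)))"
    by (subst distr_PiM_restrict_finite) auto
  also have "\<dots> = (\<Prod>k<n. LINT q|X k. g k q)"
    using assms by (intro product_integral_prod) auto
  finally show ?thesis .
qed

end

section \<open>Tensor operators and elementary tensors\<close>

context product_system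
begin

text \<open>Every point of \<open>X k\<close> has positive mass, so equality almost everywhere is
  equality.\<close>

lemma l2_rep_X:
  assumes "y \<in> square_integrable (X k)" "q \<in> {..<d k} \<times> I k"
  shows "l2_rep (l2_class (X k) y) q = y q"
proof -
  have "AE q in X k. l2_rep (l2_class (X k) y) q = y q" by (rule l2_rep_class(2)[OF assms(1)])
  then show ?thesis
    using assms(2) f_pos d_pos unfolding system_measure_def AE_point_measure
    by (force simp: mem_Times_iff case_prod_unfold)
qed

lemma loc_op_square_integrable:
  assumes "fibre_bounded k B \<tau> K" "y \<in> square_integrable (X k)"
  shows "loc_op (d k) B \<tau> y \<in> square_integrable (X k)"
proof -
  have "ennreal K * (\<integral>\<^sup>+q. ennreal ((cmod (y q))\<^sup>2) \<partial>X k) < \<infinity>"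
    using assms(2) unfolding square_integrable_iff_nn_integral by (simp add: ennreal_mult_less_top)
  then have "(\<integral>\<^sup>+q. ennreal ((cmod (loc_op (d k) B \<tau> y q))\<^sup>2) \<partial>X k) < \<infinity>"
    by (rule le_less_trans[OF loc_op_bound[OF assms(1)]])
  then show ?thesis unfolding square_integrable_iff_nn_integral by simp
qed

lemma distr_tail: "distr \<mu> (PiM {n..} X) (\<lambda>\<omega>. restrict \<omega> {n..}) = PiM {n..} X"
  using distr_PiM_reindex[of UNIV X "\<lambda>k. k" "{n..}"] prob_space_X by (simp add: \<mu>_eq)

lemma measurable_tail: "(\<lambda>\<omega>. restrict \<omega> {n..}) \<in> measurable \<mu> (PiM {n..} X)"
  unfolding \<mu>_eq by (rule measurable_restrict_subset) simp

lemma tail_square_integrable: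
  assumes "\<eta> \<in> borel_measurable (PiM {n..} X)"
  shows "(\<lambda>\<omega>. \<eta> (restrict \<omega> {n..})) \<in> square_integrable \<mu> \<longleftrightarrow> \<eta> \<in> square_integrable (PiM {n..} X)"
proof -
  have "(\<integral>\<^sup>+y. ennreal ((cmod (\<eta> y))\<^sup>2) \<partial>PiM {n..} X) = (\<integral>\<^sup>+\<omega>. ennreal ((cmod (\<eta> (restrict \<omega> {n..})))\<^sup>2) \<partial>\<mu>)"
    using assms by (subst distr_tail[symmetric]) (auto intro!: nn_integral_distr measurable_tail)
  then show ?thesis
    unfolding square_integrable_iff_nn_integral
    using assms measurable_compose[OF measurable_tail assms] by simp
qed

lemma indep_tail: "indep n (\<lambda>\<omega>. \<eta> (restrict \<omega> {n..}))"
  unfolding indep_def by (auto intro!: arg_cong[of _ _ \<eta>])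

lemma tensor_vector_elem:
  "tensor_vector X n \<xi> \<eta> = l2_class \<mu> (elem n (\<lambda>k. l2_rep (\<xi> k)) (\<lambda>\<omega>. l2_rep \<eta> (restrict \<omega> {n..})))"
  by (simp add: tensor_vector_def \<mu>_eq elem_def[abs_def])

lemma tensor_vector_parts:
  assumes "\<And>k. k < n \<Longrightarrow> \<xi> k \<in> L2 (X k)" "\<eta> \<in> L2 (PiM {n..} X)"
  shows "(\<lambda>\<omega>. l2_rep \<eta> (restrict \<omega> {n..})) \<in> square_integrable \<mu>"
    and "elem n (\<lambda>k. l2_rep (\<xi> k)) (\<lambda>\<omega>. l2_rep \<eta> (restrict \<omega> {n..})) \<in> square_integrable \<mu>"
proof -
  show *: "(\<lambda>\<omega>. l2_rep \<eta> (restrict \<omega> {n..})) \<in> square_integrable \<mu>"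
    using l2_rep_L2(1)[OF assms(2)] square_integrableD(1) by (subst tail_square_integrable) blast+
  show "elem n (\<lambda>k. l2_rep (\<xi> k)) (\<lambda>\<omega>. l2_rep \<eta> (restrict \<omega> {n..})) \<in> square_integrable \<mu>"
    using l2_rep_L2(1)[OF assms(1)] by (intro elem_square_integrable * indep_tail) auto
qed

text \<open>Existence of tensor operators in concrete form; together with uniqueness it turns the
  implicit description of the generators into formulas.\<close>

lemma is_tensor_op_class_op:
  assumes B: "\<And>k. k < n \<Longrightarrow> fibre_bounded k (B k) (\<tau> k) (K k)"
    and R: "\<And>k \<xi>. k < n \<Longrightarrow> \<xi> \<in> L2 (X k) \<Longrightarrow> R k \<xi> = l2_class (X k) (loc_op (d k) (B k) (\<tau> k) (l2_rep \<xi>))"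
  shows "is_tensor_op X n R (class_op \<mu> (tensor_op n B \<tau>))"
  unfolding is_tensor_op_def
proof (intro conjI allI impI)
  note bd = tensor_op_bounded[OF B]
  show "class_op \<mu> (tensor_op n B \<tau>) \<in> bounded_ops (PiM UNIV X)"
    using class_op_bounded_ops[OF bd] by (simp add: \<mu>_eq)
  fix \<xi> \<eta> assume "(\<forall>k<n. \<xi> k \<in> L2 (X k)) \<and> \<eta> \<in> L2 (PiM {n..} X)"
  then have \<xi>: "\<And>k. k < n \<Longrightarrow> \<xi> k \<in> L2 (X k)" and \<eta>: "\<eta> \<in> L2 (PiM {n..} X)" by auto
  let ?h = "\<lambda>\<omega>. l2_rep \<eta> (restrict \<omega> {n..})"
  have "class_op \<mu> (tensor_op n B \<tau>) (tensor_vector X n \<xi> \<eta>) =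
      l2_class \<mu> (elem n (\<lambda>k. if k < n then loc_op (d k) (B k) (\<tau> k) (l2_rep (\<xi> k)) else l2_rep (\<xi> k)) ?h)"
    unfolding tensor_vector_elem
    by (simp only: class_op_class[OF bd tensor_vector_parts(2)[OF \<xi> \<eta>]] tensor_op_elem[OF order.refl indep_tail])
  also have "\<dots> = tensor_vector X n (\<lambda>k. R k (\<xi> k)) \<eta>"
    unfolding tensor_vector_elem
  proof (rule l2_class_cong_space)
    fix \<omega> assume \<omega>: "\<omega> \<in> space \<mu>"
    have "loc_op (d k) (B k) (\<tau> k) (l2_rep (\<xi> k)) (\<omega> k) = l2_rep (R k (\<xi> k)) (\<omega> k)" if "k < n" for k
      using \<omega> loc_op_square_integrable[OF B[OF that] l2_rep_L2(1)[OF \<xi>[OF that]]]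
      by (simp add: R[OF that \<xi>[OF that]] l2_rep_X space_\<mu> mem_Times_iff)
    then show "elem n (\<lambda>k. if k < n then loc_op (d k) (B k) (\<tau> k) (l2_rep (\<xi> k)) else l2_rep (\<xi> k)) ?h \<omega> =
        elem n (\<lambda>k. l2_rep (R k (\<xi> k))) ?h \<omega>"
      by (simp add: elem_def)
  qed
  finally show "class_op \<mu> (tensor_op n B \<tau>) (tensor_vector X n \<xi> \<eta>) = tensor_vector X n (\<lambda>k. R k (\<xi> k)) \<eta>" .
qed

definition atom :: "(nat \<Rightarrow> nat \<times> 'i) \<Rightarrow> nat \<Rightarrow> nat \<times> 'i \<Rightarrow> complex" where
  "atom p k q = (if q = p k then 1 else 0)"

lemma elem_atom: "elem n (atom p) h \<omega> = (if \<forall>k<n. \<omega> k = p k then h \<omega> else 0)"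
  by (auto simp: elem_def atom_def)

lemma atom_square_integrable:
  assumes "p k \<in> {..<d k} \<times> I k"
  shows "atom p k \<in> square_integrable (X k)"
    and "0 < (\<integral>\<^sup>+q. ennreal ((cmod (atom p k q))\<^sup>2) \<partial>X k)"
proof -
  interpret prob_space "X k" by (rule prob_space_X)
  have eq: "(\<integral>\<^sup>+q. ennreal ((cmod (atom p k q))\<^sup>2) \<partial>X k) = emeasure (X k) {p k}"
  proof -
    have "ennreal ((cmod (atom p k q))\<^sup>2) = indicator {p k} q" for q
      by (simp add: atom_def indicator_def)
    then show ?thesis using assms by simp
  qed
  then show "atom p k \<in> square_integrable (X k)"
    unfolding square_integrable_iff_nn_integral by (simp add: less_top[symmetric])
  have "emeasure (X k) {p k} = ennreal (f k (snd (p k)) / d k)"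
    using assms unfolding system_measure_def
    by (subst emeasure_point_measure_finite2) (auto simp: case_prod_unfold)
  then show "0 < (\<integral>\<^sup>+q. ennreal ((cmod (atom p k q))\<^sup>2) \<partial>X k)"
    unfolding eq using assms f_pos[of "snd (p k)" k] d_pos[of k] by (simp add: mem_Times_iff)
qed

text \<open>On the cylinder where the first \<open>n\<close> coordinates equal \<open>p\<close>, a
  function is the product of atoms with its section at \<open>p\<close>, hence an elementary
  tensor.\<close>

lemma section_tensor_vector:
  assumes p: "\<And>k. k < n \<Longrightarrow> p k \<in> {..<d k} \<times> I k" and x: "x \<in> square_integrable \<mu>"
  shows "\<exists>\<xi> \<eta>. (\<forall>k<n. \<xi> k \<in> L2 (X k)) \<and> \<eta> \<in> L2 (PiM {n..} X) \<and>
    l2_class \<mu> (elem n (atom p) x) = tensor_vector X n \<xi> \<eta>"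
    and "elem n (atom p) x \<in> square_integrable \<mu>"
proof -
  \<comment> \<open>Inserts the fixed point \<open>p\<close> into the first \<open>n\<close>
    coordinates; a tail thereby becomes a full sequence, and \<open>\<eta>\<close> is the section of
    \<open>x\<close>.\<close>
  define merge where "merge y k = (if k < n then p k else y k)" for y :: "nat \<Rightarrow> nat \<times> 'i" and k
  define \<eta> where "\<eta> y = x (merge y)" for y
  have m: "merge \<in> measurable (PiM {n..} X) \<mu>"
    unfolding \<mu>_eq
  proof (rule measurable_PiM_single')
    show "(\<lambda>y. merge y k) \<in> measurable (PiM {n..} X) (X k)" if "k \<in> UNIV" for k
    proof (cases "k < n")
      case True
      then show ?thesis unfolding merge_def using p[OF True] by (simp add: measurable_const)
    next
      case False
      then show ?thesis unfolding merge_def using measurable_component_singleton[of k "{n..}" X] by simp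
    qed
    show "merge \<in> space (PiM {n..} X) \<rightarrow> (\<Pi>\<^sub>E i\<in>UNIV. space (X i))"
      using p by (auto simp: merge_def space_PiM PiE_iff)
  qed
  have \<eta>m: "\<eta> \<in> borel_measurable (PiM {n..} X)"
    unfolding \<eta>_def using measurable_compose[OF m square_integrableD(1)[OF x]] .
  let ?h = "\<lambda>\<omega>. \<eta> (restrict \<omega> {n..})"
  have hm [measurable]: "?h \<in> borel_measurable \<mu>" using measurable_compose[OF measurable_tail \<eta>m] .
  have eq: "elem n (atom p) x \<omega> = elem n (atom p) ?h \<omega>" for \<omega>
  proof (cases "\<forall>k<n. \<omega> k = p k")
    case True
    then have "merge (restrict \<omega> {n..}) = \<omega>" by (auto simp: merge_def fun_eq_iff)
    then show ?thesis by (simp only: elem_atom \<eta>_def)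
  next
    case False
    then show ?thesis by (simp only: elem_atom if_False)
  qed
  \<comment> \<open>The integral over the cylinder is the mass of the atoms times the integral of
    the section. The mass is positive, so the section is square integrable for every
    \<open>p\<close> and not only for almost every one.\<close>
  have c: "(\<Prod>k<n. \<integral>\<^sup>+q. ennreal ((cmod (atom p k q))\<^sup>2) \<partial>X k) * (\<integral>\<^sup>+\<omega>. ennreal ((cmod (?h \<omega>))\<^sup>2) \<partial>\<mu>) < \<infinity>"
  proof -
    have "(\<Prod>k<n. \<integral>\<^sup>+q. ennreal ((cmod (atom p k q))\<^sup>2) \<partial>X k) * (\<integral>\<^sup>+\<omega>. ennreal ((cmod (?h \<omega>))\<^sup>2) \<partial>\<mu>) =
        (\<integral>\<^sup>+\<omega>. (\<Prod>k<n. ennreal ((cmod (atom p k (\<omega> k)))\<^sup>2)) * ennreal ((cmod (?h \<omega>))\<^sup>2) \<partial>\<mu>)"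
      using indepD[OF indep_tail[of n \<eta>]]
      by (intro nn_integral_elem[where \<phi> = "\<lambda>k q. ennreal ((cmod (atom p k q))\<^sup>2)", symmetric])
        (simp_all add: indep_def)
    also have "\<dots> = (\<integral>\<^sup>+\<omega>. ennreal ((cmod (elem n (atom p) x \<omega>))\<^sup>2) \<partial>\<mu>)"
      unfolding eq by (intro nn_integral_cong) (auto simp: elem_atom atom_def)
    also have "\<dots> \<le> (\<integral>\<^sup>+\<omega>. ennreal ((cmod (x \<omega>))\<^sup>2) \<partial>\<mu>)"
      by (intro nn_integral_mono) (simp add: elem_atom)
    finally show ?thesis using x unfolding square_integrable_iff_nn_integral by (auto intro: le_less_trans)
  qed
  have "(\<Prod>k<n. \<integral>\<^sup>+q. ennreal ((cmod (atom p k q))\<^sup>2) \<partial>X k) \<noteq> 0"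
    using atom_square_integrable(2)[where p = p, OF p] by (simp add: less_le)
  then have hS: "?h \<in> square_integrable \<mu>"
    using c hm unfolding square_integrable_iff_nn_integral by (auto simp: ennreal_mult_less_top)
  then have \<eta>S: "\<eta> \<in> square_integrable (PiM {n..} X)" using tail_square_integrable[OF \<eta>m] by simp
  define \<xi> where "\<xi> k = l2_class (X k) (atom p k)" for k
  have \<xi>: "\<xi> k \<in> L2 (X k)" if "k < n" for k
    unfolding \<xi>_def using atom_square_integrable(1)[where p = p, OF p[OF that]] by auto
  have "AE y in distr \<mu> (PiM {n..} X) (\<lambda>\<omega>. restrict \<omega> {n..}). l2_rep (l2_class (PiM {n..} X) \<eta>) y = \<eta> y"
    unfolding distr_tail by (rule l2_rep_class(2)[OF \<eta>S])
  then have "AE \<omega> in \<mu>. l2_rep (l2_class (PiM {n..} X) \<eta>) (restrict \<omega> {n..}) = ?h \<omega>"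
    by (rule AE_distrD[OF measurable_tail])
  then have "AE \<omega> in \<mu>. elem n (atom p) x \<omega> =
      elem n (\<lambda>k. l2_rep (\<xi> k)) (\<lambda>\<omega>. l2_rep (l2_class (PiM {n..} X) \<eta>) (restrict \<omega> {n..})) \<omega>"
    using AE_space
  proof eventually_elim
    case (elim \<omega>)
    have "l2_rep (\<xi> k) (\<omega> k) = atom p k (\<omega> k)" if "k < n" for k
      unfolding \<xi>_def using elim(2) by (intro l2_rep_X atom_square_integrable p that) (auto simp: space_\<mu> mem_Times_iff)
    then show ?case unfolding eq[of \<omega>] using elim(1) by (simp add: elem_def)
  qed
  then have cl: "l2_class \<mu> (elem n (atom p) x) = tensor_vector X n \<xi> (l2_class (PiM {n..} X) \<eta>)"
    unfolding tensor_vector_elem by (rule l2_class_eqI)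
  have "elem n (atom p) x = elem n (atom p) ?h" using eq by (rule ext)
  then show "elem n (atom p) x \<in> square_integrable \<mu>"
    by (simp only:) (rule elem_square_integrable(1)[OF hS indep_tail atom_square_integrable(1)[where p = p, OF p]])
  show "\<exists>\<xi> \<eta>. (\<forall>k<n. \<xi> k \<in> L2 (X k)) \<and> \<eta> \<in> L2 (PiM {n..} X) \<and>
      l2_class \<mu> (elem n (atom p) x) = tensor_vector X n \<xi> \<eta>"
    using \<xi> l2_class_in_L2[OF \<eta>S] cl by blast
qed

text \<open>The first \<open>n\<close> coordinates are atomic, so the functions supported on finitely many of their
  values are dense.\<close>

lemma is_tensor_op_unique:
  assumes T: "is_tensor_op X n R T" and T': "is_tensor_op X n R T'"
  shows "T = T'"
proof (rule bounded_ops_ext)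
  have T_ops: "T \<in> bounded_ops \<mu>" "T' \<in> bounded_ops \<mu>" using T T' by (auto simp: is_tensor_op_def \<mu>_eq)
  show "T \<in> bounded_ops \<mu>" "T' \<in> bounded_ops \<mu>" by fact+
  note TD = bounded_opsD[OF T_ops(1)] bounded_opsD[OF T_ops(2)]
  fix u assume "u \<in> L2 \<mu>"
  then obtain x where x: "x \<in> square_integrable \<mu>" "u = l2_class \<mu> x" by (rule L2_cases)
  note [measurable] = square_integrableD(1)[OF x(1)]
  \<comment> \<open>The first \<open>m\<close> points of an enumeration of \<open>X k\<close>:
    finite sets exhausting the space.\<close>
  define F where "F m k = {q \<in> {..<d k} \<times> I k. to_nat_on ({..<d k} \<times> I k) q < m}" for m k
  have ctb: "countable ({..<d k} \<times> I k)" for k using countable_I by auto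
  have F_fin: "finite (F m k)" for m k
  proof -
    have "inj_on (to_nat_on ({..<d k} \<times> I k)) (F m k)"
      by (rule inj_on_subset[OF inj_on_to_nat_on[OF ctb]]) (auto simp: F_def)
    moreover have "to_nat_on ({..<d k} \<times> I k) ` F m k \<subseteq> {..<m}" by (auto simp: F_def)
    ultimately show ?thesis using finite_subset finite_imageD by blast
  qed
  define P where "P m = (\<Pi>\<^sub>E k\<in>{..<n}. F m k)" for m
  have P_fin: "finite (P m)" for m unfolding P_def using F_fin by (intro finite_PiE) auto
  have Pp: "p k \<in> {..<d k} \<times> I k" if "p \<in> P m" "k < n" for p m k
    using that by (auto simp: P_def F_def PiE_iff)
  \<comment> \<open>The truncation of \<open>x\<close> to the set where the first \<open>n\<close>
    coordinates lie in these finite sets, written as a finite sum of elementary tensors, on which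
    both operators agree.\<close>
  define y where "y m = (\<lambda>\<omega>. \<Sum>p\<in>P m. elem n (atom p) x \<omega>)" for m
  have part: "elem n (atom p) x \<in> square_integrable \<mu> \<and>
      T (l2_class \<mu> (elem n (atom p) x)) = T' (l2_class \<mu> (elem n (atom p) x))" if pP: "p \<in> P m" for p m
  proof -
    note sec = section_tensor_vector[where p = p and n = n, OF Pp[OF pP] x(1)]
    obtain \<xi> \<eta> where *: "\<forall>k<n. \<xi> k \<in> L2 (X k)" "\<eta> \<in> L2 (PiM {n..} X)"
      "l2_class \<mu> (elem n (atom p) x) = tensor_vector X n \<xi> \<eta>" using sec(1) by blast
    have "T (tensor_vector X n \<xi> \<eta>) = T' (tensor_vector X n \<xi> \<eta>)"
      using T T' *(1,2) unfolding is_tensor_op_def by simp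
    then show ?thesis using *(3) sec(2) by simp
  qed
  have y: "y m \<in> square_integrable \<mu> \<and> T (l2_class \<mu> (y m)) = T' (l2_class \<mu> (y m))" for m
  proof -
    have "A \<subseteq> P m \<Longrightarrow> (\<lambda>\<omega>. \<Sum>p\<in>A. elem n (atom p) x \<omega>) \<in> square_integrable \<mu> \<and>
      T (l2_class \<mu> (\<lambda>\<omega>. \<Sum>p\<in>A. elem n (atom p) x \<omega>)) = T' (l2_class \<mu> (\<lambda>\<omega>. \<Sum>p\<in>A. elem n (atom p) x \<omega>))"
      if "finite A" for A
      using that
    proof (induction A)
      case empty
      then show ?case using bounded_ops_zero[OF T_ops(1)] bounded_ops_zero[OF T_ops(2)] by (simp add: l2_zero_def)
    next
      case (insert p A)
      then have p: "elem n (atom p) x \<in> square_integrable \<mu>"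
        "T (l2_class \<mu> (elem n (atom p) x)) = T' (l2_class \<mu> (elem n (atom p) x))" using part[of p m] by auto
      have "(\<lambda>\<omega>. \<Sum>p\<in>insert p A. elem n (atom p) x \<omega>) = (\<lambda>\<omega>. elem n (atom p) x \<omega> + (\<Sum>p\<in>A. elem n (atom p) x \<omega>))"
        using insert.hyps by simp
      then show ?case
        using insert p by (simp add: square_integrable_add l2_add_class[symmetric] TD l2_class_in_L2)
    qed
    then show ?thesis unfolding y_def using P_fin by blast
  qed
  have y_eq: "y m \<omega> = (if \<forall>k<n. \<omega> k \<in> F m k then x \<omega> else 0)" for m \<omega>
  proof (cases "\<forall>k<n. \<omega> k \<in> F m k")
    case True
    let ?p = "restrict \<omega> {..<n}"
    have p: "?p \<in> P m" using True by (auto simp: P_def)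
    have "elem n (atom p) x \<omega> = (if p = ?p then x \<omega> else 0)" if "p \<in> P m" for p
    proof -
      have "(\<forall>k<n. \<omega> k = p k) \<longleftrightarrow> p = ?p"
        using that by (auto simp: P_def PiE_iff fun_eq_iff extensional_def)
      then show ?thesis by (simp add: elem_atom)
    qed
    then have "y m \<omega> = (\<Sum>p\<in>P m. if p = ?p then x \<omega> else 0)" unfolding y_def by (intro sum.cong) auto
    then show ?thesis using True p P_fin by simp
  next
    case False
    have "elem n (atom p) x \<omega> = 0" if "p \<in> P m" for p
      using that False by (auto simp: elem_atom P_def PiE_iff)
    then have "y m \<omega> = 0" unfolding y_def by (intro sum.neutral) auto
    then show ?thesis by (simp only: if_not_P[OF False])
  qed
  have ym [measurable]: "y m \<in> borel_measurable \<mu>" for m using y[of m] square_integrableD(1) by blast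
  have "(\<lambda>m. LINT \<omega>|\<mu>. (cmod (y m \<omega> - x \<omega>))\<^sup>2) \<longlonglongrightarrow> (LINT \<omega>|\<mu>. 0)"
  proof (rule integral_dominated_convergence)
    show "integrable \<mu> (\<lambda>\<omega>. (cmod (x \<omega>))\<^sup>2)" by (rule square_integrableD(2)[OF x(1)])
    show "AE \<omega> in \<mu>. (\<lambda>m. (cmod (y m \<omega> - x \<omega>))\<^sup>2) \<longlonglongrightarrow> 0"
    proof (rule AE_I2)
      fix \<omega> assume \<omega>: "\<omega> \<in> space \<mu>"
      \<comment> \<open>From this index on the finite sets contain all of the first \<open>n\<close>
        coordinates of \<open>\<omega>\<close>, so the truncations are eventually equal to
        \<open>x\<close> at this point.\<close>
      define N where "N = Suc (\<Sum>k<n. to_nat_on ({..<d k} \<times> I k) (\<omega> k))"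
      have "y m \<omega> = x \<omega>" if "m \<ge> N" for m
      proof -
        have "\<omega> k \<in> F m k" if "k < n" for k
        proof -
          have "to_nat_on ({..<d k} \<times> I k) (\<omega> k) \<le> (\<Sum>k<n. to_nat_on ({..<d k} \<times> I k) (\<omega> k))"
            using that by (intro member_le_sum) auto
          then show ?thesis using \<omega> \<open>m \<ge> N\<close> by (auto simp: F_def N_def space_\<mu> mem_Times_iff)
        qed
        then show ?thesis by (simp add: y_eq)
      qed
      then show "(\<lambda>m. (cmod (y m \<omega> - x \<omega>))\<^sup>2) \<longlonglongrightarrow> 0"
        by (intro tendsto_eventually eventually_sequentiallyI[of N]) simp
    qed
    show "AE \<omega> in \<mu>. norm ((cmod (y m \<omega> - x \<omega>))\<^sup>2) \<le> (cmod (x \<omega>))\<^sup>2" for m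
      by (rule AE_I2) (simp add: y_eq)
  qed simp_all
  then have "(\<lambda>m. (l2_norm \<mu> (l2_minus \<mu> (l2_class \<mu> (y m)) u))\<^sup>2) \<longlonglongrightarrow> 0"
    using y x by (simp add: l2_minus_class l2_norm_class_power2 square_integrable_diff)
  then have "(\<lambda>m. sqrt ((l2_norm \<mu> (l2_minus \<mu> (l2_class \<mu> (y m)) u))\<^sup>2)) \<longlonglongrightarrow> sqrt 0"
    by (rule tendsto_real_sqrt)
  then have lim: "l2_lim \<mu> (\<lambda>m. l2_class \<mu> (y m)) u" by (simp add: l2_lim_def)
  have cont: "l2_lim \<mu> (\<lambda>m. S (l2_class \<mu> (y m))) (S u)" if S: "S \<in> bounded_ops \<mu>" for S
  proof (rule l2_lim_bound)
    show "l2_norm \<mu> (l2_minus \<mu> (S (l2_class \<mu> (y m))) (S u)) \<le>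
        op_norm \<mu> S * l2_norm \<mu> (l2_minus \<mu> (l2_class \<mu> (y m)) u)" for m
      using op_norm_bound[OF S, of "l2_minus \<mu> (l2_class \<mu> (y m)) u"] y x
      by (simp add: bounded_opsD(4)[OF S] l2_class_in_L2)
    show "(\<lambda>m. op_norm \<mu> S * l2_norm \<mu> (l2_minus \<mu> (l2_class \<mu> (y m)) u)) \<longlonglongrightarrow> 0"
      using lim unfolding l2_lim_def by (rule tendsto_mult_right_zero)
  qed
  show "T u = T' u"
    by (rule l2_lim_unique[OF cont[OF T_ops(1)]]) (use cont[OF T_ops(2)] y x TD in \<open>simp_all add: l2_class_in_L2\<close>)
qed

end

section \<open>Similarities\<close>

text \<open>The operator norm is at most the Hilbert-Schmidt norm. Any finite bound would do, as it
  serves only to make single operators bounded.\<close>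

lemma sq_norm_mat_app_le:
  "sq_norm d (mat_app d a g) \<le> (\<Sum>j<d. \<Sum>l<d. (cmod (a $$ (j, l)))\<^sup>2) * sq_norm d g"
proof -
  have "(cmod (mat_app d a g j))\<^sup>2 \<le> (\<Sum>l<d. (cmod (a $$ (j, l)))\<^sup>2) * sq_norm d g" for j
  proof -
    have "cmod (mat_app d a g j) \<le> (\<Sum>l<d. cmod (a $$ (j, l)) * cmod (g l))"
      unfolding mat_app_def by (rule order.trans[OF norm_sum]) (simp add: norm_mult)
    then have "(cmod (mat_app d a g j))\<^sup>2 \<le> (\<Sum>l<d. cmod (a $$ (j, l)) * cmod (g l))\<^sup>2"
      by (rule power_mono) simp
    also have "\<dots> \<le> (\<Sum>l<d. (cmod (a $$ (j, l)))\<^sup>2) * sq_norm d g"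
      unfolding sq_norm_def by (rule Cauchy_Schwarz_ineq_sum)
    finally show ?thesis .
  qed
  then show ?thesis unfolding sq_norm_def[of d "mat_app d a g"] sum_distrib_right
    by (intro sum_mono)
qed

text \<open>The unit sphere of C^d, embedded in the function space by zeros, is a closed subset of a
  product of unit discs and so compact by Tychonoff's theorem. The topology is of the same kind as
  the one used for matrices.\<close>

lemma compact_sphere_functions:
  "compact {w :: nat \<Rightarrow> complex. (\<forall>l\<ge>d. w l = 0) \<and> sq_norm d w = 1}"
proof -
  define B where "B = (\<Pi>\<^sub>E l\<in>(UNIV :: nat set). cball (0 :: complex) 1)"
  have "compactin (product_topology (\<lambda>_. euclidean) (UNIV :: nat set)) B"
    unfolding B_def by (subst compactin_PiE) (simp add: compactin_euclidean_iff)
  then have B: "compact B" by (simp add: euclidean_product_topology compactin_euclidean_iff)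
  have cl: "closed {w :: nat \<Rightarrow> complex. (\<forall>l\<ge>d. w l = 0) \<and> sq_norm d w = 1}"
    unfolding sq_norm_def
    by (intro closed_Collect_conj closed_Collect_all closed_Collect_imp closed_Collect_eq open_Collect_const
        continuous_intros continuous_on_product_coordinates continuous_on_coordinatewise_then_product)
  have sub: "{w :: nat \<Rightarrow> complex. (\<forall>l\<ge>d. w l = 0) \<and> sq_norm d w = 1} \<subseteq> B"
  proof
    fix w assume w: "w \<in> {w :: nat \<Rightarrow> complex. (\<forall>l\<ge>d. w l = 0) \<and> sq_norm d w = 1}"
    have "cmod (w l) \<le> 1" for l
    proof (cases "l < d")
      case True
      then have "(cmod (w l))\<^sup>2 \<le> sq_norm d w" unfolding sq_norm_def by (intro member_le_sum) auto
      then show ?thesis using w abs_square_le_1[of "cmod (w l)"] by simp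
    qed (use w in simp)
    then show "w \<in> B" by (auto simp: B_def)
  qed
  show ?thesis using compact_Int_closed[OF B cl] sub by (simp only: Int_absorb1)
qed

lemma sq_norm_scale: "sq_norm d (\<lambda>l. c * g l) = (cmod c)\<^sup>2 * sq_norm d g"
  unfolding sq_norm_def by (simp add: norm_mult power_mult_distrib sum_distrib_left)

lemma mat_app_scale: "mat_app d a (\<lambda>l. c * g l) = (\<lambda>j. c * mat_app d a g j)"
  unfolding mat_app_def by (simp add: sum_distrib_left mult.left_commute)

lemma sq_norm_cong: "(\<And>l. l < d \<Longrightarrow> g l = h l) \<Longrightarrow> sq_norm d g = sq_norm d h"
  unfolding sq_norm_def by (intro sum.cong) auto

lemma sq_norm_eq_zero: "sq_norm d g = 0 \<longleftrightarrow> (\<forall>l<d. g l = 0)"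
  unfolding sq_norm_def by (subst sum_nonneg_eq_0_iff) auto

text \<open>One unit vector \<open>h\<close> serves all matrices at once, so homogeneous estimates
  need only be checked on the sphere.\<close>

lemma sq_norm_normalize:
  assumes "sq_norm d g \<noteq> 0"
  obtains c h where "c > 0" "sq_norm d h = 1" "\<forall>l\<ge>d. h l = 0"
    "\<And>a. sq_norm d (mat_app d a g) = c * sq_norm d (mat_app d a h)" "sq_norm d g = c"
proof -
  define c where "c = sq_norm d g"
  have c: "c > 0" using assms sq_norm_nonneg[of d g] unfolding c_def by linarith
  define h where "h l = (if l < d then complex_of_real (1 / sqrt c) * g l else 0)" for l
  have "sq_norm d h = (1 / sqrt c)\<^sup>2 * c"
    unfolding c_def h_def using sq_norm_scale[of d "complex_of_real (1 / sqrt (sq_norm d g))" g]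
    by (subst sq_norm_cong[of d _ "\<lambda>l. complex_of_real (1 / sqrt (sq_norm d g)) * g l"]) (simp_all add: norm_divide)
  then have 1: "sq_norm d h = 1" using c by (simp add: power_divide)
  have "sq_norm d (mat_app d a g) = c * sq_norm d (mat_app d a h)" for a
  proof -
    have "mat_app d a h = (\<lambda>j. complex_of_real (1 / sqrt c) * mat_app d a g j)"
      unfolding mat_app_scale[symmetric] by (intro ext mat_app_cong) (simp add: h_def)
    then have "sq_norm d (mat_app d a h) = (1 / sqrt c)\<^sup>2 * sq_norm d (mat_app d a g)"
      using c by (simp only: sq_norm_scale norm_of_real power2_abs)
    then show ?thesis using c by (simp add: power_divide)
  qed
  then show ?thesis by (rule that[OF c 1, rotated]) (simp_all add: h_def c_def)
qed

section \<open>Bounds for the similarities\<close>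

locale similarity_tensor =
  fixes d :: "nat \<Rightarrow> nat" and I :: "nat \<Rightarrow> 'i set" and s :: "nat \<Rightarrow> 'i \<Rightarrow> complex mat"
    and f :: "nat \<Rightarrow> 'i \<Rightarrow> real"
  assumes d2: "\<And>n. d n \<ge> 2" and sys: "\<And>n. similarity_system (d n) (I n) (s n) (f n)"
begin

sublocale product_system d I f
proof
  fix n
  show "0 < d n" using d2[of n] by simp
  show "countable (I n)" "(f n has_sum 1) (I n)" using sys[of n] by (auto simp: similarity_system_def)
  show "\<And>i. i \<in> I n \<Longrightarrow> 0 < f n i" using sys[of n] by (auto simp: similarity_system_def)
qed

definition t :: "nat \<Rightarrow> 'i \<Rightarrow> complex mat" where "t k i = the (mat_inverse (s k i))"

lemma s_inv:
  assumes "i \<in> I k"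
  shows "s k i \<in> carrier_mat (d k) (d k)" "t k i \<in> carrier_mat (d k) (d k)"
    "s k i * t k i = 1\<^sub>m (d k)" "t k i * s k i = 1\<^sub>m (d k)"
proof -
  have s: "s k i \<in> carrier_mat (d k) (d k)" "invertible_mat (s k i)"
    using sys[of k] assms by (auto simp: similarity_system_def inv_matrices_def)
  then obtain B where B: "inverts_mat (s k i) B" "inverts_mat B (s k i)" by (auto simp: invertible_mat_def)
  then have "s k i * B = 1\<^sub>m (d k)" "B * s k i = 1\<^sub>m (dim_row B)" using s(1) by (auto simp: inverts_mat_def)
  moreover from this have "B \<in> carrier_mat (d k) (d k)"
    using s(1) by (metis carrier_matD(1,2) carrier_matI index_mult_mat(2,3) index_one_mat(2,3))
  \<comment> \<open>Being a unit of the matrix ring is what excludes the value \<open>None\<close>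
    of \<open>mat_inverse\<close>.\<close>
  ultimately have "s k i \<in> Units (ring_mat TYPE(complex) (d k) ())"
    using s(1) unfolding Units_def ring_mat_def by auto
  then obtain C where C: "mat_inverse (s k i) = Some C"
    using mat_inverse(1)[OF s(1), of "()"] by (cases "mat_inverse (s k i)") auto
  show "s k i \<in> carrier_mat (d k) (d k)" by fact
  show "t k i \<in> carrier_mat (d k) (d k)" "s k i * t k i = 1\<^sub>m (d k)" "t k i * s k i = 1\<^sub>m (d k)"
    using mat_inverse(2)[OF s(1) C] C by (auto simp: t_def)
qed

lemma s_t_app:
  assumes "i \<in> I k" "j < d k"
  shows "mat_app (d k) (s k i) (mat_app (d k) (t k i) g) j = g j"
    "mat_app (d k) (t k i) (mat_app (d k) (s k i) g) j = g j"
  using mat_app_mult[OF s_inv(1,2)[OF assms(1)] assms(2), of g] mat_app_mult[OF s_inv(2,1)[OF assms(1)] assms(2), of g] assms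
  by (simp_all add: s_inv mat_app_one)

text \<open>The squared norm of a w is continuous and positive on the product of the compact closure
  with the unit sphere. Its maximum bounds the s(i), its minimum the inverses; that the closure
  consists of invertible matrices is what makes the minimum positive.\<close>

lemma s_bounds:
  "\<exists>b c. b > 0 \<and> c > 0 \<and>
    (\<forall>i\<in>I k. \<forall>g. sq_norm (d k) (mat_app (d k) (s k i) g) \<le> b * sq_norm (d k) g) \<and>
    (\<forall>i\<in>I k. \<forall>g. sq_norm (d k) (mat_app (d k) (t k i) g) \<le> c * sq_norm (d k) g)"
proof -
  define Q where "Q = closure (mat_entries (d k) ` s k ` I k)"
  define S where "S = {w :: nat \<Rightarrow> complex. (\<forall>l\<ge>d k. w l = 0) \<and> sq_norm (d k) w = 1}"
  \<comment> \<open>The squared norm of the image, written in entries so that it is a continuous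
    function of both embedded arguments.\<close>
  define G where "G p = (\<Sum>j<d k. (cmod (\<Sum>l<d k. fst p (j, l) * snd p l))\<^sup>2)"
    for p :: "(nat \<times> nat \<Rightarrow> complex) \<times> (nat \<Rightarrow> complex)"
  have G_app: "G (mat_entries (d k) a, w) = sq_norm (d k) (mat_app (d k) a w)" for a w
    unfolding G_def sq_norm_def mat_app_def by (intro sum.cong refl) (simp add: mat_entries_def)
  have Q: "compact Q" "Q \<subseteq> mat_entries (d k) ` inv_matrices (d k)"
    using sys[of k] by (auto simp: similarity_system_def Q_def)
  have QI: "mat_entries (d k) (s k i) \<in> Q" if "i \<in> I k" for i
    unfolding Q_def using that by (intro subsetD[OF closure_subset]) auto
  have "1\<^sub>m (d k) \<in> s k ` I k" using sys[of k] by (simp add: similarity_system_def)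
  then have "Q \<noteq> {}" using QI by auto
  moreover have "(\<lambda>l. if l = 0 then 1 else 0) \<in> S"
    using d_pos[of k] by (simp add: S_def sq_norm_def if_distrib[of cmod] if_distrib[of "\<lambda>x. x\<^sup>2"] cong: if_cong)
  ultimately have ne: "Q \<times> S \<noteq> {}" by auto
  have comp: "compact (Q \<times> S)" unfolding S_def by (intro compact_Times Q compact_sphere_functions)
  have c1: "continuous_on (Q \<times> S) (\<lambda>p. fst p q)" for q
    by (intro continuous_on_compose2[OF continuous_on_product_coordinates continuous_on_fst[OF continuous_on_id]]) auto
  have c2: "continuous_on (Q \<times> S) (\<lambda>p. snd p q)" for q
    by (intro continuous_on_compose2[OF continuous_on_product_coordinates continuous_on_snd[OF continuous_on_id]]) auto
  have cont: "continuous_on (Q \<times> S) G"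
    unfolding G_def by (intro continuous_intros c1 c2)
  obtain p0 where p0: "p0 \<in> Q \<times> S" "\<And>p. p \<in> Q \<times> S \<Longrightarrow> G p0 \<le> G p"
    using continuous_attains_inf[OF comp ne cont] by blast
  obtain p1 where p1: "p1 \<in> Q \<times> S" "\<And>p. p \<in> Q \<times> S \<Longrightarrow> G p \<le> G p1"
    using continuous_attains_sup[OF comp ne cont] by blast
  have "G p0 > 0"
  proof -
    obtain a where a: "a \<in> inv_matrices (d k)" "fst p0 = mat_entries (d k) a"
      using p0(1) Q(2) by (auto simp: mem_Times_iff)
    then have ac: "a \<in> carrier_mat (d k) (d k)" and "invertible_mat a" by (auto simp: inv_matrices_def)
    then obtain B where "inverts_mat a B" "inverts_mat B a" by (auto simp: invertible_mat_def)
    then have "a * B = 1\<^sub>m (d k)" "B * a = 1\<^sub>m (dim_row B)" using ac by (auto simp: inverts_mat_def)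
    then have B: "B \<in> carrier_mat (d k) (d k)" "B * a = 1\<^sub>m (d k)"
      using ac by (metis carrier_matD(1,2) carrier_matI index_mult_mat(2,3) index_one_mat(2,3))+
    define w where "w = snd p0"
    have wS: "w \<in> S" using p0(1) by (auto simp: w_def mem_Times_iff)
    have "G p0 \<noteq> 0"
    proof
      assume "G p0 = 0"
      then have "sq_norm (d k) (mat_app (d k) a w) = 0"
        using G_app[of a w] a(2) by (simp add: w_def) (metis prod.collapse)
      then have z: "mat_app (d k) a w j = 0" if "j < d k" for j using that by (simp add: sq_norm_eq_zero)
      have "w j = 0" if j: "j < d k" for j
      proof -
        have "w j = mat_app (d k) (B * a) w j" using j by (simp add: B(2) mat_app_one)
        also have "\<dots> = mat_app (d k) B (mat_app (d k) a w) j" by (rule mat_app_mult[OF B(1) ac j])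
        also have "\<dots> = mat_app (d k) B (\<lambda>_. 0) j" using z by (intro mat_app_cong) simp
        finally show ?thesis by (simp add: mat_app_def)
      qed
      then have "sq_norm (d k) w = 0" by (simp add: sq_norm_eq_zero)
      then show False using wS by (simp add: S_def)
    qed
    moreover have "G p0 \<ge> 0" unfolding G_def by (intro sum_nonneg) simp
    ultimately show ?thesis by simp
  qed
  have lower: "G p0 * sq_norm (d k) g \<le> sq_norm (d k) (mat_app (d k) (s k i) g)"
    and upper: "sq_norm (d k) (mat_app (d k) (s k i) g) \<le> G p1 * sq_norm (d k) g" if i: "i \<in> I k" for i g
  proof -
    have "G p0 * sq_norm (d k) g \<le> sq_norm (d k) (mat_app (d k) (s k i) g) \<and>
      sq_norm (d k) (mat_app (d k) (s k i) g) \<le> G p1 * sq_norm (d k) g"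
    proof (cases "sq_norm (d k) g = 0")
      case True
      then have "mat_app (d k) (s k i) g = mat_app (d k) (s k i) (\<lambda>_. 0)"
        by (intro ext mat_app_cong) (simp add: sq_norm_eq_zero)
      then show ?thesis using True by (simp add: mat_app_def sq_norm_def)
    next
      case False
      obtain c h where h: "c > 0" "sq_norm (d k) h = 1" "\<forall>l\<ge>d k. h l = 0"
        "\<And>a. sq_norm (d k) (mat_app (d k) a g) = c * sq_norm (d k) (mat_app (d k) a h)" "sq_norm (d k) g = c"
        by (rule sq_norm_normalize[OF False]) blast
      have "(mat_entries (d k) (s k i), h) \<in> Q \<times> S" using QI[OF i] h by (simp add: S_def)
      from p0(2)[OF this] p1(2)[OF this] show ?thesis
        using h unfolding G_app by (simp add: mult.commute[of _ c])
    qed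
    then show "G p0 * sq_norm (d k) g \<le> sq_norm (d k) (mat_app (d k) (s k i) g)"
      "sq_norm (d k) (mat_app (d k) (s k i) g) \<le> G p1 * sq_norm (d k) g" by auto
  qed
  have "G p1 > 0" using \<open>G p0 > 0\<close> p1(2)[OF p0(1)] by linarith
  moreover have "sq_norm (d k) (mat_app (d k) (t k i) g) \<le> 1 / G p0 * sq_norm (d k) g" if i: "i \<in> I k" for i g
  proof -
    have "G p0 * sq_norm (d k) (mat_app (d k) (t k i) g) \<le> sq_norm (d k) (mat_app (d k) (s k i) (mat_app (d k) (t k i) g))"
      by (rule lower[OF i])
    also have "\<dots> = sq_norm (d k) g" by (rule sq_norm_cong) (simp add: s_t_app[OF i])
    finally show ?thesis using \<open>G p0 > 0\<close> by (simp add: field_simps)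
  qed
  ultimately show ?thesis using \<open>G p0 > 0\<close> upper
    by (intro exI[of _ "G p1"] exI[of _ "1 / G p0"]) simp
qed

section \<open>The generators of the algebra\<close>

definition conj_mat :: "nat \<Rightarrow> complex mat \<Rightarrow> 'i \<Rightarrow> complex mat" where
  "conj_mat k a i = s k i * a * t k i"

lemma conj_mat_carrier [simp]:
  "i \<in> I k \<Longrightarrow> a \<in> carrier_mat (d k) (d k) \<Longrightarrow> conj_mat k a i \<in> carrier_mat (d k) (d k)"
  using s_inv(1,2) unfolding conj_mat_def by (intro mult_carrier_mat) auto

lemma mat_app_conj_mat:
  assumes "i \<in> I k" "a \<in> carrier_mat (d k) (d k)" "j < d k"
  shows "mat_app (d k) (conj_mat k a i) g j =
    mat_app (d k) (s k i) (mat_app (d k) a (mat_app (d k) (t k i) g)) j"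
proof -
  have sa: "s k i * a \<in> carrier_mat (d k) (d k)" using s_inv(1)[OF assms(1)] assms(2) by simp
  show ?thesis unfolding conj_mat_def
    by (simp add: mat_app_mult[OF sa s_inv(2)[OF assms(1)] assms(3)]
        mat_app_mult[OF s_inv(1)[OF assms(1)] assms(2,3)])
qed

text \<open>The bound depends on \<open>k\<close> and \<open>a\<close> but not on the fibre, thanks
  to the uniform bounds for the similarities and their inverses.\<close>

lemma conj_mat_bounded:
  assumes "a \<in> carrier_mat (d k) (d k)"
  shows "\<exists>K. fibre_bounded k (conj_mat k a) (\<lambda>i. i) K"
proof -
  obtain b c where bc: "b > 0" "c > 0"
    "\<And>i g. i \<in> I k \<Longrightarrow> sq_norm (d k) (mat_app (d k) (s k i) g) \<le> b * sq_norm (d k) g"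
    "\<And>i g. i \<in> I k \<Longrightarrow> sq_norm (d k) (mat_app (d k) (t k i) g) \<le> c * sq_norm (d k) g"
    using s_bounds[of k] by blast
  define A where "A = (\<Sum>j<d k. \<Sum>l<d k. (cmod (a $$ (j, l)))\<^sup>2)"
  have A: "A \<ge> 0" unfolding A_def by (intro sum_nonneg) simp
  have "sq_norm (d k) (mat_app (d k) (conj_mat k a i) g) \<le> b * (A * (c * sq_norm (d k) g))" if i: "i \<in> I k" for i g
  proof -
    have "sq_norm (d k) (mat_app (d k) (conj_mat k a i) g) =
        sq_norm (d k) (mat_app (d k) (s k i) (mat_app (d k) a (mat_app (d k) (t k i) g)))"
      by (rule sq_norm_cong) (simp add: mat_app_conj_mat[OF i assms])
    also have "\<dots> \<le> b * sq_norm (d k) (mat_app (d k) a (mat_app (d k) (t k i) g))" by (rule bc(3)[OF i])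
    also have "\<dots> \<le> b * (A * sq_norm (d k) (mat_app (d k) (t k i) g))"
      using bc(1) unfolding A_def by (intro mult_left_mono sq_norm_mat_app_le) simp
    also have "\<dots> \<le> b * (A * (c * sq_norm (d k) g))"
      using bc A by (intro mult_left_mono bc(4)[OF i]) auto
    finally show ?thesis .
  qed
  then have "fibre_bounded k (conj_mat k a) (\<lambda>i. i) (b * A * c)"
    using bc A f_pos[of _ k] unfolding fibre_bounded_def
    by (auto simp: bij_betw_def mult_ac intro!: mult_left_mono order.trans[OF mult_left_mono[of _ _ "f k _"]])
  then show ?thesis by blast
qed

definition gen :: "nat \<Rightarrow> (nat \<Rightarrow> complex mat) \<Rightarrow> (nat \<Rightarrow> nat \<times> 'i) l2 \<Rightarrow> (nat \<Rightarrow> nat \<times> 'i) l2" where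
  "gen n a = class_op \<mu> (tensor_op n (\<lambda>k. conj_mat k (a k)) (\<lambda>_ i. i))"

lemma psi_loc_op:
  assumes "\<xi> \<in> L2 (X k)" "a \<in> carrier_mat (d k) (d k)"
  shows "psi (d k) (I k) (s k) (f k) a \<xi> = l2_class (X k) (loc_op (d k) (conj_mat k a) (\<lambda>i. i) (l2_rep \<xi>))"
proof -
  have "l2_class (X k) (\<lambda>(j, i). ((s k i * a * the (mat_inverse (s k i))) *\<^sub>v vec (d k) (\<lambda>l. l2_rep \<xi> (l, i))) $ j) =
      l2_class (X k) (loc_op (d k) (conj_mat k a) (\<lambda>i. i) (l2_rep \<xi>))"
  proof (rule l2_class_cong_space)
    fix q assume "q \<in> space (X k)"
    then obtain j i where q: "q = (j, i)" "j < d k" "i \<in> I k" by auto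
    have "conj_mat k a i \<in> carrier_mat (d k) (d k)" using q assms(2) by simp
    then have "(conj_mat k a i *\<^sub>v vec (d k) (\<lambda>l. l2_rep \<xi> (l, i))) $ j =
        (\<Sum>l<d k. conj_mat k a i $$ (j, l) * l2_rep \<xi> (l, i))"
      using q(2) by (simp add: scalar_prod_def lessThan_atLeast0)
    then show "(case q of (j, i) \<Rightarrow> ((s k i * a * the (mat_inverse (s k i))) *\<^sub>v vec (d k) (\<lambda>l. l2_rep \<xi> (l, i))) $ j) =
        loc_op (d k) (conj_mat k a) (\<lambda>i. i) (l2_rep \<xi>) q"
      by (simp add: q loc_op_def mat_app_def conj_mat_def t_def)
  qed
  then show ?thesis using assms(1) by (simp add: psi_def)
qed

lemma gen_bound_ex:
  assumes "\<And>k. k < n \<Longrightarrow> a k \<in> carrier_mat (d k) (d k)"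
  shows "\<exists>K. \<forall>k<n. fibre_bounded k (conj_mat k (a k)) (\<lambda>i. i) (K k)"
  using conj_mat_bounded[OF assms] by metis

lemma gen_is_tensor_op:
  assumes "\<And>k. k < n \<Longrightarrow> a k \<in> carrier_mat (d k) (d k)"
  shows "is_tensor_op X n (\<lambda>k. psi (d k) (I k) (s k) (f k) (a k)) (gen n a)"
proof -
  obtain K where "\<And>k. k < n \<Longrightarrow> fibre_bounded k (conj_mat k (a k)) (\<lambda>i. i) (K k)"
    using gen_bound_ex[where a = a, OF assms] by blast
  then show ?thesis unfolding gen_def
    by (intro is_tensor_op_class_op) (auto simp: psi_loc_op assms)
qed

text \<open>Existence and uniqueness of tensor operators replace the implicit description; from here
  on the algebra is the one generated by the operators \<open>gen n a\<close>.\<close>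

lemma generators_eq:
  "{T. \<exists>n a. (\<forall>k<n. a k \<in> carrier_mat (d k) (d k)) \<and>
        is_tensor_op X n (\<lambda>k. psi (d k) (I k) (s k) (f k) (a k)) T} =
    {gen n a | n a. \<forall>k<n. a k \<in> carrier_mat (d k) (d k)}"
  using gen_is_tensor_op is_tensor_op_unique by blast

definition Gens :: "((nat \<Rightarrow> nat \<times> 'i) l2 \<Rightarrow> (nat \<Rightarrow> nat \<times> 'i) l2) set" where
  "Gens = {gen n a | n a. \<forall>k<n. a k \<in> carrier_mat (d k) (d k)}"

abbreviation A :: "((nat \<Rightarrow> nat \<times> 'i) l2 \<Rightarrow> (nat \<Rightarrow> nat \<times> 'i) l2) set" where
  "A \<equiv> D2 d I s f"

lemma A_eq: "A = closed_subalgebra_generated (op_algebra \<mu>) Gens"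
  unfolding D2_def generators_eq Gens_def ..

lemma gen_bounded_ops:
  assumes "\<And>k. k < n \<Longrightarrow> a k \<in> carrier_mat (d k) (d k)"
  shows "gen n a \<in> bounded_ops \<mu>"
  using gen_is_tensor_op[OF assms] by (simp add: is_tensor_op_def \<mu>_eq)

lemma Gens_bounded: "Gens \<subseteq> bounded_ops \<mu>"
  unfolding Gens_def using gen_bounded_ops by blast

lemma A_closed: "closed_subalgebra (op_algebra \<mu>) A"
  unfolding A_eq by (rule closed_subalgebra_generated(1)[OF Gens_bounded])

lemma gen_in_A:
  assumes "\<And>k. k < n \<Longrightarrow> a k \<in> carrier_mat (d k) (d k)"
  shows "gen n a \<in> A"
  using closed_subalgebra_generated(2)[OF Gens_bounded] assms unfolding A_eq Gens_def by blast

lemma gen_class: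
  assumes "\<And>k. k < n \<Longrightarrow> a k \<in> carrier_mat (d k) (d k)" "x \<in> square_integrable \<mu>"
  shows "gen n a (l2_class \<mu> x) = l2_class \<mu> (tensor_op n (\<lambda>k. conj_mat k (a k)) (\<lambda>_ i. i) x)"
proof -
  obtain K where "\<And>k. k < n \<Longrightarrow> fibre_bounded k (conj_mat k (a k)) (\<lambda>i. i) (K k)"
    using gen_bound_ex[where a = a, OF assms(1)] by blast
  then show ?thesis unfolding gen_def by (intro class_op_class[OF tensor_op_bounded] assms(2))
qed

lemma gen_square_integrable:
  assumes "\<And>k. k < n \<Longrightarrow> a k \<in> carrier_mat (d k) (d k)" "x \<in> square_integrable \<mu>"
  shows "tensor_op n (\<lambda>k. conj_mat k (a k)) (\<lambda>_ i. i) x \<in> square_integrable \<mu>"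
proof -
  obtain K where "\<And>k. k < n \<Longrightarrow> fibre_bounded k (conj_mat k (a k)) (\<lambda>i. i) (K k)"
    using gen_bound_ex[where a = a, OF assms(1)] by blast
  from tensor_op_bounded[where K = K, OF this] show ?thesis using assms(2) by (simp add: finitely_bounded_def)
qed

lemma conj_mat_mult:
  assumes "i \<in> I k" "a \<in> carrier_mat (d k) (d k)" "b \<in> carrier_mat (d k) (d k)"
  shows "conj_mat k a i * conj_mat k b i = conj_mat k (a * b) i"
proof -
  note S = s_inv[OF assms(1)]
  have "conj_mat k a i * conj_mat k b i = s k i * a * (t k i * (s k i * (b * t k i)))"
    unfolding conj_mat_def using S assms
    by (simp add: assoc_mult_mat[of _ "d k" "d k" _ "d k" _ "d k"])
  also have "t k i * (s k i * (b * t k i)) = (t k i * s k i) * (b * t k i)"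
    using assoc_mult_mat[OF S(2,1), of "b * t k i" "d k"] S(2) assms(3) by simp
  also have "\<dots> = b * t k i" using S(2,4) assms(3) by simp
  also have "s k i * a * (b * t k i) = conj_mat k (a * b) i"
    unfolding conj_mat_def using S assms by (simp add: assoc_mult_mat[of _ "d k" "d k" _ "d k" _ "d k"])
  finally show ?thesis .
qed

lemma conj_mat_one: "i \<in> I k \<Longrightarrow> conj_mat k (1\<^sub>m (d k)) i = 1\<^sub>m (d k)"
  unfolding conj_mat_def using s_inv[of i k] by simp

lemma gen_mult:
  assumes a: "\<And>k. k < n \<Longrightarrow> a k \<in> carrier_mat (d k) (d k)" and b: "\<And>k. k < n \<Longrightarrow> b k \<in> carrier_mat (d k) (d k)"
  shows "compose (L2 \<mu>) (gen n a) (gen n b) = gen n (\<lambda>k. a k * b k)"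
proof (rule bounded_ops_ext)
  show "compose (L2 \<mu>) (gen n a) (gen n b) \<in> bounded_ops \<mu>"
    by (intro bounded_ops_compose gen_bounded_ops a b)
  have ab: "a k * b k \<in> carrier_mat (d k) (d k)" if "k < n" for k using a[OF that] b[OF that] by simp
  show "gen n (\<lambda>k. a k * b k) \<in> bounded_ops \<mu>" by (rule gen_bounded_ops[OF ab])
  fix u assume "u \<in> L2 \<mu>"
  then obtain x where x: "x \<in> square_integrable \<mu>" "u = l2_class \<mu> x" by (rule L2_cases)
  have "compose (L2 \<mu>) (gen n a) (gen n b) u =
      l2_class \<mu> (tensor_op n (\<lambda>k. conj_mat k (a k)) (\<lambda>_ i. i) (tensor_op n (\<lambda>k. conj_mat k (b k)) (\<lambda>_ i. i) x))"
    using x by (simp add: compose_def l2_class_in_L2 gen_class[OF b] gen_class[OF a gen_square_integrable[OF b]])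
  also have "\<dots> = l2_class \<mu> (tensor_op n (\<lambda>k. conj_mat k (a k * b k)) (\<lambda>_ i. i) x)"
  proof (rule l2_class_cong_space)
    fix \<omega> assume \<omega>: "\<omega> \<in> space \<mu>"
    have "tensor_op n (\<lambda>k. conj_mat k (a k)) (\<lambda>_ i. i) (tensor_op n (\<lambda>k. conj_mat k (b k)) (\<lambda>_ i. i) x) \<omega> =
        tensor_op n (\<lambda>k i. conj_mat k (a k) i * conj_mat k (b k) i) (\<lambda>_ i. i) x \<omega>"
      using a b \<omega> by (intro tensor_op_mult) auto
    also have "\<dots> = tensor_op n (\<lambda>k. conj_mat k (a k * b k)) (\<lambda>_ i. i) x \<omega>"
      using a b \<omega> by (intro tensor_op_cong) (auto simp: conj_mat_mult)
    finally show "tensor_op n (\<lambda>k. conj_mat k (a k)) (\<lambda>_ i. i) (tensor_op n (\<lambda>k. conj_mat k (b k)) (\<lambda>_ i. i) x) \<omega> =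
        tensor_op n (\<lambda>k. conj_mat k (a k * b k)) (\<lambda>_ i. i) x \<omega>" .
  qed
  also have "\<dots> = gen n (\<lambda>k. a k * b k) u" unfolding x(2) using gen_class[OF ab x(1)] by simp
  finally show "compose (L2 \<mu>) (gen n a) (gen n b) u = gen n (\<lambda>k. a k * b k) u" .
qed

text \<open>Identity matrices in further coordinates change nothing, because conjugation fixes the
  identity; any two generators can thus be brought to the same length.\<close>

lemma gen_pad:
  assumes a: "\<And>k. k < n \<Longrightarrow> a k \<in> carrier_mat (d k) (d k)" and "n \<le> m"
  shows "gen n a = gen m (\<lambda>k. if k < n then a k else 1\<^sub>m (d k))" (is "_ = gen m ?a")
proof (rule bounded_ops_ext)
  have a': "?a k \<in> carrier_mat (d k) (d k)" for k using a by simp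
  show "gen n a \<in> bounded_ops \<mu>" by (rule gen_bounded_ops[OF a])
  show "gen m ?a \<in> bounded_ops \<mu>" by (rule gen_bounded_ops[OF a'])
  fix u assume "u \<in> L2 \<mu>"
  then obtain x where x: "x \<in> square_integrable \<mu>" "u = l2_class \<mu> x" by (rule L2_cases)
  have "l2_class \<mu> (tensor_op n (\<lambda>k. conj_mat k (a k)) (\<lambda>_ i. i) x) = l2_class \<mu> (tensor_op m (\<lambda>k. conj_mat k (?a k)) (\<lambda>_ i. i) x)"
  proof (rule l2_class_cong_space)
    fix \<omega> assume \<omega>: "\<omega> \<in> space \<mu>"
    have "tensor_op m (\<lambda>k. conj_mat k (?a k)) (\<lambda>_ i. i) x \<omega> = tensor_op n (\<lambda>k. conj_mat k (?a k)) (\<lambda>_ i. i) x \<omega>"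
      using assms(2) \<omega> by (intro tensor_op_pad) (auto simp: conj_mat_one)
    also have "\<dots> = tensor_op n (\<lambda>k. conj_mat k (a k)) (\<lambda>_ i. i) x \<omega>"
      using \<omega> by (intro tensor_op_cong) auto
    finally show "tensor_op n (\<lambda>k. conj_mat k (a k)) (\<lambda>_ i. i) x \<omega> = tensor_op m (\<lambda>k. conj_mat k (?a k)) (\<lambda>_ i. i) x \<omega>" by simp
  qed
  then show "gen n a u = gen m ?a u"
    unfolding x(2) using gen_class[OF a x(1)] gen_class[OF a' x(1)] by simp
qed

lemma gen_one: "gen 0 a = (\<lambda>u\<in>L2 \<mu>. u)"
proof (rule bounded_ops_ext)
  show "gen 0 a \<in> bounded_ops \<mu>" by (rule gen_bounded_ops) simp
  show "(\<lambda>u\<in>L2 \<mu>. u) \<in> bounded_ops \<mu>" by (rule bounded_ops_one)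
  fix u assume "u \<in> L2 \<mu>"
  then obtain x where x: "x \<in> square_integrable \<mu>" "u = l2_class \<mu> x" by (rule L2_cases)
  then show "gen 0 a u = (\<lambda>u\<in>L2 \<mu>. u) u" using gen_class[of 0 a x] by (simp add: l2_class_in_L2)
qed

lemma one_in_A: "(\<lambda>u\<in>L2 \<mu>. u) \<in> A"
  using gen_in_A[of 0 "\<lambda>_. 1\<^sub>m 0"] gen_one by simp

lemma Gens_mult:
  assumes "S \<in> Gens" "T \<in> Gens"
  shows "compose (L2 \<mu>) S T \<in> Gens"
proof -
  obtain n a m b where S: "S = gen n a" "\<And>k. k < n \<Longrightarrow> a k \<in> carrier_mat (d k) (d k)"
    and T: "T = gen m b" "\<And>k. k < m \<Longrightarrow> b k \<in> carrier_mat (d k) (d k)"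
    using assms unfolding Gens_def by blast
  let ?N = "max n m" and ?a = "\<lambda>k. if k < n then a k else 1\<^sub>m (d k)" and ?b = "\<lambda>k. if k < m then b k else 1\<^sub>m (d k)"
  have "S = gen ?N ?a" unfolding S(1) by (rule gen_pad[OF S(2)]) simp_all
  moreover have "T = gen ?N ?b" unfolding T(1) by (rule gen_pad[OF T(2)]) simp_all
  moreover have "compose (L2 \<mu>) (gen ?N ?a) (gen ?N ?b) = gen ?N (\<lambda>k. ?a k * ?b k)"
    by (rule gen_mult) (simp_all add: S(2) T(2))
  ultimately have "compose (L2 \<mu>) S T = gen ?N (\<lambda>k. ?a k * ?b k)" by simp
  moreover have "\<forall>k<?N. ?a k * ?b k \<in> carrier_mat (d k) (d k)"
    using S(2) T(2) by (intro allI impI mult_carrier_mat[of _ _ "d _"]) auto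
  ultimately show ?thesis unfolding Gens_def by blast
qed

end

section \<open>Approximate diagonals\<close>

lemma op_lim_compose:
  assumes "\<And>n. t n \<in> bounded_ops M" "T \<in> bounded_ops M" "S \<in> bounded_ops M"
    and "(\<lambda>n. op_norm M (op_minus M (t n) T)) \<longlonglongrightarrow> 0"
  shows "(\<lambda>n. op_norm M (op_minus M (compose (L2 M) S (t n)) (compose (L2 M) S T))) \<longlonglongrightarrow> 0"
    and "(\<lambda>n. op_norm M (op_minus M (compose (L2 M) (t n) S) (compose (L2 M) T S))) \<longlonglongrightarrow> 0"
proof -
  note SD = bounded_opsD[OF assms(3)] and tD = bounded_opsD[OF assms(1)] and TD = bounded_opsD[OF assms(2)]
  note tT = bounded_ops_minus[OF assms(1,2)]
  have e1: "op_minus M (compose (L2 M) S (t n)) (compose (L2 M) S T) = compose (L2 M) S (op_minus M (t n) T)" for n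
    using tD TD by (simp add: op_minus_def compose_def fun_eq_iff SD(4))
  have e2: "op_minus M (compose (L2 M) (t n) S) (compose (L2 M) T S) = compose (L2 M) (op_minus M (t n) T) S" for n
    using SD by (simp add: op_minus_def compose_def fun_eq_iff)
  have l1: "(\<lambda>n. op_norm M S * op_norm M (op_minus M (t n) T)) \<longlonglongrightarrow> 0"
    by (rule tendsto_mult_right_zero[OF assms(4)])
  have l2: "(\<lambda>n. op_norm M (op_minus M (t n) T) * op_norm M S) \<longlonglongrightarrow> 0"
    by (rule tendsto_mult_left_zero[OF assms(4)])
  have a1: "\<bar>op_norm M (compose (L2 M) S (op_minus M (t n) T))\<bar> = op_norm M (compose (L2 M) S (op_minus M (t n) T))" for n
    by (intro abs_of_nonneg op_norm_nonneg bounded_ops_compose assms(3) tT)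
  have a2: "\<bar>op_norm M (compose (L2 M) (op_minus M (t n) T) S)\<bar> = op_norm M (compose (L2 M) (op_minus M (t n) T) S)" for n
    by (intro abs_of_nonneg op_norm_nonneg bounded_ops_compose assms(3) tT)
  show "(\<lambda>n. op_norm M (op_minus M (compose (L2 M) S (t n)) (compose (L2 M) S T))) \<longlonglongrightarrow> 0"
    unfolding e1 by (rule Lim_null_comparison[OF _ l1])
      (simp only: real_norm_def a1 op_norm_compose[OF assms(3) tT] eventually_True)
  show "(\<lambda>n. op_norm M (op_minus M (compose (L2 M) (t n) S) (compose (L2 M) T S))) \<longlonglongrightarrow> 0"
    unfolding e2 by (rule Lim_null_comparison[OF _ l2])
      (simp only: real_norm_def a2 op_norm_compose[OF tT assms(3)] eventually_True)
qed

text \<open>For a multiplicative set of generators, the closed linear span is already an algebra.\<close>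

lemma generated_span_induct:
  assumes G: "G \<subseteq> bounded_ops M" "\<And>S T. S \<in> G \<Longrightarrow> T \<in> G \<Longrightarrow> compose (L2 M) S T \<in> G" "(\<lambda>u\<in>L2 M. u) \<in> G"
    and x: "x \<in> closed_subalgebra_generated (op_algebra M) G"
    and P: "\<And>T. T \<in> G \<Longrightarrow> P T"
      "\<And>S T. S \<in> bounded_ops M \<Longrightarrow> T \<in> bounded_ops M \<Longrightarrow> P S \<Longrightarrow> P T \<Longrightarrow> P (\<lambda>u\<in>L2 M. l2_add M (S u) (T u))"
      "\<And>c T. T \<in> bounded_ops M \<Longrightarrow> P T \<Longrightarrow> P (\<lambda>u\<in>L2 M. l2_scale M c (T u))"
      "\<And>t T. (\<And>n. t n \<in> bounded_ops M) \<Longrightarrow> T \<in> bounded_ops M \<Longrightarrow> (\<And>n. P (t n)) \<Longrightarrow>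
        (\<lambda>n. op_norm M (op_minus M (t n) T)) \<longlonglongrightarrow> 0 \<Longrightarrow> P T"
  shows "P x"
proof -
  \<comment> \<open>Closed linear subspaces containing \<open>G\<close>; \<open>Z\<close> is the
    smallest of them.\<close>
  define subsp where "subsp Z \<longleftrightarrow> Z \<subseteq> bounded_ops M \<and> G \<subseteq> Z \<and>
    (\<forall>S\<in>Z. \<forall>T\<in>Z. (\<lambda>u\<in>L2 M. l2_add M (S u) (T u)) \<in> Z) \<and> (\<forall>c. \<forall>T\<in>Z. (\<lambda>u\<in>L2 M. l2_scale M c (T u)) \<in> Z) \<and>
    (\<forall>t T. (\<forall>n. t n \<in> Z) \<longrightarrow> T \<in> bounded_ops M \<longrightarrow> (\<lambda>n. op_norm M (op_minus M (t n) T)) \<longlonglongrightarrow> 0 \<longrightarrow> T \<in> Z)" for Z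
  define Z where "Z = \<Inter>{Z. subsp Z}"
  have least: "Z \<subseteq> Z'" if "subsp Z'" for Z' unfolding Z_def using that by blast
  have "subsp (bounded_ops M)" unfolding subsp_def using G(1) by (auto simp: bounded_ops_add bounded_ops_scale)
  then have ZM: "Z \<subseteq> bounded_ops M" by (rule least)
  have subZ: "subsp Z"
    unfolding subsp_def
  proof (intro conjI ballI allI impI)
    show "Z \<subseteq> bounded_ops M" by (rule ZM)
    show "G \<subseteq> Z" unfolding Z_def subsp_def by blast
    show "(\<lambda>u\<in>L2 M. l2_add M (S u) (T u)) \<in> Z" if "S \<in> Z" "T \<in> Z" for S T
      using that unfolding Z_def subsp_def by blast
    show "(\<lambda>u\<in>L2 M. l2_scale M c (T u)) \<in> Z" if "T \<in> Z" for c T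
      using that unfolding Z_def subsp_def by blast
    fix t T assume *: "\<forall>n. t n \<in> Z" "T \<in> bounded_ops M" "(\<lambda>n. op_norm M (op_minus M (t n) T)) \<longlonglongrightarrow> 0"
    show "T \<in> Z" unfolding Z_def
    proof
      fix Z' assume "Z' \<in> {Z. subsp Z}"
      then have "subsp Z'" by simp
      moreover have "\<forall>n. t n \<in> Z'" using *(1) least[OF \<open>subsp Z'\<close>] by blast
      ultimately show "T \<in> Z'" using *(2,3) unfolding subsp_def by blast
    qed
  qed
  note Z = subZ[unfolded subsp_def]
  have Zlim: "T \<in> Z" if "\<And>n. t n \<in> Z" "T \<in> bounded_ops M" "(\<lambda>n. op_norm M (op_minus M (t n) T)) \<longlonglongrightarrow> 0" for t T
    using that Z by blast
  \<comment> \<open>The operators that \<open>g\<close> multiplies into \<open>Z\<close> form such a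
    subspace, so minimality gives all of \<open>Z\<close>.\<close>
  have GZ: "compose (L2 M) g z \<in> Z" if g: "g \<in> G" and z: "z \<in> Z" for g z
  proof -
    have gM: "g \<in> bounded_ops M" using g G(1) by blast
    note gD = bounded_opsD[OF gM]
    have "subsp {z \<in> bounded_ops M. compose (L2 M) g z \<in> Z}"
      unfolding subsp_def
    proof (intro conjI ballI allI impI)
      show "G \<subseteq> {z \<in> bounded_ops M. compose (L2 M) g z \<in> Z}" using G(1,2) g Z by blast
      fix S T assume "S \<in> {z \<in> bounded_ops M. compose (L2 M) g z \<in> Z}" "T \<in> {z \<in> bounded_ops M. compose (L2 M) g z \<in> Z}"
      then have ST: "S \<in> bounded_ops M" "T \<in> bounded_ops M" "compose (L2 M) g S \<in> Z" "compose (L2 M) g T \<in> Z" by auto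
      have "compose (L2 M) g (\<lambda>u\<in>L2 M. l2_add M (S u) (T u)) =
          (\<lambda>u\<in>L2 M. l2_add M (compose (L2 M) g S u) (compose (L2 M) g T u))"
        using ST by (simp add: compose_def fun_eq_iff gD(2) bounded_opsD(1))
      moreover have "(\<lambda>u\<in>L2 M. l2_add M (compose (L2 M) g S u) (compose (L2 M) g T u)) \<in> Z"
        using Z ST(3,4) by blast
      ultimately show "(\<lambda>u\<in>L2 M. l2_add M (S u) (T u)) \<in> {z \<in> bounded_ops M. compose (L2 M) g z \<in> Z}"
        using bounded_ops_add[OF ST(1,2)] by simp
    next
      fix c T assume "T \<in> {z \<in> bounded_ops M. compose (L2 M) g z \<in> Z}"
      then have T: "T \<in> bounded_ops M" "compose (L2 M) g T \<in> Z" by auto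
      have "compose (L2 M) g (\<lambda>u\<in>L2 M. l2_scale M c (T u)) = (\<lambda>u\<in>L2 M. l2_scale M c (compose (L2 M) g T u))"
        using T by (simp add: compose_def fun_eq_iff gD(3) bounded_opsD(1))
      moreover have "(\<lambda>u\<in>L2 M. l2_scale M c (compose (L2 M) g T u)) \<in> Z" using Z T(2) by blast
      ultimately show "(\<lambda>u\<in>L2 M. l2_scale M c (T u)) \<in> {z \<in> bounded_ops M. compose (L2 M) g z \<in> Z}"
        using bounded_ops_scale[OF T(1)] by simp
    next
      fix t T assume *: "\<forall>n. t n \<in> {z \<in> bounded_ops M. compose (L2 M) g z \<in> Z}" "T \<in> bounded_ops M"
        "(\<lambda>n. op_norm M (op_minus M (t n) T)) \<longlonglongrightarrow> 0"
      then have t: "t n \<in> bounded_ops M" "compose (L2 M) g (t n) \<in> Z" for n by auto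
      have "compose (L2 M) g T \<in> Z"
        by (rule Zlim[OF t(2) bounded_ops_compose[OF gM *(2)] op_lim_compose(1)[OF t(1) *(2) gM *(3)]])
      then show "T \<in> {z \<in> bounded_ops M. compose (L2 M) g z \<in> Z}" using *(2) by simp
    qed auto
    then show ?thesis using least z by blast
  qed
  \<comment> \<open>The multipliers of \<open>Z\<close> form a closed algebra, contain
    \<open>G\<close> by the previous step and hence contain \<open>x\<close>. Applied to the
    identity, which lies in \<open>Z\<close>, this puts \<open>x\<close> itself into
    \<open>Z\<close>.\<close>
  define X where "X = {x \<in> bounded_ops M. \<forall>z\<in>Z. compose (L2 M) x z \<in> Z}"
  have "closed_subalgebra (op_algebra M) X"
    unfolding closed_subalgebra_op_iff
  proof (intro conjI ballI allI impI)
    show "X \<subseteq> bounded_ops M" by (auto simp: X_def)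
    have zeroZ: "(\<lambda>u\<in>L2 M. l2_zero M) \<in> Z"
    proof -
      have "(\<lambda>u\<in>L2 M. l2_scale M 0 ((\<lambda>u\<in>L2 M. u) u)) \<in> Z" using Z G(3) by blast
      moreover have "(\<lambda>u\<in>L2 M. l2_scale M 0 ((\<lambda>u\<in>L2 M. u) u)) = (\<lambda>u\<in>L2 M. l2_zero M)"
        using l2_vector_space(9)[of _ M "l2_zero M" "l2_zero M"] by (simp add: fun_eq_iff)
      ultimately show ?thesis by simp
    qed
    have "compose (L2 M) (\<lambda>u\<in>L2 M. l2_zero M) z = (\<lambda>u\<in>L2 M. l2_zero M)" if "z \<in> Z" for z
      using that ZM bounded_opsD(1) by (force simp: compose_def fun_eq_iff)
    then show "(\<lambda>u\<in>L2 M. l2_zero M) \<in> X" using zeroZ by (simp add: X_def bounded_ops_zero_op)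
    fix S T assume "S \<in> X" "T \<in> X"
    then have ST: "S \<in> bounded_ops M" "T \<in> bounded_ops M" "\<And>z. z \<in> Z \<Longrightarrow> compose (L2 M) S z \<in> Z"
      "\<And>z. z \<in> Z \<Longrightarrow> compose (L2 M) T z \<in> Z" by (auto simp: X_def)
    have zD: "z u \<in> L2 M" if "z \<in> Z" "u \<in> L2 M" for z u using that ZM bounded_opsD(1) by blast
    have "compose (L2 M) (\<lambda>u\<in>L2 M. l2_add M (S u) (T u)) z =
        (\<lambda>u\<in>L2 M. l2_add M (compose (L2 M) S z u) (compose (L2 M) T z u))" if "z \<in> Z" for z
      using zD[OF that] by (simp add: compose_def fun_eq_iff)
    moreover have "(\<lambda>u\<in>L2 M. l2_add M (compose (L2 M) S z u) (compose (L2 M) T z u)) \<in> Z" if "z \<in> Z" for z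
      using Z ST(3,4)[OF that] by blast
    ultimately show "(\<lambda>u\<in>L2 M. l2_add M (S u) (T u)) \<in> X" using bounded_ops_add[OF ST(1,2)] by (simp add: X_def)
    have "compose (L2 M) (compose (L2 M) S T) z = compose (L2 M) S (compose (L2 M) T z)" if "z \<in> Z" for z
      using zD[OF that] by (simp add: compose_def fun_eq_iff)
    then show "compose (L2 M) S T \<in> X" using bounded_ops_compose[OF ST(1,2)] ST(3,4) by (simp add: X_def)
  next
    fix c T assume "T \<in> X"
    then have T: "T \<in> bounded_ops M" "\<And>z. z \<in> Z \<Longrightarrow> compose (L2 M) T z \<in> Z" by (auto simp: X_def)
    have zD: "z u \<in> L2 M" if "z \<in> Z" "u \<in> L2 M" for z u using that ZM bounded_opsD(1) by blast
    have "compose (L2 M) (\<lambda>u\<in>L2 M. l2_scale M c (T u)) z = (\<lambda>u\<in>L2 M. l2_scale M c (compose (L2 M) T z u))" if "z \<in> Z" for z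
      using zD[OF that] by (simp add: compose_def fun_eq_iff)
    moreover have "(\<lambda>u\<in>L2 M. l2_scale M c (compose (L2 M) T z u)) \<in> Z" if "z \<in> Z" for z
      using Z T(2)[OF that] by blast
    ultimately show "(\<lambda>u\<in>L2 M. l2_scale M c (T u)) \<in> X" using bounded_ops_scale[OF T(1)] by (simp add: X_def)
  next
    fix t T assume *: "(\<forall>n. t n \<in> X) \<and> T \<in> bounded_ops M \<and> (\<lambda>n. op_norm M (op_minus M (t n) T)) \<longlonglongrightarrow> 0"
    note tX = conjunct1[OF *] and T = conjunct1[OF conjunct2[OF *]] and lim = conjunct2[OF conjunct2[OF *]]
    have t: "t n \<in> bounded_ops M" "\<And>z. z \<in> Z \<Longrightarrow> compose (L2 M) (t n) z \<in> Z" for n using tX by (auto simp: X_def)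
    have "compose (L2 M) T z \<in> Z" if z: "z \<in> Z" for z
    proof -
      have zM: "z \<in> bounded_ops M" using z ZM by blast
      show ?thesis
        by (rule Zlim[OF t(2)[OF z] bounded_ops_compose[OF T zM] op_lim_compose(2)[OF t(1) T zM lim]])
    qed
    then show "T \<in> X" using T by (simp add: X_def)
  qed
  moreover have "G \<subseteq> X" using GZ G(1) by (auto simp: X_def)
  ultimately have xX: "x \<in> X" using closed_subalgebra_generated_least x by blast
  then have "compose (L2 M) x (\<lambda>u\<in>L2 M. u) \<in> Z" using Z G(3) by (auto simp: X_def)
  moreover have "compose (L2 M) x (\<lambda>u\<in>L2 M. u) = x"
  proof (rule bounded_ops_ext)
    show "x \<in> bounded_ops M" using xX by (simp add: X_def)
    then show "compose (L2 M) x (\<lambda>u\<in>L2 M. u) \<in> bounded_ops M" by (rule bounded_ops_compose[OF _ bounded_ops_one])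
  qed (simp add: compose_def)
  ultimately have "x \<in> Z" by simp
  moreover have "subsp {T \<in> bounded_ops M. P T}"
    unfolding subsp_def
  proof (intro conjI ballI allI impI)
    fix t T assume *: "\<forall>n. t n \<in> {T \<in> bounded_ops M. P T}" "T \<in> bounded_ops M" "(\<lambda>n. op_norm M (op_minus M (t n) T)) \<longlonglongrightarrow> 0"
    then show "T \<in> {T \<in> bounded_ops M. P T}" using P(4)[of t T] by blast
  next
    show "G \<subseteq> {T \<in> bounded_ops M. P T}" using G(1) P(1) by blast
    show "(\<lambda>u\<in>L2 M. l2_add M (S u) (T u)) \<in> {T \<in> bounded_ops M. P T}"
      if "S \<in> {T \<in> bounded_ops M. P T}" "T \<in> {T \<in> bounded_ops M. P T}" for S T
      using that bounded_ops_add[of S M T] P(2)[of S T] by blast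
    show "(\<lambda>u\<in>L2 M. l2_scale M c (T u)) \<in> {T \<in> bounded_ops M. P T}" if "T \<in> {T \<in> bounded_ops M. P T}" for c T
      using that bounded_ops_scale[of T M c] P(3)[of T c] by blast
  qed blast
  ultimately show ?thesis using least by blast
qed

text \<open>Merges two series by alternating their terms, which exhibits a difference of two tensors
  as one tensor series.\<close>

lemma sums_interleave:
  fixes g :: "nat \<Rightarrow> complex"
  assumes "g sums x" and "f sums y"
  shows "(\<lambda>n. if even n then f (n div 2) else g ((n - 1) div 2)) sums (x + y)"
  using sums_if[of "\<lambda>n. Re (g n)" "Re x" "\<lambda>n. Re (f n)" "Re y"] sums_if[of "\<lambda>n. Im (g n)" "Im x" "\<lambda>n. Im (f n)" "Im y"] assms
  unfolding sums_complex_iff by (simp add: if_distrib)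

section \<open>Bounded bilinear forms and tensors\<close>

locale operator_subalgebra =
  fixes M :: "'w measure" and B :: "('w l2 \<Rightarrow> 'w l2) set"
  assumes fin: "finite_measure M" and closed: "closed_subalgebra (op_algebra M) B"
    and one_B: "(\<lambda>u\<in>L2 M. u) \<in> B"
begin

abbreviation comp :: "('w l2 \<Rightarrow> 'w l2) \<Rightarrow> ('w l2 \<Rightarrow> 'w l2) \<Rightarrow> 'w l2 \<Rightarrow> 'w l2" where
  "comp \<equiv> compose (L2 M)"
abbreviation oadd :: "('w l2 \<Rightarrow> 'w l2) \<Rightarrow> ('w l2 \<Rightarrow> 'w l2) \<Rightarrow> 'w l2 \<Rightarrow> 'w l2" where
  "oadd S T \<equiv> (\<lambda>u\<in>L2 M. l2_add M (S u) (T u))"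
abbreviation oscale :: "complex \<Rightarrow> ('w l2 \<Rightarrow> 'w l2) \<Rightarrow> 'w l2 \<Rightarrow> 'w l2" where
  "oscale c T \<equiv> (\<lambda>u\<in>L2 M. l2_scale M c (T u))"
abbreviation \<A> :: "('w l2 \<Rightarrow> 'w l2) normed_algebra" where
  "\<A> \<equiv> op_algebra M\<lparr>carrier := B\<rparr>"

lemmas BD = closed_subalgebraD[OF closed]

lemma B_L2 [simp]: "T \<in> B \<Longrightarrow> u \<in> L2 M \<Longrightarrow> T u \<in> L2 M"
  using BD(1) bounded_opsD(1) by blast

lemma comp_one: "T \<in> B \<Longrightarrow> comp (\<lambda>u\<in>L2 M. u) T = T" "T \<in> B \<Longrightarrow> comp T (\<lambda>u\<in>L2 M. u) = T"
  using BD(1) bounded_opsD(5) by (force simp: compose_def fun_eq_iff restrict_def)+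

lemma comp_assoc: "V \<in> B \<Longrightarrow> comp (comp S T) V = comp S (comp T V)"
  by (simp add: compose_def fun_eq_iff)

text \<open>Keeps the constant explicit: the final bound rests on one form having norm at most 1
  regardless of the number of coordinates.\<close>

definition form_bound :: "real \<Rightarrow> (('w l2 \<Rightarrow> 'w l2) \<Rightarrow> ('w l2 \<Rightarrow> 'w l2) \<Rightarrow> complex) \<Rightarrow> bool" where
  "form_bound K \<phi> \<longleftrightarrow> K \<ge> 0 \<and>
    (\<forall>a\<in>B. \<forall>b\<in>B. \<forall>c\<in>B. \<phi> (oadd a b) c = \<phi> a c + \<phi> b c \<and> \<phi> a (oadd b c) = \<phi> a b + \<phi> a c) \<and>
    (\<forall>z. \<forall>a\<in>B. \<forall>b\<in>B. \<phi> (oscale z a) b = z * \<phi> a b \<and> \<phi> a (oscale z b) = z * \<phi> a b) \<and>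
    (\<forall>a\<in>B. \<forall>b\<in>B. cmod (\<phi> a b) \<le> K * op_norm M a * op_norm M b)"

lemma form_boundD:
  assumes "form_bound K \<phi>"
  shows "K \<ge> 0"
    "a \<in> B \<Longrightarrow> b \<in> B \<Longrightarrow> c \<in> B \<Longrightarrow> \<phi> (oadd a b) c = \<phi> a c + \<phi> b c"
    "a \<in> B \<Longrightarrow> b \<in> B \<Longrightarrow> c \<in> B \<Longrightarrow> \<phi> a (oadd b c) = \<phi> a b + \<phi> a c"
    "a \<in> B \<Longrightarrow> b \<in> B \<Longrightarrow> \<phi> (oscale z a) b = z * \<phi> a b"
    "a \<in> B \<Longrightarrow> b \<in> B \<Longrightarrow> \<phi> a (oscale z b) = z * \<phi> a b"
    "a \<in> B \<Longrightarrow> b \<in> B \<Longrightarrow> cmod (\<phi> a b) \<le> K * op_norm M a * op_norm M b"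
  using assms unfolding form_bound_def by blast+

lemma bilinear_forms_iff: "\<phi> \<in> bilinear_forms \<A> \<longleftrightarrow> (\<exists>K. form_bound K \<phi>)"
proof
  assume "\<phi> \<in> bilinear_forms \<A>"
  then have 1: "(\<forall>a\<in>B. \<forall>b\<in>B. \<forall>c\<in>B. \<phi> (oadd a b) c = \<phi> a c + \<phi> b c \<and> \<phi> a (oadd b c) = \<phi> a b + \<phi> a c)"
    "(\<forall>z. \<forall>a\<in>B. \<forall>b\<in>B. \<phi> (oscale z a) b = z * \<phi> a b \<and> \<phi> a (oscale z b) = z * \<phi> a b)"
    "\<exists>K. \<forall>a\<in>B. \<forall>b\<in>B. cmod (\<phi> a b) \<le> K * op_norm M a * op_norm M b"
    by (simp_all add: bilinear_forms_def)
  obtain K where K: "\<forall>a\<in>B. \<forall>b\<in>B. cmod (\<phi> a b) \<le> K * op_norm M a * op_norm M b" using 1(3) by blast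
  have "cmod (\<phi> a b) \<le> \<bar>K\<bar> * op_norm M a * op_norm M b" if "a \<in> B" "b \<in> B" for a b
  proof -
    have "K * (op_norm M a * op_norm M b) \<le> \<bar>K\<bar> * (op_norm M a * op_norm M b)"
      by (intro mult_right_mono abs_ge_self mult_nonneg_nonneg op_norm_nonneg BD(1) that)
    then show ?thesis using K that by (fastforce simp: mult.assoc)
  qed
  then have "form_bound \<bar>K\<bar> \<phi>" unfolding form_bound_def using 1(1,2) by simp
  then show "\<exists>K. form_bound K \<phi>" by blast
next
  assume "\<exists>K. form_bound K \<phi>"
  then obtain K where "form_bound K \<phi>" by blast
  then show "\<phi> \<in> bilinear_forms \<A>"
    unfolding form_bound_def bilinear_forms_def by simp blast
qed

definition bounded_map :: "real \<Rightarrow> (('w l2 \<Rightarrow> 'w l2) \<Rightarrow> 'w l2 \<Rightarrow> 'w l2) \<Rightarrow> bool" where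
  "bounded_map N L \<longleftrightarrow> N \<ge> 0 \<and> (\<forall>a\<in>B. L a \<in> B \<and> op_norm M (L a) \<le> N * op_norm M a) \<and>
    (\<forall>a\<in>B. \<forall>b\<in>B. L (oadd a b) = oadd (L a) (L b)) \<and> (\<forall>z. \<forall>a\<in>B. L (oscale z a) = oscale z (L a))"

lemma bounded_map_id: "bounded_map 1 (\<lambda>x. x)"
  by (simp add: bounded_map_def)

lemma bounded_map_left:
  assumes e: "e \<in> B"
  shows "bounded_map (op_norm M e) (comp e)"
proof -
  note eD = bounded_opsD[OF BD(1)[OF e]]
  have "comp e (oadd a b) = oadd (comp e a) (comp e b)" if "a \<in> B" "b \<in> B" for a b
    using that e by (simp add: compose_def fun_eq_iff eD(2))
  moreover have "comp e (oscale z a) = oscale z (comp e a)" if "a \<in> B" for a z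
    using that e by (simp add: compose_def fun_eq_iff eD(3))
  ultimately show ?thesis
    unfolding bounded_map_def using e by (simp add: op_norm_nonneg op_norm_compose BD(1,4))
qed

lemma bounded_map_right:
  assumes g: "g \<in> B"
  shows "bounded_map (op_norm M g) (\<lambda>y. comp y g)"
proof -
  have "comp (oadd a b) g = oadd (comp a g) (comp b g)" if "a \<in> B" "b \<in> B" for a b
    using that g by (simp add: compose_def fun_eq_iff)
  moreover have "comp (oscale z a) g = oscale z (comp a g)" if "a \<in> B" for a z
    using that g by (simp add: compose_def fun_eq_iff)
  moreover have "op_norm M (comp a g) \<le> op_norm M g * op_norm M a" if "a \<in> B" for a
    using op_norm_compose[OF BD(1)[OF that] BD(1)[OF g]] by (simp add: mult.commute)
  ultimately show ?thesis
    unfolding bounded_map_def using g by (simp add: op_norm_nonneg BD(1,4))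
qed

lemma form_bound_map:
  assumes \<phi>: "form_bound K \<phi>" and L: "bounded_map N L" and R: "bounded_map N' R"
  shows "form_bound (K * N * N') (\<lambda>x y. \<phi> (L x) (R y))"
  unfolding form_bound_def
proof (intro conjI ballI allI)
  note \<phi>D = form_boundD[OF \<phi>]
  have LB: "L a \<in> B" "R a \<in> B" if "a \<in> B" for a using L R that by (simp_all add: bounded_map_def)
  have N: "N \<ge> 0" "N' \<ge> 0" using L R by (simp_all add: bounded_map_def)
  show "K * N * N' \<ge> 0" using \<phi>D(1) N by simp
  fix a b c z assume abc: "a \<in> B" "b \<in> B"
  show "\<phi> (L (oscale z a)) (R b) = z * \<phi> (L a) (R b)" "\<phi> (L a) (R (oscale z b)) = z * \<phi> (L a) (R b)"
    using abc L R by (simp_all add: bounded_map_def \<phi>D(4,5))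
  have "cmod (\<phi> (L a) (R b)) \<le> K * op_norm M (L a) * op_norm M (R b)"
    using abc by (intro \<phi>D(6) LB)
  also have "\<dots> \<le> K * (N * op_norm M a) * (N' * op_norm M b)"
    using abc L R \<phi>D(1) N
    by (intro mult_mono mult_nonneg_nonneg op_norm_nonneg BD(1) LB order.refl) (auto simp: bounded_map_def)
  finally show "cmod (\<phi> (L a) (R b)) \<le> K * N * N' * op_norm M a * op_norm M b"
    by (simp add: mult_ac)
  assume c: "c \<in> B"
  show "\<phi> (L (oadd a b)) (R c) = \<phi> (L a) (R c) + \<phi> (L b) (R c)"
    "\<phi> (L a) (R (oadd b c)) = \<phi> (L a) (R b) + \<phi> (L a) (R c)"
    using abc c L R by (simp_all add: bounded_map_def \<phi>D(2,3))
qed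

lemma form_bound_sum:
  assumes "finite J" "\<And>j. j \<in> J \<Longrightarrow> form_bound (K j) (\<phi> j)"
  shows "form_bound (\<Sum>j\<in>J. K j) (\<lambda>x y. \<Sum>j\<in>J. \<phi> j x y)"
  using assms
proof (induction J)
  case empty
  then show ?case by (simp add: form_bound_def)
next
  case (insert j J)
  then have 1: "form_bound (K j) (\<phi> j)" and 2: "form_bound (\<Sum>j\<in>J. K j) (\<lambda>x y. \<Sum>j\<in>J. \<phi> j x y)" by auto
  have "form_bound (K j + (\<Sum>j\<in>J. K j)) (\<lambda>x y. \<phi> j x y + (\<Sum>j\<in>J. \<phi> j x y))"
    unfolding form_bound_def
  proof (intro conjI ballI allI)
    fix a b assume ab: "a \<in> B" "b \<in> B"
    show "cmod (\<phi> j a b + (\<Sum>j\<in>J. \<phi> j a b)) \<le> (K j + (\<Sum>j\<in>J. K j)) * op_norm M a * op_norm M b"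
      using norm_triangle_ineq[of "\<phi> j a b" "\<Sum>j\<in>J. \<phi> j a b"] form_boundD(6)[OF 1 ab] form_boundD(6)[OF 2 ab]
      by (simp add: distrib_right)
  qed (simp_all add: form_boundD(1-5)[OF 1] form_boundD(1-5)[OF 2] distrib_left)
  then show ?case using insert.hyps by simp
qed

text \<open>The forms that carry the argument: \<open>T\<close> sits between the two legs of a
  tensor, and for \<open>T\<close> the identity the form factors through multiplication.\<close>

lemma form_bound_inner:
  assumes T: "T \<in> bounded_ops M" and u: "u \<in> L2 M" and w: "w \<in> L2 M"
  shows "form_bound (op_norm M T * l2_norm M u * l2_norm M w) (\<lambda>x y. l2_inner M (x (T (y u))) w)"
  unfolding form_bound_def
proof (intro conjI ballI allI)
  note TD = bounded_opsD[OF T]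
  have [simp]: "T v \<in> L2 M" if "v \<in> L2 M" for v using TD(1) that .
  have BDD: "x (l2_add M p q) = l2_add M (x p) (x q)" "x (l2_scale M z p) = l2_scale M z (x p)"
    if "x \<in> B" "p \<in> L2 M" "q \<in> L2 M" for x p q z
    using bounded_opsD(2,3)[OF BD(1)[OF that(1)]] that by auto
  show "0 \<le> op_norm M T * l2_norm M u * l2_norm M w" using op_norm_nonneg[OF T] by simp
  fix a b c z assume ab: "a \<in> B" "b \<in> B"
  show "l2_inner M (oscale z a (T (b u))) w = z * l2_inner M (a (T (b u))) w"
    "l2_inner M (a (T (oscale z b u))) w = z * l2_inner M (a (T (b u))) w"
    using ab u w by (simp_all add: l2_inner_linear TD(3) BDD(2)[of _ _ "T (b u)"])
  have "cmod (l2_inner M (a (T (b u))) w) \<le> l2_norm M (a (T (b u))) * l2_norm M w"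
    using ab u w by (intro l2_Cauchy_Schwarz) auto
  also have "\<dots> \<le> (op_norm M a * (op_norm M T * (op_norm M b * l2_norm M u))) * l2_norm M w"
  proof (intro mult_right_mono)
    have "l2_norm M (a (T (b u))) \<le> op_norm M a * l2_norm M (T (b u))"
      using ab u by (intro op_norm_bound BD(1)) auto
    also have "\<dots> \<le> op_norm M a * (op_norm M T * l2_norm M (b u))"
      using ab u by (intro mult_left_mono op_norm_bound[OF T] op_norm_nonneg BD(1)) auto
    also have "\<dots> \<le> op_norm M a * (op_norm M T * (op_norm M b * l2_norm M u))"
      using ab u by (intro mult_left_mono op_norm_bound op_norm_nonneg T BD(1)) auto
    finally show "l2_norm M (a (T (b u))) \<le> op_norm M a * (op_norm M T * (op_norm M b * l2_norm M u))" .
  qed simp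
  finally show "cmod (l2_inner M (a (T (b u))) w) \<le> op_norm M T * l2_norm M u * l2_norm M w * op_norm M a * op_norm M b"
    by (simp add: mult_ac)
  assume c: "c \<in> B"
  show "l2_inner M (oadd a b (T (c u))) w = l2_inner M (a (T (c u))) w + l2_inner M (b (T (c u))) w"
    "l2_inner M (a (T (oadd b c u))) w = l2_inner M (a (T (b u))) w + l2_inner M (a (T (c u))) w"
    using ab c u w by (simp_all add: l2_inner_linear TD(2) BDD(1))
qed

lemma form_bound_cong:
  assumes "form_bound K \<phi>" "\<And>x y. x \<in> B \<Longrightarrow> y \<in> B \<Longrightarrow> \<phi> x y = \<phi>' x y"
  shows "form_bound K \<phi>'"
  using assms(1) unfolding form_bound_def by (simp add: assms(2)[symmetric] BD(3,5))

lemma tensor_series_sum: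
  assumes ab: "tensor_series \<A> a b" and \<phi>: "form_bound K \<phi>"
  shows "summable (\<lambda>n. \<phi> (a n) (b n))"
    and "cmod (\<Sum>n. \<phi> (a n) (b n)) \<le> K * (\<Sum>n. op_norm M (a n) * op_norm M (b n))"
proof -
  have m: "\<And>n. a n \<in> B" "\<And>n. b n \<in> B" and s: "summable (\<lambda>n. op_norm M (a n) * op_norm M (b n))"
    using ab by (auto simp: tensor_series_def)
  have le: "cmod (\<phi> (a n) (b n)) \<le> K * (op_norm M (a n) * op_norm M (b n))" for n
    using form_boundD(6)[OF \<phi> m(1) m(2)] by (simp add: mult.assoc)
  have sK: "summable (\<lambda>n. K * (op_norm M (a n) * op_norm M (b n)))" by (rule summable_mult[OF s])
  have sn: "summable (\<lambda>n. cmod (\<phi> (a n) (b n)))"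
    by (rule summable_comparison_test'[OF sK, of 0]) (use le in simp)
  then show "summable (\<lambda>n. \<phi> (a n) (b n))" by (rule summable_norm_cancel)
  have "cmod (\<Sum>n. \<phi> (a n) (b n)) \<le> (\<Sum>n. cmod (\<phi> (a n) (b n)))" by (rule summable_norm[OF sn])
  also have "\<dots> \<le> (\<Sum>n. K * (op_norm M (a n) * op_norm M (b n)))" by (intro suminf_le le sn sK)
  also have "\<dots> = K * (\<Sum>n. op_norm M (a n) * op_norm M (b n))" by (rule suminf_mult[OF s])
  finally show "cmod (\<Sum>n. \<phi> (a n) (b n)) \<le> K * (\<Sum>n. op_norm M (a n) * op_norm M (b n))" .
qed

lemma tensor_sum_apply: "form_bound K \<phi> \<Longrightarrow> tensor_sum \<A> a b \<phi> = (\<Sum>n. \<phi> (a n) (b n))"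
  unfolding tensor_sum_def using bilinear_forms_iff by auto

text \<open>Each representing series bounds the value, hence so does the infimum over them. The case
  \<open>K = 0\<close> is separate because the constant is divided out.\<close>

lemma proj_norm_bound:
  assumes m: "m \<in> proj_tensor \<A>" and \<phi>: "form_bound K \<phi>"
  shows "cmod (m \<phi>) \<le> K * proj_norm \<A> m"
proof -
  let ?S = "{(\<Sum>n. nrm \<A> (a n) * nrm \<A> (b n)) | a b. tensor_series \<A> a b \<and> m = tensor_sum \<A> a b}"
  have ne: "?S \<noteq> {}" using m unfolding proj_tensor_def by blast
  have le: "cmod (m \<phi>) \<le> K * r" if r: "r \<in> ?S" for r
  proof -
    obtain a b where "r = (\<Sum>n. op_norm M (a n) * op_norm M (b n))" "tensor_series \<A> a b" "m = tensor_sum \<A> a b"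
      using r by auto
    then show ?thesis using tensor_series_sum(2)[of a b, OF _ \<phi>] tensor_sum_apply[OF \<phi>, of a b] by simp
  qed
  show ?thesis
  proof (cases "K = 0")
    case True
    then show ?thesis using le ne by fastforce
  next
    case False
    then have K: "K > 0" using form_boundD(1)[OF \<phi>] by simp
    then have "cmod (m \<phi>) / K \<le> Inf ?S"
      using ne le by (intro cInf_greatest) (auto simp: field_simps)
    then show ?thesis using K unfolding proj_norm_def by (simp add: field_simps)
  qed
qed

text \<open>Forms are functions on all operators, but a tensor sees only their values on
  \<open>B\<close>; this permits rewriting inside the argument of \<open>m\<close>.\<close>

lemma tensor_cong:
  assumes "m \<in> proj_tensor \<A>" "\<And>x y. x \<in> B \<Longrightarrow> y \<in> B \<Longrightarrow> \<phi> x y = \<phi>' x y" "form_bound K \<phi>"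
  shows "m \<phi> = m \<phi>'"
proof -
  obtain a b where ab: "tensor_series \<A> a b" "m = tensor_sum \<A> a b"
    using assms(1) unfolding proj_tensor_def by blast
  have mem: "a n \<in> B" "b n \<in> B" for n using ab(1) by (auto simp: tensor_series_def)
  have "form_bound K \<phi>'" by (rule form_bound_cong[OF assms(3,2)])
  then show ?thesis
    unfolding ab(2) by (simp add: tensor_sum_apply[OF assms(3)] tensor_sum_apply[of K \<phi>'] assms(2) mem)
qed

lemma tensor_finite_sum:
  assumes m: "m \<in> proj_tensor \<A>" and "finite J" "\<And>j. j \<in> J \<Longrightarrow> form_bound (K j) (\<phi> j)"
  shows "m (\<lambda>x y. \<Sum>j\<in>J. \<phi> j x y) = (\<Sum>j\<in>J. m (\<phi> j))"
proof -
  obtain a b where ab: "tensor_series \<A> a b" "m = tensor_sum \<A> a b"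
    using m unfolding proj_tensor_def by blast
  have "(\<Sum>n. \<Sum>j\<in>J. \<phi> j (a n) (b n)) = (\<Sum>j\<in>J. \<Sum>n. \<phi> j (a n) (b n))"
    using assms(3) tensor_series_sum(1)[OF ab(1)] by (intro suminf_sum) blast
  moreover have "m (\<lambda>x y. \<Sum>j\<in>J. \<phi> j x y) = (\<Sum>n. \<Sum>j\<in>J. \<phi> j (a n) (b n))"
    unfolding ab(2) by (rule tensor_sum_apply, rule form_bound_sum[OF assms(2,3)])
  moreover have "m (\<phi> j) = (\<Sum>n. \<phi> j (a n) (b n))" if "j \<in> J" for j
    unfolding ab(2) by (rule tensor_sum_apply[OF assms(3)[OF that]])
  ultimately show ?thesis by simp
qed

lemma tensor_scale:
  assumes m: "m \<in> proj_tensor \<A>" and \<phi>: "form_bound K \<phi>"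
  shows "m (\<lambda>x y. c * \<phi> x y) = c * m \<phi>"
proof -
  obtain a b where ab: "tensor_series \<A> a b" "m = tensor_sum \<A> a b"
    using m unfolding proj_tensor_def by blast
  have "cmod (c * \<phi> x y) \<le> cmod c * K * op_norm M x * op_norm M y" if "x \<in> B" "y \<in> B" for x y
    using mult_left_mono[OF form_boundD(6)[OF \<phi> that] norm_ge_zero[of c]] by (simp add: norm_mult mult.assoc)
  then have "form_bound (cmod c * K) (\<lambda>x y. c * \<phi> x y)"
    unfolding form_bound_def using form_boundD(1-5)[OF \<phi>] by (simp add: distrib_left)
  then show ?thesis
    unfolding ab(2) by (simp add: tensor_sum_apply tensor_sum_apply[OF \<phi>] suminf_mult tensor_series_sum(1)[OF ab(1) \<phi>])
qed

text \<open>The defect a m - m a is itself a tensor, represented by the interleaved terms a p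
  \<otimes> q and - p \<otimes> q a. Knowing this is what lets its projective norm control its
  values on forms.\<close>

lemma commutator_tensor:
  assumes m: "m \<in> proj_tensor \<A>" and a: "a \<in> B"
  defines "D \<equiv> (\<lambda>\<phi>. tensor_mult \<A> (pure_tensor \<A> a \<one>\<^bsub>\<A>\<^esub>) m \<phi> - tensor_mult \<A> m (pure_tensor \<A> \<one>\<^bsub>\<A>\<^esub> a) \<phi>)"
  shows "D \<in> proj_tensor \<A>"
    and "form_bound K \<phi> \<Longrightarrow> D \<phi> = m (\<lambda>x y. \<phi> (comp a x) y) - m (\<lambda>x y. \<phi> x (comp y a))"
proof -
  obtain p q where pq: "tensor_series \<A> p q" "m = tensor_sum \<A> p q"
    using m unfolding proj_tensor_def by blast
  have mem: "\<And>n. p n \<in> B" "\<And>n. q n \<in> B" and s: "summable (\<lambda>n. op_norm M (p n) * op_norm M (q n))"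
    using pq(1) by (auto simp: tensor_series_def)
  let ?one = "\<lambda>u\<in>L2 M. u"
  have left: "tensor_mult \<A> (pure_tensor \<A> a \<one>\<^bsub>\<A>\<^esub>) m \<phi> = (\<Sum>n. \<phi> (comp a (p n)) (q n))"
    if \<phi>: "form_bound K \<phi>" for \<phi> K
  proof -
    define S where "S = (\<Sum>n. op_norm M (p n) * op_norm M (q n))"
    have S: "S \<ge> 0" unfolding S_def using s mem by (intro suminf_nonneg) (auto intro!: mult_nonneg_nonneg op_norm_nonneg BD(1))
    \<comment> \<open>Multiplying by a pure tensor on the left evaluates that pure tensor at this
      form. A pure tensor has the default value 0 off the bounded bilinear forms, so
      \<open>\<psi>\<close> must first be shown to be one of them.\<close>
    define \<psi> where "\<psi> x y = m (\<lambda>c e. \<phi> (comp x c) (comp y e))" for x y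
    have fb: "form_bound (K * op_norm M x * op_norm M y) (\<lambda>c e. \<phi> (comp x c) (comp y e))" if "x \<in> B" "y \<in> B" for x y
      by (rule form_bound_map[OF \<phi> bounded_map_left[OF that(1)] bounded_map_left[OF that(2)]])
    have \<psi>: "\<psi> x y = (\<Sum>n. \<phi> (comp x (p n)) (comp y (q n)))" if "x \<in> B" "y \<in> B" for x y
      unfolding \<psi>_def pq(2) by (rule tensor_sum_apply[OF fb[OF that]])
    have sm: "summable (\<lambda>n. \<phi> (comp x (p n)) (comp y (q n)))" if "x \<in> B" "y \<in> B" for x y
      by (rule tensor_series_sum(1)[OF pq(1) fb[OF that]])
    have "form_bound (K * S) \<psi>"
      unfolding form_bound_def
    proof (intro conjI ballI allI)
      show "K * S \<ge> 0" using form_boundD(1)[OF \<phi>] S by simp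
      fix x y z c assume xy: "x \<in> B" "y \<in> B"
      have r: "comp (oadd x x') (p n) = oadd (comp x (p n)) (comp x' (p n))"
        "comp (oadd x x') (q n) = oadd (comp x (q n)) (comp x' (q n))"
        "comp (oscale c x) (p n) = oscale c (comp x (p n))" "comp (oscale c x) (q n) = oscale c (comp x (q n))"
        if "x \<in> B" "x' \<in> B" for x x' n c
        using bounded_map_right[OF mem(1)] bounded_map_right[OF mem(2)] that by (simp_all add: bounded_map_def)
      note \<phi>D = form_boundD(2-5)[OF \<phi>]
      show "\<psi> (oscale c x) y = c * \<psi> x y" "\<psi> x (oscale c y) = c * \<psi> x y"
        using xy by (simp_all add: \<psi> BD(4,5) r \<phi>D mem suminf_mult sm)
      show "cmod (\<psi> x y) \<le> K * S * op_norm M x * op_norm M y"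
        using tensor_series_sum(2)[OF pq(1) fb[OF xy]] xy by (simp add: \<psi> S_def mult_ac)
      assume z: "z \<in> B"
      show "\<psi> (oadd x y) z = \<psi> x z + \<psi> y z" "\<psi> x (oadd y z) = \<psi> x y + \<psi> x z"
        using xy z by (simp_all add: \<psi> BD(3,4) r \<phi>D mem suminf_add sm)
    qed
    then have "\<psi> \<in> bilinear_forms \<A>" "\<phi> \<in> bilinear_forms \<A>" using bilinear_forms_iff \<phi> by blast+
    then have "tensor_mult \<A> (pure_tensor \<A> a \<one>\<^bsub>\<A>\<^esub>) m \<phi> = \<psi> a ?one"
      by (simp add: tensor_mult_def pure_tensor_def \<psi>_def[abs_def])
    also have "\<dots> = (\<Sum>n. \<phi> (comp a (p n)) (q n))"
      using \<psi>[OF a one_B] comp_one(1)[OF mem(2)] by simp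
    finally show ?thesis .
  qed
  have right: "tensor_mult \<A> m (pure_tensor \<A> \<one>\<^bsub>\<A>\<^esub> a) \<phi> = (\<Sum>n. \<phi> (p n) (comp (q n) a))"
    if \<phi>: "form_bound K \<phi>" for \<phi> K
  proof -
    have fb: "form_bound (K * op_norm M x * op_norm M y) (\<lambda>c e. \<phi> (comp x c) (comp y e))" if "x \<in> B" "y \<in> B" for x y
      by (rule form_bound_map[OF \<phi> bounded_map_left[OF that(1)] bounded_map_left[OF that(2)]])
    have "pure_tensor \<A> \<one>\<^bsub>\<A>\<^esub> a (\<lambda>c e. \<phi> (comp x c) (comp y e)) = \<phi> x (comp y a)" if "x \<in> B" "y \<in> B" for x y
    proof -
      have "(\<lambda>c e. \<phi> (comp x c) (comp y e)) \<in> bilinear_forms \<A>" using fb[OF that] bilinear_forms_iff by blast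
      then show ?thesis using comp_one(2)[OF that(1)] by (simp add: pure_tensor_def)
    qed
    \<comment> \<open>The inner pure tensor has been computed for arguments in \<open>B\<close>
      only; outside \<open>B\<close> the two forms may differ, which \<open>m\<close> does not
      notice.\<close>
    then have "m (\<lambda>x y. \<phi> x (comp y a)) = m (\<lambda>x y. pure_tensor \<A> \<one>\<^bsub>\<A>\<^esub> a (\<lambda>c e. \<phi> (comp x c) (comp y e)))"
      by (intro tensor_cong[OF m _ form_bound_map[OF \<phi> bounded_map_id bounded_map_right[OF a]]]) simp
    moreover have "\<phi> \<in> bilinear_forms \<A>" using bilinear_forms_iff \<phi> by blast
    ultimately have "tensor_mult \<A> m (pure_tensor \<A> \<one>\<^bsub>\<A>\<^esub> a) \<phi> = m (\<lambda>x y. \<phi> x (comp y a))"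
      by (simp add: tensor_mult_def)
    then show ?thesis
      unfolding pq(2) tensor_sum_apply[OF form_bound_map[OF \<phi> bounded_map_id bounded_map_right[OF a]]] .
  qed
  show "form_bound K \<phi> \<Longrightarrow> D \<phi> = m (\<lambda>x y. \<phi> (comp a x) y) - m (\<lambda>x y. \<phi> x (comp y a))" for K \<phi>
    unfolding D_def left right
    by (simp add: pq(2) tensor_sum_apply[OF form_bound_map[OF _ bounded_map_id bounded_map_right[OF a]]]
        tensor_sum_apply[OF form_bound_map[OF _ bounded_map_left[OF a] bounded_map_id]])
  define p' where "p' n = (if even n then comp a (p (n div 2)) else oscale (- 1) (p ((n - 1) div 2)))" for n
  define q' where "q' n = (if even n then q (n div 2) else comp (q ((n - 1) div 2)) a)" for n
  have mem': "p' n \<in> B" "q' n \<in> B" for n using a mem by (simp_all add: p'_def q'_def BD(4,5))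
  have "summable (\<lambda>n. op_norm M (p' n) * op_norm M (q' n))"
  proof -
    have s1: "summable (\<lambda>n. op_norm M (comp a (p n)) * op_norm M (q n))"
    proof (rule summable_comparison_test'[OF summable_mult[OF s, of "op_norm M a"], of 0])
      show "norm (op_norm M (comp a (p n)) * op_norm M (q n)) \<le> op_norm M a * (op_norm M (p n) * op_norm M (q n))" for n
        using mult_right_mono[OF op_norm_compose[OF BD(1)[OF a] BD(1)[OF mem(1)]] op_norm_nonneg[OF BD(1)[OF mem(2)]], of n n]
          op_norm_nonneg[OF BD(1)[OF BD(4)[OF a mem(1)]], of n] op_norm_nonneg[OF BD(1)[OF mem(2)], of n]
        by (simp add: abs_mult mult.assoc)
    qed
    have s2: "summable (\<lambda>n. op_norm M (oscale (- 1) (p n)) * op_norm M (comp (q n) a))"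
    proof (rule summable_comparison_test'[OF summable_mult[OF s, of "op_norm M a"], of 0])
      fix n
      have "op_norm M (oscale (- 1) (p n)) \<le> op_norm M (p n)"
        using op_norm_bound[OF BD(1)[OF mem(1)[of n]]] op_norm_nonneg[OF BD(1)[OF mem(1)]] mem(1)
        by (intro op_norm_le) (simp_all add: l2_norm_scale)
      moreover have "op_norm M (comp (q n) a) \<le> op_norm M (q n) * op_norm M a"
        by (rule op_norm_compose[OF BD(1)[OF mem(2)] BD(1)[OF a]])
      ultimately have "op_norm M (oscale (- 1) (p n)) * op_norm M (comp (q n) a) \<le> op_norm M (p n) * (op_norm M (q n) * op_norm M a)"
        by (intro mult_mono op_norm_nonneg BD(1) BD(4) mem a)
      moreover have "0 \<le> op_norm M (oscale (- 1) (p n)) * op_norm M (comp (q n) a)"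
        by (intro mult_nonneg_nonneg op_norm_nonneg BD(1) BD(4) BD(5) mem a)
      ultimately show "norm (op_norm M (oscale (- 1) (p n)) * op_norm M (comp (q n) a)) \<le> op_norm M a * (op_norm M (p n) * op_norm M (q n))"
        by (simp only: real_norm_def abs_of_nonneg mult_ac)
    qed
    have "(\<lambda>n. op_norm M (p' n) * op_norm M (q' n)) = (\<lambda>n. if even n then op_norm M (comp a (p (n div 2))) * op_norm M (q (n div 2))
        else op_norm M (oscale (- 1) (p ((n - 1) div 2))) * op_norm M (comp (q ((n - 1) div 2)) a))"
      by (simp add: fun_eq_iff p'_def q'_def)
    then show ?thesis
      using sums_summable[OF sums_if[OF summable_sums[OF s2] summable_sums[OF s1]]] by simp
  qed
  then have ts: "tensor_series \<A> p' q'" using mem' by (simp add: tensor_series_def)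
  have "D = tensor_sum \<A> p' q'"
  proof
    fix \<phi>
    show "D \<phi> = tensor_sum \<A> p' q' \<phi>"
    proof (cases "\<phi> \<in> bilinear_forms \<A>")
      case False
      then show ?thesis by (simp add: D_def tensor_mult_def tensor_sum_def)
    next
      case True
      then obtain K where \<phi>: "form_bound K \<phi>" using bilinear_forms_iff by blast
      have s1: "summable (\<lambda>n. \<phi> (comp a (p n)) (q n))"
        by (rule tensor_series_sum(1)[OF pq(1) form_bound_map[OF \<phi> bounded_map_left[OF a] bounded_map_id]])
      have s2: "summable (\<lambda>n. \<phi> (p n) (comp (q n) a))"
        by (rule tensor_series_sum(1)[OF pq(1) form_bound_map[OF \<phi> bounded_map_id bounded_map_right[OF a]]])
      have "(\<lambda>n. if even n then \<phi> (comp a (p (n div 2))) (q (n div 2)) else - \<phi> (p ((n - 1) div 2)) (comp (q ((n - 1) div 2)) a))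
          sums ((\<Sum>n. - \<phi> (p n) (comp (q n) a)) + (\<Sum>n. \<phi> (comp a (p n)) (q n)))"
        by (rule sums_interleave[OF summable_sums[OF summable_minus[OF s2]] summable_sums[OF s1]])
      moreover have "(\<lambda>n. if even n then \<phi> (comp a (p (n div 2))) (q (n div 2)) else - \<phi> (p ((n - 1) div 2)) (comp (q ((n - 1) div 2)) a)) =
          (\<lambda>n. \<phi> (p' n) (q' n))"
        using form_boundD(4)[OF \<phi>, of _ _ "- 1"] mem a by (simp add: fun_eq_iff p'_def q'_def BD(4))
      ultimately have "(\<lambda>n. \<phi> (p' n) (q' n)) sums ((\<Sum>n. - \<phi> (p n) (comp (q n) a)) + (\<Sum>n. \<phi> (comp a (p n)) (q n)))"
        by (simp only:)
      from sums_unique[OF this] have "(\<Sum>n. \<phi> (p' n) (q' n)) = (\<Sum>n. \<phi> (comp a (p n)) (q n)) - (\<Sum>n. \<phi> (p n) (comp (q n) a))"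
        unfolding suminf_minus[OF s2] by simp
      then show ?thesis unfolding D_def left[OF \<phi>] right[OF \<phi>] tensor_sum_apply[OF \<phi>] by simp
    qed
  qed
  then show "D \<in> proj_tensor \<A>" using ts unfolding proj_tensor_def by blast
qed

lemma abelian_group_\<A>: "abelian_group \<A>"
  by (rule abelian_group_op_subalgebra(1)[OF _ BD(2) BD(3) BD(5)]) (use BD(1) in auto)

lemma \<A>_minus: "S \<in> B \<Longrightarrow> T \<in> B \<Longrightarrow> S \<ominus>\<^bsub>\<A>\<^esub> T = op_minus M S T"
  by (rule abelian_group_op_subalgebra(2)[OF _ BD(2) BD(3) BD(5)]) (use BD(1) in auto)

lemma form_bound_product:
  assumes "u \<in> L2 M" "w \<in> L2 M"
  shows "\<exists>K. form_bound K (\<lambda>x y. l2_inner M (x (y u)) w)"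
proof -
  have "form_bound (op_norm M (\<lambda>u\<in>L2 M. u) * l2_norm M u * l2_norm M w) (\<lambda>x y. l2_inner M (x (y u)) w)"
    by (rule form_bound_cong[OF form_bound_inner[OF bounded_ops_one assms]]) (use assms in simp)
  then show ?thesis by blast
qed

text \<open>\<open>product_map\<close> is a definite description. A candidate is determined by its
  matrix coefficients, which are the values of \<open>m\<close> on forms and so do not depend on the
  series; a candidate exists because the partial sums are Cauchy in norm.\<close>

lemma product_map:
  assumes m: "m \<in> proj_tensor \<A>"
  shows "product_map \<A> m \<in> B"
    and "\<And>u w. u \<in> L2 M \<Longrightarrow> w \<in> L2 M \<Longrightarrow> l2_inner M (product_map \<A> m u) w = m (\<lambda>x y. l2_inner M (x (y u)) w)"
proof -
  interpret G: abelian_group \<A> by (rule abelian_group_\<A>)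
  define P where "P c \<longleftrightarrow> c \<in> carrier \<A> \<and> (\<exists>a b. tensor_series \<A> a b \<and> m = tensor_sum \<A> a b \<and>
        (\<lambda>N. nrm \<A> (finsum \<A> (\<lambda>n. a n \<otimes>\<^bsub>\<A>\<^esub> b n) {..<N} \<ominus>\<^bsub>\<A>\<^esub> c)) \<longlonglongrightarrow> 0)" for c
  have part: "finsum \<A> (\<lambda>n. a n \<otimes>\<^bsub>\<A>\<^esub> b n) {..<N} \<in> B \<and>
      (\<forall>u\<in>L2 M. \<forall>w\<in>L2 M. l2_inner M (finsum \<A> (\<lambda>n. a n \<otimes>\<^bsub>\<A>\<^esub> b n) {..<N} u) w = (\<Sum>n<N. l2_inner M (a n (b n u)) w))"
    and part_Suc: "finsum \<A> (\<lambda>n. a n \<otimes>\<^bsub>\<A>\<^esub> b n) {..<Suc N} = oadd (comp (a N) (b N)) (finsum \<A> (\<lambda>n. a n \<otimes>\<^bsub>\<A>\<^esub> b n) {..<N})"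
    if ab: "tensor_series \<A> a b" for a b N
  proof -
    have mem: "a n \<in> B" "b n \<in> B" for n using ab by (auto simp: tensor_series_def)
    show suc: "finsum \<A> (\<lambda>n. a n \<otimes>\<^bsub>\<A>\<^esub> b n) {..<Suc N} = oadd (comp (a N) (b N)) (finsum \<A> (\<lambda>n. a n \<otimes>\<^bsub>\<A>\<^esub> b n) {..<N})" for N
      unfolding lessThan_Suc by (subst G.finsum_insert) (auto simp: BD(4) mem)
    show "finsum \<A> (\<lambda>n. a n \<otimes>\<^bsub>\<A>\<^esub> b n) {..<N} \<in> B \<and>
      (\<forall>u\<in>L2 M. \<forall>w\<in>L2 M. l2_inner M (finsum \<A> (\<lambda>n. a n \<otimes>\<^bsub>\<A>\<^esub> b n) {..<N} u) w = (\<Sum>n<N. l2_inner M (a n (b n u)) w))"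
    proof (induction N)
      case 0
      have "finsum \<A> (\<lambda>n. a n \<otimes>\<^bsub>\<A>\<^esub> b n) {..<0} = (\<lambda>u\<in>L2 M. l2_zero M)"
        by (simp only: lessThan_0 G.finsum_empty) simp
      moreover have "l2_inner M ((\<lambda>u\<in>L2 M. l2_zero M) u) w = 0" if "u \<in> L2 M" "w \<in> L2 M" for u w
        using that l2_inner_linear(7)[of "l2_zero M" M "l2_zero M" w] by simp
      ultimately show ?case using BD(2) by (simp only: lessThan_0 sum.empty) blast
    next
      case (Suc N)
      define S where "S = finsum \<A> (\<lambda>n. a n \<otimes>\<^bsub>\<A>\<^esub> b n) {..<N}"
      have S: "S \<in> B" "\<And>u w. u \<in> L2 M \<Longrightarrow> w \<in> L2 M \<Longrightarrow> l2_inner M (S u) w = (\<Sum>n<N. l2_inner M (a n (b n u)) w)"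
        using Suc unfolding S_def by blast+
      have "l2_inner M (oadd (comp (a N) (b N)) S u) w = (\<Sum>n<Suc N. l2_inner M (a n (b n u)) w)"
        if "u \<in> L2 M" "w \<in> L2 M" for u w
        using that S mem by (simp add: compose_def l2_inner_linear)
      then show ?case unfolding suc S_def[symmetric] using BD(3)[OF BD(4)[OF mem] S(1)] by blast
    qed
  qed
  have P_inner: "l2_inner M (c u) w = m (\<lambda>x y. l2_inner M (x (y u)) w)" if c: "P c" and uw: "u \<in> L2 M" "w \<in> L2 M" for c u w
  proof -
    obtain a b where ab: "c \<in> B" "tensor_series \<A> a b" "m = tensor_sum \<A> a b"
      and lim: "(\<lambda>N. op_norm M (finsum \<A> (\<lambda>n. a n \<otimes>\<^bsub>\<A>\<^esub> b n) {..<N} \<ominus>\<^bsub>\<A>\<^esub> c)) \<longlonglongrightarrow> 0"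
      using c unfolding P_def by auto
    let ?s = "\<lambda>N. finsum \<A> (\<lambda>n. a n \<otimes>\<^bsub>\<A>\<^esub> b n) {..<N}"
    have sB: "?s N \<in> B" for N using part[OF ab(2)] by blast
    have lim': "(\<lambda>N. op_norm M (op_minus M (?s N) c)) \<longlonglongrightarrow> 0"
      using lim by (simp only: \<A>_minus[OF sB ab(1)])
    have "l2_lim M (\<lambda>N. ?s N u) (c u)" by (rule op_norm_lim_strong[OF BD(1)[OF sB] BD(1)[OF ab(1)] lim' uw(1)])
    then have "(\<lambda>N. l2_inner M (?s N u) w) \<longlonglongrightarrow> l2_inner M (c u) w"
      by (rule l2_lim_inner(1)) (use sB ab(1) uw in simp_all)
    then have "(\<lambda>N. \<Sum>n<N. l2_inner M (a n (b n u)) w) \<longlonglongrightarrow> l2_inner M (c u) w"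
      using part[OF ab(2)] uw by simp
    then have "(\<lambda>n. l2_inner M (a n (b n u)) w) sums l2_inner M (c u) w" by (simp add: sums_def)
    moreover obtain K where "form_bound K (\<lambda>x y. l2_inner M (x (y u)) w)" using form_bound_product[OF uw] by blast
    ultimately show ?thesis unfolding ab(3) by (simp add: tensor_sum_apply sums_unique)
  qed
  have uniq: "c = c'" if "P c" "P c'" for c c'
  proof (rule bounded_ops_ext)
    have cB: "c \<in> B" "c' \<in> B" using that by (simp_all add: P_def)
    then show "c \<in> bounded_ops M" "c' \<in> bounded_ops M" using BD(1) by blast+
    fix u assume "u \<in> L2 M"
    then show "c u = c' u" using cB P_inner that by (intro l2_eqI_inner[of _ M]) simp_all
  qed
  have ex: "\<exists>c. P c"
  proof -
    obtain a b where ab: "tensor_series \<A> a b" "m = tensor_sum \<A> a b"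
      using m unfolding proj_tensor_def by blast
    have mem: "\<And>n. a n \<in> B" "\<And>n. b n \<in> B" and sm: "summable (\<lambda>n. op_norm M (a n) * op_norm M (b n))"
      using ab by (auto simp: tensor_series_def)
    let ?s = "\<lambda>N. finsum \<A> (\<lambda>n. a n \<otimes>\<^bsub>\<A>\<^esub> b n) {..<N}" and ?r = "\<lambda>n. op_norm M (a n) * op_norm M (b n)"
    have sB: "?s N \<in> B" for N using part[OF ab(1)] by blast
    have r0: "?r n \<ge> 0" for n by (intro mult_nonneg_nonneg op_norm_nonneg BD(1) mem)
    have tail: "l2_norm M (l2_minus M (?s (N + k) u) (?s N u)) \<le> (\<Sum>n<k. ?r (n + N)) * l2_norm M u" if u: "u \<in> L2 M" for N k u
    proof (induction k)
      case 0
      then show ?case using sB[of N] u by (simp add: l2_vector_space(11)[of _ M "l2_zero M" "l2_zero M"])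
    next
      case (Suc k)
      have id: "l2_minus M (l2_add M p q) r = l2_add M p (l2_minus M q r)" if "p \<in> L2 M" "q \<in> L2 M" "r \<in> L2 M" for p q r
        using that by (elim L2_cases, simp only: l2_class_simps) (simp add: algebra_simps)
      have "l2_norm M (a (N + k) (b (N + k) u)) \<le> ?r (N + k) * l2_norm M u"
        using op_norm_bound[OF bounded_ops_compose[OF BD(1)[OF mem(1)] BD(1)[OF mem(2)]] u, of "N + k" "N + k"]
          mult_right_mono[OF op_norm_compose[OF BD(1)[OF mem(1)] BD(1)[OF mem(2)]] l2_norm_nonneg[of M u], of "N + k" "N + k"] u
        by (simp add: compose_def)
      moreover have "l2_minus M (?s (N + Suc k) u) (?s N u) = l2_add M (a (N + k) (b (N + k) u)) (l2_minus M (?s (N + k) u) (?s N u))"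
        unfolding add_Suc_right part_Suc[OF ab(1)] using u sB mem by (simp add: id compose_def)
      ultimately show ?case
        using l2_norm_triangle[of "a (N + k) (b (N + k) u)" M "l2_minus M (?s (N + k) u) (?s N u)"] Suc u sB mem
        by (simp add: distrib_right add.commute)
    qed
    obtain S where S: "S \<in> bounded_ops M" "(\<lambda>n. op_norm M (op_minus M (?s n) S)) \<longlonglongrightarrow> 0"
    proof (rule op_norm_complete[OF fin BD(1)[OF sB]])
      fix e :: real assume e: "e > 0"
      obtain N where N: "\<And>n. n \<ge> N \<Longrightarrow> norm (\<Sum>i. ?r (i + n)) < e"
        using suminf_exist_split[OF e sm] by blast
      have "op_norm M (op_minus M (?s n) (?s k)) \<le> e" if "k \<ge> N" "n \<ge> k" for k n
      proof (rule op_norm_le)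
        fix u assume u: "u \<in> L2 M"
        have "(\<Sum>i<n - k. ?r (i + k)) \<le> (\<Sum>i. ?r (i + k))"
          using r0 sm by (intro sum_le_suminf) (auto simp: summable_iff_shift[of ?r])
        also have "\<dots> \<le> e" using N[OF that(1)] by (simp only: real_norm_def abs_le_iff less_imp_le)
        finally have "(\<Sum>i<n - k. ?r (i + k)) * l2_norm M u \<le> e * l2_norm M u" by (rule mult_right_mono) simp
        then show "l2_norm M (op_minus M (?s n) (?s k) u) \<le> e * l2_norm M u"
          using tail[OF u, of k "n - k"] that u by simp
      qed (use e in simp)
      then show "\<exists>N. \<forall>m\<ge>N. \<forall>n\<ge>m. op_norm M (op_minus M (?s n) (?s m)) \<le> e" by blast
    qed
    have SB: "S \<in> B" by (rule BD(7)[OF sB S])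
    have "(\<lambda>N. op_norm M (?s N \<ominus>\<^bsub>\<A>\<^esub> S)) \<longlonglongrightarrow> 0" using S(2) by (simp only: \<A>_minus[OF sB SB])
    then have "P S" unfolding P_def using ab SB by auto
    then show ?thesis by blast
  qed
  have "product_map \<A> m = (THE c. P c)" unfolding product_map_def P_def ..
  moreover have "P (THE c. P c)" by (rule theI'[OF ex_ex1I[OF ex uniq]])
  ultimately have "P (product_map \<A> m)" by simp
  then show "product_map \<A> m \<in> B"
    "\<And>u w. u \<in> L2 M \<Longrightarrow> w \<in> L2 M \<Longrightarrow> l2_inner M (product_map \<A> m u) w = m (\<lambda>x y. l2_inner M (x (y u)) w)"
    using P_inner by (simp_all add: P_def)
qed

text \<open>From here on the net is tested against individual forms only: boundedness, asymptotic
  commutation and the product condition all become statements about numbers.\<close>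

lemma amenable_net:
  assumes "amenable \<A>"
  obtains F C where "F \<noteq> bot" "eventually (\<lambda>m. m \<in> proj_tensor \<A>) F"
    "\<And>K \<phi>. form_bound K \<phi> \<Longrightarrow> eventually (\<lambda>m. cmod (m \<phi>) \<le> K * C) F"
    "\<And>K \<phi> a. form_bound K \<phi> \<Longrightarrow> a \<in> B \<Longrightarrow>
      ((\<lambda>m. m (\<lambda>x y. \<phi> (comp a x) y) - m (\<lambda>x y. \<phi> x (comp y a))) \<longlongrightarrow> 0) F"
    "\<And>u w. u \<in> L2 M \<Longrightarrow> w \<in> L2 M \<Longrightarrow> ((\<lambda>m. m (\<lambda>x y. l2_inner M (x (y u)) w)) \<longlongrightarrow> l2_inner M u w) F"
proof -
  obtain F C where F: "F \<noteq> bot" "F \<le> principal {m \<in> proj_tensor \<A>. proj_norm \<A> m \<le> C}"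
    and comm: "\<And>a. a \<in> B \<Longrightarrow> ((\<lambda>m. proj_norm \<A> (\<lambda>\<phi>. tensor_mult \<A> (pure_tensor \<A> a \<one>\<^bsub>\<A>\<^esub>) m \<phi>
                             - tensor_mult \<A> m (pure_tensor \<A> \<one>\<^bsub>\<A>\<^esub> a) \<phi>)) \<longlongrightarrow> 0) F"
    and prod: "((\<lambda>m. nrm \<A> (product_map \<A> m \<ominus>\<^bsub>\<A>\<^esub> \<one>\<^bsub>\<A>\<^esub>)) \<longlongrightarrow> 0) F"
    using assms unfolding amenable_def by auto
  have ev: "eventually (\<lambda>m. m \<in> proj_tensor \<A> \<and> proj_norm \<A> m \<le> C) F"
    using F(2) unfolding le_principal by simp
  show ?thesis
  proof (rule that[OF F(1), of C])
    show "eventually (\<lambda>m. m \<in> proj_tensor \<A>) F" using ev by eventually_elim blast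
    show "eventually (\<lambda>m. cmod (m \<phi>) \<le> K * C) F" if \<phi>: "form_bound K \<phi>" for K \<phi>
      using ev
    proof eventually_elim
      case (elim m)
      then show ?case using proj_norm_bound[OF _ \<phi>, of m] mult_left_mono[of "proj_norm \<A> m" C K] form_boundD(1)[OF \<phi>]
        by (meson order.trans)
    qed
    show "((\<lambda>m. m (\<lambda>x y. \<phi> (comp a x) y) - m (\<lambda>x y. \<phi> x (comp y a))) \<longlongrightarrow> 0) F"
      if \<phi>: "form_bound K \<phi>" and a: "a \<in> B" for K \<phi> a
    proof (rule Lim_null_comparison)
      show "eventually (\<lambda>m. norm (m (\<lambda>x y. \<phi> (comp a x) y) - m (\<lambda>x y. \<phi> x (comp y a))) \<le>
          K * proj_norm \<A> (\<lambda>\<phi>. tensor_mult \<A> (pure_tensor \<A> a \<one>\<^bsub>\<A>\<^esub>) m \<phi>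
                             - tensor_mult \<A> m (pure_tensor \<A> \<one>\<^bsub>\<A>\<^esub> a) \<phi>)) F"
        using ev
      proof eventually_elim
        case (elim m)
        then have m: "m \<in> proj_tensor \<A>" by simp
        show ?case
          using proj_norm_bound[OF commutator_tensor(1)[OF m a] \<phi>] unfolding commutator_tensor(2)[OF m a \<phi>] .
      qed
      show "((\<lambda>m. K * proj_norm \<A> (\<lambda>\<phi>. tensor_mult \<A> (pure_tensor \<A> a \<one>\<^bsub>\<A>\<^esub>) m \<phi>
                             - tensor_mult \<A> m (pure_tensor \<A> \<one>\<^bsub>\<A>\<^esub> a) \<phi>)) \<longlongrightarrow> 0) F"
        by (rule tendsto_mult_right_zero[OF comm[OF a]])
    qed
    show "((\<lambda>m. m (\<lambda>x y. l2_inner M (x (y u)) w)) \<longlongrightarrow> l2_inner M u w) F" if uw: "u \<in> L2 M" "w \<in> L2 M" for u w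
    proof -
      have "((\<lambda>m. m (\<lambda>x y. l2_inner M (x (y u)) w) - l2_inner M u w) \<longlongrightarrow> 0) F"
      proof (rule Lim_null_comparison)
        show "eventually (\<lambda>m. norm (m (\<lambda>x y. l2_inner M (x (y u)) w) - l2_inner M u w) \<le>
            nrm \<A> (product_map \<A> m \<ominus>\<^bsub>\<A>\<^esub> \<one>\<^bsub>\<A>\<^esub>) * (l2_norm M u * l2_norm M w)) F"
          using ev
        proof eventually_elim
          case (elim m)
          then have m: "m \<in> proj_tensor \<A>" by simp
          note pB = product_map(1)[OF m]
          let ?D = "op_minus M (product_map \<A> m) (\<lambda>u\<in>L2 M. u)"
          have D: "?D \<in> bounded_ops M" by (intro bounded_ops_minus BD(1) pB one_B)
          have "m (\<lambda>x y. l2_inner M (x (y u)) w) - l2_inner M u w = l2_inner M (?D u) w"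
            using product_map(2)[OF m uw] pB uw by (simp add: l2_inner_linear)
          also have "cmod \<dots> \<le> l2_norm M (?D u) * l2_norm M w"
            by (rule l2_Cauchy_Schwarz[OF bounded_opsD(1)[OF D uw(1)] uw(2)])
          also have "\<dots> \<le> (op_norm M ?D * l2_norm M u) * l2_norm M w"
            by (intro mult_right_mono op_norm_bound[OF D uw(1)]) simp
          also have "?D = product_map \<A> m \<ominus>\<^bsub>\<A>\<^esub> \<one>\<^bsub>\<A>\<^esub>" using \<A>_minus[OF pB one_B] by simp
          finally show ?case by (simp add: mult.assoc)
        qed
        show "((\<lambda>m. nrm \<A> (product_map \<A> m \<ominus>\<^bsub>\<A>\<^esub> \<one>\<^bsub>\<A>\<^esub>) * (l2_norm M u * l2_norm M w)) \<longlongrightarrow> 0) F"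
          by (rule tendsto_mult_left_zero[OF prod])
      qed
      then show ?thesis by (simp add: LIM_zero_iff)
    qed
  qed
qed

text \<open>The factor \<open>g j\<close> moves from the left leg to the right one, since the net asymptotically
  commutes with it.\<close>

lemma approximate_diagonal_average:
  assumes ev: "eventually (\<lambda>m. m \<in> proj_tensor \<A>) F"
    and comm: "\<And>K \<phi> a. form_bound K \<phi> \<Longrightarrow> a \<in> B \<Longrightarrow>
      ((\<lambda>m. m (\<lambda>x y. \<phi> (comp a x) y) - m (\<lambda>x y. \<phi> x (comp y a))) \<longlongrightarrow> 0) F"
    and \<phi>: "form_bound K \<phi>" and J: "finite J" "\<And>j. j \<in> J \<Longrightarrow> e j \<in> B" "\<And>j. j \<in> J \<Longrightarrow> g j \<in> B"
    and unit: "\<And>x y. x \<in> B \<Longrightarrow> y \<in> B \<Longrightarrow> (\<Sum>j\<in>J. \<phi> (comp (comp (e j) (g j)) x) y) = \<phi> x y"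
  shows "\<exists>K. form_bound K (\<lambda>x y. \<Sum>j\<in>J. \<phi> (comp (e j) x) (comp y (g j)))"
    and "((\<lambda>m. m \<phi> - m (\<lambda>x y. \<Sum>j\<in>J. \<phi> (comp (e j) x) (comp y (g j)))) \<longlongrightarrow> 0) F"
proof -
  have f1: "form_bound (K * op_norm M (e j) * 1) (\<lambda>x y. \<phi> (comp (e j) x) y)" if "j \<in> J" for j
    by (rule form_bound_map[OF \<phi> bounded_map_left[OF J(2)[OF that]] bounded_map_id])
  have f2: "form_bound (K * op_norm M (e j) * op_norm M (g j)) (\<lambda>x y. \<phi> (comp (e j) x) (comp y (g j)))" if "j \<in> J" for j
    by (rule form_bound_map[OF \<phi> bounded_map_left[OF J(2)[OF that]] bounded_map_right[OF J(3)[OF that]]])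
  have f3: "form_bound (K * op_norm M (e j) * 1 * op_norm M (g j) * 1) (\<lambda>x y. \<phi> (comp (e j) (comp (g j) x)) y)" if "j \<in> J" for j
    by (rule form_bound_map[OF f1[OF that] bounded_map_left[OF J(3)[OF that]] bounded_map_id])
  show "\<exists>K. form_bound K (\<lambda>x y. \<Sum>j\<in>J. \<phi> (comp (e j) x) (comp y (g j)))"
    by (rule exI, rule form_bound_sum[OF J(1) f2])
  \<comment> \<open>Commutation is applied to the form shifted by \<open>e j\<close> and to the
    element \<open>g j\<close>, once for each of the finitely many \<open>j\<close>.\<close>
  have "((\<lambda>m. \<Sum>j\<in>J. (m (\<lambda>x y. \<phi> (comp (e j) (comp (g j) x)) y) - m (\<lambda>x y. \<phi> (comp (e j) x) (comp y (g j))))) \<longlongrightarrow> (\<Sum>j\<in>J. 0)) F"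
    by (intro tendsto_sum comm[OF f1] J)
  then have "((\<lambda>m. \<Sum>j\<in>J. (m (\<lambda>x y. \<phi> (comp (e j) (comp (g j) x)) y) - m (\<lambda>x y. \<phi> (comp (e j) x) (comp y (g j))))) \<longlongrightarrow> 0) F"
    by simp
  then show "((\<lambda>m. m \<phi> - m (\<lambda>x y. \<Sum>j\<in>J. \<phi> (comp (e j) x) (comp y (g j)))) \<longlongrightarrow> 0) F"
  proof (rule Lim_transform_eventually)
    show "\<forall>\<^sub>F m in F. (\<Sum>j\<in>J. (m (\<lambda>x y. \<phi> (comp (e j) (comp (g j) x)) y) - m (\<lambda>x y. \<phi> (comp (e j) x) (comp y (g j))))) =
        m \<phi> - m (\<lambda>x y. \<Sum>j\<in>J. \<phi> (comp (e j) x) (comp y (g j)))"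
      using ev
    proof eventually_elim
      case (elim m)
      have "m \<phi> = m (\<lambda>x y. \<Sum>j\<in>J. \<phi> (comp (e j) (comp (g j) x)) y)"
        using unit by (intro tensor_cong[OF elim _ \<phi>]) (simp add: comp_assoc)
      also have "\<dots> = (\<Sum>j\<in>J. m (\<lambda>x y. \<phi> (comp (e j) (comp (g j) x)) y))"
        by (rule tensor_finite_sum[OF elim J(1) f3])
      finally show ?case using tensor_finite_sum[OF elim J(1) f2] by (simp add: sum_subtractf)
    qed
  qed
qed

end

section \<open>The local estimate\<close>

definition cinner :: "nat \<Rightarrow> (nat \<Rightarrow> complex) \<Rightarrow> (nat \<Rightarrow> complex) \<Rightarrow> complex" where
  "cinner n x y = (\<Sum>l<n. x l * cnj (y l))"

lemma cinner_self: "cinner n x x = complex_of_real (sq_norm n x)"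
  unfolding cinner_def sq_norm_def of_real_sum complex_norm_square ..

lemma cinner_cong: "(\<And>l. l < n \<Longrightarrow> x l = x' l) \<Longrightarrow> (\<And>l. l < n \<Longrightarrow> y l = y' l) \<Longrightarrow> cinner n x y = cinner n x' y'"
  unfolding cinner_def by (intro sum.cong) auto

lemma cinner_Cauchy_Schwarz: "(cmod (cinner n x y))\<^sup>2 \<le> sq_norm n x * sq_norm n y"
proof -
  have "cmod (cinner n x y) \<le> (\<Sum>l<n. cmod (x l) * cmod (y l))"
    unfolding cinner_def by (rule order.trans[OF norm_sum]) (simp add: norm_mult)
  then have "(cmod (cinner n x y))\<^sup>2 \<le> (\<Sum>l<n. cmod (x l) * cmod (y l))\<^sup>2"
    by (rule power_mono) simp
  also have "\<dots> \<le> sq_norm n x * sq_norm n y"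
    unfolding sq_norm_def by (rule Cauchy_Schwarz_ineq_sum)
  finally show ?thesis .
qed

lemma mat_app_add:
  assumes "A \<in> carrier_mat n n" "B \<in> carrier_mat n n" "j < n"
  shows "mat_app n (A + B) g j = mat_app n A g j + mat_app n B g j"
  unfolding mat_app_def sum.distrib[symmetric] using assms by (intro sum.cong) (auto simp: distrib_right)

lemma mat_app_smult:
  assumes "A \<in> carrier_mat n n" "j < n"
  shows "mat_app n (c \<cdot>\<^sub>m A) g j = c * mat_app n A g j"
  unfolding mat_app_def sum_distrib_left using assms by (intro sum.cong) auto

definition basis :: "nat \<Rightarrow> complex" where
  "basis l = (if l = 0 then 1 else 0)"

definition unit_mat :: "nat \<Rightarrow> nat \<Rightarrow> nat \<Rightarrow> complex mat" where
  "unit_mat n j l = mat n n (\<lambda>(a, b). if a = j \<and> b = l then 1 else 0)"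

lemma unit_mat_carrier [simp]: "unit_mat n j l \<in> carrier_mat n n"
  by (simp add: unit_mat_def)

lemma mat_app_unit:
  assumes "l < n" "m < n"
  shows "mat_app n (unit_mat n j l) g m = (if m = j then g l else 0)"
proof -
  have "mat_app n (unit_mat n j l) g m = (\<Sum>b<n. if b = l then (if m = j then g l else 0) else 0)"
    unfolding mat_app_def using assms by (intro sum.cong) (auto simp: unit_mat_def)
  then show ?thesis using assms by simp
qed

lemma mat_entry_app:
  assumes "A \<in> carrier_mat n n" "0 < n"
  shows "A $$ (0, 0) = mat_app n A basis 0"
proof -
  have "mat_app n A basis 0 = (\<Sum>l<n. if l = 0 then A $$ (0, 0) else 0)"
    unfolding mat_app_def by (intro sum.cong) (auto simp: basis_def)
  then show ?thesis using assms by simp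
qed

section \<open>Contractions from resolvents\<close>

context similarity_tensor
begin

lemma adj_carrier [simp]: "adj n b \<in> carrier_mat n n"
  by (simp add: adj_def)

lemma cinner_adj: "cinner n (mat_app n b g) h = cinner n g (mat_app n (adj n b) h)"
proof -
  have "cinner n (mat_app n b g) h = (\<Sum>l<n. \<Sum>j<n. b $$ (j, l) * g l * cnj (h j))"
    unfolding cinner_def mat_app_def sum_distrib_right by (rule sum.swap)
  also have "\<dots> = cinner n g (mat_app n (adj n b) h)"
    unfolding cinner_def mat_app_def sum_distrib_left cnj_sum
    by (intro sum.cong refl) (simp_all add: adj_def mult_ac)
  finally show ?thesis .
qed

lemma cinner_cnj: "cnj (cinner n x y) = cinner n y x"
  unfolding cinner_def by (simp add: mult.commute)

text \<open>A strictly positive matrix for r > 0; its inverse is the resolvent from which the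
  exchange of two fibres is built, with r = \<gamma>^2.\<close>

definition reg :: "nat \<Rightarrow> complex mat \<Rightarrow> real \<Rightarrow> complex mat" where
  "reg n S r = adj n S * S + complex_of_real r \<cdot>\<^sub>m 1\<^sub>m n"

lemma reg_carrier: "S \<in> carrier_mat n n \<Longrightarrow> reg n S r \<in> carrier_mat n n"
  unfolding reg_def by (intro add_carrier_mat smult_carrier_mat one_carrier_mat)

lemma mat_app_reg:
  assumes S: "S \<in> carrier_mat n n" and "j < n"
  shows "mat_app n (reg n S r) z j = mat_app n (adj n S) (mat_app n S z) j + complex_of_real r * z j"
proof -
  have 1: "adj n S * S \<in> carrier_mat n n" by (rule mult_carrier_mat[OF adj_carrier S])
  show ?thesis unfolding reg_def
    using assms by (simp add: mat_app_add[OF 1] mat_app_smult[of "1\<^sub>m n"] mat_app_one mat_app_mult[OF adj_carrier S])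
qed

lemma cinner_reg:
  assumes S: "S \<in> carrier_mat n n"
  shows "cinner n (mat_app n (reg n S r) z) z = complex_of_real (sq_norm n (mat_app n S z) + r * sq_norm n z)"
proof -
  have "cinner n (mat_app n (reg n S r) z) z =
      cinner n (\<lambda>j. mat_app n (adj n S) (mat_app n S z) j + complex_of_real r * z j) z"
    using S by (intro cinner_cong) (simp_all add: mat_app_reg)
  also have "\<dots> = cinner n (mat_app n (adj n S) (mat_app n S z)) z + complex_of_real r * cinner n z z"
    unfolding cinner_def by (simp add: distrib_right sum.distrib sum_distrib_left mult.assoc)
  also have "cinner n (mat_app n (adj n S) (mat_app n S z)) z = cinner n (mat_app n S z) (mat_app n S z)"
    by (metis cinner_adj cinner_cnj)
  finally show ?thesis by (simp add: cinner_self)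
qed

text \<open>The form of \<open>reg n S r\<close> at z is the squared norm of S z plus r times that
  of z, so the kernel is trivial.\<close>

lemma reg_inverse:
  assumes S: "S \<in> carrier_mat n n" and r: "r > 0"
  obtains Q where "Q \<in> carrier_mat n n" "Q * reg n S r = 1\<^sub>m n" "reg n S r * Q = 1\<^sub>m n"
proof -
  have "Determinant.det (reg n S r) \<noteq> 0"
  proof
    assume "Determinant.det (reg n S r) = 0"
    then obtain v where v: "v \<in> carrier_vec n" "v \<noteq> 0\<^sub>v n" "reg n S r *\<^sub>v v = 0\<^sub>v n"
      using det_0_iff_vec_prod_zero_field[OF reg_carrier[OF S]] by blast
    define z where "z l = v $ l" for l
    have "mat_app n (reg n S r) z j = 0" if "j < n" for j
    proof -
      have "mat_app n (reg n S r) z j = (reg n S r *\<^sub>v v) $ j"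
        using that v(1) reg_carrier[OF S, of r]
        by (simp add: mat_app_def scalar_prod_def z_def lessThan_atLeast0)
      then show ?thesis using v(3) that by simp
    qed
    then have "cinner n (mat_app n (reg n S r) z) z = 0" unfolding cinner_def by simp
    then have "sq_norm n (mat_app n S z) + r * sq_norm n z = 0"
      unfolding cinner_reg[OF S] by (simp only: of_real_eq_0_iff)
    then have "r * sq_norm n z = 0"
      using r add_nonneg_eq_0_iff[of "sq_norm n (mat_app n S z)" "r * sq_norm n z"] by simp
    then have "\<forall>l<n. z l = 0" using r by (simp add: sq_norm_eq_zero)
    then have "v = 0\<^sub>v n" using v(1) by (intro eq_vecI) (auto simp: z_def)
    then show False using v(2) by simp
  qed
  then have "reg n S r \<in> Units (ring_mat TYPE(complex) n ())"
    by (rule det_non_zero_imp_unit[OF reg_carrier[OF S]])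
  then show ?thesis using that unfolding Units_def ring_mat_def by auto
qed

text \<open>Let z = Q y, and let a and b be the squared norms of S z and z. Then a + r b =
  \<langle>y, z\<rangle>, and 4 a r b \<le> (a + r b)^2 is at most b times the squared norm of y;
  cancel b. For z = Q (adj S) y the pairing is \<langle>y, S z\<rangle> instead, and a cancels. The
  factor 4 r is the square of 2 \<gamma>.\<close>

lemma resolvent_contraction:
  assumes S: "S \<in> carrier_mat n n" and r: "r > 0"
    and Q: "Q \<in> carrier_mat n n" "reg n S r * Q = 1\<^sub>m n"
  shows "4 * r * sq_norm n (mat_app n S (mat_app n Q y)) \<le> sq_norm n y"
    and "4 * r * sq_norm n (mat_app n Q (mat_app n (adj n S) y)) \<le> sq_norm n y"
proof -
  have Qy: "mat_app n (reg n S r) (mat_app n Q y) j = y j" if "j < n" for y j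
    using mat_app_mult[OF reg_carrier[OF S] Q(1) that, of r y] that by (simp add: Q(2) mat_app_one)
  have am: "4 * (a * (r * z)) \<le> (a + r * z)\<^sup>2" for a z :: real
    using zero_le_power2[of "a - r * z"] by (simp add: power2_eq_square algebra_simps)
  show "4 * r * sq_norm n (mat_app n S (mat_app n Q y)) \<le> sq_norm n y"
  proof -
    let ?z = "mat_app n Q y"
    let ?a = "sq_norm n (mat_app n S ?z)" and ?b = "sq_norm n ?z"
    have "complex_of_real (?a + r * ?b) = cinner n y ?z"
      unfolding cinner_reg[OF S, symmetric] by (rule cinner_cong) (simp_all add: Qy)
    then have "(?a + r * ?b)\<^sup>2 = (cmod (cinner n y ?z))\<^sup>2"
      by (metis norm_of_real power2_abs)
    also have "\<dots> \<le> sq_norm n y * ?b" by (rule cinner_Cauchy_Schwarz)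
    finally have *: "(?a + r * ?b)\<^sup>2 \<le> sq_norm n y * ?b" .
    show ?thesis
    proof (cases "?b = 0")
      case True
      then have "?a\<^sup>2 \<le> 0" using * by simp
      then show ?thesis by simp
    next
      case False
      then have b: "?b > 0" using sq_norm_nonneg[of n ?z] by linarith
      have "(4 * r * ?a) * ?b \<le> sq_norm n y * ?b" using am[of ?a ?b] * by (simp add: mult_ac)
      then show ?thesis using b by (rule mult_right_le_imp_le)
    qed
  qed
  show "4 * r * sq_norm n (mat_app n Q (mat_app n (adj n S) y)) \<le> sq_norm n y"
  proof -
    let ?z = "mat_app n Q (mat_app n (adj n S) y)"
    let ?a = "sq_norm n (mat_app n S ?z)" and ?b = "sq_norm n ?z"
    have "complex_of_real (?a + r * ?b) = cinner n (mat_app n (adj n S) y) ?z"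
      unfolding cinner_reg[OF S, symmetric] by (rule cinner_cong) (simp_all add: Qy)
    also have "\<dots> = cinner n y (mat_app n S ?z)" by (metis cinner_adj cinner_cnj)
    finally have "(?a + r * ?b)\<^sup>2 = (cmod (cinner n y (mat_app n S ?z)))\<^sup>2"
      by (metis norm_of_real power2_abs)
    also have "\<dots> \<le> sq_norm n y * ?a" by (rule cinner_Cauchy_Schwarz)
    finally have *: "(?a + r * ?b)\<^sup>2 \<le> sq_norm n y * ?a" .
    show ?thesis
    proof (cases "?a = 0")
      case True
      then have "(r * ?b)\<^sup>2 \<le> 0" using * by simp
      then show ?thesis using r by simp
    next
      case False
      then have a: "?a > 0" using sq_norm_nonneg[of n "mat_app n S ?z"] by linarith
      have "(4 * r * ?b) * ?a \<le> sq_norm n y * ?a" using am[of ?a ?b] * by (simp add: mult_ac)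
      then show ?thesis using a by (rule mult_right_le_imp_le)
    qed
  qed
qed

section \<open>Vectors supported on finitely many fibres\<close>

lemma integral_fibres:
  fixes h :: "nat \<times> 'i \<Rightarrow> complex"
  assumes F: "finite F" "F \<subseteq> I k" and h: "\<And>l i. l < d k \<Longrightarrow> i \<in> I k \<Longrightarrow> i \<notin> F \<Longrightarrow> h (l, i) = 0"
  shows "(LINT q|X k. h q) = (\<Sum>i\<in>F. complex_of_real (f k i / d k) * (\<Sum>l<d k. h (l, i)))"
proof -
  let ?A = "{..<d k} \<times> I k" and ?g = "\<lambda>q. f k (snd q) / d k"
  have X: "X k = density (count_space ?A) (\<lambda>q. ennreal (?g q))"
    by (simp add: system_measure_def point_measure_def case_prod_unfold)
  have "(LINT q|X k. h q) = (LINT q|count_space ?A. ?g q *\<^sub>R h q)"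
    unfolding X by (rule integral_density) (auto simp: AE_count_space less_imp_le f_pos)
  also have "\<dots> = (\<Sum>q | q \<in> ?A \<and> ?g q *\<^sub>R h q \<noteq> 0. ?g q *\<^sub>R h q)"
  proof (rule lebesgue_integral_count_space_finite_support)
    have "{q \<in> ?A. ?g q *\<^sub>R h q \<noteq> 0} \<subseteq> {..<d k} \<times> F" using h by auto
    then show "finite {q \<in> ?A. ?g q *\<^sub>R h q \<noteq> 0}" by (rule finite_subset) (use F in simp)
  qed
  also have "\<dots> = (\<Sum>q\<in>{..<d k} \<times> F. ?g q *\<^sub>R h q)"
    using F h by (intro sum.mono_neutral_left) auto
  also have "\<dots> = (\<Sum>i\<in>F. \<Sum>l<d k. ?g (l, i) *\<^sub>R h (l, i))"
    by (subst sum.swap) (simp add: sum.cartesian_product case_prod_unfold)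
  finally show ?thesis by (simp add: sum_distrib_left scaleR_conv_of_real)
qed

lemma square_integrable_fibres:
  assumes F: "finite F" "F \<subseteq> I k" and h: "\<And>l i. l < d k \<Longrightarrow> i \<in> I k \<Longrightarrow> i \<notin> F \<Longrightarrow> h (l, i) = 0"
  shows "h \<in> square_integrable (X k)"
proof -
  have "(\<integral>\<^sup>+q. ennreal ((cmod (h q))\<^sup>2) \<partial>X k) = (\<Sum>i\<in>F. ennreal (f k i / d k * sq_norm (d k) (\<lambda>l. h (l, i))))"
    unfolding nn_integral_sq_X
  proof (rule nn_integral_count_space')
    show "ennreal (f k i / d k * sq_norm (d k) (\<lambda>l. h (l, i))) = 0" if "i \<in> I k" "i \<notin> F" for i
      using h that by (simp add: sq_norm_def)
  qed (use F in auto)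
  also have "\<dots> = ennreal (\<Sum>i\<in>F. f k i / d k * sq_norm (d k) (\<lambda>l. h (l, i)))"
    using F by (intro sum_ennreal mult_nonneg_nonneg divide_nonneg_nonneg sq_norm_nonneg) (auto intro: less_imp_le f_pos)
  finally show ?thesis unfolding square_integrable_iff_nn_integral by simp
qed

lemma l2_norm_fibres:
  assumes F: "finite F" "F \<subseteq> I k" and h: "\<And>l i. l < d k \<Longrightarrow> i \<in> I k \<Longrightarrow> i \<notin> F \<Longrightarrow> h (l, i) = 0"
  shows "(l2_norm (X k) (l2_class (X k) h))\<^sup>2 = (\<Sum>i\<in>F. f k i / d k * sq_norm (d k) (\<lambda>l. h (l, i)))"
proof -
  have S: "h \<in> square_integrable (X k)" by (rule square_integrable_fibres[where F = F and k = k and h = h, OF F h])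
  have "complex_of_real ((l2_norm (X k) (l2_class (X k) h))\<^sup>2) = (LINT q|X k. h q * cnj (h q))"
    unfolding l2_norm_inner by (rule l2_inner_class[OF S S])
  also have "\<dots> = (\<Sum>i\<in>F. complex_of_real (f k i / d k) * (\<Sum>l<d k. h (l, i) * cnj (h (l, i))))"
    using h by (intro integral_fibres F) simp
  also have "\<dots> = complex_of_real (\<Sum>i\<in>F. f k i / d k * sq_norm (d k) (\<lambda>l. h (l, i)))"
    unfolding cinner_def[symmetric] cinner_self by simp
  finally show ?thesis using of_real_eq_iff by blast
qed

definition i0 :: "nat \<Rightarrow> 'i" where "i0 k = (SOME i. i \<in> I k \<and> s k i = 1\<^sub>m (d k))"

lemma i0: "i0 k \<in> I k" "s k (i0 k) = 1\<^sub>m (d k)" "t k (i0 k) = 1\<^sub>m (d k)"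
proof -
  have "\<exists>i. i \<in> I k \<and> s k i = 1\<^sub>m (d k)" using sys[of k] by (force simp: similarity_system_def)
  then have *: "i0 k \<in> I k \<and> s k (i0 k) = 1\<^sub>m (d k)" unfolding i0_def by (rule someI_ex)
  then show "i0 k \<in> I k" "s k (i0 k) = 1\<^sub>m (d k)" by auto
  then show "t k (i0 k) = 1\<^sub>m (d k)" using s_inv(2,4)[of "i0 k" k] by simp
qed

lemma conj_mat_i0: "a \<in> carrier_mat (d k) (d k) \<Longrightarrow> conj_mat k a (i0 k) = a"
  by (simp add: conj_mat_def i0)

text \<open>One tensor factor of the form \<open>\<langle>x T y \<xi>, \<eta>\<rangle>\<close>: its average over matrix units is \<open>L\<close> times the
  functional \<open>(a, b) \<mapsto> (a b)\<^sub>0\<^sub>0\<close>.\<close>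

definition local_form :: "nat \<Rightarrow> ((nat \<times> 'i \<Rightarrow> complex) \<Rightarrow> nat \<times> 'i \<Rightarrow> complex) \<Rightarrow>
    (nat \<times> 'i \<Rightarrow> complex) \<Rightarrow> (nat \<times> 'i \<Rightarrow> complex) \<Rightarrow> complex mat \<Rightarrow> complex mat \<Rightarrow> complex" where
  "local_form k T \<xi> \<eta> a b = (LINT q|X k. loc_op (d k) (conj_mat k a) (\<lambda>i. i)
     (T (loc_op (d k) (conj_mat k b) (\<lambda>i. i) \<xi>)) q * cnj (\<eta> q))"

text \<open>A contraction and unit vectors in each coordinate give the tensor product of the forms
  norm at most 1, however many coordinates there are; \<open>L\<close> is what the average gains in
  this coordinate.\<close>

definition local_datum :: "nat \<Rightarrow> real \<Rightarrow> ('i \<Rightarrow> complex mat) \<Rightarrow> ('i \<Rightarrow> 'i) \<Rightarrow>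
    (nat \<times> 'i \<Rightarrow> complex) \<Rightarrow> (nat \<times> 'i \<Rightarrow> complex) \<Rightarrow> bool" where
  "local_datum k L B \<tau> \<xi> \<eta> \<longleftrightarrow> fibre_bounded k B \<tau> 1 \<and>
    \<xi> \<in> square_integrable (X k) \<and> \<eta> \<in> square_integrable (X k) \<and>
    l2_norm (X k) (l2_class (X k) \<xi>) = 1 \<and> l2_norm (X k) (l2_class (X k) \<eta>) = 1 \<and>
    (\<forall>a\<in>carrier_mat (d k) (d k). \<forall>b\<in>carrier_mat (d k) (d k).
      (\<Sum>j<d k. local_form k (loc_op (d k) B \<tau>) \<xi> \<eta> (unit_mat (d k) j 0 * a) (b * unit_mat (d k) 0 j)) =
        complex_of_real L * (a * b) $$ (0, 0))"

text \<open>The normalised indicator of the point in row 0 of the reference fibre, its value being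
  the inverse square root of the mass of that point. Its form is exactly the entry (0, 0) of a b,
  the functional to which all averages are reduced.\<close>

definition \<zeta> :: "nat \<Rightarrow> nat \<times> 'i \<Rightarrow> complex" where
  "\<zeta> k q = (if snd q = i0 k \<and> fst q = 0 then complex_of_real (sqrt (d k / f k (i0 k))) else 0)"

lemma \<zeta>_unit: "\<zeta> k \<in> square_integrable (X k)" "l2_norm (X k) (l2_class (X k) (\<zeta> k)) = 1"
proof -
  have F: "finite {i0 k}" "{i0 k} \<subseteq> I k" "\<And>l i. l < d k \<Longrightarrow> i \<in> I k \<Longrightarrow> i \<notin> {i0 k} \<Longrightarrow> \<zeta> k (l, i) = 0"
    using i0 by (auto simp: \<zeta>_def)
  show "\<zeta> k \<in> square_integrable (X k)" by (rule square_integrable_fibres[where F = "{i0 k}" and k = k and h = "\<zeta> k", OF F])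
  have "sq_norm (d k) (\<lambda>l. \<zeta> k (l, i0 k)) = (\<Sum>l<d k. if l = 0 then d k / f k (i0 k) else 0)"
    unfolding sq_norm_def using f_pos[OF i0(1), of k]
    by (intro sum.cong) (auto simp: \<zeta>_def)
  then have "(l2_norm (X k) (l2_class (X k) (\<zeta> k)))\<^sup>2 = 1"
    using l2_norm_fibres[where F = "{i0 k}" and k = k and h = "\<zeta> k", OF F] f_pos[OF i0(1), of k] d_pos[of k] by simp
  then show "l2_norm (X k) (l2_class (X k) (\<zeta> k)) = 1"
    using l2_norm_nonneg[of "X k" "l2_class (X k) (\<zeta> k)"] by (simp add: power2_eq_1_iff)
qed

lemma \<zeta>_form:
  assumes a: "a \<in> carrier_mat (d k) (d k)" and b: "b \<in> carrier_mat (d k) (d k)"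
  shows "local_form k (\<lambda>y. y) (\<zeta> k) (\<zeta> k) a b = (a * b) $$ (0, 0)"
proof -
  let ?n = "d k" and ?c = "complex_of_real (sqrt (d k / f k (i0 k)))"
  have c2: "?c * ?c = complex_of_real (d k / f k (i0 k))"
    unfolding of_real_mult[symmetric] using f_pos[OF i0(1), of k] by simp
  have \<zeta>0: "(\<lambda>l. \<zeta> k (l, i0 k)) = (\<lambda>l. ?c * basis l)" by (auto simp: \<zeta>_def basis_def)
  have ab: "a * b \<in> carrier_mat ?n ?n" using a b by simp
  have "local_form k (\<lambda>y. y) (\<zeta> k) (\<zeta> k) a b =
      (\<Sum>i\<in>{i0 k}. complex_of_real (f k i / d k) * (\<Sum>l<d k. loc_op ?n (conj_mat k a) (\<lambda>i. i)
        (loc_op ?n (conj_mat k b) (\<lambda>i. i) (\<zeta> k)) (l, i) * cnj (\<zeta> k (l, i))))"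
    unfolding local_form_def using i0 by (intro integral_fibres) (auto simp: \<zeta>_def)
  also have "\<dots> = complex_of_real (f k (i0 k) / d k) * (\<Sum>l<d k. mat_app ?n a (mat_app ?n b (\<lambda>l. \<zeta> k (l, i0 k))) l * cnj (\<zeta> k (l, i0 k)))"
    by (simp add: loc_op_def conj_mat_i0 a b)
  also have "(\<Sum>l<d k. mat_app ?n a (mat_app ?n b (\<lambda>l. \<zeta> k (l, i0 k))) l * cnj (\<zeta> k (l, i0 k))) =
      (\<Sum>l<d k. if l = 0 then ?c * ?c * mat_app ?n a (mat_app ?n b basis) 0 else 0)"
    unfolding \<zeta>0 mat_app_scale by (intro sum.cong) (auto simp: \<zeta>_def mult_ac)
  also have "\<dots> = ?c * ?c * (a * b) $$ (0, 0)"
    using d_pos[of k] mat_entry_app[OF ab d_pos] mat_app_mult[OF a b d_pos] by simp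
  finally show ?thesis
    unfolding c2 using f_pos[OF i0(1), of k] d_pos[of k] by simp
qed

lemma fibre_bounded_one: "fibre_bounded k (\<lambda>_. 1\<^sub>m (d k)) (\<lambda>i. i) 1"
proof -
  have "sq_norm (d k) (mat_app (d k) (1\<^sub>m (d k)) g) = sq_norm (d k) g" for g
    by (rule sq_norm_cong) (simp add: mat_app_one)
  then show ?thesis by (simp add: fibre_bounded_def bij_betw_def)
qed

text \<open>Covers the index \<open>i0 k\<close>, for which there is no second fibre to exchange
  with. Of the matrix units only \<open>j = 0\<close> contributes, because \<open>\<zeta> k\<close>
  lives in row 0.\<close>

lemma local_datum_trivial: "local_datum k 1 (\<lambda>_. 1\<^sub>m (d k)) (\<lambda>i. i) (\<zeta> k) (\<zeta> k)"
  unfolding local_datum_def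
proof (intro conjI ballI \<zeta>_unit fibre_bounded_one)
  let ?n = "d k"
  fix a b :: "complex mat" assume a: "a \<in> carrier_mat ?n ?n" and b: "b \<in> carrier_mat ?n ?n"
  have ab: "a * b \<in> carrier_mat ?n ?n" using a b by simp
  have one: "local_form k (loc_op ?n (\<lambda>_. 1\<^sub>m ?n) (\<lambda>i. i)) \<xi> \<eta> a b = local_form k (\<lambda>y. y) \<xi> \<eta> a b" for \<xi> \<eta> a b
    unfolding local_form_def
  proof (intro Bochner_Integration.integral_cong refl)
    fix q :: "nat \<times> 'i"
    have "loc_op ?n (\<lambda>_. 1\<^sub>m ?n) (\<lambda>i. i) y (l, snd q) = y (l, snd q)" if "l < ?n" for l y
      using that by (simp add: loc_op_def mat_app_one)
    then have "loc_op ?n (conj_mat k a) (\<lambda>i. i) (loc_op ?n (\<lambda>_. 1\<^sub>m ?n) (\<lambda>i. i) y) q = loc_op ?n (conj_mat k a) (\<lambda>i. i) y q" for y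
      unfolding loc_op_def[of _ "conj_mat k a"] by (intro mat_app_cong)
    then show "loc_op ?n (conj_mat k a) (\<lambda>i. i) (loc_op ?n (\<lambda>_. 1\<^sub>m ?n) (\<lambda>i. i) (loc_op ?n (conj_mat k b) (\<lambda>i. i) \<xi>)) q * cnj (\<eta> q) =
        loc_op ?n (conj_mat k a) (\<lambda>i. i) (loc_op ?n (conj_mat k b) (\<lambda>i. i) \<xi>) q * cnj (\<eta> q)" by simp
  qed
  have "local_form k (loc_op ?n (\<lambda>_. 1\<^sub>m ?n) (\<lambda>i. i)) (\<zeta> k) (\<zeta> k) (unit_mat ?n j 0 * a) (b * unit_mat ?n 0 j) =
      (if j = 0 then (a * b) $$ (0, 0) else 0)" if j: "j < ?n" for j
  proof -
    have u: "unit_mat ?n j 0 * a \<in> carrier_mat ?n ?n" "b * unit_mat ?n 0 j \<in> carrier_mat ?n ?n"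
      by (rule mult_carrier_mat[OF unit_mat_carrier a], rule mult_carrier_mat[OF b unit_mat_carrier])
    have "local_form k (loc_op ?n (\<lambda>_. 1\<^sub>m ?n) (\<lambda>i. i)) (\<zeta> k) (\<zeta> k) (unit_mat ?n j 0 * a) (b * unit_mat ?n 0 j) =
        mat_app ?n ((unit_mat ?n j 0 * a) * (b * unit_mat ?n 0 j)) basis 0"
      unfolding one \<zeta>_form[OF u] using u by (intro mat_entry_app d_pos) simp
    also have "\<dots> = mat_app ?n (unit_mat ?n j 0) (mat_app ?n a (mat_app ?n (b * unit_mat ?n 0 j) basis)) 0"
      using mat_app_mult[OF u d_pos] mat_app_mult[OF unit_mat_carrier a d_pos] by simp
    also have "\<dots> = (if j = 0 then mat_app ?n a (mat_app ?n (b * unit_mat ?n 0 j) basis) 0 else 0)"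
      using mat_app_unit[of 0 ?n 0] d_pos[of k] by auto
    also have "mat_app ?n a (mat_app ?n (b * unit_mat ?n 0 j) basis) 0 = mat_app ?n a (mat_app ?n b (mat_app ?n (unit_mat ?n 0 j) basis)) 0"
      by (rule mat_app_cong) (simp add: mat_app_mult[OF b unit_mat_carrier])
    also have "(if j = 0 then \<dots> else 0) = (if j = 0 then mat_app ?n a (mat_app ?n b basis) 0 else 0)"
    proof -
      have "mat_app ?n b (mat_app ?n (unit_mat ?n 0 0) basis) = mat_app ?n b basis"
        by (intro ext mat_app_cong) (use mat_app_unit[of 0 ?n] d_pos[of k] in \<open>auto simp: basis_def\<close>)
      then show ?thesis by simp
    qed
    finally show ?thesis using mat_entry_app[OF ab d_pos] mat_app_mult[OF a b d_pos] by simp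
  qed
  then show "(\<Sum>j<?n. local_form k (loc_op ?n (\<lambda>_. 1\<^sub>m ?n) (\<lambda>i. i)) (\<zeta> k) (\<zeta> k) (unit_mat ?n j 0 * a) (b * unit_mat ?n 0 j)) =
      complex_of_real 1 * (a * b) $$ (0, 0)"
    using d_pos[of k] by simp
qed

text \<open>The contraction interchanges the fibres over \<open>i0 k\<close> and \<open>i\<close>. With \<open>S = s k i\<close> it is
  \<open>2 \<gamma> S (S\<^sup>* S + \<gamma>\<^sup>2)\<^sup>-\<^sup>1\<close> in one direction and the adjoint in the other, which is a contraction by
  the inequality between arithmetic and geometric means.\<close>

lemma local_datum_exists:
  assumes i: "i \<in> I k" and v: "sq_norm (d k) v = 1" and w: "sq_norm (d k) w = 1"
  shows "\<exists>B \<tau> \<xi> \<eta>. local_datum k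
    (sqrt (sqrt (sq_norm (d k) (mat_app (d k) (t k i) v)) * sqrt (sq_norm (d k) (mat_app (d k) (s k i) w)))) B \<tau> \<xi> \<eta>"
proof (cases "i = i0 k")
  \<comment> \<open>Over the reference fibre both similarities are the identity, so the constant is
    1.\<close>
  case True
  have "sq_norm (d k) (mat_app (d k) (1\<^sub>m (d k)) g) = sq_norm (d k) g" for g
    by (rule sq_norm_cong) (simp add: mat_app_one)
  then show ?thesis using local_datum_trivial[of k] v w by (force simp: True i0)
next
  case False
  let ?n = "d k" and ?o = "i0 k"
  let ?app = "mat_app ?n"
  define S where "S = s k i"
  define p where "p = sqrt (sq_norm ?n (?app (t k i) v))"
  define p' where "p' = sqrt (sq_norm ?n (?app S w))"
  note sinv = s_inv[OF i] i0[of k]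
  have S: "S \<in> carrier_mat ?n ?n" using sinv(1) by (simp add: S_def)
  \<comment> \<open>An invertible matrix does not annihilate a unit vector, so \<open>p\<close> and
    \<open>p'\<close> are positive and may be divided by.\<close>
  have inj: "sq_norm ?n g = 0" if z: "sq_norm ?n (?app A g) = 0" and A: "A \<in> carrier_mat ?n ?n" and C: "C \<in> carrier_mat ?n ?n" and CA: "C * A = 1\<^sub>m ?n" for A C g
  proof -
    have "?app A g l = 0" if "l < ?n" for l using z that by (simp add: sq_norm_eq_zero)
    have "g j = 0" if j: "j < ?n" for j
    proof -
      have "g j = ?app (C * A) g j" using j by (simp add: CA mat_app_one)
      also have "\<dots> = ?app C (?app A g) j" by (rule mat_app_mult[OF C A j])
      also have "\<dots> = ?app C (\<lambda>_. 0) j" by (rule mat_app_cong) fact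
      finally show ?thesis by (simp add: mat_app_def)
    qed
    then show ?thesis by (simp add: sq_norm_eq_zero)
  qed
  have p: "p > 0"
    unfolding p_def using inj[of "t k i" v "s k i"] sinv v sq_norm_nonneg[of ?n "?app (t k i) v"]
    by (auto simp: less_le)
  have p': "p' > 0"
    unfolding p'_def S_def using inj[of "s k i" w "t k i"] sinv w sq_norm_nonneg[of ?n "?app (s k i) w"]
    by (auto simp: less_le)
  \<comment> \<open>With this \<open>r\<close> one has p x + p' y = p (x + r y), to which the
    resolvent identity Q (adj S S + r) = 1 applies.\<close>
  define r where "r = p' / p"
  define \<gamma> where "\<gamma> = sqrt r"
  have r: "r > 0" using p p' by (simp add: r_def)
  have \<gamma>: "\<gamma> > 0" "\<gamma>\<^sup>2 = r" using r by (auto simp: \<gamma>_def)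
  obtain Q where Q: "Q \<in> carrier_mat ?n ?n" "Q * reg ?n S r = 1\<^sub>m ?n" "reg ?n S r * Q = 1\<^sub>m ?n"
    by (rule reg_inverse[OF S r])
  \<comment> \<open>Amplitudes on the fibres over \<open>?o\<close> and \<open>i\<close>, chosen so
    that each fibre carries half of the squared norm of a unit vector.\<close>
  define c0 where "c0 = sqrt (?n / (2 * f k ?o))"
  define ci where "ci = sqrt (?n / (2 * f k i))"
  have fp: "f k ?o > 0" "f k i > 0" "real ?n > 0" using f_pos i sinv d_pos by auto
  have c: "c0 > 0" "ci > 0" "c0\<^sup>2 = ?n / (2 * f k ?o)" "ci\<^sup>2 = ?n / (2 * f k i)"
    using fp by (auto simp: c0_def ci_def)
  \<comment> \<open>The ratios of amplitudes compensate for the different masses of the two fibres;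
    up to these ratios both matrices are contractions and adjoint to each other.\<close>
  define T where "T = complex_of_real (2 * \<gamma> * (c0 / ci)) \<cdot>\<^sub>m (Q * adj ?n S)"
  define T' where "T' = complex_of_real (2 * \<gamma> * (ci / c0)) \<cdot>\<^sub>m (S * Q)"
  have QS: "Q * adj ?n S \<in> carrier_mat ?n ?n" "S * Q \<in> carrier_mat ?n ?n" using Q S by auto
  have T_app: "?app T g j = complex_of_real (2 * \<gamma> * (c0 / ci)) * ?app Q (?app (adj ?n S) g) j"
    and T'_app: "?app T' g j = complex_of_real (2 * \<gamma> * (ci / c0)) * ?app S (?app Q g) j" if "j < ?n" for g j
    unfolding T_def T'_def using mat_app_smult[OF QS(1) that] mat_app_smult[OF QS(2) that]
      mat_app_mult[OF Q(1) adj_carrier that] mat_app_mult[OF S Q(1) that] by auto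
  \<comment> \<open>All fibres other than the two that are exchanged are annihilated;
    \<open>\<tau>\<close> is the transposition.\<close>
  define B where "B i' = (if i' = ?o then T else if i' = i then T' else 0\<^sub>m ?n ?n)" for i'
  define \<tau> where "\<tau> i' = (if i' = ?o then i else if i' = i then ?o else i')" for i'
  \<comment> \<open>Unit vectors in the directions of the inverse of S applied to \<open>v\<close>
    and of S applied to \<open>w\<close>: pairing these images with them yields \<open>p\<close> and
    \<open>p'\<close>.\<close>
  define v' where "v' l = complex_of_real (1 / p) * ?app (t k i) v l" for l
  define w' where "w' l = complex_of_real (1 / p') * ?app S w l" for l
  define \<xi> where "\<xi> q = (if snd q = i then complex_of_real ci * v (fst q) else if snd q = ?o then complex_of_real c0 * w (fst q) else 0)" for q
  define \<eta> where "\<eta> q = (if snd q = i then complex_of_real ci * w' (fst q) else if snd q = ?o then complex_of_real c0 * v' (fst q) else 0)" for q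
  have F: "finite {?o, i}" "{?o, i} \<subseteq> I k" using i sinv by auto
  have v'1: "sq_norm ?n v' = 1" and w'1: "sq_norm ?n w' = 1"
  proof -
    have "sq_norm ?n v' = (1 / p)\<^sup>2 * p\<^sup>2"
      unfolding v'_def[abs_def] sq_norm_scale p_def by (simp add: norm_divide)
    then show "sq_norm ?n v' = 1" using p by (simp add: power_divide)
    have "sq_norm ?n w' = (1 / p')\<^sup>2 * p'\<^sup>2"
      unfolding w'_def[abs_def] sq_norm_scale p'_def by (simp add: norm_divide)
    then show "sq_norm ?n w' = 1" using p' by (simp add: power_divide)
  qed
  have unit: "h \<in> square_integrable (X k)" "l2_norm (X k) (l2_class (X k) h) = 1"
    if h: "\<And>q. h q = (if snd q = i then complex_of_real ci * x (fst q) else if snd q = ?o then complex_of_real c0 * y (fst q) else 0)"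
      and xy: "sq_norm ?n x = 1" "sq_norm ?n y = 1" for h x y
  proof -
    have z: "\<And>l i'. l < ?n \<Longrightarrow> i' \<in> I k \<Longrightarrow> i' \<notin> {?o, i} \<Longrightarrow> h (l, i') = 0" by (simp add: h)
    show "h \<in> square_integrable (X k)" by (rule square_integrable_fibres[where F = "{?o, i}" and k = k and h = h, OF F z])
    have "(\<lambda>l. h (l, i)) = (\<lambda>l. complex_of_real ci * x l)" "(\<lambda>l. h (l, ?o)) = (\<lambda>l. complex_of_real c0 * y l)"
      using False by (auto simp: h)
    then have "(l2_norm (X k) (l2_class (X k) h))\<^sup>2 = f k ?o / ?n * c0\<^sup>2 + f k i / ?n * ci\<^sup>2"
      using l2_norm_fibres[where F = "{?o, i}" and k = k and h = h, OF F z] False xy by (simp add: sq_norm_scale)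
    also have "\<dots> = 1" using fp by (simp add: c(3,4))
    finally show "l2_norm (X k) (l2_class (X k) h) = 1"
      using l2_norm_nonneg[of "X k" "l2_class (X k) h"] by (simp add: power2_eq_1_iff)
  qed
  have bounded: "fibre_bounded k B \<tau> 1"
    unfolding fibre_bounded_def
  proof (intro conjI ballI allI)
    show "bij_betw \<tau> (I k) (I k)"
      by (rule bij_betw_byWitness[where f' = \<tau>]) (use i sinv in \<open>auto simp: \<tau>_def\<close>)
    fix i' g assume i': "i' \<in> I k"
    have cc: "(c0 / ci)\<^sup>2 = f k i / f k ?o" "(ci / c0)\<^sup>2 = f k ?o / f k i"
      using fp by (simp_all add: power_divide c(3,4))
    have "sq_norm ?n (?app T g) = (2 * \<gamma> * (c0 / ci))\<^sup>2 * sq_norm ?n (?app Q (?app (adj ?n S) g))"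
      using sq_norm_scale[of ?n "complex_of_real (2 * \<gamma> * (c0 / ci))"] sq_norm_cong[of ?n "?app T g", OF T_app]
      by (simp only: norm_of_real power2_abs)
    also have "\<dots> = f k i / f k ?o * (4 * r * sq_norm ?n (?app Q (?app (adj ?n S) g)))"
      unfolding power_mult_distrib cc \<gamma>(2) by simp
    also have "\<dots> \<le> f k i / f k ?o * sq_norm ?n g"
      using fp by (intro mult_left_mono resolvent_contraction[OF S r Q(1,3)]) simp
    finally have T1: "f k ?o * sq_norm ?n (?app T g) \<le> f k i * sq_norm ?n g" using fp by (simp add: field_simps)
    have "sq_norm ?n (?app T' g) = (2 * \<gamma> * (ci / c0))\<^sup>2 * sq_norm ?n (?app S (?app Q g))"
      using sq_norm_scale[of ?n "complex_of_real (2 * \<gamma> * (ci / c0))"] sq_norm_cong[of ?n "?app T' g", OF T'_app]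
      by (simp only: norm_of_real power2_abs)
    also have "\<dots> = f k ?o / f k i * (4 * r * sq_norm ?n (?app S (?app Q g)))"
      unfolding power_mult_distrib cc \<gamma>(2) by simp
    also have "\<dots> \<le> f k ?o / f k i * sq_norm ?n g"
      using fp by (intro mult_left_mono resolvent_contraction[OF S r Q(1,3)]) simp
    finally have T2: "f k i * sq_norm ?n (?app T' g) \<le> f k ?o * sq_norm ?n g" using fp by (simp add: field_simps)
    have "sq_norm ?n (?app (0\<^sub>m ?n ?n) g) = 0" by (simp add: sq_norm_eq_zero mat_app_def)
    then show "f k i' * sq_norm ?n (?app (B i') g) \<le> 1 * (f k (\<tau> i') * sq_norm ?n g)"
      using T1 T2 False f_pos[OF i'] by (auto simp: B_def \<tau>_def less_imp_le)
  qed simp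
  have main: "(\<Sum>j<?n. local_form k (loc_op ?n B \<tau>) \<xi> \<eta> (unit_mat ?n j 0 * a) (b * unit_mat ?n 0 j)) =
      complex_of_real (sqrt (p * p')) * (a * b) $$ (0, 0)"
    if a: "a \<in> carrier_mat ?n ?n" and b: "b \<in> carrier_mat ?n ?n" for a b
  proof -
    have ab: "a * b \<in> carrier_mat ?n ?n" using a b by simp
    \<comment> \<open>The scalars left over from the passage from \<open>i\<close> to
      \<open>?o\<close> and from \<open>?o\<close> to \<open>i\<close> respectively.\<close>
    define x where "x = ?app a (?app Q (?app (adj ?n S) (?app S (?app b basis)))) 0"
    define y where "y = ?app a (?app Q (?app b basis)) 0"
    have xy: "complex_of_real p * x + complex_of_real p' * y = complex_of_real p * (a * b) $$ (0, 0)"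
    proof -
      have lin: "?app A (\<lambda>l. g l + complex_of_real r * h l) j = ?app A g j + complex_of_real r * ?app A h j" for A g h j
        unfolding mat_app_def by (simp add: distrib_left sum.distrib sum_distrib_left mult_ac)
      have "?app Q (?app (adj ?n S) (?app S g)) j + complex_of_real r * ?app Q g j = g j" if j: "j < ?n" for g j
      proof -
        have "g j = ?app (Q * reg ?n S r) g j" using j by (simp add: Q(2) mat_app_one)
        also have "\<dots> = ?app Q (?app (reg ?n S r) g) j" by (rule mat_app_mult[OF Q(1) reg_carrier[OF S] j])
        also have "\<dots> = ?app Q (\<lambda>l. ?app (adj ?n S) (?app S g) l + complex_of_real r * g l) j"
          by (rule mat_app_cong) (rule mat_app_reg[OF S])
        finally show ?thesis by (simp add: lin)
      qed
      then have "x + complex_of_real r * y = ?app a (?app b basis) 0"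
        unfolding x_def y_def lin[symmetric] by (intro mat_app_cong) simp
      also have "\<dots> = (a * b) $$ (0, 0)" using mat_entry_app[OF ab d_pos] mat_app_mult[OF a b d_pos] by simp
      finally have "x + complex_of_real r * y = (a * b) $$ (0, 0)" .
      moreover have "complex_of_real p' = complex_of_real p * complex_of_real r" using p by (simp add: r_def)
      ultimately show ?thesis by (metis distrib_left mult.assoc)
    qed
    have form: "local_form k (loc_op ?n B \<tau>) \<xi> \<eta> (unit_mat ?n j 0 * a) (b * unit_mat ?n 0 j) =
        complex_of_real \<gamma> * x * (?app (t k i) v j * cnj (v' j)) +
        complex_of_real \<gamma> * y * (w j * cnj (?app (adj ?n S) w' j))" if j: "j < ?n" for j
    proof -
      let ?a = "unit_mat ?n j 0 * a" and ?b = "b * unit_mat ?n 0 j"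
      have u: "?a \<in> carrier_mat ?n ?n" "?b \<in> carrier_mat ?n ?n"
        by (rule mult_carrier_mat[OF unit_mat_carrier a], rule mult_carrier_mat[OF b unit_mat_carrier])
      have a_app: "?app ?a g l = (if l = j then ?app a g 0 else 0)" if "l < ?n" for g l
        using mat_app_mult[OF unit_mat_carrier a that] mat_app_unit[OF d_pos that] by simp
      have b_app: "?app ?b g l = g j * ?app b basis l" if "l < ?n" for g l
      proof -
        have "?app ?b g l = ?app b (?app (unit_mat ?n 0 j) g) l" by (rule mat_app_mult[OF b unit_mat_carrier that])
        also have "\<dots> = ?app b (\<lambda>m. g j * basis m) l"
          by (rule mat_app_cong) (simp add: mat_app_unit[OF j] basis_def)
        finally show ?thesis by (simp add: mat_app_scale)
      qed
      \<comment> \<open>\<open>y0\<close>, \<open>y1\<close> and \<open>y2\<close> follow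
        \<open>\<xi>\<close> through b, the exchange and a. The matrix units in \<open>?b\<close>
        and \<open>?a\<close> reduce each passage to a scalar times the j-th coordinates of the
        vectors involved.\<close>
      define y0 where "y0 = loc_op ?n (conj_mat k ?b) (\<lambda>i. i) \<xi>"
      have y0i: "y0 (l, i) = complex_of_real ci * ?app (t k i) v j * ?app S (?app b basis) l" if l: "l < ?n" for l
      proof -
        have "y0 (l, i) = ?app (conj_mat k ?b i) (\<lambda>l. complex_of_real ci * v l) l"
          by (simp add: y0_def loc_op_def \<xi>_def)
        also have "\<dots> = ?app S (?app ?b (?app (t k i) (\<lambda>l. complex_of_real ci * v l))) l"
          using mat_app_conj_mat[OF i u(2) l] by (simp add: S_def)
        also have "\<dots> = ?app S (\<lambda>m. ?app (t k i) (\<lambda>l. complex_of_real ci * v l) j * ?app b basis m) l"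
          by (rule mat_app_cong) (rule b_app)
        finally show ?thesis by (simp add: mat_app_scale)
      qed
      have y0o: "y0 (l, ?o) = complex_of_real c0 * w j * ?app b basis l" if l: "l < ?n" for l
        using b_app[OF l, of "\<lambda>l. complex_of_real c0 * w l"] False
        by (simp add: y0_def loc_op_def \<xi>_def conj_mat_i0[OF u(2)])
      define y1 where "y1 = loc_op ?n B \<tau> y0"
      have y1o: "y1 (l, ?o) = complex_of_real (2 * \<gamma> * c0) * ?app (t k i) v j *
          ?app Q (?app (adj ?n S) (?app S (?app b basis))) l" if l: "l < ?n" for l
      proof -
        have "y1 (l, ?o) = ?app T (\<lambda>l. y0 (l, i)) l" by (simp add: y1_def loc_op_def B_def \<tau>_def)
        also have "\<dots> = ?app T (\<lambda>l. complex_of_real ci * ?app (t k i) v j * ?app S (?app b basis) l) l"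
          by (rule mat_app_cong) (rule y0i)
        also have "\<dots> = complex_of_real ci * ?app (t k i) v j * (complex_of_real (2 * \<gamma> * (c0 / ci)) *
            ?app Q (?app (adj ?n S) (?app S (?app b basis))) l)"
          by (simp only: mat_app_scale T_app[OF l])
        finally show ?thesis using c(2) by simp
      qed
      have y1i: "y1 (l, i) = complex_of_real (2 * \<gamma> * ci) * w j * ?app S (?app Q (?app b basis)) l" if l: "l < ?n" for l
      proof -
        have "y1 (l, i) = ?app T' (\<lambda>l. y0 (l, ?o)) l" using False by (simp add: y1_def loc_op_def B_def \<tau>_def)
        also have "\<dots> = ?app T' (\<lambda>l. complex_of_real c0 * w j * ?app b basis l) l"
          by (rule mat_app_cong) (rule y0o)
        also have "\<dots> = complex_of_real c0 * w j * (complex_of_real (2 * \<gamma> * (ci / c0)) * ?app S (?app Q (?app b basis)) l)"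
          by (simp only: mat_app_scale T'_app[OF l])
        finally show ?thesis using c(1) by simp
      qed
      define y2 where "y2 = loc_op ?n (conj_mat k ?a) (\<lambda>i. i) y1"
      have y2o: "y2 (l, ?o) = (if l = j then complex_of_real (2 * \<gamma> * c0) * ?app (t k i) v j * x else 0)" if l: "l < ?n" for l
      proof -
        have "y2 (l, ?o) = ?app ?a (\<lambda>l. y1 (l, ?o)) l" by (simp add: y2_def loc_op_def conj_mat_i0[OF u(1)])
        also have "\<dots> = (if l = j then ?app a (\<lambda>l. y1 (l, ?o)) 0 else 0)" by (rule a_app[OF l])
        also have "?app a (\<lambda>l. y1 (l, ?o)) 0 = ?app a (\<lambda>l. complex_of_real (2 * \<gamma> * c0) * ?app (t k i) v j *
            ?app Q (?app (adj ?n S) (?app S (?app b basis))) l) 0"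
          by (rule mat_app_cong) (rule y1o)
        also have "\<dots> = complex_of_real (2 * \<gamma> * c0) * ?app (t k i) v j * x" by (simp only: mat_app_scale x_def)
        finally show ?thesis .
      qed
      have y2i: "y2 (l, i) = complex_of_real (2 * \<gamma> * ci) * w j * y * ?app S (\<lambda>m. if m = j then 1 else 0) l" if l: "l < ?n" for l
      proof -
        have "?app (t k i) (\<lambda>l. y1 (l, i)) m = complex_of_real (2 * \<gamma> * ci) * w j * ?app Q (?app b basis) m" if m: "m < ?n" for m
        proof -
          have "?app (t k i) (\<lambda>l. y1 (l, i)) m = ?app (t k i) (\<lambda>l. complex_of_real (2 * \<gamma> * ci) * w j * ?app S (?app Q (?app b basis)) l) m"
            by (rule mat_app_cong) (rule y1i)
          also have "\<dots> = complex_of_real (2 * \<gamma> * ci) * w j * ?app (t k i) (?app S (?app Q (?app b basis))) m"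
            by (simp only: mat_app_scale)
          finally show ?thesis using s_t_app(2)[OF i m] by (simp add: S_def)
        qed
        note t_y1 = this
        have "y2 (l, i) = ?app S (?app ?a (?app (t k i) (\<lambda>l. y1 (l, i)))) l"
          using mat_app_conj_mat[OF i u(1) l] by (simp add: y2_def loc_op_def S_def)
        also have "\<dots> = ?app S (\<lambda>m. (complex_of_real (2 * \<gamma> * ci) * w j * y) * (if m = j then 1 else 0)) l"
        proof (rule mat_app_cong)
          fix m assume m: "m < ?n"
          have "?app a (?app (t k i) (\<lambda>l. y1 (l, i))) 0 = ?app a (\<lambda>m. complex_of_real (2 * \<gamma> * ci) * w j * ?app Q (?app b basis) m) 0"
            by (rule mat_app_cong) (rule t_y1)
          also have "\<dots> = complex_of_real (2 * \<gamma> * ci) * w j * y" by (simp only: mat_app_scale y_def)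
          finally show "?app ?a (?app (t k i) (\<lambda>l. y1 (l, i))) m = (complex_of_real (2 * \<gamma> * ci) * w j * y) * (if m = j then 1 else 0)"
            using a_app[OF m] by simp
        qed
        finally show ?thesis by (simp only: mat_app_scale)
      qed
      have "local_form k (loc_op ?n B \<tau>) \<xi> \<eta> ?a ?b = (LINT q|X k. y2 q * cnj (\<eta> q))"
        by (simp add: local_form_def y2_def y1_def y0_def)
      also have "\<dots> = (\<Sum>i\<in>{?o, i}. complex_of_real (f k i / ?n) * (\<Sum>l<?n. y2 (l, i) * cnj (\<eta> (l, i))))"
        by (rule integral_fibres[OF F]) (simp add: \<eta>_def)
      also have "\<dots> = complex_of_real (f k ?o / ?n) * (\<Sum>l<?n. y2 (l, ?o) * cnj (\<eta> (l, ?o))) +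
          complex_of_real (f k i / ?n) * (\<Sum>l<?n. y2 (l, i) * cnj (\<eta> (l, i)))"
        using False by simp
      also have "(\<Sum>l<?n. y2 (l, ?o) * cnj (\<eta> (l, ?o))) =
          (\<Sum>l<?n. if l = j then complex_of_real (2 * \<gamma> * c0\<^sup>2) * ?app (t k i) v j * x * cnj (v' j) else 0)"
        using False by (intro sum.cong) (auto simp: y2o \<eta>_def power2_eq_square)
      also have "\<dots> = complex_of_real (2 * \<gamma> * c0\<^sup>2) * ?app (t k i) v j * x * cnj (v' j)" using j by simp
      also have "(\<Sum>l<?n. y2 (l, i) * cnj (\<eta> (l, i))) =
          (\<Sum>l<?n. complex_of_real (2 * \<gamma> * ci\<^sup>2) * w j * y * (?app S (\<lambda>m. if m = j then 1 else 0) l * cnj (w' l)))"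
        by (intro sum.cong) (auto simp: y2i \<eta>_def power2_eq_square)
      also have "\<dots> = complex_of_real (2 * \<gamma> * ci\<^sup>2) * w j * y * cinner ?n (?app S (\<lambda>m. if m = j then 1 else 0)) w'"
        unfolding cinner_def by (simp add: sum_distrib_left)
      also have "cinner ?n (?app S (\<lambda>m. if m = j then 1 else 0)) w' = cinner ?n (\<lambda>m. if m = j then 1 else 0) (?app (adj ?n S) w')"
        by (rule cinner_adj)
      also have "\<dots> = (\<Sum>l<?n. if l = j then cnj (?app (adj ?n S) w' j) else 0)"
        unfolding cinner_def by (intro sum.cong) auto
      also have "\<dots> = cnj (?app (adj ?n S) w' j)" using j by simp
      finally have "local_form k (loc_op ?n B \<tau>) \<xi> \<eta> ?a ?b =
          complex_of_real (f k ?o / ?n) * (complex_of_real (2 * \<gamma> * c0\<^sup>2) * ?app (t k i) v j * x * cnj (v' j)) +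
          complex_of_real (f k i / ?n) * (complex_of_real (2 * \<gamma> * ci\<^sup>2) * w j * y * cnj (?app (adj ?n S) w' j))" .
      moreover have "complex_of_real (f k ?o / ?n) * complex_of_real (2 * \<gamma> * c0\<^sup>2) = complex_of_real \<gamma>"
        "complex_of_real (f k i / ?n) * complex_of_real (2 * \<gamma> * ci\<^sup>2) = complex_of_real \<gamma>"
        unfolding of_real_mult[symmetric] c(3,4) using fp by simp_all
      moreover have "A * (C * P * x' * P') + A' * (C' * U * y' * U') = g * x' * (P * P') + g * y' * (U * U')"
        if "A * C = g" "A' * C' = g" for A C A' C' g P P' U U' x' y' :: complex
      proof -
        have "A * (C * P * x' * P') + A' * (C' * U * y' * U') = (A * C) * x' * (P * P') + (A' * C') * y' * (U * U')"
          by (simp add: mult_ac)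
        then show ?thesis unfolding that .
      qed
      ultimately show ?thesis by metis
    qed
    have "(\<Sum>j<?n. local_form k (loc_op ?n B \<tau>) \<xi> \<eta> (unit_mat ?n j 0 * a) (b * unit_mat ?n 0 j)) =
        complex_of_real \<gamma> * x * cinner ?n (?app (t k i) v) v' + complex_of_real \<gamma> * y * cinner ?n w (?app (adj ?n S) w')"
      unfolding cinner_def by (simp add: form sum.distrib sum_distrib_left)
    also have "cinner ?n w (?app (adj ?n S) w') = cinner ?n (?app S w) w'" by (rule cinner_adj[symmetric])
    also have "cinner ?n (?app S w) w' = complex_of_real (1 / p') * cinner ?n (?app S w) (?app S w)"
      unfolding cinner_def w'_def sum_distrib_left by (intro sum.cong) auto
    also have "\<dots> = complex_of_real p'"
    proof -
      have "cinner ?n (?app S w) (?app S w) = complex_of_real (p'\<^sup>2)"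
        unfolding cinner_self p'_def by simp
      then show ?thesis using p' by (simp add: power2_eq_square)
    qed
    also have "cinner ?n (?app (t k i) v) v' = complex_of_real (1 / p) * cinner ?n (?app (t k i) v) (?app (t k i) v)"
      unfolding cinner_def v'_def sum_distrib_left by (intro sum.cong) auto
    also have "\<dots> = complex_of_real p"
    proof -
      have "cinner ?n (?app (t k i) v) (?app (t k i) v) = complex_of_real (p\<^sup>2)"
        unfolding cinner_self p_def by simp
      then show ?thesis using p by (simp add: power2_eq_square)
    qed
    also have "complex_of_real \<gamma> * x * complex_of_real p + complex_of_real \<gamma> * y * complex_of_real p' =
        complex_of_real \<gamma> * (complex_of_real p * x + complex_of_real p' * y)"
      by (simp add: algebra_simps)
    also have "\<dots> = complex_of_real (\<gamma> * p) * (a * b) $$ (0, 0)" unfolding xy by simp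
    \<comment> \<open>The factor \<gamma> of the contraction times \<open>p\<close> is the geometric
      mean of \<open>p\<close> and \<open>p'\<close>; this is the origin of the outer square root in
      the local constant.\<close>
    also have "\<gamma> * p = sqrt (p * p')"
    proof -
      have "\<gamma> * p = sqrt (r * p\<^sup>2)" using p by (simp add: \<gamma>_def real_sqrt_mult)
      also have "r * p\<^sup>2 = p * p'" using p by (simp add: r_def power2_eq_square)
      finally show ?thesis .
    qed
    finally show ?thesis .
  qed
  have "local_datum k (sqrt (p * p')) B \<tau> \<xi> \<eta>"
    unfolding local_datum_def using bounded main unit[of \<xi> v w] unit[of \<eta> w' v'] v w v'1 w'1
    by (simp add: \<xi>_def \<eta>_def)
  then show ?thesis unfolding p_def p'_def S_def by blast
qed

end

section \<open>Averaging over matrix units\<close>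

context operator_subalgebra
begin

lemma form_bound_swap:
  assumes "form_bound K \<phi>"
  shows "form_bound K (\<lambda>x y. \<phi> y x)"
  unfolding form_bound_def
proof (intro conjI ballI allI)
  fix a b assume ab: "a \<in> B" "b \<in> B"
  show "cmod (\<phi> b a) \<le> K * op_norm M a * op_norm M b"
    using form_boundD(6)[OF assms ab(2,1)] by (simp add: mult_ac)
qed (simp_all add: form_boundD(1-5)[OF assms])

lemma form_bound_scale:
  assumes "form_bound K \<phi>"
  shows "form_bound (cmod c * K) (\<lambda>x y. c * \<phi> x y)"
  unfolding form_bound_def
proof (intro conjI ballI allI)
  note \<phi>D = form_boundD[OF assms]
  show "0 \<le> cmod c * K" using \<phi>D(1) by simp
  fix a b assume ab: "a \<in> B" "b \<in> B"
  show "cmod (c * \<phi> a b) \<le> cmod c * K * op_norm M a * op_norm M b"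
    using mult_left_mono[OF \<phi>D(6)[OF ab] norm_ge_zero[of c]] by (simp add: norm_mult mult.assoc)
qed (simp_all add: form_boundD(2-5)[OF assms] distrib_left)

lemma form_bound_minus:
  assumes \<phi>: "form_bound K \<phi>" and "a \<in> B" "b \<in> B" "y \<in> B"
  shows "\<phi> (op_minus M a b) y = \<phi> a y - \<phi> b y"
proof -
  have "op_minus M a b = oadd a (oscale (- 1) b)"
    unfolding op_minus_def l2_minus_def by (intro restrict_ext) simp
  then show ?thesis
    using form_boundD(2)[OF \<phi> assms(2) BD(5)[OF assms(3)] assms(4)] form_boundD(4)[OF \<phi> assms(3,4)] by simp
qed

lemma form_bound_tendsto:
  assumes \<phi>: "form_bound K \<phi>" and t: "\<And>n. t n \<in> B" and T: "T \<in> B" and y: "y \<in> B"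
    and lim: "(\<lambda>n. op_norm M (op_minus M (t n) T)) \<longlonglongrightarrow> 0"
  shows "(\<lambda>n. \<phi> (t n) y) \<longlonglongrightarrow> \<phi> T y"
proof (rule Lim_null[THEN iffD2], rule Lim_null_comparison)
  show "\<forall>\<^sub>F n in sequentially. norm (\<phi> (t n) y - \<phi> T y) \<le> K * op_norm M (op_minus M (t n) T) * op_norm M y"
    unfolding form_bound_minus[OF \<phi> t T y, symmetric] using form_boundD(6)[OF \<phi> BD(6)[OF t T] y] by simp
  show "(\<lambda>n. K * op_norm M (op_minus M (t n) T) * op_norm M y) \<longlonglongrightarrow> 0"
    using tendsto_mult_left[OF tendsto_mult_right[OF lim, of "op_norm M y"], of K] by (simp add: mult.assoc)
qed

lemma forms_eq_left:
  assumes G: "B = closed_subalgebra_generated (op_algebra M) G" "G \<subseteq> bounded_ops M"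
      "\<And>S T. S \<in> G \<Longrightarrow> T \<in> G \<Longrightarrow> comp S T \<in> G" "(\<lambda>u\<in>L2 M. u) \<in> G"
    and \<phi>: "form_bound K \<phi>" and \<phi>': "form_bound K' \<phi>'"
    and eq: "\<And>T. T \<in> G \<Longrightarrow> \<phi> T y = \<phi>' T y" and x: "x \<in> B" and y: "y \<in> B"
  shows "\<phi> x y = \<phi>' x y"
proof -
  \<comment> \<open>Membership in \<open>B\<close> is part of the predicate, since the induction
    principle itself provides only boundedness.\<close>
  let ?P = "\<lambda>x. x \<in> B \<and> \<phi> x y = \<phi>' x y"
  have "?P x"
  proof (rule generated_span_induct[where P = ?P, OF G(2-4) x[unfolded G(1)]])
    show "?P T" if "T \<in> G" for T
      using closed_subalgebra_generated(2)[OF G(2)] that eq[OF that] G(1) by blast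
    show "?P (oadd S T)" if "?P S" "?P T" for S T
      using that y by (simp add: BD(3) form_boundD(2)[OF \<phi>] form_boundD(2)[OF \<phi>'])
    show "?P (oscale c T)" if "?P T" for c T
      using that y by (simp add: BD(5) form_boundD(4)[OF \<phi>] form_boundD(4)[OF \<phi>'])
    fix t T assume t: "\<And>n. ?P (t n)" "T \<in> bounded_ops M" "(\<lambda>n. op_norm M (op_minus M (t n) T)) \<longlonglongrightarrow> 0"
    have tB: "\<And>n. t n \<in> B" using t(1) by blast
    have T: "T \<in> B" by (rule BD(7)[OF tB t(2,3)])
    have "(\<lambda>n. \<phi>' (t n) y) \<longlonglongrightarrow> \<phi> T y"
      using form_bound_tendsto[OF \<phi> tB T y t(3)] t(1) by simp
    then have "\<phi> T y = \<phi>' T y"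
      by (rule LIMSEQ_unique) (rule form_bound_tendsto[OF \<phi>' tB T y t(3)])
    then show "?P T" using T by blast
  qed
  then show ?thesis by blast
qed

text \<open>A bounded bilinear form is determined by its values on generators; continuity is used in
  one variable at a time, the second being reached by swapping the arguments.\<close>

lemma forms_eq:
  assumes G: "B = closed_subalgebra_generated (op_algebra M) G" "G \<subseteq> bounded_ops M"
      "\<And>S T. S \<in> G \<Longrightarrow> T \<in> G \<Longrightarrow> comp S T \<in> G" "(\<lambda>u\<in>L2 M. u) \<in> G"
    and \<phi>: "form_bound K \<phi>" and \<phi>': "form_bound K' \<phi>'"
    and eq: "\<And>S T. S \<in> G \<Longrightarrow> T \<in> G \<Longrightarrow> \<phi> S T = \<phi>' S T" and x: "x \<in> B" and y: "y \<in> B"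
  shows "\<phi> x y = \<phi>' x y"
proof (rule forms_eq_left[OF G \<phi> \<phi>' _ x y])
  fix T assume T: "T \<in> G"
  then have "T \<in> B" using closed_subalgebra_generated(2)[OF G(2)] G(1) by blast
  then show "\<phi> T y = \<phi>' T y"
    using forms_eq_left[where \<phi> = "\<lambda>x y. \<phi> y x" and \<phi>' = "\<lambda>x y. \<phi>' y x" and x = y and y = T,
        OF G form_bound_swap[OF \<phi>] form_bound_swap[OF \<phi>'] eq[OF T] y] by simp
qed

end

section \<open>Matrix units in one coordinate\<close>

context similarity_tensor
begin

sublocale D: operator_subalgebra \<mu> A
  by (rule operator_subalgebra.intro) (rule finite_measure_\<mu> A_closed one_in_A)+

lemma tensor_op_cong_mats:
  "(\<And>k. k < n \<Longrightarrow> B k = B' k) \<Longrightarrow> tensor_op n B \<tau> x = tensor_op n B' \<tau> x"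
  by (induction n) simp_all

lemma gen_cong:
  assumes "\<And>k. k < n \<Longrightarrow> a k = b k"
  shows "gen n a = gen n b"
proof -
  have "tensor_op n (\<lambda>k. conj_mat k (a k)) (\<lambda>_ i. i) = tensor_op n (\<lambda>k. conj_mat k (b k)) (\<lambda>_ i. i)"
    by (rule ext, rule tensor_op_cong_mats) (simp add: assms)
  then show ?thesis by (simp add: gen_def)
qed

definition slot :: "nat \<Rightarrow> complex mat \<Rightarrow> (nat \<Rightarrow> nat \<times> 'i) l2 \<Rightarrow> (nat \<Rightarrow> nat \<times> 'i) l2" where
  "slot n E = gen (Suc n) (\<lambda>k. if k = n then E else 1\<^sub>m (d k))"

lemma slot_in_A: "E \<in> carrier_mat (d n) (d n) \<Longrightarrow> slot n E \<in> A"
  unfolding slot_def by (rule gen_in_A) simp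

lemma slot_pad:
  assumes E: "E \<in> carrier_mat (d n) (d n)" and "n < m"
  shows "slot n E = gen m (\<lambda>k. if k = n then E else 1\<^sub>m (d k))"
proof -
  have "slot n E = gen m (\<lambda>k. if k < Suc n then if k = n then E else 1\<^sub>m (d k) else 1\<^sub>m (d k))"
    unfolding slot_def using assms by (intro gen_pad) auto
  then show ?thesis using gen_cong by (rule trans) auto
qed

text \<open>Multiplication by a slot changes a single matrix of the generator, which is why
  averaging over one coordinate affects a single factor of a product form.\<close>

lemma slot_gen:
  assumes E: "E \<in> carrier_mat (d n) (d n)" and n: "n < m"
    and a: "\<And>k. k < m \<Longrightarrow> a k \<in> carrier_mat (d k) (d k)"
  shows "D.comp (slot n E) (gen m a) = gen m (a(n := E * a n))"
    and "D.comp (gen m a) (slot n E) = gen m (a(n := a n * E))"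
proof -
  let ?e = "\<lambda>k. if k = n then E else 1\<^sub>m (d k)"
  have e: "?e k \<in> carrier_mat (d k) (d k)" for k using E by simp
  have "D.comp (slot n E) (gen m a) = gen m (\<lambda>k. ?e k * a k)"
    unfolding slot_pad[OF E n] by (rule gen_mult[OF e a])
  also have "\<dots> = gen m (a(n := E * a n))"
    by (rule gen_cong) (auto simp: left_mult_one_mat[OF a])
  finally show "D.comp (slot n E) (gen m a) = gen m (a(n := E * a n))" .
  have "D.comp (gen m a) (slot n E) = gen m (\<lambda>k. a k * ?e k)"
    unfolding slot_pad[OF E n] by (rule gen_mult[OF a e])
  also have "\<dots> = gen m (a(n := a n * E))"
    by (rule gen_cong) (auto simp: right_mult_one_mat[OF a])
  finally show "D.comp (gen m a) (slot n E) = gen m (a(n := a n * E))" .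
qed

lemma slot_mult:
  assumes "E \<in> carrier_mat (d n) (d n)" "F \<in> carrier_mat (d n) (d n)"
  shows "D.comp (slot n E) (slot n F) = slot n (E * F)"
proof -
  have "D.comp (slot n E) (slot n F) =
      gen (Suc n) (\<lambda>k. (if k = n then E else 1\<^sub>m (d k)) * (if k = n then F else 1\<^sub>m (d k)))"
    unfolding slot_def using assms by (intro gen_mult) auto
  also have "\<dots> = slot n (E * F)" unfolding slot_def by (rule gen_cong) auto
  finally show ?thesis .
qed

lemma slot_one: "slot n (1\<^sub>m (d n)) = (\<lambda>u\<in>L2 \<mu>. u)"
proof -
  have "slot n (1\<^sub>m (d n)) = gen (Suc n) (\<lambda>k. if k < 0 then 1\<^sub>m (d k) else 1\<^sub>m (d k))"
    unfolding slot_def by (rule gen_cong) auto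
  also have "\<dots> = gen 0 (\<lambda>k. 1\<^sub>m (d k))" by (rule gen_pad[symmetric]) auto
  finally show ?thesis unfolding gen_one .
qed

text \<open>Generators are multilinear in their matrices; additivity in one coordinate is what adds
  the diagonal matrix units up to the identity.\<close>

lemma slot_add:
  assumes E: "E \<in> carrier_mat (d n) (d n)" and F: "F \<in> carrier_mat (d n) (d n)"
  shows "slot n (E + F) = D.oadd (slot n E) (slot n F)"
proof (rule bounded_ops_ext)
  have EF: "E + F \<in> carrier_mat (d n) (d n)" using E F by simp
  note b = D.BD(1)[OF slot_in_A]
  show "slot n (E + F) \<in> bounded_ops \<mu>" by (rule b[OF EF])
  show "D.oadd (slot n E) (slot n F) \<in> bounded_ops \<mu>" by (rule bounded_ops_add[OF b[OF E] b[OF F]])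
  fix u assume u: "u \<in> L2 \<mu>"
  then obtain x where x: "x \<in> square_integrable \<mu>" "u = l2_class \<mu> x" by (rule L2_cases)
  \<comment> \<open>The identity matrices in the earlier coordinates produce a vector that does not
    depend on the matrix in slot \<open>n\<close>.\<close>
  define y where "y = tensor_op n (\<lambda>k. conj_mat k (1\<^sub>m (d k))) (\<lambda>_ i. i) x"
  have slot: "slot n G u = l2_class \<mu> (coord_op n (conj_mat n G) (\<lambda>i. i) y)"
    and sq: "coord_op n (conj_mat n G) (\<lambda>i. i) y \<in> square_integrable \<mu>"
    if G: "G \<in> carrier_mat (d n) (d n)" for G
  proof -
    let ?a = "\<lambda>k. if k = n then G else 1\<^sub>m (d k)"
    have a: "?a k \<in> carrier_mat (d k) (d k)" for k using G by simp
    have "tensor_op n (\<lambda>k. conj_mat k (?a k)) (\<lambda>_ i. i) x = y"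
      unfolding y_def by (rule tensor_op_cong_mats) simp
    then have *: "tensor_op (Suc n) (\<lambda>k. conj_mat k (?a k)) (\<lambda>_ i. i) x = coord_op n (conj_mat n G) (\<lambda>i. i) y"
      by simp
    show "slot n G u = l2_class \<mu> (coord_op n (conj_mat n G) (\<lambda>i. i) y)"
      unfolding slot_def x(2) gen_class[OF a x(1)] * ..
    show "coord_op n (conj_mat n G) (\<lambda>i. i) y \<in> square_integrable \<mu>"
      using gen_square_integrable[OF a x(1), of "Suc n"] unfolding * .
  qed
  have "l2_class \<mu> (coord_op n (conj_mat n (E + F)) (\<lambda>i. i) y) =
      l2_class \<mu> (\<lambda>\<omega>. coord_op n (conj_mat n E) (\<lambda>i. i) y \<omega> + coord_op n (conj_mat n F) (\<lambda>i. i) y \<omega>)"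
  proof (rule l2_class_cong_space)
    fix \<omega> assume "\<omega> \<in> space \<mu>"
    then have q: "fst (\<omega> n) < d n" "snd (\<omega> n) \<in> I n" by (simp_all add: space_\<mu>)
    note s = s_inv(1,2)[OF q(2)]
    have "conj_mat n (E + F) (snd (\<omega> n)) = conj_mat n E (snd (\<omega> n)) + conj_mat n F (snd (\<omega> n))"
      unfolding conj_mat_def
      by (subst mult_add_distrib_mat[OF s(1) E F], subst add_mult_distrib_mat[OF _ _ s(2)]) (use s E F in auto)
    then show "coord_op n (conj_mat n (E + F)) (\<lambda>i. i) y \<omega> =
        coord_op n (conj_mat n E) (\<lambda>i. i) y \<omega> + coord_op n (conj_mat n F) (\<lambda>i. i) y \<omega>"
      unfolding coord_op_def loc_op_def using q E F by (simp add: mat_app_add)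
  qed
  then show "slot n (E + F) u = D.oadd (slot n E) (slot n F) u"
    using u by (simp add: slot[OF E] slot[OF F] slot[OF EF] l2_class_simps sq[OF E] sq[OF F])
qed

lemma unit_mat_mult: "l < n \<Longrightarrow> unit_mat n j l * unit_mat n l m = unit_mat n j m"
proof (rule eq_matI)
  fix a b assume l: "l < n" and "a < dim_row (unit_mat n j m)" "b < dim_col (unit_mat n j m)"
  then have ab: "a < n" "b < n" by (auto simp: unit_mat_def)
  have "(unit_mat n j l * unit_mat n l m) $$ (a, b) =
      (\<Sum>c\<in>{0..<n}. (if a = j \<and> c = l then 1 else 0) * (if c = l \<and> b = m then 1 else 0))"
    using ab by (simp add: unit_mat_def scalar_prod_def)
  also have "\<dots> = (\<Sum>c\<in>{0..<n}. if c = l then if a = j \<and> b = m then 1 else 0 else 0)"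
    by (rule sum.cong) auto
  finally have "(unit_mat n j l * unit_mat n l m) $$ (a, b) =
      (\<Sum>c\<in>{0..<n}. if c = l then if a = j \<and> b = m then 1 else 0 else 0)" .
  then show "(unit_mat n j l * unit_mat n l m) $$ (a, b) = unit_mat n j m $$ (a, b)"
    using l ab by (simp add: unit_mat_def)
qed (auto simp: unit_mat_def)

lemma slot_diagonal_sum:
  assumes \<phi>: "D.form_bound K \<phi>" and x: "x \<in> A" and y: "y \<in> A"
  shows "(\<Sum>j<d n. \<phi> (D.comp (slot n (unit_mat (d n) j j)) x) y) = \<phi> x y"
proof -
  let ?n = "d n"
  \<comment> \<open>Partial sums of the diagonal matrix units. The induction starts with one
    summand, where P 1 is the unit at (0, 0), and is used at \<open>d n - 1\<close>.\<close>
  define P where "P m = mat ?n ?n (\<lambda>(a, b). if a = b \<and> a < m then 1 else 0 :: complex)" for m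
  have P: "P m \<in> carrier_mat ?n ?n" for m by (simp add: P_def)
  have "(\<Sum>j<Suc m. \<phi> (D.comp (slot n (unit_mat ?n j j)) x) y) = \<phi> (D.comp (slot n (P (Suc m))) x) y" for m
  proof (induction m)
    case 0
    have "P 1 = unit_mat ?n 0 0" by (rule eq_matI) (auto simp: P_def unit_mat_def)
    then show ?case by simp
  next
    case (Suc m)
    have "P (Suc (Suc m)) = P (Suc m) + unit_mat ?n (Suc m) (Suc m)"
      by (rule eq_matI) (auto simp: P_def unit_mat_def)
    then have "slot n (P (Suc (Suc m))) = D.oadd (slot n (P (Suc m))) (slot n (unit_mat ?n (Suc m) (Suc m)))"
      using slot_add[OF P unit_mat_carrier] by simp
    moreover have "D.comp (D.oadd (slot n (P (Suc m))) (slot n (unit_mat ?n (Suc m) (Suc m)))) x =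
        D.oadd (D.comp (slot n (P (Suc m))) x) (D.comp (slot n (unit_mat ?n (Suc m) (Suc m))) x)"
      unfolding compose_def using x by (intro restrict_ext) simp
    ultimately have "D.comp (slot n (P (Suc (Suc m)))) x =
        D.oadd (D.comp (slot n (P (Suc m))) x) (D.comp (slot n (unit_mat ?n (Suc m) (Suc m))) x)" by simp
    moreover have "\<phi> (D.oadd (D.comp (slot n (P (Suc m))) x) (D.comp (slot n (unit_mat ?n (Suc m) (Suc m))) x)) y =
        \<phi> (D.comp (slot n (P (Suc m))) x) y + \<phi> (D.comp (slot n (unit_mat ?n (Suc m) (Suc m))) x) y"
      by (rule D.form_boundD(2)[OF \<phi> D.BD(4)[OF slot_in_A[OF P] x] D.BD(4)[OF slot_in_A[OF unit_mat_carrier] x] y])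
    ultimately show ?case unfolding sum.lessThan_Suc[of _ "Suc m"] Suc.IH by (simp only:)
  qed
  from this[of "?n - 1"] have "(\<Sum>j<?n. \<phi> (D.comp (slot n (unit_mat ?n j j)) x) y) = \<phi> (D.comp (slot n (P ?n)) x) y"
    using d_pos[of n] by simp
  moreover have "P ?n = 1\<^sub>m ?n" by (rule eq_matI) (auto simp: P_def)
  ultimately show ?thesis using D.comp_one(1)[OF x] by (simp add: slot_one)
qed

text \<open>The left leg receives the unit at (j, 0), the right leg the one at (0, j). Once the
  second factor is moved to the left leg, their products are the diagonal units, which sum to 1; so
  an asymptotically commuting net does not see the averaging.\<close>

fun avg :: "nat \<Rightarrow> (((nat \<Rightarrow> nat \<times> 'i) l2 \<Rightarrow> (nat \<Rightarrow> nat \<times> 'i) l2) \<Rightarrow>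
    ((nat \<Rightarrow> nat \<times> 'i) l2 \<Rightarrow> (nat \<Rightarrow> nat \<times> 'i) l2) \<Rightarrow> complex) \<Rightarrow>
    ((nat \<Rightarrow> nat \<times> 'i) l2 \<Rightarrow> (nat \<Rightarrow> nat \<times> 'i) l2) \<Rightarrow>
    ((nat \<Rightarrow> nat \<times> 'i) l2 \<Rightarrow> (nat \<Rightarrow> nat \<times> 'i) l2) \<Rightarrow> complex" where
  "avg 0 \<phi> = \<phi>"
| "avg (Suc n) \<phi> = (\<lambda>x y. \<Sum>j<d n. avg n \<phi> (D.comp (slot n (unit_mat (d n) j 0)) x)
      (D.comp y (slot n (unit_mat (d n) 0 j))))"

lemma avg_limit:
  assumes ev: "eventually (\<lambda>m. m \<in> proj_tensor D.\<A>) F"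
    and comm: "\<And>K \<phi> a. D.form_bound K \<phi> \<Longrightarrow> a \<in> A \<Longrightarrow>
      ((\<lambda>m. m (\<lambda>x y. \<phi> (D.comp a x) y) - m (\<lambda>x y. \<phi> x (D.comp y a))) \<longlongrightarrow> 0) F"
    and \<phi>: "D.form_bound K \<phi>"
  shows "(\<exists>K. D.form_bound K (avg n \<phi>)) \<and> ((\<lambda>m. m \<phi> - m (avg n \<phi>)) \<longlongrightarrow> 0) F"
proof (induction n)
  case 0
  then show ?case using \<phi> by auto
next
  case (Suc n)
  then obtain K' where K': "D.form_bound K' (avg n \<phi>)" by blast
  have unit: "(\<Sum>j\<in>{..<d n}. avg n \<phi> (D.comp (D.comp (slot n (unit_mat (d n) j 0)) (slot n (unit_mat (d n) 0 j))) x) y) =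
      avg n \<phi> x y" if "x \<in> A" "y \<in> A" for x y
    using slot_diagonal_sum[OF K' that, of n] d_pos[of n] by (simp add: slot_mult unit_mat_mult)
  note step = D.approximate_diagonal_average[where e = "\<lambda>j. slot n (unit_mat (d n) j 0)" and
      g = "\<lambda>j. slot n (unit_mat (d n) 0 j)" and J = "{..<d n}" and F = F,
      OF ev comm K' finite_lessThan slot_in_A[OF unit_mat_carrier] slot_in_A[OF unit_mat_carrier] unit]
  have "((\<lambda>m. (m \<phi> - m (avg n \<phi>)) + (m (avg n \<phi>) - m (avg (Suc n) \<phi>))) \<longlongrightarrow> 0 + 0) F"
    unfolding avg.simps by (rule tendsto_add[OF conjunct2[OF Suc.IH] step(2)])
  then have "((\<lambda>m. m \<phi> - m (avg (Suc n) \<phi>)) \<longlongrightarrow> 0) F" by (simp del: avg.simps)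
  then show ?case using step(1) unfolding avg.simps by (intro conjI)
qed

lemma elem_cong: "(\<And>k. k < n \<Longrightarrow> g k = g' k) \<Longrightarrow> elem n g h = elem n g' h"
  unfolding elem_def by (intro ext arg_cong2[where f = "(*)"] prod.cong) simp_all

lemma elem_extend:
  assumes "n \<le> m" "\<And>k. k \<ge> n \<Longrightarrow> g k = (\<lambda>_. 1)"
  shows "elem n g (\<lambda>_. 1) = elem m g (\<lambda>_. 1)"
proof
  fix \<omega>
  show "elem n g (\<lambda>_. 1) \<omega> = elem m g (\<lambda>_. 1) \<omega>"
    unfolding elem_def using assms by (intro arg_cong2[where f = "(*)"] prod.mono_neutral_left) auto
qed

lemma one_square_integrable: "(\<lambda>_. 1) \<in> square_integrable \<mu>" "(\<lambda>_. 1) \<in> square_integrable (X k)"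
proof -
  interpret m: prob_space \<mu> by (rule prob_space_\<mu>)
  show "(\<lambda>_. 1) \<in> square_integrable \<mu>" by (simp add: square_integrable_def)
  interpret X: prob_space "X k" by (rule prob_space_X)
  show "(\<lambda>_. 1) \<in> square_integrable (X k)" by (simp add: square_integrable_def)
qed

lemma l2_norm_elem:
  assumes "\<And>k. k < n \<Longrightarrow> g k \<in> square_integrable (X k)"
    and "\<And>k. k < n \<Longrightarrow> l2_norm (X k) (l2_class (X k) (g k)) = 1"
  shows "elem n g (\<lambda>_. 1) \<in> square_integrable \<mu>" "l2_norm \<mu> (l2_class \<mu> (elem n g (\<lambda>_. 1))) = 1"
proof -
  interpret prob_space \<mu> by (rule prob_space_\<mu>)
  have i: "indep n (\<lambda>_ :: nat \<Rightarrow> nat \<times> 'i. 1 :: complex)" by (simp add: indep_def)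
  have "(l2_norm \<mu> (l2_class \<mu> (\<lambda>_. 1)))\<^sup>2 = 1"
    unfolding l2_norm_class_power2[OF one_square_integrable(1)] by (simp add: prob_space)
  then have "(l2_norm \<mu> (l2_class \<mu> (elem n g (\<lambda>_. 1))))\<^sup>2 = 1"
    using elem_square_integrable(2)[OF one_square_integrable(1) i assms(1)] assms(2) by simp
  then show "l2_norm \<mu> (l2_class \<mu> (elem n g (\<lambda>_. 1))) = 1"
    using l2_norm_nonneg[of \<mu> "l2_class \<mu> (elem n g (\<lambda>_. 1))"] by (simp add: power2_eq_1_iff)
  show "elem n g (\<lambda>_. 1) \<in> square_integrable \<mu>"
    by (rule elem_square_integrable(1)[OF one_square_integrable(1) i assms(1)])
qed

text \<open>All operators involved send elementary tensors to elementary tensors, so the integral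
  factors over the coordinates. The middle operator occupies \<open>R\<close> of them, the vectors
  \<open>N\<close>, the generators \<open>m\<close>; with \<open>R = 0\<close> the form is that of
  the plain product.\<close>

lemma form_elem:
  assumes R: "R \<le> N" "N \<le> m" and B: "\<And>k. k < R \<Longrightarrow> fibre_bounded k (B k) (\<tau> k) (K k)"
    and \<xi>: "\<And>k. k < N \<Longrightarrow> \<xi> k \<in> square_integrable (X k)" "\<And>k. k \<ge> N \<Longrightarrow> \<xi> k = (\<lambda>_. 1)"
    and \<eta>: "\<And>k. k < N \<Longrightarrow> \<eta> k \<in> square_integrable (X k)" "\<And>k. k \<ge> N \<Longrightarrow> \<eta> k = (\<lambda>_. 1)"
    and a: "\<And>k. k < m \<Longrightarrow> a k \<in> carrier_mat (d k) (d k)" and b: "\<And>k. k < m \<Longrightarrow> b k \<in> carrier_mat (d k) (d k)"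
  shows "l2_inner \<mu> (gen m a (class_op \<mu> (tensor_op R B \<tau>) (gen m b (l2_class \<mu> (elem N \<xi> (\<lambda>_. 1))))))
      (l2_class \<mu> (elem N \<eta> (\<lambda>_. 1))) =
    (\<Prod>k<m. local_form k (if k < R then loc_op (d k) (B k) (\<tau> k) else (\<lambda>y. y)) (\<xi> k) (\<eta> k) (a k) (b k))"
proof -
  note one = one_square_integrable
  have i: "indep m (\<lambda>_ :: nat \<Rightarrow> nat \<times> 'i. 1 :: complex)" by (simp add: indep_def)
  have \<xi>S: "\<xi> k \<in> square_integrable (X k)" and \<eta>S: "\<eta> k \<in> square_integrable (X k)" for k
    using \<xi> \<eta> one(2) by (metis not_le)+
  define T where "T k = (if k < R then loc_op (d k) (B k) (\<tau> k) else (\<lambda>y. y))" for k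
  have conj: "loc_op (d k) (conj_mat k c) (\<lambda>i. i) y \<in> square_integrable (X k)"
    if "c \<in> carrier_mat (d k) (d k)" "y \<in> square_integrable (X k)" for k c y
    using conj_mat_bounded[OF that(1)] loc_op_square_integrable that(2) by blast
  define y0 where "y0 k = loc_op (d k) (conj_mat k (b k)) (\<lambda>i. i) (\<xi> k)" for k
  define y1 where "y1 k = T k (y0 k)" for k
  define y2 where "y2 k = loc_op (d k) (conj_mat k (a k)) (\<lambda>i. i) (y1 k)" for k
  have y0: "y0 k \<in> square_integrable (X k)" if "k < m" for k
    unfolding y0_def by (rule conj[OF b[OF that] \<xi>S])
  have y1: "y1 k \<in> square_integrable (X k)" if "k < m" for k
    unfolding y1_def T_def using loc_op_square_integrable[OF B y0[OF that]] y0[OF that] by simp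
  have y2: "y2 k \<in> square_integrable (X k)" if "k < m" for k
    unfolding y2_def by (rule conj[OF a[OF that] y1[OF that]])
  have S: "elem m g (\<lambda>_. 1) \<in> square_integrable \<mu>" if "\<And>k. k < m \<Longrightarrow> g k \<in> square_integrable (X k)" for g
    by (rule elem_square_integrable(1)[OF one(1) i that])
  have "gen m b (l2_class \<mu> (elem N \<xi> (\<lambda>_. 1))) = l2_class \<mu> (elem m y0 (\<lambda>_. 1))"
  proof -
    have "gen m b (l2_class \<mu> (elem m \<xi> (\<lambda>_. 1))) =
        l2_class \<mu> (tensor_op m (\<lambda>k. conj_mat k (b k)) (\<lambda>_ i. i) (elem m \<xi> (\<lambda>_. 1)))"
      by (rule gen_class[OF b S]) (simp_all add: \<xi>S)
    also have "tensor_op m (\<lambda>k. conj_mat k (b k)) (\<lambda>_ i. i) (elem m \<xi> (\<lambda>_. 1)) = elem m y0 (\<lambda>_. 1)"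
      unfolding tensor_op_elem[OF order_refl i] by (rule elem_cong) (simp add: y0_def)
    finally show ?thesis using elem_extend[OF R(2) \<xi>(2)] by simp
  qed
  moreover have "class_op \<mu> (tensor_op R B \<tau>) (l2_class \<mu> (elem m y0 (\<lambda>_. 1))) = l2_class \<mu> (elem m y1 (\<lambda>_. 1))"
  proof -
    have "class_op \<mu> (tensor_op R B \<tau>) (l2_class \<mu> (elem m y0 (\<lambda>_. 1))) =
        l2_class \<mu> (tensor_op R B \<tau> (elem m y0 (\<lambda>_. 1)))"
      by (rule class_op_class[OF tensor_op_bounded[OF B] S[OF y0]])
    also have "tensor_op R B \<tau> (elem m y0 (\<lambda>_. 1)) = elem m y1 (\<lambda>_. 1)"
      unfolding tensor_op_elem[OF order.trans[OF R] i] by (rule elem_cong) (simp add: y1_def T_def)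
    finally show ?thesis .
  qed
  moreover have "gen m a (l2_class \<mu> (elem m y1 (\<lambda>_. 1))) = l2_class \<mu> (elem m y2 (\<lambda>_. 1))"
  proof -
    have "gen m a (l2_class \<mu> (elem m y1 (\<lambda>_. 1))) =
        l2_class \<mu> (tensor_op m (\<lambda>k. conj_mat k (a k)) (\<lambda>_ i. i) (elem m y1 (\<lambda>_. 1)))"
      by (rule gen_class[OF a S[OF y1]])
    also have "tensor_op m (\<lambda>k. conj_mat k (a k)) (\<lambda>_ i. i) (elem m y1 (\<lambda>_. 1)) = elem m y2 (\<lambda>_. 1)"
      unfolding tensor_op_elem[OF order_refl i] by (rule elem_cong) (simp add: y2_def)
    finally show ?thesis .
  qed
  moreover have "l2_inner \<mu> (l2_class \<mu> (elem m y2 (\<lambda>_. 1))) (l2_class \<mu> (elem N \<eta> (\<lambda>_. 1))) =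
      (\<Prod>k<m. LINT q|X k. y2 k q * cnj (\<eta> k q))"
  proof -
    have "l2_inner \<mu> (l2_class \<mu> (elem m y2 (\<lambda>_. 1))) (l2_class \<mu> (elem m \<eta> (\<lambda>_. 1))) =
        (LINT \<omega>|\<mu>. elem m y2 (\<lambda>_. 1) \<omega> * cnj (elem m \<eta> (\<lambda>_. 1) \<omega>))"
      by (rule l2_inner_class[OF S[OF y2] S[OF \<eta>S]])
    also have "\<dots> = (LINT \<omega>|\<mu>. (\<Prod>k<m. y2 k (\<omega> k) * cnj (\<eta> k (\<omega> k))))"
      by (simp add: elem_def prod.distrib)
    also have "\<dots> = (\<Prod>k<m. LINT q|X k. y2 k q * cnj (\<eta> k q))"
      by (rule integral_elem[where g = "\<lambda>k q. y2 k q * cnj (\<eta> k q)"]) (rule integrable_product[OF y2 \<eta>S])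
    finally show ?thesis using elem_extend[OF R(2) \<eta>(2)] by simp
  qed
  ultimately show ?thesis by (simp add: local_form_def y2_def y1_def y0_def T_def)
qed

lemma amenable_product_bound:
  assumes "amenable (op_algebra \<mu>\<lparr>carrier := A\<rparr>)"
  shows "\<exists>C. \<forall>N L. (\<forall>k<N. \<exists>B \<tau> \<xi> \<eta>. local_datum k (L k) B \<tau> \<xi> \<eta>) \<longrightarrow> (\<Prod>k<N. L k) \<le> C"
proof -
  obtain F C where F: "F \<noteq> bot" and ev: "eventually (\<lambda>m. m \<in> proj_tensor D.\<A>) F"
    and bd: "\<And>K \<phi>. D.form_bound K \<phi> \<Longrightarrow> eventually (\<lambda>m. cmod (m \<phi>) \<le> K * C) F"
    and comm: "\<And>K \<phi> a. D.form_bound K \<phi> \<Longrightarrow> a \<in> A \<Longrightarrow>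
      ((\<lambda>m. m (\<lambda>x y. \<phi> (D.comp a x) y) - m (\<lambda>x y. \<phi> x (D.comp y a))) \<longlongrightarrow> 0) F"
    and diag: "\<And>u w. u \<in> L2 \<mu> \<Longrightarrow> w \<in> L2 \<mu> \<Longrightarrow> ((\<lambda>m. m (\<lambda>x y. l2_inner \<mu> (x (y u)) w)) \<longlongrightarrow> l2_inner \<mu> u w) F"
    by (rule D.amenable_net[OF assms]) (rule that)
  have "(\<Prod>k<N. L k) \<le> \<bar>C\<bar>" if L: "\<And>k. k < N \<Longrightarrow> \<exists>B \<tau> \<xi> \<eta>. local_datum k (L k) B \<tau> \<xi> \<eta>" for N L
  proof -
    have "\<forall>k. \<exists>p. k < N \<longrightarrow> local_datum k (L k) (fst p) (fst (snd p)) (fst (snd (snd p))) (snd (snd (snd p)))"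
      using L by (metis fst_conv snd_conv)
    then obtain p where p: "\<And>k. k < N \<Longrightarrow>
        local_datum k (L k) (fst (p k)) (fst (snd (p k))) (fst (snd (snd (p k)))) (snd (snd (snd (p k))))"
      by metis
    define B where "B k = fst (p k)" for k
    define \<tau> where "\<tau> k = fst (snd (p k))" for k
    \<comment> \<open>Beyond \<open>N\<close> all vectors are the constant 1, a unit vector of every
      \<open>X k\<close>.\<close>
    define \<xi> where "\<xi> k = (if k < N then fst (snd (snd (p k))) else (\<lambda>_. 1))" for k
    define \<eta> where "\<eta> k = (if k < N then snd (snd (snd (p k))) else (\<lambda>_. 1))" for k
    define z where "z k = (if k < N then \<zeta> k else (\<lambda>_. 1))" for k
    have datum: "local_datum k (L k) (B k) (\<tau> k) (\<xi> k) (\<eta> k)" if "k < N" for k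
      using p[OF that] that by (simp add: B_def \<tau>_def \<xi>_def \<eta>_def)
    have B: "fibre_bounded k (B k) (\<tau> k) 1" and \<xi>: "\<xi> k \<in> square_integrable (X k)" "l2_norm (X k) (l2_class (X k) (\<xi> k)) = 1"
      and \<eta>: "\<eta> k \<in> square_integrable (X k)" "l2_norm (X k) (l2_class (X k) (\<eta> k)) = 1"
      and average: "\<And>a b. a \<in> carrier_mat (d k) (d k) \<Longrightarrow> b \<in> carrier_mat (d k) (d k) \<Longrightarrow>
        (\<Sum>j<d k. local_form k (loc_op (d k) (B k) (\<tau> k)) (\<xi> k) (\<eta> k) (unit_mat (d k) j 0 * a) (b * unit_mat (d k) 0 j)) =
        complex_of_real (L k) * (a * b) $$ (0, 0)" if "k < N" for k
      using datum[OF that] unfolding local_datum_def by blast+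
    have z: "z k \<in> square_integrable (X k)" "l2_norm (X k) (l2_class (X k) (z k)) = 1" if "k < N" for k
      using that \<zeta>_unit by (simp_all add: z_def)
    have out: "\<xi> k = (\<lambda>_. 1)" "\<eta> k = (\<lambda>_. 1)" "z k = (\<lambda>_. 1)" if "k \<ge> N" for k
      using that by (simp_all add: \<xi>_def \<eta>_def z_def)
    let ?vec = "\<lambda>g. l2_class \<mu> (elem N g (\<lambda>_. 1))"
    have S: "elem N \<xi> (\<lambda>_. 1) \<in> square_integrable \<mu>" "elem N \<eta> (\<lambda>_. 1) \<in> square_integrable \<mu>"
        "elem N z (\<lambda>_. 1) \<in> square_integrable \<mu>"
      and norm: "l2_norm \<mu> (?vec \<xi>) = 1" "l2_norm \<mu> (?vec \<eta>) = 1" "l2_norm \<mu> (?vec z) = 1"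
      using l2_norm_elem[of N \<xi>] l2_norm_elem[of N \<eta>] l2_norm_elem[of N z] \<xi> \<eta> z by blast+
    note vec = S[THEN l2_class_in_L2]
    define T where "T = class_op \<mu> (tensor_op N B \<tau>)"
    note Tb = tensor_op_bounded[where n = N and B = B and \<tau> = \<tau> and K = "\<lambda>_. 1", OF B]
    have T: "T \<in> bounded_ops \<mu>" unfolding T_def by (rule class_op_bounded_ops(1)[OF Tb])
    have T1: "op_norm \<mu> T \<le> 1"
      using class_op_bounded_ops(2)[OF Tb] unfolding T_def by (intro op_norm_le) simp_all
    \<comment> \<open>\<open>\<Phi>\<close> has norm at most 1 whatever \<open>N\<close> is;
      \<open>\<omega>\<close> is the form of the product at a unit vector, on which the net tends to
      1.\<close>
    define \<Phi> where "\<Phi> x y = l2_inner \<mu> (x (T (y (?vec \<xi>)))) (?vec \<eta>)" for x y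
    define \<omega> where "\<omega> x y = l2_inner \<mu> (x (y (?vec z))) (?vec z)" for x y :: "(nat \<Rightarrow> nat \<times> 'i) l2 \<Rightarrow> (nat \<Rightarrow> nat \<times> 'i) l2"
    have \<Phi>b: "D.form_bound (op_norm \<mu> T) \<Phi>"
      using D.form_bound_inner[OF T vec(1,2)] unfolding \<Phi>_def[abs_def] by (simp only: norm mult_1_right)
    obtain K where \<omega>b: "D.form_bound K \<omega>"
      using D.form_bound_product[OF vec(3,3)] unfolding \<omega>_def[abs_def] by blast
    define Pr where "Pr = complex_of_real (\<Prod>k<N. L k)"
    define lf where "lf k = local_form k (if k < N then loc_op (d k) (B k) (\<tau> k) else (\<lambda>y. y)) (\<xi> k) (\<eta> k)" for k
    \<comment> \<open>Averaging coordinate \<open>n\<close> changes the matrices of the generators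
      in that coordinate alone, so one local average is evaluated while the other factors stay as
      they are.\<close>
    have average_gen: "avg n \<Phi> (gen m a) (gen m b) =
        (\<Prod>k<m. if k < n then complex_of_real (L k) * (a k * b k) $$ (0, 0) else lf k (a k) (b k))"
      if "n \<le> N" "N \<le> m" "\<And>k. k < m \<Longrightarrow> a k \<in> carrier_mat (d k) (d k)" "\<And>k. k < m \<Longrightarrow> b k \<in> carrier_mat (d k) (d k)"
      for n m a b
      using that
    proof (induction n arbitrary: a b)
      case 0
      show ?case
        using form_elem[where R = N and N = N and m = m and \<xi> = \<xi> and \<eta> = \<eta> and B = B and \<tau> = \<tau> and a = a and b = b and K = "\<lambda>_. 1",
            OF order_refl 0(2) B \<xi>(1) out(1) \<eta>(1) out(2) 0(3,4)]
        by (simp add: \<Phi>_def T_def lf_def)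
    next
      case (Suc n)
      have n: "n < m" "n < N" "n \<le> N" using Suc.prems(1,2) by auto
      note ab = Suc.prems(3,4)
      let ?e = "\<lambda>k. if k < n then complex_of_real (L k) * (a k * b k) $$ (0, 0) else lf k (a k) (b k)"
      let ?r = "\<Prod>k\<in>{..<m} - {n}. ?e k"
      have summand: "avg n \<Phi> (D.comp (slot n (unit_mat (d n) j 0)) (gen m a)) (D.comp (gen m b) (slot n (unit_mat (d n) 0 j))) =
          lf n (unit_mat (d n) j 0 * a n) (b n * unit_mat (d n) 0 j) * ?r" for j
      proof -
        let ?a = "a(n := unit_mat (d n) j 0 * a n)" and ?b = "b(n := b n * unit_mat (d n) 0 j)"
        have c: "?a k \<in> carrier_mat (d k) (d k)" "?b k \<in> carrier_mat (d k) (d k)" if "k < m" for k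
          using ab[OF that] mult_carrier_mat[OF unit_mat_carrier ab(1)[OF n(1)]] mult_carrier_mat[OF ab(2)[OF n(1)] unit_mat_carrier]
          by simp_all
        have "avg n \<Phi> (D.comp (slot n (unit_mat (d n) j 0)) (gen m a)) (D.comp (gen m b) (slot n (unit_mat (d n) 0 j))) =
            avg n \<Phi> (gen m ?a) (gen m ?b)"
          using slot_gen(1)[OF unit_mat_carrier n(1) ab(1)] slot_gen(2)[OF unit_mat_carrier n(1) ab(2)] by simp
        also have "\<dots> = (\<Prod>k<m. if k < n then complex_of_real (L k) * (?a k * ?b k) $$ (0, 0) else lf k (?a k) (?b k))"
          by (rule Suc.IH[OF n(3) Suc.prems(2) c])
        also have "\<dots> = (if n < n then complex_of_real (L n) * (?a n * ?b n) $$ (0, 0) else lf n (?a n) (?b n)) *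
            (\<Prod>k\<in>{..<m} - {n}. if k < n then complex_of_real (L k) * (?a k * ?b k) $$ (0, 0) else lf k (?a k) (?b k))"
          using n(1) by (intro prod.remove) auto
        also have "(\<Prod>k\<in>{..<m} - {n}. if k < n then complex_of_real (L k) * (?a k * ?b k) $$ (0, 0) else lf k (?a k) (?b k)) = ?r"
          by (rule prod.cong) auto
        finally show ?thesis by simp
      qed
      have "avg (Suc n) \<Phi> (gen m a) (gen m b) =
          (\<Sum>j<d n. lf n (unit_mat (d n) j 0 * a n) (b n * unit_mat (d n) 0 j)) * ?r"
        unfolding avg.simps summand sum_distrib_right ..
      also have "(\<Sum>j<d n. lf n (unit_mat (d n) j 0 * a n) (b n * unit_mat (d n) 0 j)) = complex_of_real (L n) * (a n * b n) $$ (0, 0)"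
        using average[OF n(2) ab(1)[OF n(1)] ab(2)[OF n(1)]] n(2) by (simp add: lf_def)
      also have "?r = (\<Prod>k\<in>{..<m} - {n}. if k < Suc n then complex_of_real (L k) * (a k * b k) $$ (0, 0) else lf k (a k) (b k))"
        by (rule prod.cong) auto
      also have "complex_of_real (L n) * (a n * b n) $$ (0, 0) * \<dots> =
          (\<Prod>k<m. if k < Suc n then complex_of_real (L k) * (a k * b k) $$ (0, 0) else lf k (a k) (b k))"
        using n(1) by (subst prod.remove[of _ n]) auto
      finally show ?case .
    qed
    have "avg N \<Phi> S U = Pr * \<omega> S U" if SU: "S \<in> Gens" "U \<in> Gens" for S U
    proof -
      obtain n1 a1 n2 b1 where S: "S = gen n1 a1" "\<And>k. k < n1 \<Longrightarrow> a1 k \<in> carrier_mat (d k) (d k)"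
        and U: "U = gen n2 b1" "\<And>k. k < n2 \<Longrightarrow> b1 k \<in> carrier_mat (d k) (d k)"
        using SU by (auto simp: Gens_def)
      \<comment> \<open>Both generators are padded to a common length that is at least the number
        \<open>N\<close> of averaged coordinates.\<close>
      define m where "m = max N (max n1 n2)"
      define a where "a k = (if k < n1 then a1 k else 1\<^sub>m (d k))" for k
      define b where "b k = (if k < n2 then b1 k else 1\<^sub>m (d k))" for k
      have m: "n1 \<le> m" "n2 \<le> m" "N \<le> m" by (auto simp: m_def)
      have ab: "a k \<in> carrier_mat (d k) (d k)" "b k \<in> carrier_mat (d k) (d k)" for k
        using S U by (simp_all add: a_def b_def)
      have Sg: "S = gen m a" and Ug: "U = gen m b"
        unfolding S(1) U(1) a_def[abs_def] b_def[abs_def] using S(2) U(2) m by (auto intro!: gen_pad)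
      have "\<omega> S U = (\<Prod>k<m. local_form k (\<lambda>y. y) (z k) (z k) (a k) (b k))"
      proof -
        \<comment> \<open>A tensor over no coordinates is the identity; inserting it brings the
          product form into the shape of \<open>form_elem\<close> with \<open>R = 0\<close>.\<close>
        have "\<omega> S U = l2_inner \<mu> (gen m a (class_op \<mu> (tensor_op 0 B \<tau>) (gen m b (?vec z)))) (?vec z)"
        proof -
          have "gen m b (?vec z) \<in> L2 \<mu>" using gen_bounded_ops[OF ab(2)] vec(3) by (rule bounded_opsD(1))
          then obtain x where x: "x \<in> square_integrable \<mu>" "gen m b (?vec z) = l2_class \<mu> x" by (rule L2_cases)
          have 0: "tensor_op 0 B \<tau> = (\<lambda>x. x)" by (rule ext) simp
          have "class_op \<mu> (tensor_op 0 B \<tau>) (gen m b (?vec z)) = gen m b (?vec z)"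
            unfolding x(2) 0 by (rule class_op_class[OF finitely_bounded_id x(1)])
          then show ?thesis by (simp add: \<omega>_def Sg Ug)
        qed
        also have "\<dots> = (\<Prod>k<m. local_form k (\<lambda>y. y) (z k) (z k) (a k) (b k))"
          using form_elem[where R = 0 and N = N and m = m and \<xi> = z and \<eta> = z and B = B and \<tau> = \<tau> and a = a and b = b and K = "\<lambda>_. 1",
              OF _ m(3) _ z(1) out(3) z(1) out(3) ab(1) ab(2)] by simp
        finally show ?thesis .
      qed
      moreover have "avg N \<Phi> S U = (\<Prod>k<m. if k < N then complex_of_real (L k) * (a k * b k) $$ (0, 0) else lf k (a k) (b k))"
        unfolding Sg Ug by (rule average_gen[OF order_refl m(3) ab])
      moreover have "\<dots> = (\<Prod>k<m. (if k < N then complex_of_real (L k) else 1) * local_form k (\<lambda>y. y) (z k) (z k) (a k) (b k))"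
        by (rule prod.cong) (auto simp: z_def lf_def \<xi>_def \<eta>_def \<zeta>_form[OF ab])
      moreover have "(\<Prod>k<m. if k < N then complex_of_real (L k) else 1) = Pr"
        unfolding Pr_def of_real_prod using m(3) by (intro prod.mono_neutral_cong_right) auto
      ultimately show ?thesis by (simp add: prod.distrib)
    qed
    note gens = this
    have limit: "(\<exists>K. D.form_bound K (avg N \<Phi>)) \<and> ((\<lambda>m. m \<Phi> - m (avg N \<Phi>)) \<longlongrightarrow> 0) F"
      by (rule avg_limit[OF ev _ \<Phi>b]) (rule comm)
    obtain K' where K': "D.form_bound K' (avg N \<Phi>)"
      using limit by blast
    have eq: "avg N \<Phi> x y = Pr * \<omega> x y" if "x \<in> A" "y \<in> A" for x y
    proof (rule D.forms_eq[OF A_eq Gens_bounded Gens_mult _ K' D.form_bound_scale[OF \<omega>b] gens that])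
      have "gen 0 (\<lambda>k. 1\<^sub>m (d k)) \<in> Gens" unfolding Gens_def by blast
      then show "(\<lambda>u\<in>L2 \<mu>. u) \<in> Gens" unfolding gen_one .
    qed
    \<comment> \<open>The limit of \<open>m \<Phi>\<close> is that of its average, and this is
      \<open>Pr\<close> times the limit 1 of \<open>m \<omega>\<close>; comparison with the bound of
      the net at \<open>\<Phi>\<close> gives the estimate.\<close>
    have "((\<lambda>m. Pr * m \<omega>) \<longlongrightarrow> Pr * 1) F"
    proof (rule tendsto_mult_left)
      have "l2_inner \<mu> (?vec z) (?vec z) = 1" using l2_norm_inner[of \<mu> "?vec z"] unfolding norm by simp
      then show "((\<lambda>m. m \<omega>) \<longlongrightarrow> 1) F" using diag[OF vec(3,3)] unfolding \<omega>_def[abs_def] by simp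
    qed
    then have "((\<lambda>m. (m \<Phi> - m (avg N \<Phi>)) + Pr * m \<omega>) \<longlongrightarrow> 0 + Pr * 1) F"
      by (rule tendsto_add[OF conjunct2[OF limit]])
    moreover have "eventually (\<lambda>m. (m \<Phi> - m (avg N \<Phi>)) + Pr * m \<omega> = m \<Phi>) F"
      using ev
    proof eventually_elim
      case (elim m)
      have "m (avg N \<Phi>) = Pr * m \<omega>"
        using D.tensor_cong[OF elim eq K'] D.tensor_scale[OF elim \<omega>b, of Pr] by simp
      then show ?case by simp
    qed
    ultimately have "((\<lambda>m. m \<Phi>) \<longlongrightarrow> 0 + Pr * 1) F" by (rule Lim_transform_eventually)
    then have "((\<lambda>m. cmod (m \<Phi>)) \<longlongrightarrow> cmod Pr) F" using tendsto_norm by fastforce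
    then have "cmod Pr \<le> op_norm \<mu> T * C" by (rule tendsto_upperbound[OF _ bd[OF \<Phi>b] F])
    \<comment> \<open>The constant of the net carries no sign condition, hence the absolute
      value.\<close>
    also have "\<dots> \<le> 1 * \<bar>C\<bar>" using T1 op_norm_nonneg[OF T] by (intro order.trans[OF mult_left_mono mult_right_mono]) auto
    finally show ?thesis unfolding Pr_def norm_of_real by simp
  qed
  then show ?thesis by blast
qed

end

section \<open>The equivalent inner product\<close>

text \<open>The factors are replaced by their suprema one at a time; with the others fixed and
  nonnegative, the product is linear and increasing in a single factor.\<close>

lemma prod_Sup_le:
  fixes S :: "nat \<Rightarrow> real set"
  assumes S: "\<And>k. S k \<noteq> {}" "\<And>k. bdd_above (S k)" "\<And>k x. x \<in> S k \<Longrightarrow> 0 \<le> x"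
    and C: "\<And>r. (\<And>k. k < N \<Longrightarrow> r k \<in> S k) \<Longrightarrow> (\<Prod>k<N. r k) \<le> C"
  shows "(\<Prod>k<N. Sup (S k)) \<le> C"
proof -
  have "\<forall>r. (\<forall>k<N. r k \<in> S k) \<longrightarrow> (\<Prod>k<N. if k < m then Sup (S k) else r k) \<le> C" if "m \<le> N" for m
    using that
  proof (induction m)
    case 0
    then show ?case using C by simp
  next
    case (Suc m)
    show ?case
    proof (intro allI impI)
      fix r assume r: "\<forall>k<N. r k \<in> S k"
      have m: "m < N" using Suc.prems by simp
      have Sup_nonneg: "0 \<le> Sup (S k)" for k
        using S(1)[of k] S(2,3) by (metis all_not_in_conv cSup_upper order.trans)
      define Q where "Q = (\<Prod>k\<in>{..<N} - {m}. if k < m then Sup (S k) else r k)"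
      have Q: "Q \<ge> 0" unfolding Q_def using r S(3) Sup_nonneg by (intro prod_nonneg) auto
      have le: "x * Q \<le> C" if x: "x \<in> S m" for x
      proof -
        have "(\<Prod>k<N. if k < m then Sup (S k) else (r(m := x)) k) \<le> C"
          using Suc.IH m r x by simp
        also have "(\<Prod>k<N. if k < m then Sup (S k) else (r(m := x)) k) =
            x * (\<Prod>k\<in>{..<N} - {m}. if k < m then Sup (S k) else (r(m := x)) k)"
          using m by (subst prod.remove[of _ m]) auto
        also have "(\<Prod>k\<in>{..<N} - {m}. if k < m then Sup (S k) else (r(m := x)) k) = Q"
          unfolding Q_def by (rule prod.cong) auto
        finally show ?thesis .
      qed
      have "Sup (S m) * Q \<le> C"
      proof (cases "Q = 0")
        case True
        then show ?thesis using le S(1)[of m] by auto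
      next
        case False
        then have "Q > 0" using Q by simp
        then have "Sup (S m) \<le> C / Q"
          using le by (intro cSup_least S(1)) (simp add: pos_le_divide_eq)
        then show ?thesis using \<open>Q > 0\<close> by (simp add: pos_le_divide_eq)
      qed
      moreover have "(\<Prod>k<N. if k < Suc m then Sup (S k) else r k) =
          Sup (S m) * (\<Prod>k\<in>{..<N} - {m}. if k < Suc m then Sup (S k) else r k)"
        using m by (subst prod.remove[of _ m]) auto
      moreover have "(\<Prod>k\<in>{..<N} - {m}. if k < Suc m then Sup (S k) else r k) = Q"
        unfolding Q_def by (rule prod.cong) auto
      ultimately show "(\<Prod>k<N. if k < Suc m then Sup (S k) else r k) \<le> C" by simp
    qed
  qed
  from this[of N] S(1) C have "\<forall>r. (\<forall>k<N. r k \<in> S k) \<longrightarrow> (\<Prod>k<N. Sup (S k)) \<le> C" by simp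
  moreover have "\<exists>r. \<forall>k<N. r k \<in> S k" by (rule exI[of _ "\<lambda>k. SOME x. x \<in> S k"]) (use S(1) in \<open>simp add: some_in_eq\<close>)
  ultimately show ?thesis by blast
qed

lemma sq_norm_basis: "n > 0 \<Longrightarrow> sq_norm n basis = 1"
proof -
  assume "n > 0"
  moreover have "sq_norm n basis = (\<Sum>l<n. if l = 0 then 1 else 0)"
    unfolding sq_norm_def by (intro sum.cong) (auto simp: basis_def)
  ultimately show ?thesis by simp
qed

section \<open>Uniform control of the condition numbers\<close>

context similarity_tensor
begin

text \<open>Fourth powers remove both square roots from the local constants, which is why the proof
  ends with \<open>C ^ 4\<close>.\<close>

lemma similarity_product_bound:
  assumes "amenable (op_algebra \<mu>\<lparr>carrier := A\<rparr>)"
  shows "\<exists>C\<ge>1. \<forall>N i v w.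
    (\<forall>k<N. i k \<in> I k \<and> sq_norm (d k) (v k) = 1 \<and> sq_norm (d k) (w k) = 1) \<longrightarrow>
    (\<Prod>k<N. sq_norm (d k) (mat_app (d k) (t k (i k)) (v k)) * sq_norm (d k) (mat_app (d k) (s k (i k)) (w k))) \<le> C"
proof -
  obtain C where C: "\<And>N L. (\<forall>k<N. \<exists>B \<tau> \<xi> \<eta>. local_datum k (L k) B \<tau> \<xi> \<eta>) \<Longrightarrow> (\<Prod>k<N. L k) \<le> C"
    using amenable_product_bound[OF assms] by blast
  \<comment> \<open>The empty product shows that the bound is at least 1.\<close>
  have C1: "C \<ge> 1" using C[of 0] by simp
  have "(\<Prod>k<N. sq_norm (d k) (mat_app (d k) (t k (i k)) (v k)) * sq_norm (d k) (mat_app (d k) (s k (i k)) (w k))) \<le> C ^ 4"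
    if H: "\<forall>k<N. i k \<in> I k \<and> sq_norm (d k) (v k) = 1 \<and> sq_norm (d k) (w k) = 1" for N i v w
  proof -
    let ?a = "\<lambda>k. sq_norm (d k) (mat_app (d k) (t k (i k)) (v k))" and ?b = "\<lambda>k. sq_norm (d k) (mat_app (d k) (s k (i k)) (w k))"
    let ?L = "\<lambda>k. sqrt (sqrt (?a k) * sqrt (?b k))"
    have "(\<Prod>k<N. ?L k) \<le> C" using H local_datum_exists by (intro C) blast
    moreover have "0 \<le> (\<Prod>k<N. ?L k)" by (intro prod_nonneg) simp
    ultimately have "(\<Prod>k<N. ?L k) ^ 4 \<le> C ^ 4" by (rule power_mono)
    moreover have "?L k ^ 4 = ?a k * ?b k" for k
    proof -
      have "?L k ^ 4 = ((?L k)\<^sup>2)\<^sup>2" using power_mult[of "?L k" 2 2] by (simp del: real_sqrt_pow2_iff real_sqrt_mult)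
      also have "\<dots> = ?a k * ?b k" by (simp add: power_mult_distrib)
      finally show ?thesis .
    qed
    ultimately show ?thesis by (simp add: prod_power_distrib)
  qed
  then show ?thesis using one_le_power[OF C1, of 4] by blast
qed

lemma mat_app_nonzero:
  assumes "i \<in> I k" "sq_norm (d k) g \<noteq> 0"
  shows "sq_norm (d k) (mat_app (d k) (t k i) g) > 0"
proof (rule ccontr)
  assume "\<not> sq_norm (d k) (mat_app (d k) (t k i) g) > 0"
  then have "sq_norm (d k) (mat_app (d k) (t k i) g) = 0"
    using sq_norm_nonneg[of "d k" "mat_app (d k) (t k i) g"] by linarith
  then have z: "mat_app (d k) (t k i) g l = 0" if "l < d k" for l using that by (simp add: sq_norm_eq_zero)
  have "g j = 0" if j: "j < d k" for j
  proof -
    have "g j = mat_app (d k) (s k i) (mat_app (d k) (t k i) g) j" by (rule s_t_app(1)[OF assms(1) j, symmetric])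
    also have "\<dots> = mat_app (d k) (s k i) (\<lambda>_. 0) j" by (rule mat_app_cong) (rule z)
    finally show ?thesis by (simp add: mat_app_def)
  qed
  then show False using assms(2) by (simp add: sq_norm_eq_zero)
qed

text \<open>\<open>\<kappa> k\<close> is the supremum over i of the squared condition number of
  s(i), and \<open>\<sigma> k i\<close> is the reciprocal norm of the inverse of s(i). Scaling by
  \<open>\<sigma> k i\<close> makes that inverse a contraction whose own inverse has squared norm at
  most \<open>\<kappa> k\<close>; scalars are harmless since they cancel in conjugations.\<close>

lemma scaling_exists:
  assumes "amenable (op_algebra \<mu>\<lparr>carrier := A\<rparr>)"
  shows "\<exists>C \<kappa> \<sigma>. C \<ge> 1 \<and> (\<forall>k. \<kappa> k > 0) \<and> (\<forall>N. (\<Prod>k<N. \<kappa> k) \<le> C) \<and>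
    (\<forall>k. \<forall>i\<in>I k. \<sigma> k i > 0 \<and> (\<forall>g. (\<sigma> k i)\<^sup>2 * sq_norm (d k) (mat_app (d k) (t k i) g) \<le> sq_norm (d k) g \<and>
      sq_norm (d k) (mat_app (d k) (s k i) g) \<le> \<kappa> k * ((\<sigma> k i)\<^sup>2 * sq_norm (d k) g)))"
proof -
  obtain C where C: "C \<ge> 1" and bound: "\<And>N i v w.
      (\<forall>k<N. i k \<in> I k \<and> sq_norm (d k) (v k) = 1 \<and> sq_norm (d k) (w k) = 1) \<Longrightarrow>
      (\<Prod>k<N. sq_norm (d k) (mat_app (d k) (t k (i k)) (v k)) * sq_norm (d k) (mat_app (d k) (s k (i k)) (w k))) \<le> C"
    using similarity_product_bound[OF assms] by blast
  define a where "a k i v = sq_norm (d k) (mat_app (d k) (t k i) v)" for k i v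
  define b where "b k i w = sq_norm (d k) (mat_app (d k) (s k i) w)" for k i w
  define U where "U k = {v. sq_norm (d k) v = 1}" for k
  \<comment> \<open>\<open>v\<close> and \<open>w\<close> vary independently, so for each i the
    supremum is a product of two squared operator norms, and bounds for arbitrary choices of i, v, w
    become a bound for the product of suprema.\<close>
  define S where "S k = {a k i v * b k i w | i v w. i \<in> I k \<and> v \<in> U k \<and> w \<in> U k}" for k
  define \<kappa> where "\<kappa> k = Sup (S k)" for k
  define Tn where "Tn k i = Sup (a k i ` U k)" for k i
  have basis: "basis \<in> U k" for k using sq_norm_basis[OF d_pos] by (simp add: U_def)
  have ab0: "0 \<le> a k i v" "0 \<le> b k i v" for k i v by (simp_all add: a_def b_def)
  obtain ca cb where ca: "\<And>k i v. i \<in> I k \<Longrightarrow> v \<in> U k \<Longrightarrow> a k i v \<le> ca k"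
    and cb: "\<And>k i v. i \<in> I k \<Longrightarrow> v \<in> U k \<Longrightarrow> b k i v \<le> cb k"
  proof -
    have "\<exists>p. \<forall>i\<in>I k. \<forall>v\<in>U k. a k i v \<le> fst p \<and> b k i v \<le> snd p" for k
    proof -
      obtain b' c where "\<forall>i\<in>I k. \<forall>g. sq_norm (d k) (mat_app (d k) (s k i) g) \<le> b' * sq_norm (d k) g"
          "\<forall>i\<in>I k. \<forall>g. sq_norm (d k) (mat_app (d k) (t k i) g) \<le> c * sq_norm (d k) g"
        using s_bounds[of k] by blast
      then have "\<forall>i\<in>I k. \<forall>v\<in>U k. a k i v \<le> fst (c, b') \<and> b k i v \<le> snd (c, b')"
        unfolding a_def b_def U_def by (metis (mono_tags, lifting) fst_conv mem_Collect_eq mult_1_right snd_conv)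
      then show ?thesis by blast
    qed
    then obtain p where "\<And>k. \<forall>i\<in>I k. \<forall>v\<in>U k. a k i v \<le> fst (p k) \<and> b k i v \<le> snd (p k)" by metis
    then show thesis by (intro that[of "\<lambda>k. fst (p k)" "\<lambda>k. snd (p k)"]) blast+
  qed
  have S_ne: "S k \<noteq> {}" for k using i0(1) basis unfolding S_def by blast
  have S_bdd: "bdd_above (S k)" for k
  proof (rule bdd_aboveI)
    fix x assume "x \<in> S k"
    then obtain i v w where x: "x = a k i v * b k i w" "i \<in> I k" "v \<in> U k" "w \<in> U k" unfolding S_def by blast
    then show "x \<le> ca k * cb k"
      using ca[OF x(2,3)] cb[OF x(2,4)] ab0 by (auto intro!: mult_mono intro: order.trans)
  qed
  have prod: "(\<Prod>k<N. \<kappa> k) \<le> C" for N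
    unfolding \<kappa>_def
  proof (rule prod_Sup_le[OF S_ne S_bdd])
    show "0 \<le> x" if "x \<in> S k" for k x using that ab0 unfolding S_def by auto
    fix r assume "\<And>k. k < N \<Longrightarrow> r k \<in> S k"
    then have "\<forall>k. \<exists>p. k < N \<longrightarrow> fst p \<in> I k \<and> fst (snd p) \<in> U k \<and> snd (snd p) \<in> U k \<and>
        r k = a k (fst p) (fst (snd p)) * b k (fst p) (snd (snd p))"
      unfolding S_def by fastforce
    then obtain p where p: "\<And>k. k < N \<Longrightarrow> fst (p k) \<in> I k \<and> fst (snd (p k)) \<in> U k \<and> snd (snd (p k)) \<in> U k \<and>
        r k = a k (fst (p k)) (fst (snd (p k))) * b k (fst (p k)) (snd (snd (p k)))" by metis
    have "(\<Prod>k<N. r k) = (\<Prod>k<N. a k (fst (p k)) (fst (snd (p k))) * b k (fst (p k)) (snd (snd (p k))))"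
      using p by (intro prod.cong) auto
    also have "\<dots> \<le> C" unfolding a_def b_def using p by (intro bound) (simp add: U_def)
    finally show "(\<Prod>k<N. r k) \<le> C" .
  qed
  have Tn_bdd: "bdd_above (a k i ` U k)" if "i \<in> I k" for k i
    using ca[OF that] by (intro bdd_aboveI[of _ "ca k"]) auto
  have a_le: "a k i v \<le> Tn k i" if "i \<in> I k" "v \<in> U k" for k i v
    unfolding Tn_def using that by (intro cSup_upper Tn_bdd) auto
  have Tn_pos: "Tn k i > 0" if "i \<in> I k" for k i
    using mat_app_nonzero[OF that, of basis] a_le[OF that basis] sq_norm_basis[OF d_pos[of k]] by (simp add: a_def)
  have a_hom: "sq_norm (d k) (mat_app (d k) (t k i) g) \<le> Tn k i * sq_norm (d k) g" if i: "i \<in> I k" for k i g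
  proof (cases "sq_norm (d k) g = 0")
    case True
    then have "mat_app (d k) (t k i) g = (\<lambda>_. 0)" by (auto simp: sq_norm_eq_zero mat_app_def)
    then show ?thesis using True by (simp add: sq_norm_def)
  next
    case False
    then obtain c h where ch: "c > 0" "sq_norm (d k) h = 1" "sq_norm (d k) g = c"
      "\<And>m. sq_norm (d k) (mat_app (d k) m g) = c * sq_norm (d k) (mat_app (d k) m h)"
      using sq_norm_normalize by metis
    have "c * a k i h \<le> c * Tn k i" using ch by (intro mult_left_mono a_le i) (simp_all add: U_def)
    then show ?thesis by (simp add: ch a_def mult.commute)
  qed
  have b_hom: "Tn k i * sq_norm (d k) (mat_app (d k) (s k i) g) \<le> \<kappa> k * sq_norm (d k) g" if i: "i \<in> I k" for k i g
  proof (cases "sq_norm (d k) g = 0")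
    case True
    then have "mat_app (d k) (s k i) g = (\<lambda>_. 0)" by (auto simp: sq_norm_eq_zero mat_app_def)
    then show ?thesis using True by (simp add: sq_norm_def)
  next
    case False
    then obtain c h where ch: "c > 0" "sq_norm (d k) h = 1" "sq_norm (d k) g = c"
      "\<And>m. sq_norm (d k) (mat_app (d k) m g) = c * sq_norm (d k) (mat_app (d k) m h)"
      using sq_norm_normalize by metis
    have h: "h \<in> U k" using ch by (simp add: U_def)
    \<comment> \<open>The supremum over \<open>v\<close> is taken with \<open>h\<close> fixed;
      dividing by \<open>b k i h\<close> requires it to be positive, hence the two cases.\<close>
    have "Tn k i * b k i h \<le> \<kappa> k"
    proof (cases "b k i h = 0")
      case True
      have "0 \<le> a k i h * b k i h" using ab0 by simp
      also have "\<dots> \<le> \<kappa> k" unfolding \<kappa>_def S_def using i h S_bdd[unfolded S_def] by (intro cSup_upper) auto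
      finally show ?thesis using True by simp
    next
      case False
      then have bp: "b k i h > 0" using ab0(2)[of k i h] by simp
      have "a k i v \<le> \<kappa> k / b k i h" if "v \<in> U k" for v
      proof -
        have "a k i v * b k i h \<le> \<kappa> k"
          unfolding \<kappa>_def by (rule cSup_upper[OF _ S_bdd]) (use i h that in \<open>auto simp: S_def\<close>)
        then show ?thesis using bp by (simp add: pos_le_divide_eq)
      qed
      then have "Tn k i \<le> \<kappa> k / b k i h" unfolding Tn_def using basis by (intro cSup_least) auto
      then show ?thesis using bp by (simp add: pos_le_divide_eq)
    qed
    then have "c * (Tn k i * b k i h) \<le> c * \<kappa> k" using ch by (intro mult_left_mono) simp_all
    then show ?thesis by (simp add: ch b_def mult_ac)
  qed
  have \<kappa>_pos: "\<kappa> k > 0" for k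
  proof -
    have "sq_norm (d k) (mat_app (d k) (s k (i0 k)) basis) = 1"
    proof -
      have "sq_norm (d k) (mat_app (d k) (s k (i0 k)) basis) = sq_norm (d k) basis"
        by (rule sq_norm_cong) (simp add: i0 mat_app_one)
      then show ?thesis using sq_norm_basis[OF d_pos] by simp
    qed
    then have "Tn k (i0 k) \<le> \<kappa> k" using b_hom[OF i0(1), of k basis] sq_norm_basis[OF d_pos[of k]] by simp
    then show ?thesis using Tn_pos[OF i0(1), of k] by linarith
  qed
  have "1 / sqrt (Tn k i) > 0 \<and> (\<forall>g. (1 / sqrt (Tn k i))\<^sup>2 * sq_norm (d k) (mat_app (d k) (t k i) g) \<le> sq_norm (d k) g \<and>
      sq_norm (d k) (mat_app (d k) (s k i) g) \<le> \<kappa> k * ((1 / sqrt (Tn k i))\<^sup>2 * sq_norm (d k) g))" if i: "i \<in> I k" for k i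
    using Tn_pos[OF i] a_hom[OF i] b_hom[OF i] by (simp add: power_divide divide_le_eq le_divide_eq mult.commute)
  then show ?thesis using C \<kappa>_pos prod by (intro exI[of _ C] exI[of _ \<kappa>] exI[of _ "\<lambda>k i. 1 / sqrt (Tn k i)"]) blast
qed

text \<open>When each fibre is mapped to itself, the weights on both sides agree.\<close>

lemma fibre_boundedI:
  assumes "K \<ge> 0" "\<And>i g. i \<in> I k \<Longrightarrow> sq_norm (d k) (mat_app (d k) (B i) g) \<le> K * sq_norm (d k) g"
  shows "fibre_bounded k B (\<lambda>i. i) K"
  unfolding fibre_bounded_def
proof (intro conjI ballI allI)
  fix i g assume i: "i \<in> I k"
  have "f k i * sq_norm (d k) (mat_app (d k) (B i) g) \<le> f k i * (K * sq_norm (d k) g)"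
    using f_pos[OF i] by (intro mult_left_mono assms(2) i) simp
  then show "f k i * sq_norm (d k) (mat_app (d k) (B i) g) \<le> K * (f k i * sq_norm (d k) g)" by (simp add: mult_ac)
qed (simp_all add: assms(1) bij_betw_def)

text \<open>Common notation for generators, normalised similarities and constant matrices, so that
  their products and adjoints can be computed fibre by fibre.\<close>

definition fop :: "nat \<Rightarrow> (nat \<Rightarrow> 'i \<Rightarrow> complex mat) \<Rightarrow> (nat \<Rightarrow> nat \<times> 'i) l2 \<Rightarrow> (nat \<Rightarrow> nat \<times> 'i) l2" where
  "fop n B = class_op \<mu> (tensor_op n B (\<lambda>_ i. i))"

lemma fop_bounded:
  assumes "\<And>k. k < n \<Longrightarrow> fibre_bounded k (B k) (\<lambda>i. i) (K k)"
  shows "fop n B \<in> bounded_ops \<mu>"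
    and "u \<in> L2 \<mu> \<Longrightarrow> fop n B u \<in> L2 \<mu>"
    and "u \<in> L2 \<mu> \<Longrightarrow> l2_norm \<mu> (fop n B u) \<le> sqrt (\<Prod>k<n. K k) * l2_norm \<mu> u"
proof -
  have b: "finitely_bounded \<mu> (\<Prod>k<n. K k) (tensor_op n B (\<lambda>_ i. i))"
    by (rule tensor_op_bounded) (rule assms)
  show "fop n B \<in> bounded_ops \<mu>" unfolding fop_def by (rule class_op_bounded_ops(1)[OF b])
  then show "u \<in> L2 \<mu> \<Longrightarrow> fop n B u \<in> L2 \<mu>" by (rule bounded_opsD(1))
  show "u \<in> L2 \<mu> \<Longrightarrow> l2_norm \<mu> (fop n B u) \<le> sqrt (\<Prod>k<n. K k) * l2_norm \<mu> u"
    unfolding fop_def by (rule class_op_bounded_ops(2)[OF b])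
qed

lemma fop_cong:
  assumes "\<And>k i. k < n \<Longrightarrow> i \<in> I k \<Longrightarrow> B k i = B' k i"
  shows "fop n B = fop n B'"
  unfolding fop_def class_op_def
  by (intro restrict_ext l2_class_cong_space tensor_op_cong) (use assms in auto)

lemma fop_mult:
  assumes "\<And>k. k < n \<Longrightarrow> fibre_bounded k (A' k) (\<lambda>i. i) (K k)" "\<And>k. k < n \<Longrightarrow> fibre_bounded k (B k) (\<lambda>i. i) (K' k)"
    and "\<And>k i. k < n \<Longrightarrow> i \<in> I k \<Longrightarrow> A' k i \<in> carrier_mat (d k) (d k)" "\<And>k i. k < n \<Longrightarrow> i \<in> I k \<Longrightarrow> B k i \<in> carrier_mat (d k) (d k)"
    and u: "u \<in> L2 \<mu>"
  shows "fop n A' (fop n B u) = fop n (\<lambda>k i. A' k i * B k i) u"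
proof -
  have "fop n A' (fop n B u) = class_op \<mu> (\<lambda>x. tensor_op n A' (\<lambda>_ i. i) (tensor_op n B (\<lambda>_ i. i) x)) u"
    unfolding fop_def
  proof (rule class_op_comp[OF _ _ u])
    show "finitely_bounded \<mu> (\<Prod>k<n. K k) (tensor_op n A' (\<lambda>_ i. i))" by (rule tensor_op_bounded) (rule assms(1))
    show "finitely_bounded \<mu> (\<Prod>k<n. K' k) (tensor_op n B (\<lambda>_ i. i))" by (rule tensor_op_bounded) (rule assms(2))
  qed
  also have "\<dots> = fop n (\<lambda>k i. A' k i * B k i) u"
    unfolding fop_def class_op_def using u
    by (simp, intro l2_class_cong_space tensor_op_mult assms(3,4))
  finally show ?thesis .
qed

lemma fop_one:
  assumes "\<And>k i. k < n \<Longrightarrow> i \<in> I k \<Longrightarrow> B k i = 1\<^sub>m (d k)" and u: "u \<in> L2 \<mu>"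
  shows "fop n B u = u"
proof -
  have "fop n B u = l2_class \<mu> (l2_rep u)"
  proof -
    have "tensor_op n B (\<lambda>_ i. i) (l2_rep u) \<omega> = l2_rep u \<omega>" if "\<omega> \<in> space \<mu>" for \<omega>
      using tensor_op_pad[of 0 n B \<omega> "l2_rep u"] assms(1) that by simp
    then show ?thesis unfolding fop_def class_op_def using u by (simp, intro l2_class_cong_space)
  qed
  then show ?thesis using u by (simp add: l2_rep_L2)
qed

lemma fop_adjoint:
  assumes B: "\<And>k. k < n \<Longrightarrow> fibre_bounded k (B k) (\<lambda>i. i) (K k)"
    and B': "\<And>k. k < n \<Longrightarrow> fibre_bounded k (\<lambda>i. adj (d k) (B k i)) (\<lambda>i. i) (K' k)"
    and u: "u \<in> L2 \<mu>" and w: "w \<in> L2 \<mu>"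
  shows "l2_inner \<mu> (fop n B u) w = l2_inner \<mu> u (fop n (\<lambda>k i. adj (d k) (B k i)) w)"
proof -
  obtain x y where x: "x \<in> square_integrable \<mu>" "u = l2_class \<mu> x" and y: "y \<in> square_integrable \<mu>" "w = l2_class \<mu> y"
    using u w by (metis L2_cases)
  have b: "finitely_bounded \<mu> (\<Prod>k<n. K k) (tensor_op n B (\<lambda>_ i. i))"
    and b': "finitely_bounded \<mu> (\<Prod>k<n. K' k) (tensor_op n (\<lambda>k i. adj (d k) (B k i)) (\<lambda>_ i. i))"
    by (rule tensor_op_bounded, rule B, assumption) (rule tensor_op_bounded, rule B', assumption)
  have S: "tensor_op n B (\<lambda>_ i. i) x \<in> square_integrable \<mu>"
    "tensor_op n (\<lambda>k i. adj (d k) (B k i)) (\<lambda>_ i. i) y \<in> square_integrable \<mu>"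
    using b b' x(1) y(1) unfolding finitely_bounded_def by blast+
  show ?thesis
    unfolding fop_def x(2) y(2) class_op_class[OF b x(1)] class_op_class[OF b' y(1)]
      l2_inner_class[OF S(1) y(1)] l2_inner_class[OF x(1) S(2)]
    by (rule tensor_op_adjoint[OF _ _ x(1) y(1)]) (rule B, assumption, rule B')
qed

text \<open>Serves monotonicity: a further coordinate with a contraction cannot increase the
  norm.\<close>

lemma fop_Suc:
  assumes "\<And>k. k < Suc n \<Longrightarrow> fibre_bounded k (B k) (\<lambda>i. i) (K k)" and u: "u \<in> L2 \<mu>"
  shows "l2_norm \<mu> (fop (Suc n) B u) \<le> sqrt (K n) * l2_norm \<mu> (fop n B u)"
proof -
  have c: "finitely_bounded \<mu> (K n) (coord_op n (B n) (\<lambda>i. i))"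
    by (rule coord_op_bounded) (use assms(1) in simp)
  have b: "finitely_bounded \<mu> (\<Prod>k<n. K k) (tensor_op n B (\<lambda>_ i. i))"
    by (rule tensor_op_bounded) (use assms(1) in simp)
  have "tensor_op (Suc n) B (\<lambda>_ i. i) = (\<lambda>x. coord_op n (B n) (\<lambda>i. i) (tensor_op n B (\<lambda>_ i. i) x))" by auto
  then have "fop (Suc n) B u = class_op \<mu> (coord_op n (B n) (\<lambda>i. i)) (fop n B u)"
    unfolding fop_def using class_op_comp[OF c b u] by simp
  then show ?thesis
    using class_op_bounded_ops(2)[OF c bounded_opsD(1)[OF class_op_bounded_ops(1)[OF b] u]] by (simp add: fop_def)
qed

text \<open>With h = (adj B) g the squared norm of h is \<langle>B h, g\<rangle>; Cauchy-Schwarz and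
  the bound for B then let one factor cancel.\<close>

lemma adj_contraction:
  assumes "K \<ge> 0" "\<And>g. sq_norm n (mat_app n B g) \<le> K * sq_norm n g"
  shows "sq_norm n (mat_app n (adj n B) g) \<le> K * sq_norm n g"
proof (cases "sq_norm n (mat_app n (adj n B) g) = 0")
  case True
  then show ?thesis using assms(1) by simp
next
  case False
  let ?h = "mat_app n (adj n B) g"
  have pos: "sq_norm n ?h > 0" using False sq_norm_nonneg[of n ?h] by linarith
  have "complex_of_real (sq_norm n ?h) = cinner n (mat_app n B ?h) g"
    unfolding cinner_self[symmetric] by (rule cinner_adj[symmetric])
  then have "(sq_norm n ?h)\<^sup>2 = (cmod (cinner n (mat_app n B ?h) g))\<^sup>2"
    by (metis norm_of_real power2_abs)
  also have "\<dots> \<le> sq_norm n (mat_app n B ?h) * sq_norm n g" by (rule cinner_Cauchy_Schwarz)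
  also have "\<dots> \<le> (K * sq_norm n ?h) * sq_norm n g" by (intro mult_right_mono assms(2)) simp
  finally have "sq_norm n ?h * sq_norm n ?h \<le> (K * sq_norm n g) * sq_norm n ?h" by (simp add: power2_eq_square mult_ac)
  then show ?thesis using pos by (rule mult_right_le_imp_le)
qed

lemma adj_one: "adj n (1\<^sub>m n) = 1\<^sub>m n"
  by (rule eq_matI) (auto simp: adj_def)

lemma constant_fibre_bounded: "\<exists>K. \<forall>k. fibre_bounded k (\<lambda>_. c k) (\<lambda>i. i) (K k)"
proof (intro exI allI)
  fix k
  show "fibre_bounded k (\<lambda>_. c k) (\<lambda>i. i) (\<Sum>j<d k. \<Sum>l<d k. (cmod (c k $$ (j, l)))\<^sup>2)"
    by (rule fibre_boundedI[OF _ sq_norm_mat_app_le]) (intro sum_nonneg zero_le_power2)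
qed

theorem similar_to_cstar_of_amenable:
  assumes am: "amenable (op_algebra \<mu>\<lparr>carrier := A\<rparr>)"
  shows "\<exists>v \<in> Units (op_algebra \<mu>). cstar_subalgebra \<mu>
    ((\<lambda>a. v \<otimes>\<^bsub>op_algebra \<mu>\<^esub> a \<otimes>\<^bsub>op_algebra \<mu>\<^esub> inv\<^bsub>op_algebra \<mu>\<^esub> v) ` A)"
proof -
  obtain C \<kappa> \<sigma> where C: "C \<ge> 1" and \<kappa>: "\<And>k. \<kappa> k > 0" "\<And>N. (\<Prod>k<N. \<kappa> k) \<le> C"
    and \<sigma>: "\<And>k i. i \<in> I k \<Longrightarrow> \<sigma> k i > 0"
      "\<And>k i g. i \<in> I k \<Longrightarrow> (\<sigma> k i)\<^sup>2 * sq_norm (d k) (mat_app (d k) (t k i) g) \<le> sq_norm (d k) g"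
      "\<And>k i g. i \<in> I k \<Longrightarrow> sq_norm (d k) (mat_app (d k) (s k i) g) \<le> \<kappa> k * ((\<sigma> k i)\<^sup>2 * sq_norm (d k) g)"
    using scaling_exists[OF am] by blast
  \<comment> \<open>The inverse similarities normalised to contractions, and their inverses
    \<open>w\<close>, of squared norm at most \<open>\<kappa> k\<close> in coordinate
    \<open>k\<close>.\<close>
  define v where "v k i = complex_of_real (\<sigma> k i) \<cdot>\<^sub>m t k i" for k i
  define w where "w k i = complex_of_real (1 / \<sigma> k i) \<cdot>\<^sub>m s k i" for k i
  have v_carrier: "v k i \<in> carrier_mat (d k) (d k)" and w_carrier: "w k i \<in> carrier_mat (d k) (d k)"
    if "i \<in> I k" for k i using s_inv[OF that] by (simp_all add: v_def w_def)
  have smult_norm: "sq_norm n (mat_app n (complex_of_real c \<cdot>\<^sub>m m) g) = c\<^sup>2 * sq_norm n (mat_app n m g)"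
    if "m \<in> carrier_mat n n" for n c m g
  proof -
    have "sq_norm n (mat_app n (complex_of_real c \<cdot>\<^sub>m m) g) = sq_norm n (\<lambda>j. complex_of_real c * mat_app n m g j)"
      by (rule sq_norm_cong) (rule mat_app_smult[OF that])
    then show ?thesis by (simp add: sq_norm_scale)
  qed
  have v_contr: "sq_norm (d k) (mat_app (d k) (v k i) g) \<le> 1 * sq_norm (d k) g" if "i \<in> I k" for k i g
    unfolding v_def smult_norm[OF s_inv(2)[OF that]] using \<sigma>(2)[OF that] by simp
  have vb: "fibre_bounded k (v k) (\<lambda>i. i) 1" for k
    by (rule fibre_boundedI) (simp, rule v_contr)
  have vab: "fibre_bounded k (\<lambda>i. adj (d k) (v k i)) (\<lambda>i. i) 1" for k
    by (rule fibre_boundedI) (simp, rule adj_contraction, simp, rule v_contr)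
  have wb: "fibre_bounded k (w k) (\<lambda>i. i) (\<kappa> k)" for k
  proof (rule fibre_boundedI)
    show "\<kappa> k \<ge> 0" using \<kappa>(1)[of k] by simp
    fix i g assume i: "i \<in> I k"
    show "sq_norm (d k) (mat_app (d k) (w k i) g) \<le> \<kappa> k * sq_norm (d k) g"
      unfolding w_def smult_norm[OF s_inv(1)[OF i]] using \<sigma>(1,3)[OF i]
      by (simp add: power_divide divide_le_eq mult_ac)
  qed
  define V where "V N = fop N v" for N
  define V' where "V' N = fop N (\<lambda>k i. adj (d k) (v k i))" for N
  note V = fop_bounded[where B = v and K = "\<lambda>_. 1", OF vb, folded V_def, simplified]
  note V' = fop_bounded[where B = "\<lambda>k i. adj (d k) (v k i)" and K = "\<lambda>_. 1", OF vab, folded V'_def, simplified]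
  have V_dec: "l2_norm \<mu> (V (Suc N) u) \<le> l2_norm \<mu> (V N u)" if "u \<in> L2 \<mu>" for N u
    using fop_Suc[of N v "\<lambda>_. 1", OF vb that] unfolding V_def by simp
  \<comment> \<open>The left inverse built from \<open>w\<close> has squared norm at most the
    product of the \<open>\<kappa> k\<close>, hence at most \<open>C\<close> for every
    \<open>N\<close>. This uniform lower bound is what amenability provides.\<close>
  have V_low: "(l2_norm \<mu> u)\<^sup>2 \<le> C * (l2_norm \<mu> (V N u))\<^sup>2" if u: "u \<in> L2 \<mu>" for N u
  proof -
    have "w k i * v k i = 1\<^sub>m (d k)" if i: "i \<in> I k" for k i
    proof -
      note m = s_inv(1,2)[OF i]
      have "w k i * v k i = complex_of_real (1 / \<sigma> k i) \<cdot>\<^sub>m (complex_of_real (\<sigma> k i) \<cdot>\<^sub>m (s k i * t k i))"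
        unfolding w_def v_def mult_smult_assoc_mat[OF m(1) smult_carrier_mat[OF m(2)]] mult_smult_distrib[OF m] ..
      also have "\<dots> = 1\<^sub>m (d k)" unfolding s_inv(3)[OF i] using \<sigma>(1)[OF i] by (intro eq_matI) simp_all
      finally show ?thesis .
    qed
    then have "fop N w (V N u) = u"
      unfolding V_def using fop_mult[of N w \<kappa> v "\<lambda>_. 1", OF wb vb w_carrier v_carrier u] fop_one[OF _ u] by simp
    then have "l2_norm \<mu> u \<le> sqrt (\<Prod>k<N. \<kappa> k) * l2_norm \<mu> (V N u)"
      using fop_bounded(3)[of N w \<kappa>, OF wb V(2)[OF u, of N]] by simp
    then have "(l2_norm \<mu> u)\<^sup>2 \<le> (sqrt (\<Prod>k<N. \<kappa> k) * l2_norm \<mu> (V N u))\<^sup>2"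
      by (rule power_mono) simp
    also have "\<dots> = (\<Prod>k<N. \<kappa> k) * (l2_norm \<mu> (V N u))\<^sup>2"
      using \<kappa>(1) by (simp add: power_mult_distrib prod_nonneg less_imp_le)
    also have "\<dots> \<le> C * (l2_norm \<mu> (V N u))\<^sup>2" by (intro mult_right_mono \<kappa>(2)) simp
    finally show ?thesis .
  qed
  \<comment> \<open>The positive operators whose quadratic forms are the squared norms of
    \<open>V N u\<close>; these forms decrease with \<open>N\<close>.\<close>
  define Q where "Q N = compose (L2 \<mu>) (V' N) (V N)" for N
  have Q: "Q N \<in> bounded_ops \<mu>" for N unfolding Q_def by (rule bounded_ops_compose[OF V'(1) V(1)])
  note QL = bounded_opsD(1)[OF Q]
  have Q_inner: "l2_inner \<mu> (Q N x) y = l2_inner \<mu> (V N x) (V N y)" if "x \<in> L2 \<mu>" "y \<in> L2 \<mu>" for N x y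
  proof -
    have "l2_inner \<mu> (V N y) (V N x) = l2_inner \<mu> y (V' N (V N x))"
      unfolding V'_def V_def
      by (rule fop_adjoint[OF vb vab that(2)]) (rule V(2)[OF that(1), unfolded V_def])
    then show ?thesis
      using l2_inner_cnj[of \<mu> "V N y" "V N x"] l2_inner_cnj[of \<mu> y "V' N (V N x)"] that(1)
      by (simp add: Q_def compose_def)
  qed
  have Q_self: "l2_inner \<mu> (Q N x) y = l2_inner \<mu> x (Q N y)" if "x \<in> L2 \<mu>" "y \<in> L2 \<mu>" for N x y
    using Q_inner[OF that] Q_inner[OF that(2,1)] by (metis l2_inner_cnj)
  have Q_Re: "Re (l2_inner \<mu> (Q N x) x) = (l2_norm \<mu> (V N x))\<^sup>2" if "x \<in> L2 \<mu>" for N x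
    using Q_inner[OF that that] l2_norm_inner[of \<mu> "V N x"] by (metis Re_complex_of_real)
  have V_mono: "(l2_norm \<mu> (V n u))\<^sup>2 \<le> (l2_norm \<mu> (V m u))\<^sup>2" if "m \<le> n" "u \<in> L2 \<mu>" for m n u
    using that(1)
  proof (induction n rule: dec_induct)
    case (step n)
    have "(l2_norm \<mu> (V (Suc n) u))\<^sup>2 \<le> (l2_norm \<mu> (V n u))\<^sup>2"
      by (rule power_mono[OF V_dec[OF that(2)] l2_norm_nonneg])
    then show ?case using step.IH by simp
  qed simp
  have V_le: "(l2_norm \<mu> (V n u))\<^sup>2 \<le> (l2_norm \<mu> u)\<^sup>2" if "u \<in> L2 \<mu>" for n u
    by (rule power_mono[OF V(3)[OF that] l2_norm_nonneg])
  have Q_diff: "(l2_norm \<mu> (l2_minus \<mu> (Q m u) (Q n u)))\<^sup>2 \<le> (l2_norm \<mu> (V m u))\<^sup>2 - (l2_norm \<mu> (V n u))\<^sup>2"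
    if "m \<le> n" and u: "u \<in> L2 \<mu>" for m n u
  proof -
    let ?D = "op_minus \<mu> (Q m) (Q n)"
    have D: "?D \<in> bounded_ops \<mu>" by (rule bounded_ops_minus[OF Q Q])
    have form: "l2_inner \<mu> (?D x) y = l2_inner \<mu> (Q m x) y - l2_inner \<mu> (Q n x) y"
      "l2_inner \<mu> y (?D x) = l2_inner \<mu> y (Q m x) - l2_inner \<mu> y (Q n x)"
      if "x \<in> L2 \<mu>" "y \<in> L2 \<mu>" for x y
      using l2_inner_linear(3,4)[OF QL[OF that(1)] QL[OF that(1)] that(2)] that(1) by simp_all
    have Re: "Re (l2_inner \<mu> (?D x) x) = (l2_norm \<mu> (V m x))\<^sup>2 - (l2_norm \<mu> (V n x))\<^sup>2" if "x \<in> L2 \<mu>" for x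
      using Q_Re[OF that] form(1)[OF that that] by simp
    \<comment> \<open>The difference lies between 0 and 1, so the squared norm of its value is at
      most its form. This converts monotone convergence of numbers into convergence of
      vectors.\<close>
    have "(l2_norm \<mu> (?D u))\<^sup>2 \<le> 1 * Re (l2_inner \<mu> (?D u) u)"
    proof (rule positive_operator_bound[OF D _ _ _ _ u])
      show "adjoint_pair \<mu> ?D ?D" unfolding adjoint_pair_def using form Q_self by simp
      show "0 \<le> Re (l2_inner \<mu> (?D x) x)" if "x \<in> L2 \<mu>" for x
        using V_mono[OF \<open>m \<le> n\<close> that] Re[OF that] by simp
      show "Re (l2_inner \<mu> (?D x) x) \<le> 1 * (l2_norm \<mu> x)\<^sup>2" if "x \<in> L2 \<mu>" for x
        using V_le[OF that, of m] zero_le_power2[of "l2_norm \<mu> (V n x)"] unfolding Re[OF that] by linarith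
    qed simp
    then show ?thesis using Re[OF u] u by simp
  qed
  have "\<exists>w\<in>L2 \<mu>. l2_lim \<mu> (\<lambda>n. Q n u) w" if u: "u \<in> L2 \<mu>" for u
    unfolding l2_lim_def
  proof (rule l2_complete[OF finite_measure_\<mu> QL[OF u]])
    fix e :: real assume e: "e > 0"
    define q where "q n = (l2_norm \<mu> (V n u))\<^sup>2" for n
    have "decseq q" unfolding decseq_def q_def using V_mono u by blast
    then obtain l where "q \<longlonglongrightarrow> l"
      by (rule decseq_convergent[where B = 0]) (simp_all add: q_def)
    then have "Cauchy q" by (rule LIMSEQ_imp_Cauchy)
    then obtain n0 where n0: "\<And>m n. m \<ge> n0 \<Longrightarrow> n \<ge> n0 \<Longrightarrow> norm (q m - q n) < e\<^sup>2"
      using CauchyD[of q "e\<^sup>2"] e by auto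
    have "l2_norm \<mu> (l2_minus \<mu> (Q n u) (Q m u)) < e" if "n0 \<le> m" "m \<le> n" for m n
    proof -
      have "(l2_norm \<mu> (l2_minus \<mu> (Q n u) (Q m u)))\<^sup>2 \<le> q m - q n"
        using Q_diff[OF that(2) u] l2_norm_minus_commute[OF QL[OF u] QL[OF u]] by (simp add: q_def)
      also have "\<dots> < e\<^sup>2" using n0[of m n] that by (simp add: abs_less_iff)
      finally show ?thesis by (rule power2_less_imp_less) (use e in simp)
    qed
    then show "\<exists>N. \<forall>m\<ge>N. \<forall>n\<ge>m. l2_norm \<mu> (l2_minus \<mu> (Q n u) (Q m u)) < e" by blast
  qed
  note Q_lim = this
  have Q_norm: "l2_norm \<mu> (Q n u) \<le> 1 * l2_norm \<mu> u" if u: "u \<in> L2 \<mu>" for n u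
  proof -
    have "l2_norm \<mu> (Q n u) \<le> l2_norm \<mu> (V n u)" using V'(3)[OF V(2)[OF u]] u by (simp add: Q_def compose_def)
    then show ?thesis using V(3)[OF u, of n] by simp
  qed
  obtain P where P: "P \<in> bounded_ops \<mu>" and P_lim: "\<And>u. u \<in> L2 \<mu> \<Longrightarrow> l2_lim \<mu> (\<lambda>n. Q n u) (P u)"
    and P_norm: "\<And>u. u \<in> L2 \<mu> \<Longrightarrow> l2_norm \<mu> (P u) \<le> 1 * l2_norm \<mu> u"
    by (rule strong_limit[OF Q Q_norm Q_lim]) (assumption, assumption, rule that)
  note PL = bounded_opsD(1)[OF P]
  have P_inner: "(\<lambda>n. l2_inner \<mu> (Q n x) y) \<longlonglongrightarrow> l2_inner \<mu> (P x) y"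
    "(\<lambda>n. l2_inner \<mu> y (Q n x)) \<longlonglongrightarrow> l2_inner \<mu> y (P x)" if "x \<in> L2 \<mu>" "y \<in> L2 \<mu>" for x y
    using l2_lim_inner[OF P_lim[OF that(1)] QL[OF that(1)] PL[OF that(1)] that(2)] by blast+
  have P_adj: "adjoint_pair \<mu> P P"
    unfolding adjoint_pair_def
  proof (intro ballI)
    fix x y assume xy: "x \<in> L2 \<mu>" "y \<in> L2 \<mu>"
    have "(\<lambda>n. l2_inner \<mu> (Q n x) y) \<longlonglongrightarrow> l2_inner \<mu> x (P y)"
      using P_inner(2)[OF xy(2,1)] Q_self[OF xy] by simp
    then show "l2_inner \<mu> (P x) y = l2_inner \<mu> x (P y)" by (rule LIMSEQ_unique[OF P_inner(1)[OF xy]])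
  qed
  have P_Re: "(\<lambda>n. (l2_norm \<mu> (V n x))\<^sup>2) \<longlonglongrightarrow> Re (l2_inner \<mu> (P x) x)" if "x \<in> L2 \<mu>" for x
    using tendsto_Re[OF P_inner(1)[OF that that]] Q_Re[OF that] by simp
  have P_low: "1 / C * (l2_norm \<mu> x)\<^sup>2 \<le> Re (l2_inner \<mu> (P x) x)" if "x \<in> L2 \<mu>" for x
  proof (rule LIMSEQ_le_const[OF P_Re[OF that]], intro exI allI impI)
    show "1 / C * (l2_norm \<mu> x)\<^sup>2 \<le> (l2_norm \<mu> (V n x))\<^sup>2" for n
      using V_low[OF that, of n] C by (simp add: divide_le_eq mult.commute)
  qed
  have P_up: "Re (l2_inner \<mu> (P x) x) \<le> (l2_norm \<mu> x)\<^sup>2" if "x \<in> L2 \<mu>" for x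
    by (rule LIMSEQ_le_const2[OF P_Re[OF that]]) (use V_le[OF that] in blast)
  \<comment> \<open>Since t (s c t) = c t, the operator \<open>V N\<close> carries the generator
    over to the constant matrices \<open>c k\<close> in every fibre; for these the adjoint is again
    constant, with no trace of the similarities.\<close>
  have V_gen: "V N (gen N c u) = fop N (\<lambda>k _. c k) (V N u)"
    if c: "\<And>k. c k \<in> carrier_mat (d k) (d k)" and u: "u \<in> L2 \<mu>" for N c u
  proof -
    obtain K where K: "\<forall>k<N. fibre_bounded k (conj_mat k (c k)) (\<lambda>i. i) (K k)" using gen_bound_ex[OF c] by blast
    obtain K' where K': "\<And>k. fibre_bounded k (\<lambda>_. c k) (\<lambda>i. i) (K' k)" using constant_fibre_bounded by blast
    have mat: "v k i * conj_mat k (c k) i = c k * v k i" if i: "i \<in> I k" for k i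
    proof -
      note m = s_inv(1,2)[OF i] c[of k]
      have "t k i * (s k i * c k * t k i) = (t k i * s k i) * (c k * t k i)"
        using m by (simp add: assoc_mult_mat[of _ "d k" "d k" _ "d k" _ "d k"])
      also have "\<dots> = c k * t k i" using s_inv(4)[OF i] m by simp
      finally have "t k i * (s k i * c k * t k i) = c k * t k i" .
      moreover have "s k i * c k * t k i \<in> carrier_mat (d k) (d k)" using m by simp
      ultimately show ?thesis
        unfolding v_def conj_mat_def mult_smult_distrib[OF m(3,2)] using mult_smult_assoc_mat[OF m(2)] by metis
    qed
    have "V N (gen N c u) = fop N v (fop N (\<lambda>k. conj_mat k (c k)) u)" by (simp add: V_def gen_def fop_def)
    also have "\<dots> = fop N (\<lambda>k i. v k i * conj_mat k (c k) i) u"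
      by (rule fop_mult[where K = "\<lambda>_. 1" and K' = K]) (use vb K v_carrier c u in auto)
    also have "fop N (\<lambda>k i. v k i * conj_mat k (c k) i) = fop N (\<lambda>k i. c k * v k i)"
      by (rule fop_cong) (rule mat)
    also have "fop N (\<lambda>k i. c k * v k i) u = fop N (\<lambda>k _. c k) (V N u)"
      unfolding V_def by (rule fop_mult[symmetric, where K = K' and K' = "\<lambda>_. 1"]) (use vb K' v_carrier c u in auto)
    finally show ?thesis .
  qed
  \<comment> \<open>The elements of the algebra that have a relative adjoint in the algebra; they
    form a closed subalgebra, so it is enough to treat generators.\<close>
  let ?E = "{T \<in> A. \<exists>S\<in>A. \<forall>u\<in>L2 \<mu>. \<forall>w\<in>L2 \<mu>. l2_inner \<mu> (P (T u)) w = l2_inner \<mu> (P u) (S w)}"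
  have E: "closed_subalgebra (op_algebra \<mu>) ?E"
    by (rule relative_adjoint_closed[OF finite_measure_\<mu> P P_adj _ _ P_low A_closed]) (use P_norm C in auto)
  have "Gens \<subseteq> ?E"
  proof
    fix T assume "T \<in> Gens"
    then obtain n a where T: "T = gen n a" and a: "\<And>k. k < n \<Longrightarrow> a k \<in> carrier_mat (d k) (d k)"
      by (auto simp: Gens_def)
    \<comment> \<open>The generator of the adjoint matrices is in general not the Hilbert space
      adjoint of \<open>T\<close>, but it is the adjoint relative to each \<open>Q N\<close> with
      \<open>N \<ge> n\<close>.\<close>
    define S where "S = gen n (\<lambda>k. adj (d k) (a k))"
    define a' where "a' k = (if k < n then a k else 1\<^sub>m (d k))" for k
    have a': "a' k \<in> carrier_mat (d k) (d k)" for k using a by (simp add: a'_def)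
    have TA: "T \<in> A" unfolding T by (rule gen_in_A[OF a])
    have SA: "S \<in> A" unfolding S_def by (rule gen_in_A) simp
    have "l2_inner \<mu> (P (T x)) y = l2_inner \<mu> (P x) (S y)" if x: "x \<in> L2 \<mu>" and y: "y \<in> L2 \<mu>" for x y
    proof -
      have Tx: "T x \<in> L2 \<mu>" and Sy: "S y \<in> L2 \<mu>" using TA SA x y by simp_all
      have "l2_inner \<mu> (Q N (T x)) y = l2_inner \<mu> (Q N x) (S y)" if N: "N \<ge> n" for N
      proof -
        have T': "T = gen N a'" unfolding T a'_def[abs_def] by (rule gen_pad[OF a N])
        have S': "S = gen N (\<lambda>k. adj (d k) (a' k))"
        proof -
          have "S = gen N (\<lambda>k. if k < n then adj (d k) (a k) else 1\<^sub>m (d k))"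
            unfolding S_def by (rule gen_pad[OF adj_carrier N])
          also have "\<dots> = gen N (\<lambda>k. adj (d k) (a' k))" by (rule gen_cong) (simp add: a'_def adj_one)
          finally show ?thesis .
        qed
        obtain K where K: "\<And>k. fibre_bounded k (\<lambda>_. a' k) (\<lambda>i. i) (K k)" using constant_fibre_bounded by blast
        obtain K' where K': "\<And>k. fibre_bounded k (\<lambda>_. adj (d k) (a' k)) (\<lambda>i. i) (K' k)" using constant_fibre_bounded[of "\<lambda>k. adj (d k) (a' k)"] by blast
        have "l2_inner \<mu> (Q N (T x)) y = l2_inner \<mu> (fop N (\<lambda>k _. a' k) (V N x)) (V N y)"
          unfolding Q_inner[OF Tx y] unfolding T' V_gen[OF a' x] ..
        also have "\<dots> = l2_inner \<mu> (V N x) (fop N (\<lambda>k _. adj (d k) (a' k)) (V N y))"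
          by (rule fop_adjoint[OF K K' V(2)[OF x] V(2)[OF y]])
        also have "\<dots> = l2_inner \<mu> (Q N x) (S y)"
          unfolding Q_inner[OF x Sy] unfolding S' V_gen[OF adj_carrier y] ..
        finally show ?thesis .
      qed
      \<comment> \<open>For \<open>N \<ge> n\<close> the relation is exact, so it survives in the
        limit \<open>P\<close> without any error estimate.\<close>
      then have "eventually (\<lambda>N. l2_inner \<mu> (Q N x) (S y) = l2_inner \<mu> (Q N (T x)) y) sequentially"
        by (intro eventually_sequentiallyI[of n]) simp
      from Lim_transform_eventually[OF P_inner(1)[OF x Sy] this]
      have "(\<lambda>N. l2_inner \<mu> (Q N (T x)) y) \<longlonglongrightarrow> l2_inner \<mu> (P x) (S y)" .
      then show ?thesis by (rule LIMSEQ_unique[OF P_inner(1)[OF Tx y]])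
    qed
    then show "T \<in> ?E" using TA SA by blast
  qed
  then have "A \<subseteq> ?E" unfolding A_eq[symmetric] using closed_subalgebra_generated_least[OF E] A_eq by simp
  then have B_adj: "\<exists>S\<in>A. \<forall>u\<in>L2 \<mu>. \<forall>w\<in>L2 \<mu>. l2_inner \<mu> (P (T u)) w = l2_inner \<mu> (P u) (S w)" if "T \<in> A" for T
    using that by blast
  have c: "0 < 1 / C" "1 / C \<le> 1" using C by auto
  show ?thesis by (rule similar_to_cstar_subalgebra[OF finite_measure_\<mu> P P_adj c P_low P_up A_closed B_adj])
qed

end

theorem theorem4p11:
  fixes d :: "nat \<Rightarrow> nat"
    and I :: "nat \<Rightarrow> 'i set"
    and s :: "nat \<Rightarrow> 'i \<Rightarrow> complex mat"
    and f :: "nat \<Rightarrow> 'i \<Rightarrow> real"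
  assumes "\<And>n. d n \<ge> 2"
    and "\<And>n. similarity_system (d n) (I n) (s n) (f n)"
    and "amenable ((op_algebra (product_measure d I f))\<lparr>carrier := D2 d I s f\<rparr>)"
  shows "\<exists>v \<in> Units (op_algebra (product_measure d I f)).
    cstar_subalgebra (product_measure d I f)
      ((\<lambda>a. v \<otimes>\<^bsub>op_algebra (product_measure d I f)\<^esub> a
              \<otimes>\<^bsub>op_algebra (product_measure d I f)\<^esub>
              inv\<^bsub>op_algebra (product_measure d I f)\<^esub> v) ` D2 d I s f)"
proof -
  interpret similarity_tensor d I s f using assms(1,2) by unfold_locales
  show ?thesis by (rule similar_to_cstar_of_amenable[OF assms(3)])
qed

end
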